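(* Let $d\in\{2,3\}$, let $\Omega\subseteq\mathbb{R}^d$ be a bounded polygonal/polyhedral Lipschitz domain and $s\in(0,1)$. There exists a constant $C>0$, depending only on $s$, $d$ and the $\gamma$-shape regularity of $\mathcal{T}_\ell$, such that for every $\mathcal{T}_\ell\in\mathbb{T}$ with uniform refinement $\mathcal{T}_{\ell,u}:=\operatorname{refine}(\mathcal{T}_\ell,\mathcal{T}_\ell)$ and all $v_{\ell,u}\in\mathcal{S}^1_0(\mathcal{T}_{\ell,u})$, $$C^{-1}\left\|\widetilde h_\ell^{-s}(1-J_\ell)v_{\ell,u}\right\|_{L^2(\Omega)}\le\left\|\widetilde h_\ell^{-s}(1-I_\ell)v_{\ell,u}\right\|_{L^2(\Omega)}\le C\left\|\widetilde h_\ell^{-s}(1-J_\ell)v_{\ell,u}\right\|_{L^2(\Omega)},$$ where $I_\ell$ is the nodal interpolation operator and $J_\ell$ the Scott-Zhang projection onto $\mathcal{S}^1_0(\mathcal{T}_\ell)$.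
   Context: Meshes. Triangulations $\mathcal{T}$ of $\Omega$ are regular (conforming, no hanging nodes) decompositions of $\Omega$ into open triangles ($d=2$) or tetrahedra ($d=3$); all are assumed $\gamma$-shape regular, i.e. $\max_{T\in\mathcal{T}}\operatorname{diam}(T)/|T|^{1/d}\le\gamma$ with $\gamma>0$ fixed. $\mathcal{N}^*_{\mathcal{T}}$ is the set of all vertices of elements of $\mathcal{T}$ lying inside $\Omega$ (not on $\partial\Omega$). $\mathcal{S}^1_0(\mathcal{T})$ is the space of continuous functions on $\overline\Omega$, affine on each $T\in\mathcal{T}$, vanishing on $\partial\Omega$. Refinement. Meshes are refined by newest vertex bisection (NVB). Elements are tagged simplices $(z_0,\dots,z_d)_\beta$, $\beta\in\{0,\dots,d-1\}$ (the refinement type), with refinement edge $\overline{z_0z_d}$; bisection with midpoint $z'=(z_0+z_d)/2$ yields the sons $(z_0,z',z_1,\dots,z_\beta,z_{\beta+1},\dots,z_{d-1})_{(\beta+1)\bmod d}$ and $(z_d,z',z_1,\dots,z_\beta,z_{d-1},\dots,z_{\beta+1})_{(\beta+1)\bmod d}$; for $d=2$ this means that the edge opposite to the newest vertex is halved. For $\mathcal{M}\subseteq\mathcal{T}$ (marked elements): if $d=2$, $\operatorname{refine}(\mathcal{T},\mathcal{M})$ is the coarsest conforming NVB refinement of $\mathcal{T}$ in which all edges of marked elements are bisected (each marked element is bisected three times into four sons). If $d=3$, let $\Lambda(\mathcal{M})$ be the set of all $T'\in\mathcal{T}$ that are in $\mathcal{M}$ or share at least one edge with an element of $\mathcal{M}$;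 $\operatorname{refine}(\mathcal{T},\mathcal{M})$ is the coarsest conforming NVB refinement of $\mathcal{T}$ in which all faces of elements of $\Lambda(\mathcal{M})$ contain an interior node (each such element is split into 18 sons if $\beta\in\{0,1\}$, 20 sons if $\beta=2$; the 14 nodes of the sons are its 4 vertices, the midpoints of its 6 edges and one interior node on each of its 4 faces). $\mathcal{T}_0$ is a fixed initial conforming triangulation, tagged such that these coarsest refinements exist, and $\mathbb{T}$ is the set of all triangulations obtained by refining $\mathcal{T}_0$ finitely many times. Weight function. The mesh width is $h_\ell|_T:=|T|^{1/d}$ for $T\in\mathcal{T}_\ell$, and $\omega_\ell(x):=\inf_{T\in\mathcal{T}_\ell}\inf_{y\in\partial T}|x-y|$ is the distance of $x\in\Omega$ to the mesh skeleton. Set $\widetilde h_\ell^s:=h_\ell^s$ for $0<s\le1/2$ and $\widetilde h_\ell^s:=h_\ell^{1/2}\omega_\ell^{s-1/2}$ for $1/2<s<1$; $\widetilde h_\ell^{-s}:=1/\widetilde h_\ell^s$. Operators. For $z\in\mathcal{N}^*_{\mathcal{T}_\ell}$ let $\varphi^\ell_z\in\mathcal{S}^1_0(\mathcal{T}_\ell)$ be the nodal basis function, $\varphi^\ell_z(z')=\delta_{zz'}$ for all $z'\in\mathcal{N}^*_{\mathcal{T}_\ell}$. Nodal interpolation: $I_\ell(v):=\sum_{z\in\mathcal{N}^*_{\mathcal{T}_\ell}}v(z)\varphi^\ell_z$. Scott-Zhang projection: for each $z\in\mathcal{N}^*_{\mathcal{T}_\ell}$ an element $T_z\in\mathcal{T}_\ell$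 having $z$ as a vertex is chosen; $\varphi^{\ell*}_z$ is the unique affine function on $T_z$ with $\int_{T_z}\varphi^{\ell*}_z\varphi^\ell_{z'}\,dx=\delta_{zz'}$ for all vertices $z'$ of $T_z$ (where $\varphi^\ell_{z'}$ is the piecewise affine hat function of the vertex $z'$), and $$J_\ell(v):=\sum_{z\in\mathcal{N}^*_{\mathcal{T}_\ell}}\Big(\int_{T_z}\varphi^{\ell*}_z v\,dx\Big)\varphi^\ell_z .$$ *)

theory Defs
  imports "HOL-Analysis.Analysis"
begin

section \<open>Domains\<close>

text \<open>Near every boundary point, a Lipschitz domain is the strict epigraph, in some unit
  direction \<open>e\<close>, of a Lipschitz function on the hyperplane orthogonal to \<open>e\<close>.  Taking the
  function to be Lipschitz on the whole space is no restriction: compose it with the projection.\<close>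

definition lipschitz_boundary :: "(real^'n) set \<Rightarrow> bool" where
  "lipschitz_boundary \<Omega> \<longleftrightarrow>
     (\<forall>x\<in>frontier \<Omega>. \<exists>r>0. \<exists>e. norm e = 1 \<and>
        (\<exists>(g :: real^'n \<Rightarrow> real) L. L-lipschitz_on UNIV g \<and>
           (\<forall>y\<in>ball x r. y \<in> \<Omega> \<longleftrightarrow> g (y - (y \<bullet> e) *\<^sub>R e) < y \<bullet> e)))"

definition polyhedral_boundary :: "(real^'n) set \<Rightarrow> bool" where
  "polyhedral_boundary \<Omega> \<longleftrightarrow>
     (\<exists>\<F>. finite \<F> \<and> (\<forall>F\<in>\<F>. polytope F \<and> aff_dim F = int CARD('n) - 1) \<and>
          frontier \<Omega> = \<Union>\<F>)"

definition polyhedral_lipschitz_domain :: "(real^'n) set \<Rightarrow> bool" where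
  "polyhedral_lipschitz_domain \<Omega> \<longleftrightarrow>
     open \<Omega> \<and> connected \<Omega> \<and> \<Omega> \<noteq> {} \<and> bounded \<Omega> \<and>
     lipschitz_boundary \<Omega> \<and> polyhedral_boundary \<Omega>"


section \<open>Meshes of tagged simplices\<close>

text \<open>The pair \<open>([z\<^sub>0, \<dots>, z\<^sub>d], \<beta>)\<close> is the tagged simplex \<open>(z\<^sub>0, \<dots>, z\<^sub>d)\<^sub>\<beta>\<close>, with
  \<open>d = CARD('n)\<close>.\<close>

type_synonym 'n tsimplex = "(real^'n) list \<times> nat"

abbreviation verts :: "'n::finite tsimplex \<Rightarrow> (real^'n) set" where
  "verts \<tau> \<equiv> set (fst \<tau>)"

definition elem :: "'n::finite tsimplex \<Rightarrow> (real^'n) set" where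
  "elem \<tau> = interior (convex hull (verts \<tau>))"

definition nodes :: "'n::finite tsimplex set \<Rightarrow> (real^'n) set" where
  "nodes \<T> = (\<Union>\<tau>\<in>\<T>. verts \<tau>)"

definition interior_nodes :: "(real^'n) set \<Rightarrow> 'n::finite tsimplex set \<Rightarrow> (real^'n) set" where
  "interior_nodes \<Omega> \<T> = nodes \<T> \<inter> \<Omega>"

definition valid_tsimplex :: "'n::finite tsimplex \<Rightarrow> bool" where
  "valid_tsimplex \<tau> \<longleftrightarrow>
     length (fst \<tau>) = CARD('n) + 1 \<and> distinct (fst \<tau>) \<and>
     \<not> affine_dependent (verts \<tau>) \<and> snd \<tau> < CARD('n)"

text \<open>For nondegenerate simplices this implies that distinct elements are disjoint: they have
  different vertex sets, so their closures meet in a proper face.\<close>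

definition conforming :: "'n::finite tsimplex set \<Rightarrow> bool" where
  "conforming \<T> \<longleftrightarrow> inj_on verts \<T> \<and>
     (\<forall>\<sigma>\<in>\<T>. \<forall>\<tau>\<in>\<T>. convex hull (verts \<sigma>) \<inter> convex hull (verts \<tau>)
                     = convex hull (verts \<sigma> \<inter> verts \<tau>))"

definition triangulation :: "(real^'n) set \<Rightarrow> 'n::finite tsimplex set \<Rightarrow> bool" where
  "triangulation \<Omega> \<T> \<longleftrightarrow>
     finite \<T> \<and> (\<forall>\<tau>\<in>\<T>. valid_tsimplex \<tau>) \<and> conforming \<T> \<and>
     closure \<Omega> = (\<Union>\<tau>\<in>\<T>. convex hull (verts \<tau>))"

definition shape_regular :: "real \<Rightarrow> 'n::finite tsimplex set \<Rightarrow> bool" where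
  "shape_regular \<gamma> \<T> \<longleftrightarrow>
     (\<forall>\<tau>\<in>\<T>. diameter (elem \<tau>) / measure lborel (elem \<tau>) powr (1 / real CARD('n)) \<le> \<gamma>)"


section \<open>Newest vertex bisection\<close>

definition sons :: "'n::finite tsimplex \<Rightarrow> 'n tsimplex set" where
  "sons = (\<lambda>(z, \<beta>).
     let d = CARD('n);
         m = midpoint (z ! 0) (z ! d);
         front = map ((!) z) [1..<Suc \<beta>];
         back = map ((!) z) [Suc \<beta>..<d];
         \<beta>' = (\<beta> + 1) mod d
     in {(z ! 0 # m # front @ back, \<beta>'), (z ! d # m # front @ rev back, \<beta>')})"

text \<open>Intermediate meshes in a sequence of bisections may have hanging nodes.\<close>

inductive nvb_refinement :: "'n::finite tsimplex set \<Rightarrow> 'n tsimplex set \<Rightarrow> bool"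
  for \<T> where
  refl: "nvb_refinement \<T> \<T>"
| bisect: "nvb_refinement \<T> \<T>' \<Longrightarrow> \<tau> \<in> \<T>' \<Longrightarrow>
            nvb_refinement \<T> ((\<T>' - {\<tau>}) \<union> sons \<tau>)"

text \<open>Every two vertices of a simplex span an edge, so in a conforming mesh elements share an
  edge iff they share two vertices.\<close>

definition edge_neighbourhood :: "'n::finite tsimplex set \<Rightarrow> 'n tsimplex set \<Rightarrow> 'n tsimplex set" where
  "edge_neighbourhood \<T> \<M> =
     {\<sigma>\<in>\<T>. \<sigma> \<in> \<M> \<or> (\<exists>\<tau>\<in>\<M>. \<exists>a b. a \<noteq> b \<and> {a, b} \<subseteq> verts \<sigma> \<inter> verts \<tau>)}"

text \<open>The two cases are meant for \<open>d = 2\<close> and \<open>d = 3\<close>; other dimensions are not considered.\<close>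

definition marking_resolved ::
    "'n::finite tsimplex set \<Rightarrow> 'n tsimplex set \<Rightarrow> 'n tsimplex set \<Rightarrow> bool" where
  "marking_resolved \<T> \<M> \<T>' \<longleftrightarrow>
     (if CARD('n) = 2
      then \<forall>\<tau>\<in>\<M>. \<forall>a\<in>verts \<tau>. \<forall>b\<in>verts \<tau>. a \<noteq> b \<longrightarrow> midpoint a b \<in> nodes \<T>'
      else \<forall>\<tau>\<in>edge_neighbourhood \<T> \<M>. \<forall>F. F \<subseteq> verts \<tau> \<and> card F = 3 \<longrightarrow>
             (\<exists>z\<in>nodes \<T>'. z \<in> rel_interior (convex hull F)))"

definition admissible_refinement ::
    "'n::finite tsimplex set \<Rightarrow> 'n tsimplex set \<Rightarrow> 'n tsimplex set \<Rightarrow> bool" where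
  "admissible_refinement \<T> \<M> \<T>' \<longleftrightarrow>
     nvb_refinement \<T> \<T>' \<and> conforming \<T>' \<and> marking_resolved \<T> \<M> \<T>'"

definition coarsest_refinement ::
    "'n::finite tsimplex set \<Rightarrow> 'n tsimplex set \<Rightarrow> 'n tsimplex set \<Rightarrow> bool" where
  "coarsest_refinement \<T> \<M> \<T>' \<longleftrightarrow>
     admissible_refinement \<T> \<M> \<T>' \<and>
     (\<forall>\<T>''. admissible_refinement \<T> \<M> \<T>'' \<longrightarrow> nvb_refinement \<T>' \<T>'')"

definition refine :: "'n::finite tsimplex set \<Rightarrow> 'n tsimplex set \<Rightarrow> 'n tsimplex set" where
  "refine \<T> \<M> = (THE \<T>'. coarsest_refinement \<T> \<M> \<T>')"

inductive_set meshes :: "'n::finite tsimplex set \<Rightarrow> 'n tsimplex set set"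
  for \<T>\<^sub>0 where
  initial: "\<T>\<^sub>0 \<in> meshes \<T>\<^sub>0"
| refine: "\<T> \<in> meshes \<T>\<^sub>0 \<Longrightarrow> \<M> \<subseteq> \<T> \<Longrightarrow> refine \<T> \<M> \<in> meshes \<T>\<^sub>0"

definition initial_triangulation :: "(real^'n) set \<Rightarrow> 'n::finite tsimplex set \<Rightarrow> bool" where
  "initial_triangulation \<Omega> \<T>\<^sub>0 \<longleftrightarrow>
     triangulation \<Omega> \<T>\<^sub>0 \<and>
     (\<forall>\<T>\<in>meshes \<T>\<^sub>0. \<forall>\<M>\<subseteq>\<T>. \<exists>\<T>'. coarsest_refinement \<T> \<M> \<T>')"


section \<open>Weights\<close>

text \<open>The mesh width is only relevant off the mesh skeleton, a null set; it is set to zero there.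
  Since the elements are disjoint, at most one summand is nonzero.\<close>

definition mesh_width :: "'n::finite tsimplex set \<Rightarrow> real^'n \<Rightarrow> real" where
  "mesh_width \<T> x =
     (\<Sum>\<tau>\<in>\<T>. indicator (elem \<tau>) x * measure lborel (elem \<tau>) powr (1 / real CARD('n)))"

definition skeleton_dist :: "'n::finite tsimplex set \<Rightarrow> real^'n \<Rightarrow> real" where
  "skeleton_dist \<T> x = (INF \<tau>\<in>\<T>. INF y\<in>frontier (elem \<tau>). norm (x - y))"

definition weight :: "real \<Rightarrow> 'n::finite tsimplex set \<Rightarrow> real^'n \<Rightarrow> real" where
  "weight s \<T> x =
     (if s \<le> 1/2 then mesh_width \<T> x powr s
      else mesh_width \<T> x powr (1/2) * skeleton_dist \<T> x powr (s - 1/2))"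

text \<open>The norm takes values in \<open>[0, \<infinity>]\<close>, so that no default value for the integral of a
  non-integrable function can enter.\<close>

definition L2_norm :: "(real^'n) set \<Rightarrow> (real^'n \<Rightarrow> real) \<Rightarrow> ennreal" where
  "L2_norm \<Omega> f =
     (let I = (\<integral>\<^sup>+x\<in>\<Omega>. ennreal ((f x)\<^sup>2) \<partial>lborel)
      in if I = \<infinity> then \<infinity> else ennreal (sqrt (enn2real I)))"


section \<open>Finite element spaces and operators\<close>

definition affine_on :: "(real^'n) set \<Rightarrow> (real^'n \<Rightarrow> real) \<Rightarrow> bool" where
  "affine_on S f \<longleftrightarrow> (\<exists>a b. \<forall>x\<in>S. f x = a \<bullet> x + b)"

text \<open>A function on \<open>closure \<Omega>\<close> is represented by its extension by zero, so that basis functions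
  are determined by their nodal values.\<close>

definition S1 :: "(real^'n) set \<Rightarrow> 'n::finite tsimplex set \<Rightarrow> (real^'n \<Rightarrow> real) set" where
  "S1 \<Omega> \<T> = {v. continuous_on (closure \<Omega>) v \<and> (\<forall>\<tau>\<in>\<T>. affine_on (elem \<tau>) v) \<and>
                 (\<forall>x. x \<notin> closure \<Omega> \<longrightarrow> v x = 0)}"

definition S10 :: "(real^'n) set \<Rightarrow> 'n::finite tsimplex set \<Rightarrow> (real^'n \<Rightarrow> real) set" where
  "S10 \<Omega> \<T> = {v \<in> S1 \<Omega> \<T>. \<forall>x\<in>frontier \<Omega>. v x = 0}"

definition hat :: "(real^'n) set \<Rightarrow> 'n::finite tsimplex set \<Rightarrow> real^'n \<Rightarrow> real^'n \<Rightarrow> real" where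
  "hat \<Omega> \<T> z = (THE \<phi>. \<phi> \<in> S1 \<Omega> \<T> \<and> (\<forall>z'\<in>nodes \<T>. \<phi> z' = (if z' = z then 1 else 0)))"

definition nodal_basis ::
    "(real^'n) set \<Rightarrow> 'n::finite tsimplex set \<Rightarrow> real^'n \<Rightarrow> real^'n \<Rightarrow> real" where
  "nodal_basis \<Omega> \<T> z =
     (THE \<phi>. \<phi> \<in> S10 \<Omega> \<T> \<and> (\<forall>z'\<in>interior_nodes \<Omega> \<T>. \<phi> z' = (if z' = z then 1 else 0)))"

definition nodal_interpolation ::
    "(real^'n) set \<Rightarrow> 'n::finite tsimplex set \<Rightarrow> (real^'n \<Rightarrow> real) \<Rightarrow> real^'n \<Rightarrow> real" where
  "nodal_interpolation \<Omega> \<T> v x = (\<Sum>z\<in>interior_nodes \<Omega> \<T>. v z * nodal_basis \<Omega> \<T> z x)"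

text \<open>The dual function lives on the chosen element \<open>\<tau>\<close>; it is represented by its affine extension
  to the whole space, and only integrated over \<open>\<tau>\<close>.\<close>

definition dual_basis ::
    "(real^'n) set \<Rightarrow> 'n::finite tsimplex set \<Rightarrow> 'n tsimplex \<Rightarrow> real^'n \<Rightarrow> real^'n \<Rightarrow> real" where
  "dual_basis \<Omega> \<T> \<tau> z =
     (THE \<psi>. affine_on UNIV \<psi> \<and>
        (\<forall>z'\<in>verts \<tau>. (LINT x:elem \<tau>|lborel. \<psi> x * hat \<Omega> \<T> z' x) = (if z' = z then 1 else 0)))"

definition scott_zhang_choice ::
    "(real^'n) set \<Rightarrow> 'n::finite tsimplex set \<Rightarrow> (real^'n \<Rightarrow> 'n tsimplex) \<Rightarrow> bool" where
  "scott_zhang_choice \<Omega> \<T> Tz \<longleftrightarrow>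
     (\<forall>z\<in>interior_nodes \<Omega> \<T>. Tz z \<in> \<T> \<and> z \<in> verts (Tz z))"

definition scott_zhang ::
    "(real^'n) set \<Rightarrow> 'n::finite tsimplex set \<Rightarrow> (real^'n \<Rightarrow> 'n tsimplex) \<Rightarrow>
     (real^'n \<Rightarrow> real) \<Rightarrow> real^'n \<Rightarrow> real" where
  "scott_zhang \<Omega> \<T> Tz v x =
     (\<Sum>z\<in>interior_nodes \<Omega> \<T>.
        (LINT y:elem (Tz z)|lborel. dual_basis \<Omega> \<T> (Tz z) z y * v y) * nodal_basis \<Omega> \<T> z x)"

end

(* Both operators are projections onto the coarse space, so with w = (1 - I) v and e = (1 - J) v one
   has (1 - J) v = (1 - J) w and (1 - I) v = (1 - I) e.  It therefore suffices to bound J on bounded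
   functions, and I on the functions e that are affine on the elements of the fine mesh, in the
   weighted norm.

   On an element of size h, the squared inverse weight is bounded from below by c h^(-2s), and its
   mean is bounded from above by C h^(-2s): for s > 1/2 the distance to the skeleton is at least a
   constant times h times the smallest barycentric coordinate, whose power 1 - 2s is integrable.
   Since finitely many elements of comparable size meet at a node, both bounds reduce to estimates
   of single nodal coefficients by local L2 norms.  For J this is Cauchy-Schwarz with the explicit
   dual functions.  For I, the value e(z) is controlled by the L2 norm of e on a fine element with
   vertex z, provided that this element is not much smaller than its ancestor.

   To see this, apply to every element a fixed sequence of three (d = 2) or ten (d = 3) edge
   bisections that depends only on its type.  For d = 3 the patterns of two tetrahedra match on a common face if
   both bisect the same edge of it first, and this can be read off from any conforming refinement with
   a node inside the face.  So the patterns form an admissible refinement, and the uniform refinement,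
   being the coarsest one, is at most that fine. *)
theory Submission
  imports Defs
begin

section \<open>Barycentric coordinates\<close>

text \<open>The coarsest refinement is never described explicitly. It is coarser than every
  admissible refinement, so exhibiting one of bounded depth bounds its depth; at most ten bisections
  per element give the factor \<open>2 ^ 10\<close> between volumes. The obstacle is d = 3.
  \<open>initial_triangulation\<close> only demands that coarsest refinements exist and states no
  matching condition on tags, so the agreement of neighbours on the first edge of a common face must
  be extracted from that existence. Barycentric coordinates carry the geometry: two simplices are
  conforming iff their coordinates agree on the intersection, and bisecting an edge changes
  coordinates by one formula depending only on the end points. Conformity after a bisection becomes
  an equality of functions. Shape regularity concerns single elements. Sizes of neighbours are
  compared through common edges, and around an interior node any two elements are linked by a chain
  of such comparisons. Interior nodes suffice because both operators sum over them only.\<close>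

definition nondeg :: "(real^'n::finite) set \<Rightarrow> bool" where
  "nondeg S \<longleftrightarrow> finite S \<and> \<not> affine_dependent S \<and> card S = CARD('n) + 1"

text \<open>Coordinates are functions on the whole space that vanish off \<open>S\<close>, so the
  coordinates of one point in two simplices can be compared by plain equality. The choice is
  harmless by \<open>bary_unique\<close>.\<close>

definition bary :: "(real^'n::finite) set \<Rightarrow> real^'n \<Rightarrow> real^'n \<Rightarrow> real" where
  "bary S x = (SOME u. (\<forall>v. v \<notin> S \<longrightarrow> u v = 0) \<and> sum u S = 1 \<and> (\<Sum>v\<in>S. u v *\<^sub>R v) = x)"

lemma nondegD:
  assumes "nondeg (S :: (real^'n::finite) set)"
  shows "finite S" "\<not> affine_dependent S" "card S = CARD('n) + 1" "S \<noteq> {}" "affine hull S = UNIV"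
  using assms affine_independent_span_eq[of S] unfolding nondeg_def by auto

lemma nondeg_verts: "valid_tsimplex \<tau> \<Longrightarrow> nondeg (verts \<tau>)"
  unfolding valid_tsimplex_def nondeg_def by (auto simp: distinct_card)

lemma
  assumes "nondeg S"
  shows bary_outside: "v \<notin> S \<Longrightarrow> bary S x v = 0"
    and sum_bary: "sum (bary S x) S = 1"
    and sum_bary_scaleR: "(\<Sum>v\<in>S. bary S x v *\<^sub>R v) = x"
proof -
  have "x \<in> affine hull S"
    using nondegD(5)[OF assms] by simp
  then obtain u where u: "sum u S = 1" "(\<Sum>v\<in>S. u v *\<^sub>R v) = x"
    unfolding affine_hull_finite[OF nondegD(1)[OF assms]] by auto
  define u' where "u' = (\<lambda>v. if v \<in> S then u v else 0)"
  have ex: "\<exists>u. (\<forall>v. v \<notin> S \<longrightarrow> u v = 0) \<and> sum u S = 1 \<and> (\<Sum>v\<in>S. u v *\<^sub>R v) = x"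
    using u by (intro exI[of _ u']) (auto simp: u'_def)
  have *: "(\<forall>v. v \<notin> S \<longrightarrow> bary S x v = 0) \<and> sum (bary S x) S = 1 \<and> (\<Sum>v\<in>S. bary S x v *\<^sub>R v) = x"
    unfolding bary_def by (rule someI_ex[OF ex])
  then show "v \<notin> S \<Longrightarrow> bary S x v = 0" "sum (bary S x) S = 1" "(\<Sum>v\<in>S. bary S x v *\<^sub>R v) = x"
    by auto
qed

lemma bary_unique:
  assumes "nondeg S" "\<And>v. v \<notin> S \<Longrightarrow> u v = 0" "sum u S = 1" "(\<Sum>v\<in>S. u v *\<^sub>R v) = x"
  shows "bary S x = u"
proof (rule ccontr)
  assume "bary S x \<noteq> u"
  then obtain v where v: "bary S x v \<noteq> u v"
    by auto
  then have vS: "v \<in> S"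
    using assms(2) bary_outside[OF assms(1)] by force
  have "sum (\<lambda>v. bary S x v - u v) S = 0" "(\<Sum>v\<in>S. (bary S x v - u v) *\<^sub>R v) = 0"
    using sum_bary[OF assms(1), of x] sum_bary_scaleR[OF assms(1), of x] assms(3,4)
    by (simp_all add: sum_subtractf scaleR_left_diff_distrib)
  then have "affine_dependent S"
    using v vS unfolding affine_dependent_explicit_finite[OF nondegD(1)[OF assms(1)]]
    by (intro exI[of _ "\<lambda>v. bary S x v - u v"]) auto
  then show False
    using nondegD(2)[OF assms(1)] by simp
qed

lemma bary_vertex:
  assumes "nondeg S" "v \<in> S"
  shows "bary S v w = (if w = v then 1 else 0)"
proof -
  have "bary S v = (\<lambda>w. if w = v then 1 else 0)"
    using assms nondegD(1)[OF assms(1)]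
    by (intro bary_unique) (auto simp: if_distrib[of "\<lambda>c. c *\<^sub>R _"] sum.delta' cong: if_cong)
  then show ?thesis by simp
qed

lemma bary_affine_combination:
  assumes "nondeg S" "finite I" "sum c I = 1"
  shows "bary S (\<Sum>i\<in>I. c i *\<^sub>R x i) v = (\<Sum>i\<in>I. c i * bary S (x i) v)"
proof -
  have "bary S (\<Sum>i\<in>I. c i *\<^sub>R x i) = (\<lambda>v. \<Sum>i\<in>I. c i * bary S (x i) v)"
  proof (rule bary_unique[OF assms(1)])
    show "(\<Sum>i\<in>I. c i * bary S (x i) v) = 0" if "v \<notin> S" for v
      using that by (simp add: bary_outside[OF assms(1)])
    have "(\<Sum>v\<in>S. \<Sum>i\<in>I. c i * bary S (x i) v) = (\<Sum>i\<in>I. c i * (\<Sum>v\<in>S. bary S (x i) v))"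
      by (subst sum.swap) (simp add: sum_distrib_left)
    then show "(\<Sum>v\<in>S. \<Sum>i\<in>I. c i * bary S (x i) v) = 1"
      using assms(3) sum_bary[OF assms(1)] by simp
    have "(\<Sum>v\<in>S. (\<Sum>i\<in>I. c i * bary S (x i) v) *\<^sub>R v)
        = (\<Sum>i\<in>I. c i *\<^sub>R (\<Sum>v\<in>S. bary S (x i) v *\<^sub>R v))"
      unfolding scaleR_sum_left by (subst sum.swap) (simp add: scaleR_sum_right)
    then show "(\<Sum>v\<in>S. (\<Sum>i\<in>I. c i * bary S (x i) v) *\<^sub>R v) = (\<Sum>i\<in>I. c i *\<^sub>R x i)"
      using sum_bary_scaleR[OF assms(1)] by simp
  qed
  then show ?thesis by simp
qed

lemma bary_comb2:
  assumes "nondeg S" "s + t = 1"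
  shows "bary S (s *\<^sub>R x + t *\<^sub>R y) v = s * bary S x v + t * bary S y v"
  using bary_affine_combination[OF assms(1), of "{True, False}" "\<lambda>i. if i then s else t" "\<lambda>i. if i then x else y" v]
    assms(2) by (simp add: add.commute)

lemma bary_comb3:
  assumes "nondeg S" "r + s + t = 1"
  shows "bary S (r *\<^sub>R x + s *\<^sub>R y + t *\<^sub>R z) v = r * bary S x v + s * bary S y v + t * bary S z v"
  using bary_affine_combination[OF assms(1), of "{0, 1, 2::nat}" "\<lambda>i. if i = 0 then r else if i = 1 then s else t"
      "\<lambda>i. if i = 0 then x else if i = 1 then y else z" v]
    assms(2) by (simp add: add.assoc)

lemma bary_midpoint:
  assumes "nondeg S"
  shows "bary S (midpoint x y) v = (bary S x v + bary S y v) / 2"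
  using bary_comb2[OF assms, of "1/2" "1/2" x y v] by (simp add: midpoint_def scaleR_add_right)

text \<open>Subtracting the value at the origin leaves a linear functional; the vector
  \<open>n\<close> representing it is the gradient of the coordinate, whose length is estimated in
  \<open>bary_lipschitz\<close>.\<close>

lemma bary_inner:
  assumes "nondeg S"
  obtains n c where "\<And>x. bary S x v = n \<bullet> x + c"
proof -
  define f where "f x = bary S x v - bary S 0 v" for x
  have "linear f"
  proof
    fix x y :: "real^'a" and r :: real
    show "f (x + y) = f x + f y"
      using bary_comb3[OF assms, of 1 1 "-1" x y 0 v] by (simp add: f_def)
    show "f (r *\<^sub>R x) = r *\<^sub>R f x"
      using bary_comb2[OF assms, of r "1 - r" x 0 v] by (simp add: f_def algebra_simps)
  qed
  then have "f x = adjoint f 1 \<bullet> x" for x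
    using adjoint_works[of f x 1] by (simp add: inner_commute)
  then show ?thesis
    using that[of "adjoint f 1" "bary S 0 v"] unfolding f_def by (metis diff_eq_eq)
qed

lemma affine_eq_sum_bary:
  assumes "nondeg S" "affine_on UNIV f"
  shows "f x = (\<Sum>v\<in>S. f v * bary S x v)"
proof -
  obtain a b where f: "\<And>x. f x = a \<bullet> x + b"
    using assms(2) unfolding affine_on_def by auto
  have "f x = a \<bullet> (\<Sum>v\<in>S. bary S x v *\<^sub>R v) + b * sum (bary S x) S"
    using sum_bary[OF assms(1)] sum_bary_scaleR[OF assms(1)] f by simp
  also have "\<dots> = (\<Sum>v\<in>S. f v * bary S x v)"
    by (simp add: f inner_sum_right sum_distrib_left sum.distrib algebra_simps)
  finally show ?thesis .
qed

lemma continuous_on_bary [continuous_intros]: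
  assumes "nondeg S"
  shows "continuous_on A (\<lambda>x. bary S x v)"
proof -
  obtain n c where "\<And>x. bary S x v = n \<bullet> x + c"
    using bary_inner[OF assms] by blast
  then show ?thesis by (auto intro!: continuous_intros)
qed

text \<open>Faces of \<open>S\<close> become zero sets of coordinates; later arguments about edges
  and faces go through this equivalence.\<close>

lemma subset_hull_iff_bary:
  assumes "nondeg S" "A \<subseteq> S"
  shows "x \<in> convex hull A \<longleftrightarrow> (\<forall>v. 0 \<le> bary S x v \<and> (v \<notin> A \<longrightarrow> bary S x v = 0))"
proof
  have finA: "finite A"
    using assms nondegD(1) finite_subset by blast
  assume "x \<in> convex hull A"
  then obtain u where u: "\<forall>v\<in>A. 0 \<le> u v" "sum u A = 1" "(\<Sum>v\<in>A. u v *\<^sub>R v) = x"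
    unfolding convex_hull_finite[OF finA] by auto
  have "bary S x = (\<lambda>v. if v \<in> A then u v else 0)"
    using u assms nondegD(1)[OF assms(1)]
    by (intro bary_unique) (auto simp: if_distrib[of "\<lambda>c. c *\<^sub>R _"] sum.If_cases Int_absorb1 cong: if_cong)
  then show "\<forall>v. 0 \<le> bary S x v \<and> (v \<notin> A \<longrightarrow> bary S x v = 0)"
    using u by auto
next
  have finA: "finite A"
    using assms nondegD(1) finite_subset by blast
  assume *: "\<forall>v. 0 \<le> bary S x v \<and> (v \<notin> A \<longrightarrow> bary S x v = 0)"
  have "sum (bary S x) A = sum (bary S x) S"
    using * assms nondegD(1)[OF assms(1)] by (intro sum.mono_neutral_left) auto
  moreover have "(\<Sum>v\<in>A. bary S x v *\<^sub>R v) = (\<Sum>v\<in>S. bary S x v *\<^sub>R v)"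
    using * assms nondegD(1)[OF assms(1)] by (intro sum.mono_neutral_left) auto
  ultimately show "x \<in> convex hull A"
    unfolding convex_hull_finite[OF finA]
    using * sum_bary[OF assms(1)] sum_bary_scaleR[OF assms(1)] by auto
qed

lemma hull_iff_bary:
  assumes "nondeg S"
  shows "x \<in> convex hull S \<longleftrightarrow> (\<forall>v\<in>S. 0 \<le> bary S x v)"
  using subset_hull_iff_bary[OF assms order_refl, of x] bary_outside[OF assms] by fastforce

lemma bary_nonneg: "nondeg S \<Longrightarrow> x \<in> convex hull S \<Longrightarrow> 0 \<le> bary S x v"
  using subset_hull_iff_bary[of S S x] by auto

lemma bary_le_1:
  assumes "nondeg S" "x \<in> convex hull S"
  shows "bary S x v \<le> 1"
proof (cases "v \<in> S")
  case True
  then have "bary S x v \<le> sum (bary S x) S"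
    using bary_nonneg[OF assms] nondegD(1)[OF assms(1)] by (intro member_le_sum) auto
  then show ?thesis using sum_bary[OF assms(1)] by simp
qed (simp add: bary_outside[OF assms(1)])

lemma interior_hull_iff_bary:
  assumes "nondeg (S :: (real^'n::finite) set)"
  shows "x \<in> interior (convex hull S) \<longleftrightarrow> (\<forall>v\<in>S. 0 < bary S x v)"
proof -
  have "x \<in> interior (convex hull S) \<longleftrightarrow>
      (\<exists>u. (\<forall>v\<in>S. 0 < u v) \<and> sum u S = 1 \<and> (\<Sum>v\<in>S. u v *\<^sub>R v) = x)"
    using nondegD(2,3)[OF assms] by (subst interior_convex_hull_explicit_minimal) auto
  also have "\<dots> \<longleftrightarrow> (\<forall>v\<in>S. 0 < bary S x v)"
  proof
    assume "\<exists>u. (\<forall>v\<in>S. 0 < u v) \<and> sum u S = 1 \<and> (\<Sum>v\<in>S. u v *\<^sub>R v) = x"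
    then obtain u where u: "\<forall>v\<in>S. 0 < u v" "sum u S = 1" "(\<Sum>v\<in>S. u v *\<^sub>R v) = x" by blast
    have "bary S x = (\<lambda>v. if v \<in> S then u v else 0)"
      using u assms by (intro bary_unique) auto
    then show "\<forall>v\<in>S. 0 < bary S x v" using u by auto
  next
    assume "\<forall>v\<in>S. 0 < bary S x v"
    then show "\<exists>u. (\<forall>v\<in>S. 0 < u v) \<and> sum u S = 1 \<and> (\<Sum>v\<in>S. u v *\<^sub>R v) = x"
      using sum_bary[OF assms] sum_bary_scaleR[OF assms] by blast
  qed
  finally show ?thesis .
qed

lemma interior_hull_nonempty:
  assumes "nondeg S"
  shows "interior (convex hull S) \<noteq> {}"
proof -
  define c where "c = 1 / real (card S)"
  have c: "c > 0" "sum (\<lambda>v. c) S = 1"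
    using nondegD(1,4)[OF assms] by (auto simp: c_def card_gt_0_iff)
  have "bary S (\<Sum>v\<in>S. c *\<^sub>R v) w > 0" if "w \<in> S" for w
    using bary_affine_combination[OF assms nondegD(1)[OF assms] c(2), of "\<lambda>v. v" w] c(1) that
      bary_vertex[OF assms] nondegD(1)[OF assms] by (simp add: if_distrib cong: if_cong)
  then show ?thesis
    using interior_hull_iff_bary[OF assms] by blast
qed

lemma subset_hull_subset:
  assumes "nondeg S" "A \<subseteq> S" "w \<in> S" "w \<in> convex hull A"
  shows "w \<in> A"
  using subset_hull_iff_bary[OF assms(1,2), of w] assms(3,4) bary_vertex[OF assms(1), of w w] by auto

text \<open>Conformity of two simplices means that their barycentric coordinates agree on the
  intersection.\<close>

lemma bary_eq_of_conforming:
  assumes "nondeg S" "nondeg T" "x \<in> convex hull (S \<inter> T)"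
  shows "bary S x = bary T x"
proof (rule bary_unique[OF assms(1)])
  have S: "0 \<le> bary S x v \<and> (v \<notin> S \<inter> T \<longrightarrow> bary S x v = 0)" for v
    using assms subset_hull_iff_bary[OF assms(1), of "S \<inter> T" x] by auto
  have T: "0 \<le> bary T x v \<and> (v \<notin> S \<inter> T \<longrightarrow> bary T x v = 0)" for v
    using assms subset_hull_iff_bary[OF assms(2), of "S \<inter> T" x] by auto
  show "bary T x v = 0" if "v \<notin> S" for v
    using T that by auto
  have "sum (bary T x) S = sum (bary T x) (S \<inter> T)"
    using T nondegD(1)[OF assms(1)] by (intro sum.mono_neutral_right) auto
  also have "\<dots> = sum (bary T x) T"
    using T nondegD(1)[OF assms(2)] by (intro sum.mono_neutral_left) auto
  finally show "sum (bary T x) S = 1"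
    using sum_bary[OF assms(2)] by simp
  have "(\<Sum>v\<in>S. bary T x v *\<^sub>R v) = (\<Sum>v\<in>S\<inter>T. bary T x v *\<^sub>R v)"
    using T nondegD(1)[OF assms(1)] by (intro sum.mono_neutral_right) auto
  also have "\<dots> = (\<Sum>v\<in>T. bary T x v *\<^sub>R v)"
    using T nondegD(1)[OF assms(2)] by (intro sum.mono_neutral_left) auto
  finally show "(\<Sum>v\<in>S. bary T x v *\<^sub>R v) = x"
    using sum_bary_scaleR[OF assms(2)] by simp
qed

text \<open>A coordinate function common to both simplices vanishes off \<open>S\<close> and off
  \<open>T\<close>, hence off \<open>S \<inter> T\<close>, which places the point in the common
  face.\<close>

lemma conforming_of_bary_eq:
  assumes "nondeg S" "nondeg T"
    and "\<And>x. x \<in> convex hull S \<Longrightarrow> x \<in> convex hull T \<Longrightarrow> bary S x = bary T x"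
  shows "convex hull S \<inter> convex hull T = convex hull (S \<inter> T)"
proof
  show "convex hull S \<inter> convex hull T \<subseteq> convex hull (S \<inter> T)"
  proof
    fix x assume "x \<in> convex hull S \<inter> convex hull T"
    then have x: "x \<in> convex hull S" "x \<in> convex hull T" by auto
    then have "bary S x v = 0" if "v \<notin> S \<inter> T" for v
      using that assms(3)[OF x] bary_outside[OF assms(1)] bary_outside[OF assms(2)] by (metis IntI)
    then show "x \<in> convex hull (S \<inter> T)"
      using subset_hull_iff_bary[OF assms(1), of "S \<inter> T"] bary_nonneg[OF assms(1) x(1)] by auto
  qed
  show "convex hull (S \<inter> T) \<subseteq> convex hull S \<inter> convex hull T"
    by (simp add: hull_mono)
qed

section \<open>Bisection of a simplex\<close>

lemma midpoint_notin:
  assumes "nondeg S" "a \<in> S" "b \<in> S" "a \<noteq> b"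
  shows "midpoint a b \<notin> S"
proof
  assume "midpoint a b \<in> S"
  then have "bary S (midpoint a b) a \<in> {0, 1}"
    using bary_vertex[OF assms(1)] by auto
  moreover have "bary S (midpoint a b) a = 1/2"
    using assms by (simp add: bary_midpoint bary_vertex)
  ultimately show False by simp
qed

text \<open>Since \<open>a\<close> is the reflection of \<open>b\<close> in the midpoint, the new
  vertex set still spans the whole space; having the minimal number of points for this, it is
  affinely independent.\<close>

lemma nondeg_bisect:
  assumes S: "nondeg (S :: (real^'n::finite) set)" and ab: "a \<in> S" "b \<in> S" "a \<noteq> b"
  shows "nondeg (insert (midpoint a b) (S - {a}))"
proof -
  let ?m = "midpoint a b" and ?S = "insert (midpoint a b) (S - {a})"
  have card: "card ?S = CARD('n) + 1"
    using midpoint_notin[OF assms] nondegD(1,3)[OF S] ab by (simp add: card_Diff_singleton)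
  have "a = 2 *\<^sub>R ?m + (-1) *\<^sub>R b"
    by (simp add: midpoint_def)
  moreover have "?m \<in> affine hull ?S" "b \<in> affine hull ?S"
    using ab by (auto intro: hull_inc)
  ultimately have "a \<in> affine hull ?S"
    using mem_affine[OF affine_affine_hull, of ?m ?S b 2 "-1"] by simp
  then have "S \<subseteq> affine hull ?S"
    by (auto intro: hull_inc)
  then have "affine hull S \<subseteq> affine hull ?S"
    by (metis hull_minimal affine_affine_hull)
  then have "affine hull ?S = UNIV"
    using nondegD(5)[OF S] by auto
  then have "aff_dim ?S = int (CARD('n))"
    by (metis aff_dim_affine_hull aff_dim_UNIV DIM_cart DIM_real mult_1_right)
  then have "\<not> affine_dependent ?S"
    using card nondegD(1)[OF S] by (simp add: affine_independent_iff_card)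
  then show ?thesis
    using card nondegD(1)[OF S] by (simp add: nondeg_def)
qed

text \<open>Substitute \<open>a = 2 m - b\<close>, with \<open>m\<close> the midpoint, in the affine
  combination of the vertices: the weight of \<open>a\<close> passes twice to \<open>m\<close> and
  is subtracted from that of \<open>b\<close>.\<close>

lemma bary_bisect:
  assumes S: "nondeg S" and ab: "a \<in> S" "b \<in> S" "a \<noteq> b"
  shows "bary (insert (midpoint a b) (S - {a})) x v =
     (if v = midpoint a b then 2 * bary S x a
      else if v = a then 0 else if v = b then bary S x b - bary S x a else bary S x v)"
proof -
  let ?m = "midpoint a b" and ?S = "insert (midpoint a b) (S - {a})"
  let ?u = "\<lambda>v. if v = ?m then 2 * bary S x a
      else if v = a then 0 else if v = b then bary S x b - bary S x a else bary S x v"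
  have m: "?m \<notin> S" "?m \<noteq> a" "?m \<noteq> b" "b \<noteq> ?m"
    using midpoint_notin[OF assms] ab by auto
  have fin: "finite S" using nondegD(1)[OF S] .
  have Seq: "S = insert a (insert b (S - {a, b}))" "S - {a} = insert b (S - {a, b})"
    using ab by auto
  have "bary ?S x = ?u"
  proof (rule bary_unique[OF nondeg_bisect[OF assms]])
    show "?u v = 0" if "v \<notin> ?S" for v
      using that ab bary_outside[OF S] by auto
    have r: "sum ?u (S - {a,b}) = sum (bary S x) (S - {a,b})"
      using m by (intro sum.cong) auto
    have "sum ?u ?S = ?u ?m + (?u b + sum ?u (S - {a, b}))"
      using fin m ab by (subst Seq(2)) (simp del: if_image_distrib)
    also have "\<dots> = bary S x a + (bary S x b + sum (bary S x) (S - {a, b}))"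
      using m ab r by simp
    also have "\<dots> = sum (bary S x) S"
      using fin ab by (subst (4) Seq(1)) simp
    finally show "sum ?u ?S = 1" using sum_bary[OF S] by simp
    have r: "(\<Sum>v\<in>S - {a,b}. ?u v *\<^sub>R v) = (\<Sum>v\<in>S - {a,b}. bary S x v *\<^sub>R v)"
      using m by (intro sum.cong) auto
    have "(\<Sum>v\<in>?S. ?u v *\<^sub>R v) = ?u ?m *\<^sub>R ?m + (?u b *\<^sub>R b + (\<Sum>v\<in>S - {a, b}. ?u v *\<^sub>R v))"
      using fin m ab by (subst Seq(2)) simp
    also have "\<dots> = bary S x a *\<^sub>R a + (bary S x b *\<^sub>R b + (\<Sum>v\<in>S - {a, b}. bary S x v *\<^sub>R v))"
      using m ab r by (simp add: midpoint_def algebra_simps)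
    also have "\<dots> = (\<Sum>v\<in>S. bary S x v *\<^sub>R v)"
      using fin ab by (subst (4) Seq(1)) simp
    finally show "(\<Sum>v\<in>?S. ?u v *\<^sub>R v) = x" using sum_bary_scaleR[OF S] by simp
  qed
  then show ?thesis by simp
qed

text \<open>Among the new coordinates only that of \<open>b\<close> can change sign, so the half
  that keeps \<open>b\<close> is cut out by one inequality between two old coordinates.\<close>

lemma hull_bisect_iff:
  assumes S: "nondeg S" and ab: "a \<in> S" "b \<in> S" "a \<noteq> b"
  shows "x \<in> convex hull (insert (midpoint a b) (S - {a})) \<longleftrightarrow>
     x \<in> convex hull S \<and> bary S x a \<le> bary S x b"
proof -
  have "(\<forall>v\<in>insert (midpoint a b) (S - {a}). 0 \<le> bary (insert (midpoint a b) (S - {a})) x v) \<longleftrightarrow>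
      (\<forall>v\<in>S. 0 \<le> bary S x v) \<and> bary S x a \<le> bary S x b"
    using ab midpoint_notin[OF assms] unfolding bary_bisect[OF assms]
    by (smt (verit, best) Diff_iff insertE insertI1 insertI2 singletonD)
  then show ?thesis
    by (simp add: hull_iff_bary[OF S] hull_iff_bary[OF nondeg_bisect[OF assms]])
qed

section \<open>Linear changes of variables\<close>

lemma emeasure_open_nonzero:
  fixes S :: "'a::euclidean_space set"
  assumes "open S" "S \<noteq> {}"
  shows "emeasure lborel S \<noteq> 0"
proof
  assume "emeasure lborel S = 0"
  then have "S \<in> null_sets lborel"
    using assms(1) by (simp add: null_sets_def)
  then have "negligible S"
    using negligible_iff_null_sets null_sets_completion_iff2 null_sets_completionI by blast
  then show False
    using open_not_negligible[OF assms] by simp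
qed

lemma nn_integral_lborel_shift:
  fixes h :: "'a::euclidean_space \<Rightarrow> ennreal"
  assumes [measurable]: "h \<in> borel_measurable borel"
  shows "(\<integral>\<^sup>+x. h (x + c) \<partial>lborel) = (\<integral>\<^sup>+x. h x \<partial>lborel)"
proof -
  have "(\<integral>\<^sup>+x. h x \<partial>lborel) = (\<integral>\<^sup>+x. h x \<partial>distr lborel borel ((+) c))"
    by (simp add: lborel_distr_plus)
  also have "\<dots> = (\<integral>\<^sup>+x. h (x + c) \<partial>lborel)"
    by (subst nn_integral_distr) (auto simp: add.commute)
  finally show ?thesis ..
qed

text \<open>The push-forward of Lebesgue measure under \<open>g\<close> is translation invariant, hence a multiple of
  Lebesgue measure by the uniqueness argument for Haar measures.\<close>

lemma nn_integral_lborel_linear: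
  fixes g :: "'a::euclidean_space \<Rightarrow> 'a"
  assumes lin: "linear g" and inj: "inj g"
  obtains k :: real where "0 < k"
    "\<And>h c. h \<in> borel_measurable borel \<Longrightarrow>
       (\<integral>\<^sup>+x. h x \<partial>lborel) = ennreal k * (\<integral>\<^sup>+x. h (g x + c) \<partial>lborel)"
proof -
  have contg: "continuous_on UNIV g"
    using lin by (simp add: linear_continuous_on linear_conv_bounded_linear)
  then have [measurable]: "g \<in> borel_measurable borel"
    by (rule borel_measurable_continuous_onI)
  have surj: "surj g"
    using eucl.linear_inj_imp_surj[OF lin inj] .
  let ?B = "ball 0 1 :: 'a set"
  have [measurable]: "?B \<in> sets borel" by simp
  have ind[measurable]: "(indicator ?B :: 'a \<Rightarrow> ennreal) \<in> borel_measurable borel" by measurable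
  define K where "K = emeasure lborel (g -` ?B)"
  have gB: "open (g -` ?B)"
    using contg open_vimage[of ?B g] by simp
  have "0 \<in> g -` ?B"
    using lin by (simp add: linear_0)
  then have K0: "K \<noteq> 0"
    unfolding K_def using emeasure_open_nonzero[OF gB] by blast
  obtain e where e: "e > 0" "\<And>x. e * norm x \<le> norm (g x)"
    using linear_inj_bounded_below_pos[OF lin inj] by auto
  \<comment> \<open>The lower bound for \<open>norm (g x)\<close> makes the preimage of the unit
    ball bounded, so that its measure \<open>K\<close> is finite and can be divided by.\<close>
  have "g -` ?B \<subseteq> ball 0 (2 / e)"
  proof
    fix x assume "x \<in> g -` ?B"
    then have "e * norm x < 2" using e(2)[of x] by auto
    then show "x \<in> ball 0 (2/e)" using e(1) by (simp add: field_simps)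
  qed
  then have "K \<le> emeasure lborel (ball 0 (2/e) :: 'a set)"
    unfolding K_def by (intro emeasure_mono) auto
  then have Kinf: "K < \<infinity>"
    using emeasure_lborel_ball_finite[of 0 "2/e"] by (rule order_le_less_trans)
  define L where "L = emeasure lborel ?B"
  have L: "L \<noteq> 0" "L < \<infinity>"
    unfolding L_def using emeasure_lborel_ball_finite emeasure_open_nonzero[of ?B] by auto
  \<comment> \<open>Both sides are the double integral of
    \<open>indicator ?B y * h (g x + y)\<close>. Integrating over \<open>x\<close> first,
    translation invariance makes the inner integral independent of \<open>y\<close> and leaves
    \<open>L\<close>, the measure of the ball. Replacing \<open>y\<close> by \<open>y - g x\<close>
    beforehand leaves \<open>K\<close>, the measure of its preimage.\<close>
  have main: "L * (\<integral>\<^sup>+x. h (g x) \<partial>lborel) = K * (\<integral>\<^sup>+x. h x \<partial>lborel)"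
    if [measurable]: "h \<in> borel_measurable borel" for h
  proof -
    have shift: "(\<integral>\<^sup>+x. h (g x + y) \<partial>lborel) = (\<integral>\<^sup>+x. h (g x) \<partial>lborel)" for y
    proof -
      obtain z where "y = g z" using surj by auto
      then have "(\<integral>\<^sup>+x. h (g x + y) \<partial>lborel) = (\<integral>\<^sup>+x. (\<lambda>x. h (g x)) (x + z) \<partial>lborel)"
        using lin by (simp add: linear_add)
      also have "\<dots> = (\<integral>\<^sup>+x. h (g x) \<partial>lborel)"
        by (rule nn_integral_lborel_shift) measurable
      finally show ?thesis .
    qed
    have "L * (\<integral>\<^sup>+x. h (g x) \<partial>lborel) = (\<integral>\<^sup>+y. indicator ?B y * (\<integral>\<^sup>+x. h (g x + y) \<partial>lborel) \<partial>lborel)"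
      unfolding shift L_def using ind by (subst nn_integral_multc) auto
    also have "\<dots> = (\<integral>\<^sup>+y. (\<integral>\<^sup>+x. indicator ?B y * h (g x + y) \<partial>lborel) \<partial>lborel)"
      by (intro nn_integral_cong) (subst nn_integral_cmult, auto)
    also have "\<dots> = (\<integral>\<^sup>+x. (\<integral>\<^sup>+y. indicator ?B y * h (g x + y) \<partial>lborel) \<partial>lborel)"
      by (rule lborel_pair.Fubini') measurable
    also have "\<dots> = (\<integral>\<^sup>+x. (\<integral>\<^sup>+y. indicator ?B (y - g x) * h y \<partial>lborel) \<partial>lborel)"
    proof (rule nn_integral_cong)
      fix x
      show "(\<integral>\<^sup>+y. indicator ?B y * h (g x + y) \<partial>lborel) = (\<integral>\<^sup>+y. indicator ?B (y - g x) * h y \<partial>lborel)"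
        using nn_integral_lborel_shift[of "\<lambda>y. indicator ?B (y - g x) * h y" "g x"]
        by (simp add: add.commute)
    qed
    also have "\<dots> = (\<integral>\<^sup>+y. (\<integral>\<^sup>+x. indicator ?B (y - g x) * h y \<partial>lborel) \<partial>lborel)"
      by (rule lborel_pair.Fubini') measurable
    also have "\<dots> = (\<integral>\<^sup>+y. K * h y \<partial>lborel)"
    proof (rule nn_integral_cong)
      fix y
      obtain z where z: "y = g z" using surj by auto
      have "(\<integral>\<^sup>+x. indicator ?B (y - g x) * h y \<partial>lborel) = (\<integral>\<^sup>+x. indicator ?B (y - g x) \<partial>lborel) * h y"
        by (rule nn_integral_multc) measurable
      also have "(\<integral>\<^sup>+x. indicator ?B (y - g x) \<partial>lborel) = (\<integral>\<^sup>+x. (\<lambda>x. indicator (g -` ?B) x) (x + (- z)) \<partial>lborel)"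
        using lin by (intro nn_integral_cong)
          (auto simp: z indicator_def linear_diff dist_norm norm_minus_commute)
      also have "\<dots> = (\<integral>\<^sup>+x. indicator (g -` ?B) x \<partial>lborel)"
        using gB by (intro nn_integral_lborel_shift) measurable
      also have "\<dots> = K"
        using gB by (simp add: K_def)
      finally show "(\<integral>\<^sup>+x. indicator ?B (y - g x) * h y \<partial>lborel) = K * h y" .
    qed
    also have "\<dots> = K * (\<integral>\<^sup>+x. h x \<partial>lborel)"
      by (rule nn_integral_cmult) measurable
    finally show ?thesis .
  qed
  obtain r where r: "K = ennreal r" "r > 0"
    using K0 Kinf by (cases K) auto
  obtain l where l: "L = ennreal l" "l > 0"
    using L by (cases L) auto
  show ?thesis
  proof (rule that[of "l / r"])
    show "0 < l / r" using r l by simp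
    fix h :: "'a \<Rightarrow> ennreal" and c
    assume [measurable]: "h \<in> borel_measurable borel"
    have "L * (\<integral>\<^sup>+x. h (g x + c) \<partial>lborel) = K * (\<integral>\<^sup>+x. h (x + c) \<partial>lborel)"
      by (rule main) measurable
    also have "\<dots> = K * (\<integral>\<^sup>+x. h x \<partial>lborel)"
      by (simp add: nn_integral_lborel_shift)
    finally have "ennreal (1 / r) * (K * (\<integral>\<^sup>+x. h x \<partial>lborel)) = ennreal (1/r) * (L * (\<integral>\<^sup>+x. h (g x + c) \<partial>lborel))"
      by simp
    then show "(\<integral>\<^sup>+x. h x \<partial>lborel) = ennreal (l/r) * (\<integral>\<^sup>+x. h (g x + c) \<partial>lborel)"
      using r l by (simp add: mult.assoc[symmetric] ennreal_mult[symmetric])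
  qed
qed

text \<open>The unit ball is its own preimage and has positive finite measure, which forces the
  factor of the linear change of variables to be 1.\<close>

lemma nn_integral_lborel_orthogonal:
  fixes g :: "'a::euclidean_space \<Rightarrow> 'a"
  assumes g: "orthogonal_transformation g" and h: "h \<in> borel_measurable borel"
  shows "(\<integral>\<^sup>+x. h (g x) \<partial>lborel) = (\<integral>\<^sup>+x. h x \<partial>lborel)"
proof -
  obtain k :: real where k: "0 < k" "\<And>h c. h \<in> borel_measurable borel \<Longrightarrow>
       (\<integral>\<^sup>+x. h x \<partial>lborel) = ennreal k * (\<integral>\<^sup>+x. h (g x + c) \<partial>lborel)"
    using nn_integral_lborel_linear[OF orthogonal_transformation_linear[OF g] orthogonal_transformation_inj[OF g]]
    by blast
  let ?B = "ball 0 1 :: 'a set"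
  have [measurable]: "?B \<in> sets borel" by simp
  have ind[measurable]: "(indicator ?B :: 'a \<Rightarrow> ennreal) \<in> borel_measurable borel" by measurable
  have "emeasure lborel ?B = ennreal k * (\<integral>\<^sup>+x. indicator ?B (g x + 0) \<partial>lborel)"
    using ind by (subst k(2)[symmetric]) auto
  also have "(\<lambda>x. indicator ?B (g x + 0)) = (indicator ?B :: 'a \<Rightarrow> ennreal)"
    using g by (auto simp: indicator_def fun_eq_iff orthogonal_transformation)
  finally have "emeasure lborel ?B = ennreal k * emeasure lborel ?B" by simp
  moreover have "emeasure lborel ?B \<noteq> 0" "emeasure lborel ?B < \<infinity>"
    using emeasure_lborel_ball_finite emeasure_open_nonzero[of ?B] by auto
  moreover from this obtain b where "emeasure lborel ?B = ennreal b" "b > 0"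
    by (cases "emeasure lborel ?B") auto
  ultimately have "ennreal k = 1"
    using k(1) by (simp add: ennreal_mult[symmetric])
  then show ?thesis
    using k(2)[OF h, of 0] by simp
qed

section \<open>Integration over simplices\<close>

definition vol :: "(real^'n::finite) set \<Rightarrow> real" where
  "vol S = measure lborel (convex hull S)"

lemma hull_props:
  assumes "nondeg S"
  shows "compact (convex hull S)" "convex hull S \<in> sets borel" "emeasure lborel (convex hull S) < \<infinity>"
    "emeasure lborel (convex hull S) = ennreal (vol S)" "0 < vol S"
    "measure lborel (interior (convex hull S)) = vol S"
    "closure (interior (convex hull S)) = convex hull S"
proof -
  show c: "compact (convex hull S)"
    using nondegD(1)[OF assms] by (simp add: finite_imp_compact compact_convex_hull)
  then show s: "convex hull S \<in> sets borel"
    by (simp add: borel_compact)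
  show f: "emeasure lborel (convex hull S) < \<infinity>"
    using emeasure_compact_finite[OF c] by (simp add: less_top)
  then show e: "emeasure lborel (convex hull S) = ennreal (vol S)"
    by (simp add: vol_def emeasure_eq_ennreal_measure)
  have "0 < emeasure lborel (interior (convex hull S))"
    using emeasure_open_nonzero[OF open_interior interior_hull_nonempty[OF assms]]
    by (simp add: zero_less_iff_neq_zero)
  also have "\<dots> \<le> emeasure lborel (convex hull S)"
    using s by (intro emeasure_mono interior_subset) auto
  finally show "0 < vol S" unfolding e by simp
  have "negligible (frontier (convex hull S))"
    by (simp add: negligible_convex_frontier)
  then have "emeasure lborel (frontier (convex hull S)) = 0"
    using borel_closed[OF frontier_closed, of "convex hull S"]
    by (simp add: negligible_iff_emeasure0)
  moreover have "convex hull S = interior (convex hull S) \<union> frontier (convex hull S)"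
    using c compact_imp_closed[OF c] interior_subset by (auto simp: frontier_def)
  moreover have "emeasure lborel (interior (convex hull S) \<union> frontier (convex hull S))
      = emeasure lborel (interior (convex hull S))"
    using calculation(1) by (intro emeasure_Un_null_set) (auto simp: null_sets_def)
  ultimately have "emeasure lborel (convex hull S) = emeasure lborel (interior (convex hull S))"
    by simp
  then show "measure lborel (interior (convex hull S)) = vol S"
    by (simp add: vol_def measure_def)
  show "closure (interior (convex hull S)) = convex hull S"
    using convex_closure_interior[of "convex hull S"] interior_hull_nonempty[OF assms] compact_imp_closed[OF c]
    by (simp add: convex_convex_hull)
qed

text \<open>\<open>\<phi>\<close> is the affine map that carries each vertex \<open>v\<close> to
  \<open>f v\<close>, and \<open>k\<close> is its Jacobian. It preserves coordinates up to the
  relabelling \<open>f\<close>, so integrals of functions of the coordinates can be computed on one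
  reference simplex.\<close>

lemma simplex_transfer:
  fixes S S' :: "(real^'n::finite) set"
  assumes S: "nondeg S" and S': "nondeg S'" and f: "bij_betw f S S'"
  obtains \<phi> and k :: real where "0 < k"
    "\<And>h. h \<in> borel_measurable borel \<Longrightarrow>
       (\<integral>\<^sup>+y. h y * indicator (convex hull S') y \<partial>lborel)
        = ennreal k * (\<integral>\<^sup>+x. h (\<phi> x) * indicator (convex hull S) x \<partial>lborel)"
    "\<And>x v. v \<in> S \<Longrightarrow> bary S' (\<phi> x) (f v) = bary S x v"
proof -
  define \<phi> where "\<phi> x = (\<Sum>v\<in>S. bary S x v *\<^sub>R f v)" for x
  have fS: "f v \<in> S'" if "v \<in> S" for v
    using f that by (auto simp: bij_betw_def)
  have inj: "f v = f w \<longleftrightarrow> v = w" if "v \<in> S" "w \<in> S" for v w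
    using f that by (auto simp: bij_betw_def inj_on_def)
  have bary: "bary S' (\<phi> x) (f v) = bary S x v" if v: "v \<in> S" for x v
  proof -
    have "bary S' (\<phi> x) (f v) = (\<Sum>w\<in>S. bary S x w * bary S' (f w) (f v))"
      unfolding \<phi>_def using nondegD(1)[OF S] sum_bary[OF S] by (intro bary_affine_combination[OF S'])
    also have "\<dots> = (\<Sum>w\<in>S. if w = v then bary S x w else 0)"
      using fS v by (intro sum.cong) (auto simp: bary_vertex[OF S'] inj)
    also have "\<dots> = bary S x v"
      using v nondegD(1)[OF S] by simp
    finally show ?thesis .
  qed
  define g where "g x = \<phi> x - \<phi> 0" for x
  have "linear g"
  proof
    fix x y :: "real^'n" and r :: real
    have "\<phi> (x + y) = \<phi> x + \<phi> y - \<phi> 0"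
      unfolding \<phi>_def
      by (simp add: sum.distrib[symmetric] sum_subtractf[symmetric] scaleR_left_distrib[symmetric]
          scaleR_left_diff_distrib[symmetric])
        (use bary_comb3[OF S, of 1 1 "-1" x y 0] in simp)
    then show "g (x + y) = g x + g y" by (simp add: g_def)
    have "\<phi> (r *\<^sub>R x) = r *\<^sub>R \<phi> x + (1 - r) *\<^sub>R \<phi> 0"
      unfolding \<phi>_def scaleR_sum_right scaleR_scaleR
      by (simp add: sum.distrib[symmetric] scaleR_left_distrib[symmetric])
        (use bary_comb2[OF S, of r "1 - r" x 0] in simp)
    then show "g (r *\<^sub>R x) = r *\<^sub>R g x" by (simp add: g_def algebra_simps)
  qed
  moreover have "inj g"
  proof (rule injI)
    fix x y assume "g x = g y"
    then have "\<phi> x = \<phi> y" by (simp add: g_def)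
    then have "bary S x v = bary S y v" if "v \<in> S" for v
      using bary[OF that, of x] bary[OF that, of y] by simp
    then show "x = y"
      using sum_bary_scaleR[OF S, of x] sum_bary_scaleR[OF S, of y] by (metis (no_types, lifting) sum.cong)
  qed
  ultimately obtain k :: real where k: "0 < k" "\<And>h c. h \<in> borel_measurable borel \<Longrightarrow>
       (\<integral>\<^sup>+x. h x \<partial>lborel) = ennreal k * (\<integral>\<^sup>+x. h (g x + c) \<partial>lborel)"
    using nn_integral_lborel_linear by blast
  have hull: "\<phi> x \<in> convex hull S' \<longleftrightarrow> x \<in> convex hull S" for x
  proof -
    have "S' = f ` S" using f by (auto simp: bij_betw_def)
    then have "(\<forall>w\<in>S'. 0 \<le> bary S' (\<phi> x) w) \<longleftrightarrow> (\<forall>v\<in>S. 0 \<le> bary S' (\<phi> x) (f v))"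
      by blast
    then show ?thesis
      by (simp add: hull_iff_bary[OF S] hull_iff_bary[OF S'] bary)
  qed
  have [measurable]: "convex hull S' \<in> sets borel"
    using hull_props[OF S'] by simp
  show ?thesis
  proof (rule that[OF k(1) _ bary])
    fix h :: "real^'n \<Rightarrow> ennreal"
    assume [measurable]: "h \<in> borel_measurable borel"
    have "(\<integral>\<^sup>+y. h y * indicator (convex hull S') y \<partial>lborel)
        = ennreal k * (\<integral>\<^sup>+x. h (g x + \<phi> 0) * indicator (convex hull S') (g x + \<phi> 0) \<partial>lborel)"
      by (rule k(2)) measurable
    also have "(\<lambda>x. h (g x + \<phi> 0) * indicator (convex hull S') (g x + \<phi> 0)) =
        (\<lambda>x. h (\<phi> x) * indicator (convex hull S) x)"
      by (auto simp: g_def hull indicator_def)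
    finally show "(\<integral>\<^sup>+y. h y * indicator (convex hull S') y \<partial>lborel)
        = ennreal k * (\<integral>\<^sup>+x. h (\<phi> x) * indicator (convex hull S) x \<partial>lborel)" .
  qed
qed

lemma borel_measurable_bary:
  assumes "nondeg S"
  shows "(\<lambda>x. bary S x v) \<in> borel_measurable borel"
  by (intro borel_measurable_continuous_onI continuous_on_bary assms)

lemma bij_betw_extend2:
  assumes "finite S" "finite S'" "card S = card S'" "a \<in> S" "b \<in> S" "a \<noteq> b" "a' \<in> S'" "b' \<in> S'" "a' \<noteq> b'"
  obtains f where "bij_betw f S S'" "f a = a'" "f b = b'"
proof -
  have "card (S - {a, b}) = card (S' - {a', b'})"
    using assms by (simp add: card_Diff_subset)
  then obtain h where h: "bij_betw h (S - {a, b}) (S' - {a', b'})"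
    using assms finite_same_card_bij[of "S - {a, b}" "S' - {a', b'}"] by auto
  define f where "f = h(a := a', b := b')"
  have "bij_betw f (S - {a, b}) (S' - {a', b'})"
    using h by (subst bij_betw_cong[of _ _ h]) (auto simp: f_def)
  moreover have "bij_betw f {a, b} {a', b'}"
    using assms by (auto simp: f_def bij_betw_def)
  ultimately have "bij_betw f ((S - {a, b}) \<union> {a, b}) ((S' - {a', b'}) \<union> {a', b'})"
    by (intro bij_betw_combine) auto
  moreover have "(S - {a, b}) \<union> {a, b} = S" "(S' - {a', b'}) \<union> {a', b'} = S'"
    using assms by auto
  ultimately show ?thesis
    using that[of f] assms by (simp add: f_def)
qed

text \<open>An integrand in two coordinates only requires a bijection of the vertices that matches
  two prescribed pairs. The Jacobian is identified as the ratio of volumes by testing with the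
  constant 1.\<close>

lemma simplex_transfer2:
  fixes S S' :: "(real^'n::finite) set" and G :: "real \<Rightarrow> real \<Rightarrow> ennreal"
  assumes S: "nondeg S" "a \<in> S" "b \<in> S" "a \<noteq> b" and S': "nondeg S'" "a' \<in> S'" "b' \<in> S'" "a' \<noteq> b'"
    and G: "case_prod G \<in> borel_measurable (borel \<Otimes>\<^sub>M borel)"
  shows "(\<integral>\<^sup>+x. G (bary S' x a') (bary S' x b') * indicator (convex hull S') x \<partial>lborel)
       = ennreal (vol S' / vol S) * (\<integral>\<^sup>+x. G (bary S x a) (bary S x b) * indicator (convex hull S) x \<partial>lborel)"
proof -
  obtain f where f: "bij_betw f S S'" "f a = a'" "f b = b'"
    using bij_betw_extend2[of S S' a b a' b'] S S' nondegD(1,3)[OF S(1)] nondegD(1,3)[OF S'(1)] by auto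
  show ?thesis
  proof (rule simplex_transfer[OF S(1) S'(1) f(1)])
  fix k :: real and \<phi>
  assume k: "0 < k"
    "\<And>h. h \<in> borel_measurable borel \<Longrightarrow>
       (\<integral>\<^sup>+y. h y * indicator (convex hull S') y \<partial>lborel)
        = ennreal k * (\<integral>\<^sup>+x. h (\<phi> x) * indicator (convex hull S) x \<partial>lborel)"
    "\<And>x v. v \<in> S \<Longrightarrow> bary S' (\<phi> x) (f v) = bary S x v"
  have "ennreal (vol S') = ennreal k * ennreal (vol S)"
    using k(2)[of "\<lambda>_. 1"] hull_props[OF S(1)] hull_props[OF S'(1)] by simp
  then have "vol S' = k * vol S"
    using k(1) hull_props(5)[OF S(1)] hull_props(5)[OF S'(1)] by (simp add: ennreal_mult[symmetric])
  then have keq: "vol S' / vol S = k"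
    using hull_props(5)[OF S(1)] by simp
  have "(\<lambda>x. case_prod G (bary S' x a', bary S' x b')) \<in> borel_measurable borel"
    by (intro measurable_compose[OF _ G] measurable_Pair borel_measurable_bary S'(1))
  then show ?thesis
    unfolding keq using k(2)[of "\<lambda>x. G (bary S' x a') (bary S' x b')"] k(3)[OF S(2)] k(3)[OF S(3)] f
    by simp
  qed
qed

lemma nn_integral_compact:
  fixes g :: "'a::euclidean_space \<Rightarrow> real"
  assumes "compact K" "continuous_on K g"
  shows "set_integrable lborel K g"
    and "(\<And>x. x \<in> K \<Longrightarrow> 0 \<le> g x) \<Longrightarrow>
      (\<integral>\<^sup>+x. ennreal (g x) * indicator K x \<partial>lborel) = ennreal (LINT x:K|lborel. g x)"
proof -
  show *: "set_integrable lborel K g"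
    unfolding set_integrable_def using borel_integrable_compact[OF assms]
    by (simp add: indicator_scaleR_eq_if)
  assume nn: "\<And>x. x \<in> K \<Longrightarrow> 0 \<le> g x"
  have "(\<integral>\<^sup>+x. ennreal (g x) * indicator K x \<partial>lborel) = (\<integral>\<^sup>+x. ennreal (indicator K x *\<^sub>R g x) \<partial>lborel)"
    by (intro nn_integral_cong) (auto simp: indicator_def)
  also have "\<dots> = ennreal (LINT x:K|lborel. g x)"
    unfolding set_lebesgue_integral_def using * nn
    by (intro nn_integral_eq_integral) (auto simp: set_integrable_def indicator_def)
  finally show "(\<integral>\<^sup>+x. ennreal (g x) * indicator K x \<partial>lborel) = ennreal (LINT x:K|lborel. g x)" .
qed

lemma set_lebesgue_integral_nonneg_compact:
  fixes g :: "'a::euclidean_space \<Rightarrow> real"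
  assumes "\<And>x. x \<in> K \<Longrightarrow> 0 \<le> g x"
  shows "0 \<le> (LINT x:K|lborel. g x)"
  unfolding set_lebesgue_integral_def
  by (rule integral_nonneg_AE) (use assms in \<open>auto simp: indicator_def\<close>)

lemma two_vertices:
  assumes "nondeg S" "a \<in> S"
  obtains b where "b \<in> S" "b \<noteq> a"
proof -
  have "card S \<noteq> 1"
    using nondegD(3)[OF assms(1)] by simp
  then have "S \<noteq> {a}" by auto
  then show ?thesis using assms(2) that by auto
qed

section \<open>Moments of barycentric coordinates\<close>

lemma bary_transfer_integral:
  fixes S S' :: "(real^'n::finite) set" and G :: "real \<Rightarrow> real \<Rightarrow> real"
  assumes S: "nondeg S" "a \<in> S" "b \<in> S" "a \<noteq> b" and S': "nondeg S'" "a' \<in> S'" "b' \<in> S'" "a' \<noteq> b'"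
    and G: "continuous_on UNIV (case_prod G)" "\<And>s t. 0 \<le> s \<Longrightarrow> 0 \<le> t \<Longrightarrow> 0 \<le> G s t"
  shows "(LINT x:convex hull S'|lborel. G (bary S' x a') (bary S' x b'))
       = vol S' / vol S * (LINT x:convex hull S|lborel. G (bary S x a) (bary S x b))"
proof -
  have cont: "continuous_on A (\<lambda>x. G (bary T x c) (bary T x d))" if "nondeg T" for A and T :: "(real^'n) set" and c d :: "real^'n"
  proof -
    have "continuous_on A (\<lambda>x. case_prod G (bary T x c, bary T x d))"
      by (intro continuous_on_compose2[OF G(1)] continuous_intros that) auto
    then show ?thesis by simp
  qed
  have nn: "ennreal (LINT x:convex hull T|lborel. G (bary T x c) (bary T x d)) =
      (\<integral>\<^sup>+x. ennreal (G (bary T x c) (bary T x d)) * indicator (convex hull T) x \<partial>lborel)"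
     "0 \<le> (LINT x:convex hull T|lborel. G (bary T x c) (bary T x d))" if "nondeg T" for T :: "(real^'n) set" and c d :: "real^'n"
    using nn_integral_compact(2)[OF hull_props(1)[OF that] cont[OF that]] bary_nonneg[OF that] G(2)
    by (auto intro!: set_lebesgue_integral_nonneg_compact)
  have G': "case_prod (\<lambda>s t. ennreal (G s t)) \<in> borel_measurable (borel \<Otimes>\<^sub>M borel)"
    using borel_measurable_continuous_onI[OF G(1)] unfolding borel_prod[symmetric] case_prod_unfold
    by measurable
  have "ennreal (LINT x:convex hull S'|lborel. G (bary S' x a') (bary S' x b'))
      = ennreal (vol S' / vol S) * ennreal (LINT x:convex hull S|lborel. G (bary S x a) (bary S x b))"
    unfolding nn(1)[OF S(1)] nn(1)[OF S'(1)] by (rule simplex_transfer2[OF S S' G'])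
  then show ?thesis
    using nn(2)[OF S(1)] nn(2)[OF S'(1)] hull_props(5)[OF S(1)] hull_props(5)[OF S'(1)]
    by (simp add: ennreal_mult[symmetric])
qed

lemma ex_nondeg: "\<exists>S :: (real^'n::finite) set. nondeg S \<and> S = insert 0 Basis"
proof -
  have 0: "(0::real^'n) \<notin> Basis"
    using nonzero_Basis by blast
  have "\<not> affine_dependent (insert 0 (Basis :: (real^'n) set))"
    using 0 independent_Basis by (simp add: affine_dependent_iff_dependent)
  then show ?thesis
    using 0 by (simp add: nondeg_def)
qed

text \<open>The constants exist because every permutation of the vertices extends to an affine map.\<close>

lemma simplex_gram:
  "\<exists>A B L :: real. 0 \<le> B \<and> B < A \<and> 0 < L \<and>
    (\<forall>(S :: (real^'n::finite) set) a. nondeg S \<longrightarrow> a \<in> S \<longrightarrow>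
       (LINT x:convex hull S|lborel. bary S x a) = L * vol S) \<and>
    (\<forall>(S :: (real^'n) set) a b. nondeg S \<longrightarrow> a \<in> S \<longrightarrow> b \<in> S \<longrightarrow>
       (LINT x:convex hull S|lborel. bary S x a * bary S x b) = (if a = b then A else B) * vol S)"
proof -
  obtain S :: "(real^'n) set" where S: "nondeg S"
    using ex_nondeg by auto
  obtain a where a: "a \<in> S" using nondegD(4)[OF S] by auto
  obtain b where b: "b \<in> S" "a \<noteq> b" using two_vertices[OF S a] by metis
  note pos = hull_props(5)[OF S]
  define A where "A = (LINT x:convex hull S|lborel. bary S x a * bary S x a) / vol S"
  define B where "B = (LINT x:convex hull S|lborel. bary S x a * bary S x b) / vol S"
  define L where "L = (LINT x:convex hull S|lborel. bary S x a) / vol S"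
  have G1: "continuous_on UNIV (case_prod (\<lambda>(s::real) (t::real). s))"
    "continuous_on UNIV (case_prod (\<lambda>(s::real) (t::real). s * s))"
    "continuous_on UNIV (case_prod (\<lambda>(s::real) (t::real). s * t))"
    "continuous_on UNIV (case_prod (\<lambda>(s::real) (t::real). (s - t)\<^sup>2))"
    unfolding case_prod_unfold by (auto intro!: continuous_intros)
  have int: "set_integrable lborel (convex hull S) (\<lambda>x. bary S x c * bary S x d)" for c d
    by (intro nn_integral_compact(1) hull_props(1) S continuous_intros)
  have L: "(LINT x:convex hull T|lborel. bary T x c) = L * vol T" if T: "nondeg T" "c \<in> T" for T :: "(real^'n) set" and c
  proof -
    obtain d where d: "d \<in> T" "c \<noteq> d" using two_vertices[OF T] by metis
    show ?thesis
      using bary_transfer_integral[where G="\<lambda>s t. s", OF S a b T d G1(1)] pos by (simp add: L_def)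
  qed
  have AA: "(LINT x:convex hull T|lborel. bary T x c * bary T x c) = A * vol T" if T: "nondeg T" "c \<in> T" for T :: "(real^'n) set" and c
  proof -
    obtain d where d: "d \<in> T" "c \<noteq> d" using two_vertices[OF T] by metis
    show ?thesis
      using bary_transfer_integral[where G="\<lambda>s t. s * s", OF S a b T d G1(2)] pos by (simp add: A_def)
  qed
  have BB: "(LINT x:convex hull T|lborel. bary T x c * bary T x d) = B * vol T"
    if T: "nondeg T" "c \<in> T" "d \<in> T" "c \<noteq> d" for T :: "(real^'n) set" and c d
    using bary_transfer_integral[where G="\<lambda>s t. s * t", OF S a b T G1(3)] pos by (simp add: B_def)
  have "0 \<le> B"
    unfolding B_def using pos bary_nonneg[OF S]
    by (intro divide_nonneg_pos set_lebesgue_integral_nonneg_compact) auto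
  \<comment> \<open>The interior of the simplex is dense in it, so a continuous \<open>g\<close>
    with \<open>g a \<noteq> 0\<close> is nonzero on a nonempty open subset of the interior, which
    has positive measure.\<close>
  have posint: "0 < (LINT x:convex hull S|lborel. g x)"
    if g: "continuous_on UNIV g" "\<And>x. x \<in> convex hull S \<Longrightarrow> 0 \<le> g x" "g a \<noteq> 0" for g :: "real^'n \<Rightarrow> real"
  proof -
    let ?U = "interior (convex hull S) \<inter> {x. g x \<noteq> 0}"
    have "open ?U"
      using g(1) by (intro open_Int open_interior open_Collect_neq) auto
    moreover have "?U \<noteq> {}"
    proof
      assume "?U = {}"
      then have "interior (convex hull S) \<subseteq> {x. g x = 0}" by auto
      moreover have "closed {x. g x = 0}"
        using g(1) by (intro closed_Collect_eq) auto
      ultimately have "closure (interior (convex hull S)) \<subseteq> {x. g x = 0}"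
        by (rule closure_minimal)
      then have "convex hull S \<subseteq> {x. g x = 0}"
        using hull_props(7)[OF S] by simp
      then show False using a g(3) by (auto intro: hull_inc dest!: subsetD[of _ _ a])
    qed
    ultimately have U: "emeasure lborel ?U \<noteq> 0" by (rule emeasure_open_nonzero)
    have [measurable]: "g \<in> borel_measurable borel"
      using g(1) by (rule borel_measurable_continuous_onI)
    have [measurable]: "convex hull S \<in> sets borel"
      using hull_props[OF S] by simp
    have "(\<integral>\<^sup>+x. ennreal (g x) * indicator (convex hull S) x \<partial>lborel) \<noteq> 0"
    proof
      assume "(\<integral>\<^sup>+x. ennreal (g x) * indicator (convex hull S) x \<partial>lborel) = 0"
      then have zero: "emeasure lborel {x \<in> space lborel. ennreal (g x) * indicator (convex hull S) x \<noteq> 0} = 0"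
        by (subst (asm) nn_integral_0_iff) measurable
      have "?U \<subseteq> {x \<in> space lborel. ennreal (g x) * indicator (convex hull S) x \<noteq> 0}"
        using interior_subset[of "convex hull S"] g(2) by (force simp: indicator_def less_le)
      then have "emeasure lborel ?U
          \<le> emeasure lborel {x \<in> space lborel. ennreal (g x) * indicator (convex hull S) x \<noteq> 0}"
        by (rule emeasure_mono) measurable
      then show False using U unfolding zero by simp
    qed
    moreover have "(\<integral>\<^sup>+x. ennreal (g x) * indicator (convex hull S) x \<partial>lborel)
        = ennreal (LINT x:convex hull S|lborel. g x)"
      using g by (intro nn_integral_compact(2) hull_props(1) S) (auto intro: continuous_on_subset)
    ultimately show ?thesis
      by (simp add: zero_less_iff_neq_zero[symmetric])
  qed
  have "0 < (LINT x:convex hull S|lborel. bary S x a)"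
    using bary_nonneg[OF S] a by (intro posint continuous_intros S) (auto simp: bary_vertex[OF S])
  then have "0 < L" using pos by (simp add: L_def)
  \<comment> \<open>Expanding the square turns this integral into
    \<open>2 * (A - B) * vol S\<close>, so its positivity is the claim \<open>B < A\<close>.\<close>
  have "0 < (LINT x:convex hull S|lborel. (bary S x a - bary S x b)\<^sup>2)"
    using a b by (intro posint continuous_intros S) (auto simp: bary_vertex[OF S])
  also have "\<dots> = (LINT x:convex hull S|lborel. (bary S x a * bary S x a + bary S x b * bary S x b) - 2 * (bary S x a * bary S x b))"
    by (intro arg_cong[where f="\<lambda>g. set_lebesgue_integral lborel (convex hull S) g"] ext)
      (simp add: power2_eq_square algebra_simps)
  also have "\<dots> = A * vol S + A * vol S - 2 * (B * vol S)"
    using int a b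
    by (simp add: set_integral_diff(2) set_integral_add(2) set_integral_add(1) AA[OF S] BB[OF S])
  finally have "B < A" using pos by (simp add: algebra_simps)
  show ?thesis
    using \<open>0 \<le> B\<close> \<open>B < A\<close> \<open>0 < L\<close> L AA BB
    by (intro exI[of _ A] exI[of _ B] exI[of _ L]) auto
qed

lemma frontier_hull_null:
  assumes "nondeg S"
  shows "frontier (convex hull S) \<in> null_sets lborel"
proof -
  have "negligible (frontier (convex hull S))"
    by (simp add: negligible_convex_frontier)
  then show ?thesis
    using borel_closed[OF frontier_closed, of "convex hull S"]
    by (simp add: negligible_iff_emeasure0 null_sets_def)
qed

lemma AE_interior_hull_iff:
  assumes "nondeg S"
  shows "AE x in lborel. x \<in> interior (convex hull S) \<longleftrightarrow> x \<in> convex hull S"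
proof -
  have "convex hull S - interior (convex hull S) = frontier (convex hull S)"
    using hull_props(1)[OF assms] by (simp add: frontier_def compact_imp_closed)
  then show ?thesis
    using AE_not_in[OF frontier_hull_null[OF assms]] interior_subset[of "convex hull S"] by auto
qed

lemma set_integral_interior_hull:
  fixes f :: "real^'n::finite \<Rightarrow> real"
  assumes S: "nondeg S" and [measurable]: "f \<in> borel_measurable borel"
  shows "(LINT x:interior (convex hull S)|lborel. f x) = (LINT x:convex hull S|lborel. f x)"
proof -
  have [measurable]: "convex hull S \<in> sets borel" "interior (convex hull S) \<in> sets borel"
    using hull_props[OF S] by (simp_all add: borel_open)
  show ?thesis
    unfolding set_lebesgue_integral_def
    by (rule integral_cong_AE, measurable) (use AE_interior_hull_iff[OF S] in \<open>auto simp: indicator_def\<close>)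
qed

lemma nn_integral_interior_hull:
  assumes S: "nondeg S"
  shows "(\<integral>\<^sup>+x. f x * indicator (interior (convex hull S)) x \<partial>lborel)
       = (\<integral>\<^sup>+x. f x * indicator (convex hull S) x \<partial>lborel)"
  by (intro nn_integral_cong_AE) (use AE_interior_hull_iff[OF S] in \<open>auto simp: indicator_def\<close>)

text \<open>The Gram matrix of the coordinates is \<open>vol S\<close> times \<open>A - B\<close> on
  the diagonal plus the constant \<open>B\<close>. The constant part contributes a nonnegative
  square, so \<open>A - B\<close> bounds the quadratic form from below; this is the constant chosen
  here.\<close>

lemma affine_vertex_bound:
  "\<exists>C>0. \<forall>(S :: (real^'n::finite) set) f a. nondeg S \<longrightarrow> affine_on UNIV f \<longrightarrow> a \<in> S \<longrightarrow>
       (f a)\<^sup>2 * vol S \<le> C * (LINT x:convex hull S|lborel. (f x)\<^sup>2)"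
proof -
  obtain A B L :: real where g: "0 \<le> B" "B < A" "0 < L"
    "\<forall>(S :: (real^'n) set) a. nondeg S \<longrightarrow> a \<in> S \<longrightarrow>
       (LINT x:convex hull S|lborel. bary S x a) = L * vol S"
    "\<forall>(S :: (real^'n) set) a b. nondeg S \<longrightarrow> a \<in> S \<longrightarrow> b \<in> S \<longrightarrow>
       (LINT x:convex hull S|lborel. bary S x a * bary S x b) = (if a = b then A else B) * vol S"
    using simplex_gram[where 'n = 'n] by (elim exE conjE) (rule that, assumption+)
  show ?thesis
  proof (intro exI[of _ "1 / (A - B)"] conjI allI impI)
    show "0 < 1 / (A - B)" using g by simp
    fix S :: "(real^'n) set" and f :: "real^'n \<Rightarrow> real" and a
    assume S: "nondeg S" and f: "affine_on UNIV f" and a: "a \<in> S"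
    note fin = nondegD(1)[OF S]
    have int: "set_integrable lborel (convex hull S) (\<lambda>x. f u * f v * (bary S x u * bary S x v))" for u v
      by (intro nn_integral_compact(1) hull_props(1) S continuous_intros)
    have "(LINT x:convex hull S|lborel. (f x)\<^sup>2)
        = (LINT x:convex hull S|lborel. \<Sum>u\<in>S. \<Sum>v\<in>S. f u * f v * (bary S x u * bary S x v))"
      by (intro arg_cong[where f="\<lambda>g. set_lebesgue_integral lborel (convex hull S) g"] ext)
        (subst affine_eq_sum_bary[OF S f], simp add: power2_eq_square sum_product algebra_simps)
    also have "\<dots> = (\<Sum>u\<in>S. \<Sum>v\<in>S. LINT x:convex hull S|lborel. f u * f v * (bary S x u * bary S x v))"
      using int unfolding set_lebesgue_integral_def set_integrable_def scaleR_sum_right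
      by (simp add: Bochner_Integration.integral_sum Bochner_Integration.integrable_sum)
    also have "\<dots> = (\<Sum>u\<in>S. \<Sum>v\<in>S. f u * f v * ((if u = v then A else B) * vol S))"
      using g(5)[rule_format, OF S] by (intro sum.cong HOL.refl) simp_all
    also have "\<dots> = vol S * ((\<Sum>u\<in>S. \<Sum>v\<in>S. if v = u then (A - B) * (f u)\<^sup>2 else 0) + B * (\<Sum>u\<in>S. \<Sum>v\<in>S. f u * f v))"
      unfolding sum_distrib_left distrib_left sum.distrib[symmetric]
      by (intro sum.cong HOL.refl) (auto simp: algebra_simps power2_eq_square)
    also have "(\<Sum>u\<in>S. \<Sum>v\<in>S. if v = u then (A - B) * (f u)\<^sup>2 else 0) = (A - B) * (\<Sum>u\<in>S. (f u)\<^sup>2)"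
      using fin by (simp add: sum_distrib_left)
    also have "(\<Sum>u\<in>S. \<Sum>v\<in>S. f u * f v) = (sum f S)\<^sup>2"
      by (simp only: power2_eq_square sum_product)
    finally have eq: "(LINT x:convex hull S|lborel. (f x)\<^sup>2) = vol S * ((A - B) * (\<Sum>u\<in>S. (f u)\<^sup>2) + B * (sum f S)\<^sup>2)" .
    have "(f a)\<^sup>2 \<le> (\<Sum>u\<in>S. (f u)\<^sup>2)"
      using fin a by (intro member_le_sum) auto
    then have "(A - B) * (f a)\<^sup>2 \<le> (A - B) * (\<Sum>u\<in>S. (f u)\<^sup>2)"
      using g(2) by simp
    moreover have "0 \<le> B * (sum f S)\<^sup>2"
      using g(1) by simp
    ultimately have "(A - B) * (f a)\<^sup>2 \<le> (A - B) * (\<Sum>u\<in>S. (f u)\<^sup>2) + B * (sum f S)\<^sup>2"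
      by linarith
    then have "vol S * ((A - B) * (f a)\<^sup>2) \<le> (LINT x:convex hull S|lborel. (f x)\<^sup>2)"
      unfolding eq using hull_props(5)[OF S] by (intro mult_left_mono) auto
    then show "(f a)\<^sup>2 * vol S \<le> 1 / (A - B) * (LINT x:convex hull S|lborel. (f x)\<^sup>2)"
      using g(2) by (simp add: field_simps)
  qed
qed

definition dual_bounded :: "real \<Rightarrow> (real^'n::finite) set \<Rightarrow> bool" where
  "dual_bounded K S \<longleftrightarrow> (\<forall>z\<in>S. \<exists>\<psi>. affine_on UNIV \<psi> \<and>
     (\<forall>v\<in>S. (LINT x:convex hull S|lborel. \<psi> x * bary S x v) = (if v = z then 1 else 0)) \<and>
     (\<forall>x\<in>convex hull S. \<bar>\<psi> x\<bar> \<le> K / vol S))"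

text \<open>Subtracting the constant \<open>B / L\<close> from the coordinate of \<open>z\<close>
  cancels the off-diagonal entries \<open>B\<close> of the Gram matrix, because every coordinate has
  integral \<open>L * vol S\<close>. Scaling by \<open>1 / ((A - B) * vol S)\<close> normalises the
  remaining diagonal entry.\<close>

lemma dual_function: "\<exists>K>0. \<forall>S :: (real^'n::finite) set. nondeg S \<longrightarrow> dual_bounded K S"
proof -
  obtain A B L :: real where g: "0 \<le> B" "B < A" "0 < L"
    "\<forall>(S :: (real^'n) set) a. nondeg S \<longrightarrow> a \<in> S \<longrightarrow>
       (LINT x:convex hull S|lborel. bary S x a) = L * vol S"
    "\<forall>(S :: (real^'n) set) a b. nondeg S \<longrightarrow> a \<in> S \<longrightarrow> b \<in> S \<longrightarrow>
       (LINT x:convex hull S|lborel. bary S x a * bary S x b) = (if a = b then A else B) * vol S"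
    using simplex_gram[where 'n = 'n] by (elim exE conjE) (rule that, assumption+)
  show ?thesis
    unfolding dual_bounded_def
  proof (intro exI[of _ "(1 + B / L) / (A - B)"] conjI allI impI ballI)
    show "0 < (1 + B / L) / (A - B)"
      using g(1-3) by (intro divide_pos_pos add_pos_nonneg) auto
    fix S :: "(real^'n) set" and z
    assume S: "nondeg S" and z: "z \<in> S"
    define c where "c = 1 / ((A - B) * vol S)"
    define \<psi> where "\<psi> x = c * (bary S x z - B / L)" for x
    have c: "0 < c" using g hull_props(5)[OF S] by (simp add: c_def)
    have "affine_on UNIV \<psi>"
    proof -
      obtain n b where "\<And>x. bary S x z = n \<bullet> x + b"
        using bary_inner[OF S] by blast
      then have "\<psi> x = (c *\<^sub>R n) \<bullet> x + c * (b - B / L)" for x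
        by (simp add: \<psi>_def algebra_simps)
      then show ?thesis unfolding affine_on_def by blast
    qed
    moreover have "(LINT x:convex hull S|lborel. \<psi> x * bary S x v) = (if v = z then 1 else 0)" if v: "v \<in> S" for v
    proof -
      have "(LINT x:convex hull S|lborel. \<psi> x * bary S x v)
          = (LINT x:convex hull S|lborel. c * (bary S x z * bary S x v) - (c * B / L) * bary S x v)"
        by (simp add: \<psi>_def algebra_simps)
      also have "\<dots> = c * ((if z = v then A else B) * vol S) - c * B / L * (L * vol S)"
        using g(4)[rule_format, OF S v] g(5)[rule_format, OF S z v]
          set_integral_diff(2)[OF nn_integral_compact(1)[OF hull_props(1)[OF S], of "\<lambda>x. c * (bary S x z * bary S x v)"]
            nn_integral_compact(1)[OF hull_props(1)[OF S], of "\<lambda>x. (c * B / L) * bary S x v"]]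
        by (simp add: continuous_intros S)
      also have "\<dots> = c * vol S * ((if z = v then A else B) - B)"
        using g(3) by (simp add: field_simps)
      also have "\<dots> = (if v = z then c * vol S * (A - B) else 0)" by simp
      also have "c * vol S * (A - B) = 1"
        using g(2) hull_props(5)[OF S] by (simp add: c_def)
      finally show ?thesis .
    qed
    moreover have "\<bar>\<psi> x\<bar> \<le> (1 + B / L) / (A - B) / vol S" if x: "x \<in> convex hull S" for x
    proof -
      have "0 \<le> B / L" using g by simp
      then have "\<bar>bary S x z - B / L\<bar> \<le> 1 + B / L"
        using bary_nonneg[OF S x, of z] bary_le_1[OF S x, of z] by linarith
      then have "\<bar>\<psi> x\<bar> \<le> c * (1 + B / L)"
        using c by (simp add: \<psi>_def abs_mult)
      then show ?thesis by (simp add: c_def)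
    qed
    ultimately show "\<exists>\<psi>. affine_on UNIV \<psi> \<and>
        (\<forall>v\<in>S. (LINT x:convex hull S|lborel. \<psi> x * bary S x v) = (if v = z then 1 else 0)) \<and>
         (\<forall>x\<in>convex hull S. \<bar>\<psi> x\<bar> \<le> (1 + B / L) / (A - B) / vol S)"
      by blast
  qed
qed

text \<open>In the simplex spanned by the origin and the unit vectors the coordinate of a unit
  vector is a Cartesian coordinate. This simplex lies in the unit cube, over which the integral
  factorises with a single factor different from 1, the integral of \<open>r powr (- t)\<close> over
  [0, 1]. Other simplices follow by transfer.\<close>

lemma bary_powr_integral:
  fixes t :: real
  assumes t: "0 \<le> t" "t < 1"
  shows "\<exists>K>0. \<forall>(S :: (real^'n::finite) set) a. nondeg S \<longrightarrow> a \<in> S \<longrightarrow>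
       (\<integral>\<^sup>+x. ennreal (bary S x a powr (- t)) * indicator (convex hull S) x \<partial>lborel) \<le> ennreal (K * vol S)"
proof -
  let ?S = "insert 0 Basis :: (real^'n) set"
  have S: "nondeg ?S" using ex_nondeg by auto
  obtain i :: "real^'n" where i: "i \<in> Basis" using nonempty_Basis by blast
  have 0: "(0::real^'n) \<notin> Basis" using nonzero_Basis by blast
  have bary: "bary ?S x b = x \<bullet> b" if "b \<in> Basis" for x b
  proof -
    let ?u = "\<lambda>v. if v = 0 then 1 - (\<Sum>b\<in>Basis. x \<bullet> b) else if v \<in> Basis then x \<bullet> v else 0"
    have "(\<Sum>v\<in>Basis. ?u v) = (\<Sum>b\<in>Basis. x \<bullet> b)" "(\<Sum>v\<in>Basis. ?u v *\<^sub>R v) = (\<Sum>b\<in>Basis. (x \<bullet> b) *\<^sub>R b)"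
      using 0 by (auto intro!: sum.cong)
    then have "bary ?S x = ?u"
      using 0 by (intro bary_unique S) (auto simp: euclidean_representation)
    then show ?thesis using that 0 by auto
  qed
  define f :: "real^'n \<Rightarrow> real \<Rightarrow> ennreal" where
    "f b r = (if b = i then ennreal (r powr (- t)) else 1) * indicator {0..1} r" for b r
  have "(\<integral>\<^sup>+x. ennreal (bary ?S x i powr (- t)) * indicator (convex hull ?S) x \<partial>lborel)
      \<le> (\<integral>\<^sup>+x. (\<Prod>b\<in>Basis. f b (x \<bullet> b)) \<partial>lborel)"
  proof (rule nn_integral_mono)
    fix x :: "real^'n"
    show "ennreal (bary ?S x i powr (- t)) * indicator (convex hull ?S) x \<le> (\<Prod>b\<in>Basis. f b (x \<bullet> b))"
    proof (cases "x \<in> convex hull ?S")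
      case True
      have "0 \<le> x \<bullet> b" "x \<bullet> b \<le> 1" if "b \<in> Basis" for b
        using bary[OF that, of x] bary_nonneg[OF S True, of b] bary_le_1[OF S True, of b] by auto
      then have "(\<Prod>b\<in>Basis. f b (x \<bullet> b)) = (\<Prod>b\<in>Basis. if b = i then ennreal ((x \<bullet> b) powr (- t)) else 1)"
        by (intro prod.cong) (auto simp: f_def)
      then show ?thesis using True i by (simp add: bary)
    qed simp
  qed
  also have "\<dots> = (\<Prod>b\<in>Basis. (\<integral>\<^sup>+r. f b r \<partial>lborel))"
    by (rule nn_integral_lborel_prod) (auto simp: f_def)
  also have "\<dots> = (\<Prod>b\<in>Basis. if b = i then ennreal (1 / (1 - t)) else 1)"
  proof (rule prod.cong[OF HOL.refl])
    fix b :: "real^'n" assume "b \<in> Basis"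
    have "((\<lambda>x. x powr (- t)) has_integral (1 / (1 - t))) {0..1}"
      using has_integral_powr_from_0[of "- t" 1] t by simp
    then have "(\<integral>\<^sup>+r. indicator {0..1} r * r powr (- t) \<partial>lborel) = ennreal (1 / (1 - t))"
      by (intro nn_integral_has_integral_lebesgue) auto
    moreover have "(\<integral>\<^sup>+r. f i r \<partial>lborel) = (\<integral>\<^sup>+r. indicator {0..1} r * r powr (- t) \<partial>lborel)"
      by (intro nn_integral_cong) (auto simp: f_def indicator_def)
    ultimately show "(\<integral>\<^sup>+r. f b r \<partial>lborel) = (if b = i then ennreal (1 / (1 - t)) else 1)"
      by (auto simp: f_def)
  qed
  also have "\<dots> = ennreal (1 / (1 - t))"
    using i by simp
  finally have I: "(\<integral>\<^sup>+x. ennreal (bary ?S x i powr (- t)) * indicator (convex hull ?S) x \<partial>lborel)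
      \<le> ennreal (1 / (1 - t))" .
  note pos = hull_props(5)[OF S]
  show ?thesis
  proof (intro exI[of _ "1 / (1 - t) / vol ?S"] conjI allI impI)
    show "0 < 1 / (1 - t) / vol ?S" using t pos by simp
    fix T :: "(real^'n) set" and a assume T: "nondeg T" "a \<in> T"
    obtain b where b: "b \<in> T" "a \<noteq> b" using two_vertices[OF T] by metis
    have "(\<integral>\<^sup>+x. ennreal (bary T x a powr (- t)) * indicator (convex hull T) x \<partial>lborel)
       = ennreal (vol T / vol ?S) * (\<integral>\<^sup>+x. ennreal (bary ?S x i powr (- t)) * indicator (convex hull ?S) x \<partial>lborel)"
      by (rule simplex_transfer2[where G="\<lambda>s _. ennreal (s powr (- t))", of ?S i 0 T a b])
        (use S T b i 0 in \<open>auto simp: case_prod_unfold\<close>)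
    also have "\<dots> \<le> ennreal (vol T / vol ?S) * ennreal (1 / (1 - t))"
      by (intro mult_left_mono I) auto
    also have "\<dots> = ennreal (1 / (1 - t) / vol ?S * vol T)"
      using t pos hull_props(5)[OF T(1)] by (simp add: ennreal_mult[symmetric])
    finally show "(\<integral>\<^sup>+x. ennreal (bary T x a powr (- t)) * indicator (convex hull T) x \<partial>lborel)
        \<le> ennreal (1 / (1 - t) / vol ?S * vol T)" .
  qed
qed

text \<open>The simplex lies in a slab of width \<open>1 / norm n\<close>, where \<open>n\<close> is the gradient of the
  barycentric coordinate, and in a ball of radius \<open>diameter\<close>.\<close>

lemma bary_lipschitz:
  fixes S :: "(real^'n::finite) set"
  assumes S: "nondeg S" and a: "a \<in> S"
  shows "\<bar>bary S x a - bary S y a\<bar>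
    \<le> 2 ^ CARD('n) * diameter (convex hull S) ^ (CARD('n) - 1) / vol S * norm (x - y)"
proof -
  let ?D = "diameter (convex hull S)"
  obtain n c where nc: "\<And>x. bary S x a = n \<bullet> x + c"
    using bary_inner[OF S] by blast
  obtain b where b: "b \<in> S" "b \<noteq> a" using two_vertices[OF S a] by metis
  have "n \<noteq> 0"
    using nc[of a] nc[of b] bary_vertex[OF S a, of a] bary_vertex[OF S b(1), of a] b by auto
  then have n: "norm n > 0" by simp
  obtain k :: 'n where True by simp
  have "norm (axis k (1::real)) = norm (n /\<^sub>R norm n)"
    using n by simp
  then obtain g where g: "orthogonal_transformation g" "g (axis k (1::real)) = n /\<^sub>R norm n"
    using orthogonal_transformation_exists by blast
  have [measurable]: "convex hull S \<in> sets borel"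
    using hull_props[OF S] by simp
  have bdd: "bounded (convex hull S)"
    using hull_props(1)[OF S] compact_imp_bounded by blast
  have surj: "surj g" using g(1) orthogonal_transformation_surj by blast
  obtain x0 where x0: "g x0 = a" using surj by (metis surjD)
  have a_hull: "a \<in> convex hull S" using a by (simp add: hull_inc)
  have D0: "0 \<le> ?D" using diameter_ge_0[OF bdd] .
  \<comment> \<open>The orthogonal map \<open>g\<close> takes axis \<open>k\<close> to the direction
    of \<open>n\<close>. The coordinate of \<open>a\<close> is 1 at \<open>a\<close> and has values
    in [0, 1], so component \<open>k\<close> differs from that of \<open>x0\<close> by at most
    \<open>1 / norm n\<close>; the other components differ by at most the diameter. Comparing
    \<open>vol S\<close> with the volume of this box bounds \<open>norm n\<close>.\<close>
  define l :: "real^'n" where "l = (\<chi> j. if j = k then x0 $ k - 1 / norm n else x0 $ j - ?D)"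
  define u :: "real^'n" where "u = (\<chi> j. if j = k then x0 $ k + 1 / norm n else x0 $ j + ?D)"
  have sub: "x \<in> cbox l u" if "g x \<in> convex hull S" for x
  proof -
    have "norm (g x - g x0) \<le> ?D"
      using diameter_bounded_bound[OF bdd that a_hull] by (simp add: x0 dist_norm)
    then have "norm (x - x0) \<le> ?D"
      using g(1) by (metis orthogonal_transformation_linear linear_diff orthogonal_transformation)
    then have 1: "\<bar>x $ j - x0 $ j\<bar> \<le> ?D" for j
      using component_le_norm_cart[of "x - x0" j] by simp
    have "n \<bullet> g y = norm n * y $ k" for y
    proof -
      have "n = norm n *\<^sub>R g (axis k 1)" using n g(2) by simp
      then have "n \<bullet> g y = norm n * (g (axis k 1) \<bullet> g y)" by (metis inner_scaleR_left)
      also have "g (axis k 1) \<bullet> g y = axis k 1 \<bullet> y"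
        using g(1) by (simp add: orthogonal_transformation_def)
      finally show ?thesis by (simp add: inner_axis')
    qed
    then have "bary S (g x) a - bary S (g x0) a = norm n * (x $ k - x0 $ k)"
      unfolding nc by (simp add: algebra_simps)
    moreover have "\<bar>bary S (g x) a - bary S (g x0) a\<bar> \<le> 1"
      using bary_nonneg[OF S that, of a] bary_le_1[OF S that, of a] bary_vertex[OF S a, of a] x0 by simp
    ultimately have "norm n * \<bar>x $ k - x0 $ k\<bar> \<le> 1"
      using n by (simp add: abs_mult)
    then have "\<bar>x $ k - x0 $ k\<bar> \<le> 1 / norm n"
      using n by (simp add: field_simps)
    then have "l $ j \<le> x $ j \<and> x $ j \<le> u $ j" for j
      using 1[of j] by (auto simp: l_def u_def abs_le_iff)
    then show ?thesis by (simp add: mem_box_cart)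
  qed
  have lu: "l $ j \<le> u $ j" for j using D0 n by (auto simp: l_def u_def)
  have "ennreal (vol S) = (\<integral>\<^sup>+x. indicator (convex hull S) (g x) \<partial>lborel)"
    using nn_integral_lborel_orthogonal[OF g(1), of "indicator (convex hull S)"] hull_props(4)[OF S] by simp
  also have "\<dots> \<le> (\<integral>\<^sup>+x. indicator (cbox l u) x \<partial>lborel)"
    using sub by (intro nn_integral_mono) (auto simp: indicator_def)
  also have "\<dots> = ennreal (measure lborel (cbox l u))"
    using emeasure_lborel_cbox_finite[of l u] by (simp add: emeasure_eq_ennreal_measure less_top)
  finally have "vol S \<le> measure lborel (cbox l u)"
    by (simp add: ennreal_le_iff)
  also have "\<dots> = (\<Prod>j\<in>UNIV. u $ j - l $ j)"
    using lu by (intro content_cbox_cart) (auto simp: interval_ne_empty_cart)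
  also have "\<dots> = (u $ k - l $ k) * (\<Prod>j\<in>UNIV - {k}. u $ j - l $ j)"
    by (simp add: prod.remove)
  also have "(\<Prod>j\<in>UNIV - {k}. u $ j - l $ j) = (\<Prod>j\<in>UNIV - {k}. 2 * ?D)"
    by (intro prod.cong) (auto simp: l_def u_def)
  also have "\<dots> = (2 * ?D) ^ (CARD('n) - 1)"
    by (simp add: card_Diff_singleton)
  also have "u $ k - l $ k = 2 / norm n" by (simp add: l_def u_def)
  finally have "vol S \<le> 2 / norm n * (2 * ?D) ^ (CARD('n) - 1)" .
  also have "\<dots> = 2 * 2 ^ (CARD('n) - 1) * ?D ^ (CARD('n) - 1) / norm n"
    by (simp add: power_mult_distrib)
  also have "2 * 2 ^ (CARD('n) - 1) = (2 :: real) ^ CARD('n)"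
    using power_Suc[of "2::real" "CARD('n) - 1"] zero_less_card_finite[where 'a='n] by simp
  finally have "norm n \<le> 2 ^ CARD('n) * ?D ^ (CARD('n) - 1) / vol S"
    using n hull_props(5)[OF S] by (simp add: field_simps)
  moreover have "\<bar>bary S x a - bary S y a\<bar> \<le> norm n * norm (x - y)"
  proof -
    have "bary S x a - bary S y a = n \<bullet> (x - y)" by (simp add: nc algebra_simps)
    then show ?thesis using Cauchy_Schwarz_ineq2[of n "x - y"] by simp
  qed
  ultimately show ?thesis
    by (meson mult_right_mono norm_ge_zero order_trans)
qed

section \<open>Newest vertex bisection\<close>

lemma hull_bisect_Un:
  assumes S: "nondeg S" and ab: "a \<in> S" "b \<in> S" "a \<noteq> b"
  shows "convex hull (insert (midpoint a b) (S - {a})) \<union> convex hull (insert (midpoint a b) (S - {b})) = convex hull S"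
proof (rule set_eqI)
  fix x
  note B = hull_bisect_iff[OF S ab(2,1) ab(3)[symmetric], unfolded midpoint_sym[of b a]]
  show "x \<in> convex hull (insert (midpoint a b) (S - {a})) \<union> convex hull (insert (midpoint a b) (S - {b}))
      \<longleftrightarrow> x \<in> convex hull S"
    unfolding Un_iff hull_bisect_iff[OF S ab] B using linear[of "bary S x a" "bary S x b"] by blast
qed

text \<open>The affine map exchanging \<open>a\<close> and \<open>b\<close> maps the two halves onto
  each other, so their volumes agree. They overlap only where the coordinates of \<open>a\<close>
  and \<open>b\<close> coincide, which is a hyperplane and hence a null set.\<close>

lemma vol_bisect:
  fixes S :: "(real^'n::finite) set"
  assumes S: "nondeg S" and ab: "a \<in> S" "b \<in> S" "a \<noteq> b"
  shows "vol (insert (midpoint a b) (S - {a})) = vol S / 2"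
proof -
  let ?A = "convex hull (insert (midpoint a b) (S - {a}))"
  let ?B = "convex hull (insert (midpoint a b) (S - {b}))"
  note nA = nondeg_bisect[OF S ab]
  have nB: "nondeg (insert (midpoint a b) (S - {b}))"
    using nondeg_bisect[OF S ab(2,1) ab(3)[symmetric]] by (simp add: midpoint_sym)
  have B: "x \<in> ?B \<longleftrightarrow> x \<in> convex hull S \<and> bary S x b \<le> bary S x a" for x
    using hull_bisect_iff[OF S ab(2,1) ab(3)[symmetric]] by (simp add: midpoint_sym)
  have [measurable]: "?A \<in> sets borel" "?B \<in> sets borel" "convex hull S \<in> sets borel"
    using hull_props[OF nA] hull_props[OF nB] hull_props[OF S] by auto
  let ?G = "\<lambda>s t::real. indicator {p. fst p \<le> snd p} (s, t) :: ennreal"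
  have G: "case_prod ?G \<in> borel_measurable (borel \<Otimes>\<^sub>M borel)"
    unfolding case_prod_unfold prod.collapse borel_prod
    by (intro borel_measurable_indicator borel_closed closed_Collect_le continuous_intros)
  have "(\<integral>\<^sup>+x. ?G (bary S x a) (bary S x b) * indicator (convex hull S) x \<partial>lborel) =
      ennreal (vol S / vol S) * (\<integral>\<^sup>+x. ?G (bary S x b) (bary S x a) * indicator (convex hull S) x \<partial>lborel)"
    by (rule simplex_transfer2[where G="?G"]) (use S ab G in auto)
  moreover have "(\<integral>\<^sup>+x. ?G (bary S x a) (bary S x b) * indicator (convex hull S) x \<partial>lborel) = (\<integral>\<^sup>+x. indicator ?A x \<partial>lborel)"
    by (intro nn_integral_cong) (auto simp: indicator_def hull_bisect_iff[OF S ab])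
  moreover have "(\<integral>\<^sup>+x. ?G (bary S x b) (bary S x a) * indicator (convex hull S) x \<partial>lborel) = (\<integral>\<^sup>+x. indicator ?B x \<partial>lborel)"
    by (intro nn_integral_cong) (auto simp: indicator_def B)
  ultimately have "emeasure lborel ?A = emeasure lborel ?B"
    using hull_props(5)[OF S] by simp
  then have eq: "vol (insert (midpoint a b) (S - {a})) = vol (insert (midpoint a b) (S - {b}))"
    unfolding vol_def measure_def by simp
  obtain n c where n: "\<And>x. bary S x a = n \<bullet> x + c" using bary_inner[OF S] by blast
  obtain n' c' where n': "\<And>x. bary S x b = n' \<bullet> x + c'" using bary_inner[OF S] by blast
  have "n \<noteq> n'"
  proof
    assume "n = n'"
    then have "bary S a a - bary S b a = bary S a b - bary S b b"
      using n n' by simp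
    then show False using ab by (simp add: bary_vertex[OF S])
  qed
  then have "negligible {x. (n - n') \<bullet> x = c' - c}"
    by (intro negligible_hyperplane) simp
  moreover have H: "{x. (n - n') \<bullet> x = c' - c} \<in> sets borel"
    by (intro borel_closed closed_hyperplane)
  ultimately have "{x. (n - n') \<bullet> x = c' - c} \<in> null_sets lborel"
    by (simp add: negligible_iff_emeasure0 null_sets_def)
  then have "AE x in lborel. x \<notin> {x. (n - n') \<bullet> x = c' - c}"
    by (rule AE_not_in)
  then have "AE x in lborel. indicator (convex hull S) x = (indicator ?A x + indicator ?B x :: ennreal)"
  proof eventually_elim
    case (elim x)
    then have "bary S x a \<noteq> bary S x b"
      by (auto simp: n n' algebra_simps)
    then show ?case
      by (auto simp: indicator_def hull_bisect_iff[OF S ab] B)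
  qed
  then have "(\<integral>\<^sup>+x. indicator (convex hull S) x \<partial>lborel) = (\<integral>\<^sup>+x. indicator ?A x + indicator ?B x \<partial>lborel)"
    by (rule nn_integral_cong_AE)
  also have "\<dots> = (\<integral>\<^sup>+x. indicator ?A x \<partial>lborel) + (\<integral>\<^sup>+x. indicator ?B x \<partial>lborel)"
    by (rule nn_integral_add) auto
  finally have "ennreal (vol S) = ennreal (vol (insert (midpoint a b) (S - {a}))) + ennreal (vol (insert (midpoint a b) (S - {b})))"
    using hull_props(4)[OF S] hull_props(4)[OF nA] hull_props(4)[OF nB] by simp
  then show ?thesis
    using eq hull_props(5)[OF S] hull_props(5)[OF nA]
    by (simp add: ennreal_plus[symmetric] del: ennreal_plus)
qed

text \<open>\<open>ref0\<close> and \<open>ref1\<close> are the end points of the refinement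
  edge.\<close>

definition ref0 :: "'n::finite tsimplex \<Rightarrow> real^'n" where "ref0 \<tau> = fst \<tau> ! 0"
definition ref1 :: "'n::finite tsimplex \<Rightarrow> real^'n" where "ref1 \<tau> = fst \<tau> ! CARD('n)"

lemma verts_split:
  fixes \<tau> :: "'n::finite tsimplex"
  assumes "valid_tsimplex \<tau>"
  shows "verts \<tau> = insert (ref0 \<tau>) (insert (ref1 \<tau>) ((!) (fst \<tau>) ` {1..<CARD('n)}))"
    and "ref0 \<tau> \<noteq> ref1 \<tau>"
    and "ref0 \<tau> \<notin> (!) (fst \<tau>) ` {1..<CARD('n)}" "ref1 \<tau> \<notin> (!) (fst \<tau>) ` {1..<CARD('n)}"
proof -
  let ?z = "fst \<tau>"
  have len: "length ?z = CARD('n) + 1" and dist: "distinct ?z"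
    using assms unfolding valid_tsimplex_def by auto
  have "{..<CARD('n) + 1} = insert 0 (insert (CARD('n)) {1..<CARD('n)})"
    using zero_less_card_finite[where 'a='n] by auto
  moreover have "set ?z = (!) ?z ` {..<CARD('n) + 1}"
    using len by (auto simp: set_conv_nth image_def)
  ultimately have "set ?z = (!) ?z ` insert 0 (insert (CARD('n)) {1..<CARD('n)})"
    by simp
  then show "verts \<tau> = insert (ref0 \<tau>) (insert (ref1 \<tau>) ((!) (fst \<tau>) ` {1..<CARD('n)}))"
    by (simp add: ref0_def ref1_def)
  have nth_eq: "?z ! i = ?z ! j \<longleftrightarrow> i = j" if "i \<le> CARD('n)" "j \<le> CARD('n)" for i j
    using that len dist by (simp add: nth_eq_iff_index_eq)
  show "ref0 \<tau> \<noteq> ref1 \<tau>"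
    using nth_eq[of 0 "CARD('n)"] by (simp add: ref0_def ref1_def)
  show "ref0 \<tau> \<notin> (!) (fst \<tau>) ` {1..<CARD('n)}" "ref1 \<tau> \<notin> (!) (fst \<tau>) ` {1..<CARD('n)}"
    using nth_eq by (auto simp: ref0_def ref1_def)
qed

lemma insert_Diff_swap:
  assumes "p \<noteq> q" "q \<notin> I" "m \<notin> insert p (insert q I)"
  shows "insert p (insert m I) = insert m (insert p (insert q I) - {q})"
proof (rule set_eqI)
  fix x show "x \<in> insert p (insert m I) \<longleftrightarrow> x \<in> insert m (insert p (insert q I) - {q})"
    using assms by (cases "x = q") auto
qed

text \<open>The type \<open>\<beta>\<close> only influences the order of the inherited vertices; as
  sets, the vertices of the two sons are always those of the two halves of a bisection.\<close>

lemma sons_valid: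
  fixes \<tau> :: "'n::finite tsimplex"
  assumes v: "valid_tsimplex \<tau>"
  shows "\<exists>\<rho>\<^sub>0 \<rho>\<^sub>1. sons \<tau> = {\<rho>\<^sub>0, \<rho>\<^sub>1} \<and> valid_tsimplex \<rho>\<^sub>0 \<and> valid_tsimplex \<rho>\<^sub>1 \<and>
     verts \<rho>\<^sub>0 = insert (midpoint (ref0 \<tau>) (ref1 \<tau>)) (verts \<tau> - {ref1 \<tau>}) \<and>
     verts \<rho>\<^sub>1 = insert (midpoint (ref0 \<tau>) (ref1 \<tau>)) (verts \<tau> - {ref0 \<tau>})"
proof -
  obtain z \<beta> where \<tau>: "\<tau> = (z, \<beta>)" by (cases \<tau>)
  have \<beta>: "\<beta> < CARD('n)" using v by (simp add: \<tau> valid_tsimplex_def)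
  let ?d = "CARD('n)"
  let ?m = "midpoint (ref0 \<tau>) (ref1 \<tau>)"
  let ?f = "map ((!) z) [1..<Suc \<beta>]" and ?b = "map ((!) z) [Suc \<beta>..<?d]"
  let ?\<rho>0 = "(ref0 \<tau> # ?m # ?f @ ?b, (\<beta> + 1) mod ?d)" and ?\<rho>1 = "(ref1 \<tau> # ?m # ?f @ rev ?b, (\<beta> + 1) mod ?d)"
  have sons: "sons \<tau> = {?\<rho>0, ?\<rho>1}"
    by (simp add: sons_def Let_def \<tau> ref0_def ref1_def)
  note N = nondeg_verts[OF v] and sp = verts_split[OF v]
  have U: "{1..<Suc \<beta>} \<union> {Suc \<beta>..<?d} = {1..<?d}" using \<beta> by auto
  have fb: "set (?f @ ?b) = (!) (fst \<tau>) ` {1..<?d}"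
    by (simp only: set_append set_map set_upt image_Un[symmetric] U \<tau> fst_conv)
  have m: "?m \<notin> verts \<tau>"
    using sp by (intro midpoint_notin[OF N]) auto
  have "set (fst ?\<rho>0) = insert (ref0 \<tau>) (insert ?m ((!) (fst \<tau>) ` {1..<?d}))"
    unfolding fb[symmetric] by simp
  also have "\<dots> = insert ?m (verts \<tau> - {ref1 \<tau>})"
    using sp(2-4) m unfolding sp(1) by (intro insert_Diff_swap(1))
  finally have s0: "set (fst ?\<rho>0) = insert ?m (verts \<tau> - {ref1 \<tau>})" .
  have "set (fst ?\<rho>1) = insert (ref1 \<tau>) (insert ?m ((!) (fst \<tau>) ` {1..<?d}))"
    unfolding fb[symmetric] by simp
  also have "\<dots> = insert ?m (verts \<tau> - {ref0 \<tau>})"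
    using sp(2-4) m unfolding sp(1) insert_commute[of "ref0 \<tau>" "ref1 \<tau>"]
    by (intro insert_Diff_swap(1)) auto
  finally have s1: "set (fst ?\<rho>1) = insert ?m (verts \<tau> - {ref0 \<tau>})" .
  have n0: "nondeg (set (fst ?\<rho>0))"
    unfolding s0 using nondeg_bisect[OF N, of "ref1 \<tau>" "ref0 \<tau>"] sp by (simp add: midpoint_sym)
  have n1: "nondeg (set (fst ?\<rho>1))"
    unfolding s1 using nondeg_bisect[OF N, of "ref0 \<tau>" "ref1 \<tau>"] sp by simp
  have len: "length (fst ?\<rho>0) = ?d + 1" "length (fst ?\<rho>1) = ?d + 1"
    using \<beta> by auto
  have dist: "distinct (fst ?\<rho>0)" "distinct (fst ?\<rho>1)"
    by (rule card_distinct, simp only: nondegD(3)[OF n0] nondegD(3)[OF n1] len)+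
  have \<beta>': "(\<beta> + 1) mod ?d < ?d" by simp
  have "valid_tsimplex ?\<rho>0" "valid_tsimplex ?\<rho>1"
    unfolding valid_tsimplex_def snd_conv
    by (intro conjI len dist nondegD(2)[OF n0] nondegD(2)[OF n1] \<beta>')+
  then show ?thesis
    by (intro exI[of _ ?\<rho>0] exI[of _ ?\<rho>1] conjI sons s0 s1)
qed

text \<open>Treats both sons alike: \<open>a\<close> is the end point of the refinement edge that
  the son has lost, \<open>b\<close> the one that it has kept.\<close>

lemma son_cases:
  assumes v: "valid_tsimplex \<tau>" and \<rho>: "\<rho> \<in> sons \<tau>"
  shows "\<exists>a b. a \<in> verts \<tau> \<and> b \<in> verts \<tau> \<and> a \<noteq> b \<and> {a, b} = {ref0 \<tau>, ref1 \<tau>} \<and>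
    verts \<rho> = insert (midpoint a b) (verts \<tau> - {a}) \<and> valid_tsimplex \<rho>"
proof -
  obtain \<rho>0 \<rho>1 where s: "sons \<tau> = {\<rho>0, \<rho>1}" and v01: "valid_tsimplex \<rho>0" "valid_tsimplex \<rho>1"
    and r0: "verts \<rho>0 = insert (midpoint (ref0 \<tau>) (ref1 \<tau>)) (verts \<tau> - {ref1 \<tau>})"
    and r1: "verts \<rho>1 = insert (midpoint (ref0 \<tau>) (ref1 \<tau>)) (verts \<tau> - {ref0 \<tau>})"
    using sons_valid[OF v] by (elim exE conjE) (rule that, assumption+)
  have mem: "ref0 \<tau> \<in> verts \<tau>" "ref1 \<tau> \<in> verts \<tau>" "ref0 \<tau> \<noteq> ref1 \<tau>"
    using verts_split(1,2)[OF v] by simp_all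
  from s \<rho> consider "\<rho> = \<rho>0" | "\<rho> = \<rho>1" by auto
  then show ?thesis
  proof cases
    case 1
    then show ?thesis
      using mem r0 v01(1)
      by (intro exI[of _ "ref1 \<tau>"] exI[of _ "ref0 \<tau>"]) (simp add: midpoint_sym[of "ref1 \<tau>"] insert_commute)
  next
    case 2
    then show ?thesis
      using mem r1 v01(2) by (intro exI[of _ "ref0 \<tau>"] exI[of _ "ref1 \<tau>"]) simp
  qed
qed

lemma sons_cover:
  assumes v: "valid_tsimplex \<tau>" and x: "x \<in> convex hull (verts \<tau>)"
  shows "\<exists>\<rho>\<in>sons \<tau>. x \<in> convex hull (verts \<rho>)"
proof -
  obtain \<rho>0 \<rho>1 where s: "sons \<tau> = {\<rho>0, \<rho>1}"
    and r0: "verts \<rho>0 = insert (midpoint (ref0 \<tau>) (ref1 \<tau>)) (verts \<tau> - {ref1 \<tau>})"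
    and r1: "verts \<rho>1 = insert (midpoint (ref0 \<tau>) (ref1 \<tau>)) (verts \<tau> - {ref0 \<tau>})"
    using sons_valid[OF v] by (elim exE conjE) (rule that, assumption+)
  have mem: "ref0 \<tau> \<in> verts \<tau>" "ref1 \<tau> \<in> verts \<tau>" "ref0 \<tau> \<noteq> ref1 \<tau>"
    using verts_split(1,2)[OF v] by simp_all
  have "x \<in> convex hull (verts \<rho>1) \<union> convex hull (verts \<rho>0)"
    unfolding r0 r1 hull_bisect_Un[OF nondeg_verts[OF v] mem] by (rule x)
  then show ?thesis unfolding s by blast
qed

lemma sons_hull:
  assumes "valid_tsimplex \<tau>" "\<rho> \<in> sons \<tau>"
  shows "convex hull (verts \<rho>) \<subseteq> convex hull (verts \<tau>)"
proof -
  obtain a b where ab: "a \<in> verts \<tau>" "b \<in> verts \<tau>" "a \<noteq> b"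
    and \<rho>: "verts \<rho> = insert (midpoint a b) (verts \<tau> - {a})"
    using son_cases[OF assms] by blast
  show ?thesis
    unfolding \<rho> using hull_bisect_iff[OF nondeg_verts[OF assms(1)] ab] by blast
qed

lemma vol_son:
  assumes "valid_tsimplex \<tau>" "\<rho> \<in> sons \<tau>"
  shows "vol (verts \<rho>) = vol (verts \<tau>) / 2"
proof -
  obtain a b where ab: "a \<in> verts \<tau>" "b \<in> verts \<tau>" "a \<noteq> b"
    and \<rho>: "verts \<rho> = insert (midpoint a b) (verts \<tau> - {a})"
    using son_cases[OF assms] by blast
  show ?thesis
    unfolding \<rho> by (rule vol_bisect[OF nondeg_verts[OF assms(1)] ab])
qed

section \<open>Descendants and sequences of bisections\<close>

definition desc :: "'n::finite tsimplex \<Rightarrow> 'n tsimplex \<Rightarrow> bool" where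
  "desc = (\<lambda>\<tau> \<rho>. \<rho> \<in> sons \<tau>)\<^sup>*\<^sup>*"

lemma desc_refl [simp]: "desc \<tau> \<tau>" by (simp add: desc_def)

lemma desc_step: "desc \<tau> \<rho> \<Longrightarrow> \<sigma> \<in> sons \<rho> \<Longrightarrow> desc \<tau> \<sigma>"
  unfolding desc_def by (rule rtranclp.rtrancl_into_rtrancl)

lemma desc_trans: "desc \<tau> \<rho> \<Longrightarrow> desc \<rho> \<sigma> \<Longrightarrow> desc \<tau> \<sigma>"
  unfolding desc_def by (rule rtranclp_trans)

lemma desc_valid_hull:
  assumes "desc \<tau> \<rho>" "valid_tsimplex \<tau>"
  shows "valid_tsimplex \<rho> \<and> convex hull (verts \<rho>) \<subseteq> convex hull (verts \<tau>) \<and> vol (verts \<rho>) \<le> vol (verts \<tau>)"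
  using assms unfolding desc_def
proof (induction rule: rtranclp_induct)
  case (step \<rho> \<sigma>)
  then have v: "valid_tsimplex \<rho>" by simp
  have "valid_tsimplex \<sigma>" using son_cases[OF v step(2)] by metis
  moreover have "vol (verts \<sigma>) \<le> vol (verts \<rho>)"
    using vol_son[OF v step(2)] hull_props(5)[OF nondeg_verts[OF v]] by simp
  ultimately show ?case
    using sons_hull[OF v step(2)] step by auto
qed simp

lemma desc_valid: "desc \<tau> \<rho> \<Longrightarrow> valid_tsimplex \<tau> \<Longrightarrow> valid_tsimplex \<rho>"
  and desc_hull: "desc \<tau> \<rho> \<Longrightarrow> valid_tsimplex \<tau> \<Longrightarrow> convex hull (verts \<rho>) \<subseteq> convex hull (verts \<tau>)"
  and desc_vol: "desc \<tau> \<rho> \<Longrightarrow> valid_tsimplex \<tau> \<Longrightarrow> vol (verts \<rho>) \<le> vol (verts \<tau>)"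
  by (simp_all add: desc_valid_hull)

lemma elem_nonempty: "valid_tsimplex \<tau> \<Longrightarrow> elem \<tau> \<noteq> {}"
  unfolding elem_def by (intro interior_hull_nonempty nondeg_verts)

lemma desc_elem: "desc \<tau> \<rho> \<Longrightarrow> valid_tsimplex \<tau> \<Longrightarrow> elem \<rho> \<subseteq> elem \<tau>"
  unfolding elem_def by (intro interior_mono desc_hull)

lemma nvb_trans: "nvb_refinement A B \<Longrightarrow> nvb_refinement B C \<Longrightarrow> nvb_refinement A C"
  by (rotate_tac, induction rule: nvb_refinement.induct) (auto intro: nvb_refinement.bisect)

lemma nvb_desc:
  assumes "nvb_refinement A B" "\<tau> \<in> B"
  shows "\<exists>\<sigma>\<in>A. desc \<sigma> \<tau>"
  using assms
proof (induction arbitrary: \<tau> rule: nvb_refinement.induct)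
  case refl
  then show ?case by (intro bexI[of _ \<tau>]) simp_all
next
  case (bisect B \<sigma>)
  show ?case
  proof (cases "\<tau> \<in> sons \<sigma>")
    case True
    obtain \<rho> where "\<rho> \<in> A" "desc \<rho> \<sigma>" using bisect.IH[OF bisect.hyps(2)] by blast
    then show ?thesis using desc_step[OF _ True] by blast
  next
    case False
    then show ?thesis using bisect.IH bisect.prems by blast
  qed
qed

lemma nvb_valid:
  assumes "nvb_refinement A B" "\<forall>\<tau>\<in>A. valid_tsimplex \<tau>"
  shows "\<forall>\<tau>\<in>B. valid_tsimplex \<tau>"
  using assms nvb_desc desc_valid by blast

lemma nvb_finite:
  assumes "nvb_refinement A B" "finite A"
  shows "finite B"
  using assms by (induction rule: nvb_refinement.induct) (auto simp: sons_def Let_def split: prod.splits)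

lemma nvb_cover:
  assumes "nvb_refinement A B" "\<forall>\<tau>\<in>A. valid_tsimplex \<tau>" "\<tau> \<in> A" "x \<in> convex hull (verts \<tau>)"
  shows "\<exists>\<rho>\<in>B. desc \<tau> \<rho> \<and> x \<in> convex hull (verts \<rho>)"
  using assms
proof (induction rule: nvb_refinement.induct)
  case (bisect B \<sigma>)
  then obtain \<rho> where \<rho>: "\<rho> \<in> B" "desc \<tau> \<rho>" "x \<in> convex hull (verts \<rho>)" by blast
  show ?case
  proof (cases "\<rho> = \<sigma>")
    case True
    have "valid_tsimplex \<rho>" using \<rho>(2) bisect.prems desc_valid by blast
    then obtain \<rho>' where "\<rho>' \<in> sons \<rho>" "x \<in> convex hull (verts \<rho>')"
      using \<rho>(3) sons_cover by blast
    then show ?thesis using True \<rho>(2) desc_step by blast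
  next
    case False
    then show ?thesis using \<rho> by blast
  qed
next
  case refl
  then show ?case by (intro bexI[of _ \<tau>]) simp_all
qed

text \<open>The sum of the volumes is preserved, but that of their squares strictly decreases, since
  two halves contribute half of the old square. As meshes are sets, sons may coincide with present
  elements, which only makes the sum smaller.\<close>

lemma nvb_potential:
  assumes "nvb_refinement A B" "finite A" "\<forall>\<tau>\<in>A. valid_tsimplex \<tau>"
  shows "A = B \<or> (\<Sum>\<tau>\<in>B. (vol (verts \<tau>))\<^sup>2) < (\<Sum>\<tau>\<in>A. (vol (verts \<tau>))\<^sup>2)"
  using assms
proof (induction rule: nvb_refinement.induct)
  case (bisect B \<tau>)
  let ?f = "\<lambda>\<tau>. (vol (verts \<tau>))\<^sup>2"
  have fin: "finite B" using nvb_finite[OF bisect(1)] bisect.prems by blast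
  have v: "valid_tsimplex \<tau>" using nvb_valid[OF bisect(1)] bisect by blast
  obtain \<rho>0 \<rho>1 where \<rho>: "sons \<tau> = {\<rho>0, \<rho>1}" using sons_valid[OF v] by blast
  have "(\<Sum>\<sigma>\<in>B - {\<tau>} \<union> sons \<tau>. ?f \<sigma>) \<le> (\<Sum>\<sigma>\<in>B - {\<tau>}. ?f \<sigma>) + (\<Sum>\<sigma>\<in>sons \<tau>. ?f \<sigma>)"
    using fin \<rho> by (subst sum.union_inter[symmetric]) (auto intro!: sum_nonneg)
  also have "(\<Sum>\<sigma>\<in>sons \<tau>. ?f \<sigma>) \<le> ?f \<rho>0 + ?f \<rho>1"
    unfolding \<rho> by (cases "\<rho>0 = \<rho>1") auto
  also have "\<dots> = ?f \<tau> / 2"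
    using vol_son[OF v, of \<rho>0] vol_son[OF v, of \<rho>1] unfolding \<rho> by (simp add: power2_eq_square del: eq_divide_eq_numeral1)
  also have "\<dots> < ?f \<tau>"
    using hull_props(5)[OF nondeg_verts[OF v]] by simp
  also have "(\<Sum>\<sigma>\<in>B - {\<tau>}. ?f \<sigma>) + ?f \<tau> = (\<Sum>\<sigma>\<in>B. ?f \<sigma>)"
    using fin bisect(2) by (simp add: sum.remove add.commute)
  finally have "(\<Sum>\<sigma>\<in>B - {\<tau>} \<union> sons \<tau>. ?f \<sigma>) < (\<Sum>\<sigma>\<in>B. ?f \<sigma>)" by simp
  moreover have "(\<Sum>\<sigma>\<in>B. ?f \<sigma>) \<le> (\<Sum>\<sigma>\<in>A. ?f \<sigma>)"
    using bisect.IH bisect.prems by auto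
  ultimately show ?case by linarith
qed simp

lemma nvb_antisym:
  assumes "nvb_refinement A B" "nvb_refinement B A" "finite A" "\<forall>\<tau>\<in>A. valid_tsimplex \<tau>"
  shows "A = B"
  using nvb_potential[OF assms(1,3,4)] nvb_potential[OF assms(2) nvb_finite[OF assms(1,3)] nvb_valid[OF assms(1,4)]]
  by (meson less_asym)

text \<open>Two coarsest refinements refine each other, hence are equal by
  \<open>nvb_antisym\<close>; uniqueness is what gives the description operator in
  \<open>refine\<close> its meaning.\<close>

lemma refine_coarsest:
  assumes "\<exists>\<T>'. coarsest_refinement \<T> \<M> \<T>'" "finite \<T>" "\<forall>\<tau>\<in>\<T>. valid_tsimplex \<tau>"
  shows "coarsest_refinement \<T> \<M> (refine \<T> \<M>)"
proof -
  have "\<exists>!\<T>'. coarsest_refinement \<T> \<M> \<T>'"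
  proof (rule ex_ex1I[OF assms(1)])
    fix A B assume AB: "coarsest_refinement \<T> \<M> A" "coarsest_refinement \<T> \<M> B"
    then have n: "nvb_refinement A B" "nvb_refinement B A" "nvb_refinement \<T> A"
      unfolding coarsest_refinement_def admissible_refinement_def by blast+
    show "A = B"
      by (rule nvb_antisym[OF n(1,2) nvb_finite[OF n(3) assms(2)] nvb_valid[OF n(3) assms(3)]])
  qed
  then show ?thesis unfolding refine_def by (rule theI')
qed

lemma nvb_triangulation:
  assumes T: "triangulation \<Omega> \<T>" and nvb: "nvb_refinement \<T> \<T>'" and "conforming \<T>'"
  shows "triangulation \<Omega> \<T>'"
proof -
  have v: "\<forall>\<tau>\<in>\<T>. valid_tsimplex \<tau>" and f: "finite \<T>" using T by (auto simp: triangulation_def)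
  have "(\<Union>\<tau>\<in>\<T>. convex hull (verts \<tau>)) = (\<Union>\<tau>\<in>\<T>'. convex hull (verts \<tau>))"
  proof (intro set_eqI iffI)
    fix x assume "x \<in> (\<Union>\<tau>\<in>\<T>. convex hull (verts \<tau>))"
    then show "x \<in> (\<Union>\<tau>\<in>\<T>'. convex hull (verts \<tau>))"
      using nvb_cover[OF nvb v] by blast
  next
    fix x assume "x \<in> (\<Union>\<tau>\<in>\<T>'. convex hull (verts \<tau>))"
    then obtain \<rho> where \<rho>: "\<rho> \<in> \<T>'" "x \<in> convex hull (verts \<rho>)" by blast
    then obtain \<tau> where "\<tau> \<in> \<T>" "desc \<tau> \<rho>" using nvb_desc[OF nvb] by blast
    then show "x \<in> (\<Union>\<tau>\<in>\<T>. convex hull (verts \<tau>))"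
      using desc_hull[of \<tau> \<rho>] v \<rho>(2) by auto
  qed
  then show ?thesis
    using T assms(3) nvb_finite[OF nvb f] nvb_valid[OF nvb v] by (simp add: triangulation_def)
qed

lemma mesh_triangulation:
  assumes T0: "initial_triangulation \<Omega> \<T>\<^sub>0" and "\<T> \<in> meshes \<T>\<^sub>0"
  shows "triangulation \<Omega> \<T>"
  using assms(2)
proof induction
  case initial
  then show ?case using T0 by (simp add: initial_triangulation_def)
next
  case (refine \<T> \<M>)
  then have "\<exists>\<T>'. coarsest_refinement \<T> \<M> \<T>'"
    using T0 by (simp add: initial_triangulation_def)
  then have "coarsest_refinement \<T> \<M> (refine \<T> \<M>)"
    using refine.IH by (intro refine_coarsest) (simp_all add: triangulation_def)
  then have "nvb_refinement \<T> (refine \<T> \<M>)" "conforming (refine \<T> \<M>)"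
    unfolding coarsest_refinement_def admissible_refinement_def by blast+
  then show ?case
    by (rule nvb_triangulation[OF refine.IH])
qed

lemma mesh_refine_coarsest:
  assumes T0: "initial_triangulation \<Omega> \<T>\<^sub>0" and T: "\<T> \<in> meshes \<T>\<^sub>0" and M: "\<M> \<subseteq> \<T>"
  shows "coarsest_refinement \<T> \<M> (refine \<T> \<M>)"
  using T0 T M mesh_triangulation[OF T0 T]
  by (intro refine_coarsest) (auto simp: initial_triangulation_def triangulation_def)

section \<open>Compatible edge bisections\<close>

text \<open>Injectivity of \<open>verts\<close> is kept apart from the intersection condition: only
  the latter is propagated through edge bisections, while for the patterns injectivity is checked on
  labels.\<close>

definition conf :: "'n::finite tsimplex set \<Rightarrow> bool" where
  "conf K \<longleftrightarrow> (\<forall>\<sigma>\<in>K. valid_tsimplex \<sigma>) \<and>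
     (\<forall>\<sigma>\<in>K. \<forall>\<tau>\<in>K. convex hull (verts \<sigma>) \<inter> convex hull (verts \<tau>) = convex hull (verts \<sigma> \<inter> verts \<tau>))"

lemma conf_bary_eq:
  assumes "conf K" "\<sigma> \<in> K" "\<tau> \<in> K" "x \<in> convex hull (verts \<sigma>)" "x \<in> convex hull (verts \<tau>)"
  shows "bary (verts \<sigma>) x = bary (verts \<tau>) x"
proof (rule bary_eq_of_conforming)
  show "nondeg (verts \<sigma>)" "nondeg (verts \<tau>)"
    using assms by (auto simp: conf_def intro: nondeg_verts)
  have "convex hull (verts \<sigma>) \<inter> convex hull (verts \<tau>) = convex hull (verts \<sigma> \<inter> verts \<tau>)"
    using assms(1-3) unfolding conf_def by blast
  then show "x \<in> convex hull (verts \<sigma> \<inter> verts \<tau>)"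
    using assms(4,5) by blast
qed

text \<open>The absence of hanging nodes: the coordinate of \<open>w\<close> at \<open>w\<close>
  itself is 1 in \<open>\<sigma>\<close>, hence also in \<open>\<tau>\<close>, and coordinates
  vanish off the vertices.\<close>

lemma conf_vertex:
  assumes "conf K" "\<sigma> \<in> K" "\<tau> \<in> K" "w \<in> verts \<sigma>" "w \<in> convex hull (verts \<tau>)"
  shows "w \<in> verts \<tau>"
proof (rule ccontr)
  assume "w \<notin> verts \<tau>"
  have v: "nondeg (verts \<sigma>)" "nondeg (verts \<tau>)"
    using assms by (auto simp: conf_def intro: nondeg_verts)
  have "bary (verts \<sigma>) w = bary (verts \<tau>) w"
    using assms by (intro conf_bary_eq[OF assms(1-3)]) (auto intro: hull_inc)
  then have "bary (verts \<tau>) w w = 1"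
    using bary_vertex[OF v(1) assms(4), of w] by simp
  then show False
    using bary_outside[OF v(2) \<open>w \<notin> verts \<tau>\<close>, of w] by simp
qed

lemma conf_midpoint:
  assumes "conf K" "\<sigma> \<in> K" "\<tau> \<in> K" "a \<in> verts \<tau>" "b \<in> verts \<tau>" "a \<noteq> b"
  shows "midpoint a b \<notin> verts \<sigma>"
proof
  assume m: "midpoint a b \<in> verts \<sigma>"
  have "midpoint a b \<in> convex hull (verts \<tau>)"
    using assms(4,5) by (intro midpoints_in_convex_hull hull_inc)
  then have "midpoint a b \<in> verts \<tau>"
    by (rule conf_vertex[OF assms(1-3) m])
  moreover have "nondeg (verts \<tau>)"
    using assms(1,3) by (auto simp: conf_def intro: nondeg_verts)
  ultimately show False
    using midpoint_notin assms(4-6) by blast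
qed

text \<open>How barycentric coordinates change when the edge between \<open>a\<close> and \<open>b\<close> is bisected; the
  formula is the same for both halves and has no effect on simplices not containing the edge.\<close>

definition split_coord :: "real^'n::finite \<Rightarrow> real^'n \<Rightarrow> (real^'n \<Rightarrow> real) \<Rightarrow> real^'n \<Rightarrow> real" where
  "split_coord a b u v =
     (if v = midpoint a b then 2 * min (u a) (u b)
      else if v = a \<or> v = b then u v - min (u a) (u b) else u v)"

lemma split_coord_sym: "split_coord a b = split_coord b a"
  by (auto simp: split_coord_def midpoint_sym min.commute fun_eq_iff)

lemma bary_son:
  assumes v: "valid_tsimplex \<sigma>" and ab: "{a, b} = {ref0 \<sigma>, ref1 \<sigma>}" and \<rho>: "\<rho> \<in> sons \<sigma>"
    and x: "x \<in> convex hull (verts \<rho>)"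
  shows "bary (verts \<rho>) x = split_coord a b (bary (verts \<sigma>) x)"
proof -
  obtain p q where pq: "p \<in> verts \<sigma>" "q \<in> verts \<sigma>" "p \<noteq> q" "{p, q} = {ref0 \<sigma>, ref1 \<sigma>}"
    and r: "verts \<rho> = insert (midpoint p q) (verts \<sigma> - {p})"
    using son_cases[OF v \<rho>] by blast
  note N = nondeg_verts[OF v]
  have le: "bary (verts \<sigma>) x p \<le> bary (verts \<sigma>) x q"
    using x unfolding r hull_bisect_iff[OF N pq(1-3)] by simp
  have "bary (verts \<rho>) x w = split_coord p q (bary (verts \<sigma>) x) w" for w
    unfolding r bary_bisect[OF N pq(1-3)] using le pq(3) by (auto simp: split_coord_def min_def)
  moreover have "split_coord p q = split_coord a b"
  proof -
    have "(p = a \<and> q = b) \<or> (p = b \<and> q = a)"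
      using ab pq(4) by (metis doubleton_eq_iff)
    then show ?thesis using split_coord_sym by metis
  qed
  ultimately show ?thesis by (simp add: fun_eq_iff)
qed

lemma split_coord_id:
  assumes N: "nondeg S" and x: "x \<in> convex hull S" and "\<not> {a, b} \<subseteq> S" and "midpoint a b \<notin> S"
  shows "split_coord a b (bary S x) = bary S x"
proof -
  have "bary S x a = 0 \<or> bary S x b = 0"
    using assms(3) bary_outside[OF N] by auto
  then have "min (bary S x a) (bary S x b) = 0"
    using bary_nonneg[OF N x] by (auto simp: min_def order_antisym)
  then show ?thesis
    using bary_outside[OF N assms(4)] by (auto simp: split_coord_def fun_eq_iff)
qed

definition bisect_edge :: "real^'n::finite \<Rightarrow> real^'n \<Rightarrow> 'n tsimplex set \<Rightarrow> 'n tsimplex set" where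
  "bisect_edge a b K = (K - {\<tau>\<in>K. {a, b} \<subseteq> verts \<tau>}) \<union> (\<Union>\<tau>\<in>{\<tau>\<in>K. {a, b} \<subseteq> verts \<tau>}. sons \<tau>)"

text \<open>Every member of the new family has the coordinates of its parent transformed by
  \<open>split_coord a b\<close>, be it a son or an element left alone. Since parents agree at
  common points, so do the members. Assumption \<open>ref\<close> says that the elements at this
  edge all have it as refinement edge.\<close>

lemma conf_bisect_edge:
  assumes K: "conf K" and ab: "a \<noteq> b" and ex: "\<tau>\<^sub>0 \<in> K" "{a, b} \<subseteq> verts \<tau>\<^sub>0"
    and ref: "\<And>\<tau>. \<tau> \<in> K \<Longrightarrow> {a, b} \<subseteq> verts \<tau> \<Longrightarrow> {ref0 \<tau>, ref1 \<tau>} = {a, b}"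
  shows "conf (bisect_edge a b K)"
proof -
  have parent: "\<exists>\<sigma>\<in>K. valid_tsimplex \<rho> \<and> (\<forall>x\<in>convex hull (verts \<rho>). x \<in> convex hull (verts \<sigma>) \<and>
      bary (verts \<rho>) x = split_coord a b (bary (verts \<sigma>) x))"
    if mem: "\<rho> \<in> bisect_edge a b K" for \<rho>
  proof -
    consider "\<rho> \<in> K" "\<not> {a, b} \<subseteq> verts \<rho>" | \<sigma> where "\<sigma> \<in> K" "{a, b} \<subseteq> verts \<sigma>" "\<rho> \<in> sons \<sigma>"
      using mem unfolding bisect_edge_def by blast
    then show ?thesis
    proof cases
      case 1
      have v: "valid_tsimplex \<rho>" using K 1 by (simp add: conf_def)
      have "midpoint a b \<notin> verts \<rho>"
        using conf_midpoint[OF K 1(1) ex(1)] ex(2) ab by auto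
      then have "\<forall>x\<in>convex hull (verts \<rho>). bary (verts \<rho>) x = split_coord a b (bary (verts \<rho>) x)"
        using split_coord_id[OF nondeg_verts[OF v] _ 1(2)] by simp
      then show ?thesis using 1(1) v by blast
    next
      case 2
      have v: "valid_tsimplex \<sigma>" using K 2 by (simp add: conf_def)
      have "valid_tsimplex \<rho>" using son_cases[OF v 2(3)] by blast
      then show ?thesis
        using bary_son[OF v ref[OF 2(1,2), symmetric] 2(3)] sons_hull[OF v 2(3)] 2(1) by blast
    qed
  qed
  show ?thesis
    unfolding conf_def
  proof (intro conjI ballI)
    fix \<rho> assume "\<rho> \<in> bisect_edge a b K"
    then show "valid_tsimplex \<rho>" using parent by blast
  next
    fix \<rho> \<rho>' assume r: "\<rho> \<in> bisect_edge a b K" "\<rho>' \<in> bisect_edge a b K"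
    obtain \<sigma> where s: "\<sigma> \<in> K" "valid_tsimplex \<rho>" "\<forall>x\<in>convex hull (verts \<rho>). x \<in> convex hull (verts \<sigma>) \<and>
      bary (verts \<rho>) x = split_coord a b (bary (verts \<sigma>) x)"
      using parent[OF r(1)] by blast
    obtain \<sigma>' where s': "\<sigma>' \<in> K" "valid_tsimplex \<rho>'" "\<forall>x\<in>convex hull (verts \<rho>'). x \<in> convex hull (verts \<sigma>') \<and>
      bary (verts \<rho>') x = split_coord a b (bary (verts \<sigma>') x)"
      using parent[OF r(2)] by blast
    show "convex hull (verts \<rho>) \<inter> convex hull (verts \<rho>') = convex hull (verts \<rho> \<inter> verts \<rho>')"
    proof (rule conforming_of_bary_eq)
      show "nondeg (verts \<rho>)" "nondeg (verts \<rho>')"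
        using s s' nondeg_verts by blast+
      fix x assume x: "x \<in> convex hull (verts \<rho>)" "x \<in> convex hull (verts \<rho>')"
      have "bary (verts \<sigma>) x = bary (verts \<sigma>') x"
        using s s' x by (intro conf_bary_eq[OF K]) auto
      then show "bary (verts \<rho>) x = bary (verts \<rho>') x"
        using s s' x by simp
    qed
  qed
qed

text \<open>Single bisections can be done in any order as long as a new son is never one of the
  elements still to be bisected, for otherwise it would be removed with it; the last assumption
  excludes this.\<close>

lemma nvb_bisect_set:
  assumes "finite D" "D \<subseteq> K" "\<And>\<tau>. \<tau> \<in> D \<Longrightarrow> sons \<tau> \<inter> K = {}"
  shows "nvb_refinement K ((K - D) \<union> (\<Union>\<tau>\<in>D. sons \<tau>))"
  using assms
proof (induction D rule: finite_induct)
  case empty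
  then show ?case by (simp add: nvb_refinement.refl)
next
  case (insert \<tau> D)
  have "nvb_refinement K ((K - D) \<union> (\<Union>\<tau>\<in>D. sons \<tau>))"
    using insert.prems by (intro insert.IH) auto
  moreover have "\<tau> \<in> (K - D) \<union> (\<Union>\<tau>\<in>D. sons \<tau>)"
    using insert.prems insert.hyps by auto
  ultimately have "nvb_refinement K (((K - D) \<union> (\<Union>\<tau>\<in>D. sons \<tau>)) - {\<tau>} \<union> sons \<tau>)"
    by (rule nvb_refinement.bisect)
  moreover have "((K - D) \<union> (\<Union>\<tau>\<in>D. sons \<tau>)) - {\<tau>} \<union> sons \<tau> = (K - insert \<tau> D) \<union> (\<Union>\<tau>\<in>insert \<tau> D. sons \<tau>)"
    using insert.prems insert.hyps by blast
  ultimately show ?case by simp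
qed

lemma son_midpoint:
  assumes v: "valid_tsimplex \<sigma>" and \<rho>: "\<rho> \<in> sons \<sigma>"
  shows "midpoint (ref0 \<sigma>) (ref1 \<sigma>) \<in> verts \<rho>"
proof -
  obtain p q where "{p, q} = {ref0 \<sigma>, ref1 \<sigma>}" and r: "verts \<rho> = insert (midpoint p q) (verts \<sigma> - {p})"
    using son_cases[OF v \<rho>] by blast
  then have "midpoint p q = midpoint (ref0 \<sigma>) (ref1 \<sigma>)"
    by (metis doubleton_eq_iff midpoint_sym)
  then show ?thesis using r by simp
qed

lemma nvb_bisect_edge:
  assumes K: "conf K" "finite K" and ab: "a \<noteq> b"
    and ref: "\<And>\<tau>. \<tau> \<in> K \<Longrightarrow> {a, b} \<subseteq> verts \<tau> \<Longrightarrow> {ref0 \<tau>, ref1 \<tau>} = {a, b}"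
  shows "nvb_refinement K (bisect_edge a b K)"
  unfolding bisect_edge_def
proof (rule nvb_bisect_set)
  show "finite {\<tau> \<in> K. {a, b} \<subseteq> verts \<tau>}" using K(2) by simp
  show "{\<tau> \<in> K. {a, b} \<subseteq> verts \<tau>} \<subseteq> K" by blast
  fix \<tau> assume "\<tau> \<in> {\<tau> \<in> K. {a, b} \<subseteq> verts \<tau>}"
  then have t: "\<tau> \<in> K" "{a, b} \<subseteq> verts \<tau>" by auto
  have v: "valid_tsimplex \<tau>" using K t by (simp add: conf_def)
  show "sons \<tau> \<inter> K = {}"
  proof (rule ccontr)
    assume "sons \<tau> \<inter> K \<noteq> {}"
    then obtain \<rho> where r: "\<rho> \<in> sons \<tau>" "\<rho> \<in> K" by blast
    have "midpoint (ref0 \<tau>) (ref1 \<tau>) \<in> verts \<rho>" by (rule son_midpoint[OF v r(1)])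
    moreover have "midpoint (ref0 \<tau>) (ref1 \<tau>) \<notin> verts \<rho>"
      using verts_split(1,2)[OF v] by (intro conf_midpoint[OF K(1) r(2) t(1)]) auto
    ultimately show False by simp
  qed
qed

section \<open>Refinement patterns on labelled vertices\<close>

text \<open>Symbolic copy of \<open>sons\<close> in which the label of the midpoint is a parameter,
  so that whole sequences of bisections can be run by evaluation.\<close>

definition lab_sons :: "nat \<Rightarrow> nat \<Rightarrow> nat list \<times> nat \<Rightarrow> (nat list \<times> nat) list" where
  "lab_sons d m = (\<lambda>(z, \<beta>).
     let front = map ((!) z) [1..<Suc \<beta>]; back = map ((!) z) [Suc \<beta>..<d]; \<beta>' = (\<beta> + 1) mod d
     in [(z ! 0 # m # front @ back, \<beta>'), (z ! d # m # front @ rev back, \<beta>')])"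

definition has_edge :: "nat \<Rightarrow> nat \<Rightarrow> nat list \<times> nat \<Rightarrow> bool" where
  "has_edge a b \<tau> \<longleftrightarrow> List.member (fst \<tau>) a \<and> List.member (fst \<tau>) b"

fun lab_step :: "nat \<Rightarrow> nat \<times> nat \<times> nat \<Rightarrow> (nat list \<times> nat) list \<Rightarrow> (nat list \<times> nat) list" where
  "lab_step d (a, b, m) L = concat (map (\<lambda>\<tau>. if has_edge a b \<tau> then lab_sons d m \<tau> else [\<tau>]) L)"

text \<open>Collects on labels what \<open>conf_bisect_edge\<close> requires of the edge between
  \<open>a\<close> and \<open>b\<close>: it occurs, and it is the refinement edge of each simplex
  containing it. In addition the label \<open>m\<close> must be fresh.\<close>

fun lab_ok :: "nat \<Rightarrow> nat \<times> nat \<times> nat \<Rightarrow> (nat list \<times> nat) list \<Rightarrow> bool" where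
  "lab_ok d (a, b, m) L \<longleftrightarrow> a \<noteq> b \<and> list_ex (has_edge a b) L \<and>
     list_all (\<lambda>\<tau>. \<not> List.member (fst \<tau>) m \<and>
       (has_edge a b \<tau> \<longrightarrow> (fst \<tau> ! 0 = a \<and> fst \<tau> ! d = b) \<or> (fst \<tau> ! 0 = b \<and> fst \<tau> ! d = a))) L"

fun lab_run :: "nat \<Rightarrow> (nat \<times> nat \<times> nat) list \<Rightarrow> (nat list \<times> nat) list \<Rightarrow> (nat list \<times> nat) list option" where
  "lab_run d [] L = Some L"
| "lab_run d (s # ss) L = (if lab_ok d s L then lab_run d ss (lab_step d s L) else None)"

definition realize :: "(nat \<Rightarrow> real^'n::finite) \<Rightarrow> nat list \<times> nat \<Rightarrow> 'n tsimplex" where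
  "realize \<rho> \<tau> = (map \<rho> (fst \<tau>), snd \<tau>)"

lemma verts_realize: "verts (realize \<rho> \<tau>) = \<rho> ` set (fst \<tau>)"
  by (simp add: realize_def)

definition labels :: "(nat list \<times> nat) list \<Rightarrow> nat set" where
  "labels L = (\<Union>\<tau>\<in>set L. set (fst \<tau>))"

lemma sons_realize:
  fixes \<rho> :: "nat \<Rightarrow> real^'n::finite"
  assumes v: "valid_tsimplex (realize \<rho> \<tau>)" and m: "\<rho> m = midpoint (ref0 (realize \<rho> \<tau>)) (ref1 (realize \<rho> \<tau>))"
  shows "sons (realize \<rho> \<tau>) = realize \<rho> ` set (lab_sons (CARD('n)) m \<tau>)"
proof -
  obtain z \<beta> where t: "\<tau> = (z, \<beta>)" by (cases \<tau>)
  have len: "length z = CARD('n) + 1" and \<beta>: "\<beta> < CARD('n)"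
    using v by (simp_all add: valid_tsimplex_def realize_def t)
  have f: "map ((!) (map \<rho> z)) [1..<Suc \<beta>] = map \<rho> (map ((!) z) [1..<Suc \<beta>])"
    using len \<beta> by (auto simp del: upt_Suc)
  have b: "map ((!) (map \<rho> z)) [Suc \<beta>..<CARD('n)] = map \<rho> (map ((!) z) [Suc \<beta>..<CARD('n)])"
    using len \<beta> by (auto simp del: upt_Suc)
  have n: "map \<rho> z ! 0 = \<rho> (z ! 0)" "map \<rho> z ! CARD('n) = \<rho> (z ! CARD('n))"
    using len by (auto intro!: nth_map)
  have m': "midpoint (map \<rho> z ! 0) (map \<rho> z ! CARD('n)) = \<rho> m"
    using m by (simp add: ref0_def ref1_def realize_def t)
  show ?thesis
    unfolding sons_def lab_sons_def t realize_def fst_conv snd_conv prod.case Let_def f b m'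
    unfolding n by (simp add: rev_map)
qed

text \<open>Injectivity of \<open>\<rho>\<close> makes containing an edge the same for labels and
  for points, so a checked step on labels is an edge bisection of the realised family.\<close>

lemma realize_step:
  fixes \<rho> :: "nat \<Rightarrow> real^'n::finite"
  assumes inj: "inj_on \<rho> (labels L)" and ok: "lab_ok (CARD('n)) (a, b, m) L" and m: "\<rho> m = midpoint (\<rho> a) (\<rho> b)"
    and v: "\<forall>\<tau>\<in>set L. valid_tsimplex (realize \<rho> \<tau>)"
  shows "realize \<rho> ` set (lab_step (CARD('n)) (a, b, m) L) = bisect_edge (\<rho> a) (\<rho> b) (realize \<rho> ` set L)"
    and "\<rho> a \<noteq> \<rho> b" "\<exists>\<tau>\<in>realize \<rho> ` set L. {\<rho> a, \<rho> b} \<subseteq> verts \<tau>"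
    and "\<And>\<tau>. \<tau> \<in> realize \<rho> ` set L \<Longrightarrow> {\<rho> a, \<rho> b} \<subseteq> verts \<tau> \<Longrightarrow> {ref0 \<tau>, ref1 \<tau>} = {\<rho> a, \<rho> b}"
proof -
  obtain \<tau>\<^sub>0 where t0: "\<tau>\<^sub>0 \<in> set L" "has_edge a b \<tau>\<^sub>0"
    using ok by (auto simp: list_ex_iff)
  have ab: "a \<in> labels L" "b \<in> labels L"
    using t0 by (auto simp: labels_def has_edge_def)
  have edge: "has_edge a b \<tau> \<longleftrightarrow> {\<rho> a, \<rho> b} \<subseteq> verts (realize \<rho> \<tau>)" if "\<tau> \<in> set L" for \<tau>
  proof -
    have sub: "set (fst \<tau>) \<subseteq> labels L" using that by (auto simp: labels_def)
    show ?thesis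
      unfolding verts_realize has_edge_def
      using inj_on_image_mem_iff[OF inj ab(1) sub] inj_on_image_mem_iff[OF inj ab(2) sub] by simp
  qed
  show ne: "\<rho> a \<noteq> \<rho> b"
    using ok inj ab by (auto simp: inj_on_def)
  show "\<exists>\<tau>\<in>realize \<rho> ` set L. {\<rho> a, \<rho> b} \<subseteq> verts \<tau>"
    using t0 edge by blast
  have ref: "{ref0 (realize \<rho> \<tau>), ref1 (realize \<rho> \<tau>)} = {\<rho> a, \<rho> b}"
    if "\<tau> \<in> set L" "has_edge a b \<tau>" for \<tau>
  proof -
    have len: "length (fst \<tau>) = CARD('n) + 1"
      using v that by (auto simp: valid_tsimplex_def realize_def)
    have "(fst \<tau> ! 0 = a \<and> fst \<tau> ! CARD('n) = b) \<or> (fst \<tau> ! 0 = b \<and> fst \<tau> ! CARD('n) = a)"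
      using ok that by (auto simp: list_all_iff)
    then show ?thesis
      using len by (auto simp: ref0_def ref1_def realize_def)
  qed
  then show "{ref0 \<tau>, ref1 \<tau>} = {\<rho> a, \<rho> b}" if "\<tau> \<in> realize \<rho> ` set L" "{\<rho> a, \<rho> b} \<subseteq> verts \<tau>" for \<tau>
    using that edge by blast
  have sons: "sons (realize \<rho> \<tau>) = realize \<rho> ` set (lab_sons (CARD('n)) m \<tau>)"
    if "\<tau> \<in> set L" "has_edge a b \<tau>" for \<tau>
  proof (rule sons_realize)
    show "valid_tsimplex (realize \<rho> \<tau>)" using v that by blast
    show "\<rho> m = midpoint (ref0 (realize \<rho> \<tau>)) (ref1 (realize \<rho> \<tau>))"
      using ref[OF that] unfolding m by (metis doubleton_eq_iff midpoint_sym)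
  qed
  have "realize \<rho> ` set (lab_step (CARD('n)) (a, b, m) L)
      = realize \<rho> ` {\<tau>\<in>set L. \<not> has_edge a b \<tau>} \<union> (\<Union>\<tau>\<in>{\<tau>\<in>set L. has_edge a b \<tau>}. realize \<rho> ` set (lab_sons (CARD('n)) m \<tau>))"
    by (auto split: if_splits)
  also have "(\<Union>\<tau>\<in>{\<tau>\<in>set L. has_edge a b \<tau>}. realize \<rho> ` set (lab_sons (CARD('n)) m \<tau>))
      = (\<Union>\<tau>\<in>{\<tau>\<in>set L. has_edge a b \<tau>}. sons (realize \<rho> \<tau>))"
    using sons by simp
  also have "realize \<rho> ` {\<tau>\<in>set L. \<not> has_edge a b \<tau>} \<union> \<dots> = bisect_edge (\<rho> a) (\<rho> b) (realize \<rho> ` set L)"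
  proof -
    define P :: "'n tsimplex \<Rightarrow> bool" where "P \<tau> \<longleftrightarrow> {\<rho> a, \<rho> b} \<subseteq> verts \<tau>" for \<tau>
    have P: "has_edge a b \<tau> \<longleftrightarrow> P (realize \<rho> \<tau>)" if "\<tau> \<in> set L" for \<tau>
      using edge[OF that] by (simp only: P_def)
    have 1: "{\<tau> \<in> realize \<rho> ` set L. P \<tau>} = realize \<rho> ` {\<tau>\<in>set L. has_edge a b \<tau>}"
      using P by auto
    have 2: "realize \<rho> ` set L - realize \<rho> ` {\<tau>\<in>set L. has_edge a b \<tau>} = realize \<rho> ` {\<tau>\<in>set L. \<not> has_edge a b \<tau>}"
      using P by auto
    show ?thesis
      unfolding bisect_edge_def P_def[symmetric] 1 2 by simp
  qed
  finally show "realize \<rho> ` set (lab_step (CARD('n)) (a, b, m) L) = bisect_edge (\<rho> a) (\<rho> b) (realize \<rho> ` set L)" .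
qed

lemma set_lab_sons:
  assumes "length (fst \<tau>) = d + 1" "snd \<tau> < d" "\<tau>' \<in> set (lab_sons d m \<tau>)"
  shows "set (fst \<tau>') \<subseteq> insert m (set (fst \<tau>))"
  using assms by (auto simp: lab_sons_def Let_def split: prod.splits simp del: upt_Suc)

text \<open>The invariants support each other: in a conforming family the midpoint of an edge is not
  a vertex, so \<open>\<rho>\<close> stays injective on the enlarged label set, and injectivity in
  turn lets the next step act on points. Each step halves volumes at most once, whence
  \<open>2 ^ length ss\<close>.\<close>

lemma lab_run_sound:
  fixes \<rho> :: "nat \<Rightarrow> real^'n::finite"
  assumes "lab_run (CARD('n)) ss L = Some L'" "inj_on \<rho> (labels L)" "conf (realize \<rho> ` set L)"
    "\<And>a b m. (a, b, m) \<in> set ss \<Longrightarrow> \<rho> m = midpoint (\<rho> a) (\<rho> b)"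
    "\<forall>\<tau>\<in>set L. V \<le> vol (verts (realize \<rho> \<tau>))" "0 \<le> V"
  shows "inj_on \<rho> (labels L') \<and> conf (realize \<rho> ` set L') \<and>
    nvb_refinement (realize \<rho> ` set L) (realize \<rho> ` set L') \<and>
    (\<forall>\<tau>\<in>set L'. V / 2 ^ length ss \<le> vol (verts (realize \<rho> \<tau>)))"
  using assms
proof (induction ss arbitrary: L V)
  case Nil
  then show ?case by (simp add: nvb_refinement.refl)
next
  case (Cons s ss)
  obtain a b m where s: "s = (a, b, m)" by (cases s)
  have ok: "lab_ok (CARD('n)) (a, b, m) L" and run: "lab_run (CARD('n)) ss (lab_step (CARD('n)) (a, b, m) L) = Some L'"
    using Cons.prems(1) unfolding s by (simp_all split: if_splits)
  have m: "\<rho> m = midpoint (\<rho> a) (\<rho> b)" using Cons.prems(4) s by simp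
  let ?K = "realize \<rho> ` set L" and ?L = "lab_step (CARD('n)) (a, b, m) L"
  have v: "\<forall>\<tau>\<in>set L. valid_tsimplex (realize \<rho> \<tau>)"
    using Cons.prems(3) by (auto simp: conf_def)
  note st = realize_step[OF Cons.prems(2) ok m v]
  obtain \<tau>\<^sub>0 where t0: "\<tau>\<^sub>0 \<in> ?K" "{\<rho> a, \<rho> b} \<subseteq> verts \<tau>\<^sub>0" using st(3) by blast
  have conf: "conf (realize \<rho> ` set ?L)"
    unfolding st(1) by (rule conf_bisect_edge[OF Cons.prems(3) st(2) t0 st(4)])
  have nvb: "nvb_refinement ?K (realize \<rho> ` set ?L)"
    unfolding st(1) by (rule nvb_bisect_edge[OF Cons.prems(3) _ st(2) st(4)]) simp
  have new: "\<rho> m \<notin> \<rho> ` labels L"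
  proof
    assume "\<rho> m \<in> \<rho> ` labels L"
    then obtain \<tau> where "\<tau> \<in> set L" "\<rho> m \<in> verts (realize \<rho> \<tau>)"
      by (auto simp: labels_def verts_realize)
    then show False
      using conf_midpoint[OF Cons.prems(3) _ t0(1), of "realize \<rho> \<tau>" "\<rho> a" "\<rho> b"] t0(2) st(2) m by auto
  qed
  have "labels ?L \<subseteq> insert m (labels L)"
  proof
    fix l assume "l \<in> labels ?L"
    then obtain \<tau>' where t': "\<tau>' \<in> set ?L" "l \<in> set (fst \<tau>')" by (auto simp: labels_def)
    then obtain \<tau> where t0: "\<tau> \<in> set L" "\<tau>' \<in> set (if has_edge a b \<tau> then lab_sons (CARD('n)) m \<tau> else [\<tau>])"
      unfolding lab_step.simps set_concat set_map by blast
    then have t: "\<tau> \<in> set L" "\<tau>' = \<tau> \<or> \<tau>' \<in> set (lab_sons (CARD('n)) m \<tau>)"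
      by (cases "has_edge a b \<tau>"; simp)+
    have "length (fst \<tau>) = CARD('n) + 1" "snd \<tau> < CARD('n)"
      using v t(1) by (auto simp: valid_tsimplex_def realize_def)
    then have "l \<in> insert m (set (fst \<tau>))"
      using t(2) t'(2) set_lab_sons by blast
    then show "l \<in> insert m (labels L)" using t(1) by (auto simp: labels_def)
  qed
  moreover have "inj_on \<rho> (insert m (labels L))"
    using Cons.prems(2) new unfolding inj_on_insert by blast
  ultimately have inj: "inj_on \<rho> (labels ?L)" by (rule inj_on_subset[rotated])
  have vol: "\<forall>\<tau>\<in>set ?L. V / 2 \<le> vol (verts (realize \<rho> \<tau>))"
  proof
    fix \<tau> assume "\<tau> \<in> set ?L"
    then have "realize \<rho> \<tau> \<in> bisect_edge (\<rho> a) (\<rho> b) ?K" unfolding st(1)[symmetric] by blast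
    then obtain \<sigma> where s: "\<sigma> \<in> ?K" "realize \<rho> \<tau> = \<sigma> \<or> realize \<rho> \<tau> \<in> sons \<sigma>"
      unfolding bisect_edge_def by blast
    have "valid_tsimplex \<sigma>" "V \<le> vol (verts \<sigma>)" using s v Cons.prems(5) by auto
    then show "V / 2 \<le> vol (verts (realize \<rho> \<tau>))"
      using s(2) vol_son[of \<sigma> "realize \<rho> \<tau>"] Cons.prems(6) by auto
  qed
  have "inj_on \<rho> (labels L') \<and> conf (realize \<rho> ` set L') \<and>
    nvb_refinement (realize \<rho> ` set ?L) (realize \<rho> ` set L') \<and>
    (\<forall>\<tau>\<in>set L'. V / 2 / 2 ^ length ss \<le> vol (verts (realize \<rho> \<tau>)))"
  proof (rule Cons.IH[OF run inj conf _ vol])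
    show "\<rho> m = midpoint (\<rho> a) (\<rho> b)" if "(a, b, m) \<in> set ss" for a b m
      using Cons.prems(4) that by simp
    show "0 \<le> V / 2" using Cons.prems(6) by simp
  qed
  then show ?case
    using nvb_trans[OF nvb] by (simp add: field_simps)
qed

text \<open>Labels are bit masks: \<open>2\<^sup>i\<close> stands for the vertex \<open>z\<^sub>i\<close>, sums of two such powers for edge
  midpoints, and sums of three for the additional node on a face, which is the midpoint of the
  median that meets the first bisected edge of the face.  A step \<open>(a, b, m)\<close> bisects the edge
  between \<open>a\<close> and \<open>b\<close>, with midpoint \<open>m\<close>.\<close>

definition pattern_steps :: "nat \<Rightarrow> nat \<Rightarrow> (nat \<times> nat \<times> nat) list" where
  "pattern_steps d \<beta> =
     (if d = 2 then [(1,4,5), (1,2,3), (2,4,6)]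
      else if \<beta> = 0 then [(1,8,9), (1,4,5), (2,8,10), (1,2,3), (2,4,6), (4,8,12), (2,9,11), (4,9,13), (2,5,7), (4,10,14)]
      else if \<beta> = 1 then [(1,8,9), (1,4,5), (4,8,12), (1,2,3), (2,4,6), (2,8,10), (2,5,7), (2,12,14), (2,9,11), (4,9,13)]
      else [(1,8,9), (1,4,5), (4,8,12), (4,9,13), (2,4,6), (1,2,3), (2,8,10), (2,9,11), (2,5,7), (2,12,14)])"

definition vertex_labels :: "nat \<Rightarrow> nat list" where
  "vertex_labels d = (if d = 2 then [1,2,4] else [1,2,4,8])"

definition pattern :: "nat \<Rightarrow> nat \<Rightarrow> (nat list \<times> nat) list" where
  "pattern d \<beta> = the (lab_run d (pattern_steps d \<beta>) [(vertex_labels d, \<beta>)])"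

text \<open>By evaluation, one run for each dimension and type: whenever an edge is bisected, all
  current simplices at that edge agree that it is their refinement edge.\<close>

lemma pattern_ok:
  "lab_run 2 (pattern_steps 2 0) [(vertex_labels 2, 0)] \<noteq> None"
  "lab_run 2 (pattern_steps 2 1) [(vertex_labels 2, 1)] \<noteq> None"
  "lab_run 3 (pattern_steps 3 0) [(vertex_labels 3, 0)] \<noteq> None"
  "lab_run 3 (pattern_steps 3 1) [(vertex_labels 3, 1)] \<noteq> None"
  "lab_run 3 (pattern_steps 3 2) [(vertex_labels 3, 2)] \<noteq> None"
  by code_simp+

text \<open>Among the labels of a pattern, only the position of 14, the extra node on the face
  opposite to \<open>z ! 0\<close>, depends on the type: for type 0 that face is first bisected
  between \<open>z ! 1\<close> and \<open>z ! 3\<close>, otherwise between \<open>z ! 2\<close> and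
  \<open>z ! 3\<close>.\<close>

definition pt :: "nat \<Rightarrow> (real^'n::finite) list \<Rightarrow> nat \<Rightarrow> real^'n" where
  "pt \<beta> z l =
     (if l = 1 then z ! 0 else if l = 2 then z ! 1 else if l = 4 then z ! 2 else if l = 8 then z ! 3
      else if l = 3 then midpoint (z ! 0) (z ! 1) else if l = 5 then midpoint (z ! 0) (z ! 2)
      else if l = 9 then midpoint (z ! 0) (z ! 3) else if l = 6 then midpoint (z ! 1) (z ! 2)
      else if l = 10 then midpoint (z ! 1) (z ! 3) else if l = 12 then midpoint (z ! 2) (z ! 3)
      else if l = 7 then midpoint (z ! 1) (midpoint (z ! 0) (z ! 2))
      else if l = 11 then midpoint (z ! 1) (midpoint (z ! 0) (z ! 3))
      else if l = 13 then midpoint (z ! 2) (midpoint (z ! 0) (z ! 3))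
      else if \<beta> = 0 then midpoint (z ! 2) (midpoint (z ! 1) (z ! 3))
      else midpoint (z ! 1) (midpoint (z ! 2) (z ! 3)))"

definition node_labels :: "nat \<Rightarrow> nat list" where
  "node_labels d = (if d = 2 then [1,2,3,4,5,6] else [1,2,3,4,5,6,7,8,9,10,11,12,13,14])"

text \<open>A triple \<open>(a, b, c)\<close> is the face whose first bisected edge joins
  \<open>a\<close> and \<open>b\<close>. Faces at the refinement edge are bisected there. The other
  two survive in one son each and are bisected at its refinement edge: the son at
  \<open>z\<^sub>0\<close> has \<open>z\<^sub>2\<close> last, the son at \<open>z\<^sub>3\<close>
  has \<open>z\<^sub>1\<close> last for type 0 and \<open>z\<^sub>2\<close> otherwise.\<close>

definition lab_faces :: "nat \<Rightarrow> (nat \<times> nat \<times> nat) list" where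
  "lab_faces \<beta> = [(1,8,2), (1,8,4), (1,4,2), if \<beta> = 0 then (2,8,4) else (4,8,2)]"

text \<open>The trace of the pattern on a face: bisect at the edge
  \<open>a\<close>-\<open>b\<close>, bisect the halves at \<open>a\<close>-\<open>c\<close> and
  \<open>b\<close>-\<open>c\<close>, and split those two quarters that contain \<open>c\<close> once
  more along the median from \<open>c\<close>. This leaves six triangles.\<close>

definition lab_pieces :: "nat \<times> nat \<times> nat \<Rightarrow> nat list list" where
  "lab_pieces = (\<lambda>(a, b, c). [[a,a+b,a+c], [c,a+b+c,a+c], [a+b,a+b+c,a+c],
                              [b,a+b,b+c], [c,a+b+c,b+c], [a+b,a+b+c,b+c]])"

definition lab_in_face :: "nat \<times> nat \<times> nat \<Rightarrow> nat list" where
  "lab_in_face = (\<lambda>(a, b, c). [a, b, c, a+b, a+c, b+c, a+b+c])"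

text \<open>The second conjunct is the injectivity of vertex sets within a pattern, in evaluable
  form.\<close>

definition check_nodes :: "nat \<Rightarrow> (nat list \<times> nat) list \<Rightarrow> bool" where
  "check_nodes d L \<longleftrightarrow>
     list_all (\<lambda>\<tau>. list_all (List.member (node_labels d)) (fst \<tau>)) L \<and>
     list_all (\<lambda>\<tau>. list_all (\<lambda>\<sigma>. list_all (List.member (fst \<sigma>)) (fst \<tau>) \<longrightarrow> \<sigma> = \<tau>) L) L"

definition check_edges :: "nat \<Rightarrow> (nat list \<times> nat) list \<Rightarrow> bool" where
  "check_edges d L \<longleftrightarrow>
     list_all (\<lambda>a. list_all (\<lambda>b. a \<noteq> b \<longrightarrow>
       list_all (\<lambda>\<tau>. \<not> has_edge a b \<tau>) L \<and> list_ex (has_edge a (a + b)) L) (vertex_labels d)) (vertex_labels d)"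

text \<open>The face labels of each simplex lie in one piece, and each piece lies in some simplex.
  With the same pieces on the other side of a face, every simplex then finds a partner there that
  contains its vertices on the face.\<close>

definition check_faces :: "nat \<Rightarrow> (nat list \<times> nat) list \<Rightarrow> bool" where
  "check_faces \<beta> L \<longleftrightarrow>
     list_all (\<lambda>f. list_all (\<lambda>\<tau>. list_ex (\<lambda>X. list_all (\<lambda>l. List.member (lab_in_face f) l \<longrightarrow> List.member X l) (fst \<tau>)) (lab_pieces f)) L \<and>
        list_all (\<lambda>X. list_ex (\<lambda>\<tau>. list_all (List.member (fst \<tau>)) X) L) (lab_pieces f)) (lab_faces \<beta>)"

lemma check_2: "check_nodes 2 (pattern 2 0)" "check_nodes 2 (pattern 2 1)"
  "check_edges 2 (pattern 2 0)" "check_edges 2 (pattern 2 1)"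
  by code_simp+

lemma check_3_nodes: "check_nodes 3 (pattern 3 0)" "check_nodes 3 (pattern 3 1)" "check_nodes 3 (pattern 3 2)"
  by code_simp+

lemma check_3_edges: "check_edges 3 (pattern 3 0)" "check_edges 3 (pattern 3 1)" "check_edges 3 (pattern 3 2)"
  by code_simp+

lemma check_3_faces: "check_faces 0 (pattern 3 0)" "check_faces 1 (pattern 3 1)" "check_faces 2 (pattern 3 2)"
  by code_simp+

section \<open>The pattern inside one element and its traces on edges and faces\<close>

definition local_refinement :: "'n::finite tsimplex \<Rightarrow> 'n tsimplex set" where
  "local_refinement \<tau> = realize (pt (snd \<tau>) (fst \<tau>)) ` set (pattern (CARD('n)) (snd \<tau>))"

text \<open>\<open>even (l div c)\<close> says that the bit \<open>c\<close> of the mask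
  \<open>l\<close> is not set, which by \<open>bary_pt\<close> means that the coordinate of the
  vertex \<open>c\<close> vanishes at the node. Thus the only nodes on an edge are its end points
  and its midpoint.\<close>

lemma check_edge_bits:
  "list_all (\<lambda>a. list_all (\<lambda>b. list_all (\<lambda>l. list_all (\<lambda>c. c \<noteq> a \<and> c \<noteq> b \<longrightarrow> even (l div c)) (vertex_labels d)
     \<longrightarrow> l = a \<or> l = b \<or> l = a + b) (node_labels d)) (vertex_labels d)) (vertex_labels d)" if "d = 2 \<or> d = 3"
proof -
  have "list_all (\<lambda>a. list_all (\<lambda>b. list_all (\<lambda>l. list_all (\<lambda>c. c \<noteq> a \<and> c \<noteq> b \<longrightarrow> even (l div c)) (vertex_labels 2)
     \<longrightarrow> l = a \<or> l = b \<or> l = a + b) (node_labels 2)) (vertex_labels 2)) (vertex_labels 2)"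
    "list_all (\<lambda>a. list_all (\<lambda>b. list_all (\<lambda>l. list_all (\<lambda>c. c \<noteq> a \<and> c \<noteq> b \<longrightarrow> even (l div c)) (vertex_labels 3)
     \<longrightarrow> l = a \<or> l = b \<or> l = a + b) (node_labels 3)) (vertex_labels 3)) (vertex_labels 3)"
    by code_simp+
  then show ?thesis using that by auto
qed

lemma check_face_bits:
  "list_all (\<lambda>(a, b, c). list_all (\<lambda>l. list_all (\<lambda>e. e \<noteq> a \<and> e \<noteq> b \<and> e \<noteq> c \<longrightarrow> even (l div e)) (vertex_labels 3)
     \<longrightarrow> List.member (lab_in_face (a, b, c)) l) (node_labels 3)) (lab_faces \<beta>)"
proof -
  have "list_all (\<lambda>(a, b, c). list_all (\<lambda>l. list_all (\<lambda>e. e \<noteq> a \<and> e \<noteq> b \<and> e \<noteq> c \<longrightarrow> even (l div e)) (vertex_labels 3)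
     \<longrightarrow> List.member (lab_in_face (a, b, c)) l) (node_labels 3)) (lab_faces 0)"
    "list_all (\<lambda>(a, b, c). list_all (\<lambda>l. list_all (\<lambda>e. e \<noteq> a \<and> e \<noteq> b \<and> e \<noteq> c \<longrightarrow> even (l div e)) (vertex_labels 3)
     \<longrightarrow> List.member (lab_in_face (a, b, c)) l) (node_labels 3)) (lab_faces 1)"
    by code_simp+
  note ck = this
  show ?thesis
  proof (cases "\<beta> = 0")
    case True
    then show ?thesis using ck(1) by (simp only:)
  next
    case False
    then have "lab_faces \<beta> = lab_faces 1" by (simp add: lab_faces_def)
    then show ?thesis using ck(2) by (simp only:)
  qed
qed

lemma check_edgesD:
  assumes "check_edges d L" "a \<in> set (vertex_labels d)" "b \<in> set (vertex_labels d)" "a \<noteq> b"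
  shows "\<And>\<tau>. \<tau> \<in> set L \<Longrightarrow> \<not> has_edge a b \<tau>" "\<exists>\<tau>\<in>set L. has_edge a (a + b) \<tau>"
  using assms by (simp_all add: check_edges_def list_all_iff list_ex_iff)

lemma check_facesD:
  assumes "check_faces \<beta> L" "f \<in> set (lab_faces \<beta>)"
  shows "\<And>\<tau>. \<tau> \<in> set L \<Longrightarrow> \<exists>X\<in>set (lab_pieces f). \<forall>l\<in>set (fst \<tau>). List.member (lab_in_face f) l \<longrightarrow> l \<in> set X"
    "\<And>X. X \<in> set (lab_pieces f) \<Longrightarrow> \<exists>\<tau>\<in>set L. set X \<subseteq> set (fst \<tau>)"
  using assms by (simp_all add: check_faces_def list_all_iff list_ex_iff subset_eq)

lemma check_edge_bitsD:
  assumes d: "d = 2 \<or> d = 3" and "a \<in> set (vertex_labels d)" "b \<in> set (vertex_labels d)" "l \<in> set (node_labels d)"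
    and "\<And>c. c \<in> set (vertex_labels d) \<Longrightarrow> c \<noteq> a \<Longrightarrow> c \<noteq> b \<Longrightarrow> even (l div c)"
  shows "l = a \<or> l = b \<or> l = a + b"
proof -
  have "(\<forall>c\<in>set (vertex_labels d). c \<noteq> a \<and> c \<noteq> b \<longrightarrow> even (l div c)) \<longrightarrow> l = a \<or> l = b \<or> l = a + b"
    by (rule bspec[OF bspec[OF bspec[OF check_edge_bits[OF d, unfolded list_all_iff] assms(2)] assms(3)] assms(4)])
  then show ?thesis using assms(5) by blast
qed

lemma check_face_bitsD:
  assumes "(a, b, c) \<in> set (lab_faces \<beta>)" "l \<in> set (node_labels 3)"
    and "\<And>e. e \<in> set (vertex_labels 3) \<Longrightarrow> e \<noteq> a \<Longrightarrow> e \<noteq> b \<Longrightarrow> e \<noteq> c \<Longrightarrow> even (l div e)"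
  shows "List.member (lab_in_face (a, b, c)) l"
proof -
  have "\<forall>l\<in>set (node_labels 3). (\<forall>e\<in>set (vertex_labels 3). e \<noteq> a \<and> e \<noteq> b \<and> e \<noteq> c \<longrightarrow> even (l div e))
      \<longrightarrow> List.member (lab_in_face (a, b, c)) l"
    using bspec[OF check_face_bits[of \<beta>, unfolded list_all_iff] assms(1)] by (simp only: prod.case)
  then show ?thesis using assms(2,3) by blast
qed

lemma valid_nth:
  fixes \<tau> :: "'n::finite tsimplex"
  assumes v: "valid_tsimplex \<tau>" and "i \<le> CARD('n)" "j \<le> CARD('n)"
  shows "fst \<tau> ! i \<in> verts \<tau>" "fst \<tau> ! i = fst \<tau> ! j \<longleftrightarrow> i = j"
    "bary (verts \<tau>) (fst \<tau> ! i) (fst \<tau> ! j) = (if i = j then 1 else 0)"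
proof -
  have len: "length (fst \<tau>) = CARD('n) + 1" "distinct (fst \<tau>)"
    using v by (auto simp: valid_tsimplex_def)
  show 1: "fst \<tau> ! i \<in> verts \<tau>" using len assms by simp
  show 2: "fst \<tau> ! i = fst \<tau> ! j \<longleftrightarrow> i = j" using len assms by (simp add: nth_eq_iff_index_eq)
  show "bary (verts \<tau>) (fst \<tau> ! i) (fst \<tau> ! j) = (if i = j then 1 else 0)"
    using bary_vertex[OF nondeg_verts[OF v] 1] 2 by auto
qed

lemma verts_pt:
  fixes \<tau> :: "'n::finite tsimplex"
  assumes v: "valid_tsimplex \<tau>" and d: "CARD('n) = 2 \<or> CARD('n) = 3"
  shows "verts \<tau> = pt (snd \<tau>) (fst \<tau>) ` set (vertex_labels (CARD('n)))"
    and "map (pt (snd \<tau>) (fst \<tau>)) (vertex_labels (CARD('n))) = fst \<tau>"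
proof -
  have len: "length (fst \<tau>) = CARD('n) + 1" using v by (simp add: valid_tsimplex_def)
  show m: "map (pt (snd \<tau>) (fst \<tau>)) (vertex_labels (CARD('n))) = fst \<tau>"
  proof (cases "CARD('n) = 2")
    case True
    then obtain a b c where "fst \<tau> = [a, b, c]"
      using len by (auto simp: length_Suc_conv numeral_eq_Suc)
    then show ?thesis using True by (simp add: vertex_labels_def pt_def numeral_eq_Suc)
  next
    case False
    then have "CARD('n) = 3" using d by simp
    moreover from this obtain a b c e where "fst \<tau> = [a, b, c, e]"
      using len by (auto simp: length_Suc_conv numeral_eq_Suc)
    ultimately show ?thesis by (simp add: vertex_labels_def pt_def numeral_eq_Suc)
  qed
  have "verts \<tau> = set (map (pt (snd \<tau>) (fst \<tau>)) (vertex_labels (CARD('n))))" unfolding m ..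
  then show "verts \<tau> = pt (snd \<tau>) (fst \<tau>) ` set (vertex_labels (CARD('n)))"
    by (simp add: vertex_labels_def split: if_splits)
qed

lemma pt_inj:
  fixes \<tau> :: "'n::finite tsimplex"
  assumes v: "valid_tsimplex \<tau>" and d: "CARD('n) = 2 \<or> CARD('n) = 3"
  shows "inj_on (pt (snd \<tau>) (fst \<tau>)) (set (vertex_labels (CARD('n))))"
proof -
  have "distinct (map (pt (snd \<tau>) (fst \<tau>)) (vertex_labels (CARD('n))))"
    unfolding verts_pt(2)[OF v d] using v by (simp add: valid_tsimplex_def)
  then show ?thesis by (simp add: distinct_map vertex_labels_def)
qed

lemma bary_pt:
  fixes \<tau> :: "'n::finite tsimplex"
  assumes v: "valid_tsimplex \<tau>" and d: "CARD('n) = 2 \<or> CARD('n) = 3"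
    and l: "l \<in> set (node_labels (CARD('n)))" and c: "c \<in> set (vertex_labels (CARD('n)))"
  shows "0 \<le> bary (verts \<tau>) (pt (snd \<tau>) (fst \<tau>) l) (pt (snd \<tau>) (fst \<tau>) c)"
    and "bary (verts \<tau>) (pt (snd \<tau>) (fst \<tau>) l) (pt (snd \<tau>) (fst \<tau>) c) = 0 \<longleftrightarrow> even (l div c)"
proof -
  note simps = pt_def bary_midpoint[OF nondeg_verts[OF v]] valid_nth(3)[OF v]
  have "0 \<le> bary (verts \<tau>) (pt (snd \<tau>) (fst \<tau>) l) (pt (snd \<tau>) (fst \<tau>) c) \<and>
    (bary (verts \<tau>) (pt (snd \<tau>) (fst \<tau>) l) (pt (snd \<tau>) (fst \<tau>) c) = 0 \<longleftrightarrow> even (l div c))"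
    using d
  proof
    assume 2: "CARD('n) = 2"
    have "l = 1 \<or> l = 2 \<or> l = 3 \<or> l = 4 \<or> l = 5 \<or> l = 6" "c = 1 \<or> c = 2 \<or> c = 4"
      using l c by (auto simp: 2 node_labels_def vertex_labels_def)
    then show ?thesis
      by (elim disjE) (simp_all add: simps 2)
  next
    assume 3: "CARD('n) = 3"
    have "l = 1 \<or> l = 2 \<or> l = 3 \<or> l = 4 \<or> l = 5 \<or> l = 6 \<or> l = 7 \<or> l = 8 \<or> l = 9 \<or> l = 10 \<or> l = 11 \<or> l = 12 \<or> l = 13 \<or> l = 14"
      "c = 1 \<or> c = 2 \<or> c = 4 \<or> c = 8"
      using l c by (auto simp: 3 node_labels_def vertex_labels_def)
    then show ?thesis
      by (elim disjE) (simp_all add: simps 3)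
  qed
  then show "0 \<le> bary (verts \<tau>) (pt (snd \<tau>) (fst \<tau>) l) (pt (snd \<tau>) (fst \<tau>) c)"
    "bary (verts \<tau>) (pt (snd \<tau>) (fst \<tau>) l) (pt (snd \<tau>) (fst \<tau>) c) = 0 \<longleftrightarrow> even (l div c)"
    by auto
qed

lemma pattern_checks:
  assumes "d = 2 \<or> d = 3" "\<beta> < d"
  shows "lab_run d (pattern_steps d \<beta>) [(vertex_labels d, \<beta>)] = Some (pattern d \<beta>)"
    "check_nodes d (pattern d \<beta>)" "check_edges d (pattern d \<beta>)" "d = 3 \<Longrightarrow> check_faces \<beta> (pattern d \<beta>)"
proof -
  have c: "(d = 2 \<and> \<beta> = 0) \<or> (d = 2 \<and> \<beta> = 1) \<or> (d = 3 \<and> \<beta> = 0) \<or> (d = 3 \<and> \<beta> = 1) \<or> (d = 3 \<and> \<beta> = 2)"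
    using assms by auto
  show "lab_run d (pattern_steps d \<beta>) [(vertex_labels d, \<beta>)] = Some (pattern d \<beta>)"
    unfolding pattern_def using c pattern_ok by (elim disjE conjE) simp_all
  show "check_nodes d (pattern d \<beta>)" "check_edges d (pattern d \<beta>)" "d = 3 \<Longrightarrow> check_faces \<beta> (pattern d \<beta>)"
    using c check_2 check_3_nodes check_3_edges check_3_faces by (elim disjE conjE; simp)+
qed

text \<open>The factor \<open>2 ^ 10\<close> reflects that a pattern has at most ten steps, each
  halving volumes at most once.\<close>

lemma local_refinement_sound:
  fixes \<tau> :: "'n::finite tsimplex"
  assumes v: "valid_tsimplex \<tau>" and d: "CARD('n) = 2 \<or> CARD('n) = 3"
  shows "inj_on (pt (snd \<tau>) (fst \<tau>)) (labels (pattern (CARD('n)) (snd \<tau>)))"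
    and "conf (local_refinement \<tau>)" "nvb_refinement {\<tau>} (local_refinement \<tau>)"
    and "\<And>\<sigma>. \<sigma> \<in> local_refinement \<tau> \<Longrightarrow> vol (verts \<tau>) / 2 ^ 10 \<le> vol (verts \<sigma>)"
proof -
  let ?\<rho> = "pt (snd \<tau>) (fst \<tau>)"
  have \<beta>: "snd \<tau> < CARD('n)" using v by (simp add: valid_tsimplex_def)
  have whole: "realize ?\<rho> (vertex_labels (CARD('n)), snd \<tau>) = \<tau>"
    using verts_pt(2)[OF v d] by (simp add: realize_def)
  have "inj_on ?\<rho> (set (vertex_labels (CARD('n))))"
    using pt_inj[OF v d] by (simp add: vertex_labels_def)
  then have inj: "inj_on ?\<rho> (labels [(vertex_labels (CARD('n)), snd \<tau>)])" by (simp add: labels_def)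
  have steps: "?\<rho> m = midpoint (?\<rho> a) (?\<rho> b)" if "(a, b, m) \<in> set (pattern_steps (CARD('n)) (snd \<tau>))" for a b m
    using that
    by (cases "CARD('n) = 2"; cases "snd \<tau> = 0"; cases "snd \<tau> = 1"; simp add: pattern_steps_def;
        elim disjE conjE; simp add: pt_def)
  have pos: "0 \<le> vol (verts \<tau>)" by (simp add: vol_def)
  have len: "length (pattern_steps (CARD('n)) (snd \<tau>)) \<le> 10" by (simp add: pattern_steps_def)
  have *: "inj_on ?\<rho> (labels (pattern (CARD('n)) (snd \<tau>))) \<and> conf (realize ?\<rho> ` set (pattern (CARD('n)) (snd \<tau>))) \<and>
    nvb_refinement (realize ?\<rho> ` set [(vertex_labels (CARD('n)), snd \<tau>)]) (realize ?\<rho> ` set (pattern (CARD('n)) (snd \<tau>))) \<and>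
    (\<forall>\<sigma>\<in>set (pattern (CARD('n)) (snd \<tau>)). vol (verts \<tau>) / 2 ^ length (pattern_steps (CARD('n)) (snd \<tau>)) \<le> vol (verts (realize ?\<rho> \<sigma>)))"
  proof (rule lab_run_sound[OF pattern_checks(1)[OF d \<beta>] inj _ steps _ pos])
    show "conf (realize ?\<rho> ` set [(vertex_labels (CARD('n)), snd \<tau>)])"
      using v by (simp add: whole conf_def)
    show "\<forall>\<sigma>\<in>set [(vertex_labels (CARD('n)), snd \<tau>)]. vol (verts \<tau>) \<le> vol (verts (realize ?\<rho> \<sigma>))"
      by (simp add: whole)
  qed
  then show "inj_on ?\<rho> (labels (pattern (CARD('n)) (snd \<tau>)))" "conf (local_refinement \<tau>)" "nvb_refinement {\<tau>} (local_refinement \<tau>)"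
    by (simp_all add: local_refinement_def whole)
  fix \<sigma> assume "\<sigma> \<in> local_refinement \<tau>"
  then have "vol (verts \<tau>) / 2 ^ length (pattern_steps (CARD('n)) (snd \<tau>)) \<le> vol (verts \<sigma>)"
    using * by (auto simp: local_refinement_def)
  moreover have "vol (verts \<tau>) / 2 ^ 10 \<le> vol (verts \<tau>) / 2 ^ length (pattern_steps (CARD('n)) (snd \<tau>))"
    using len pos by (intro divide_left_mono power_increasing) auto
  ultimately show "vol (verts \<tau>) / 2 ^ 10 \<le> vol (verts \<sigma>)" by linarith
qed

lemma local_refinement_nodes:
  fixes \<tau> :: "'n::finite tsimplex"
  assumes v: "valid_tsimplex \<tau>" and d: "CARD('n) = 2 \<or> CARD('n) = 3" and s: "\<sigma> \<in> local_refinement \<tau>"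
  shows "\<exists>L\<in>set (pattern (CARD('n)) (snd \<tau>)). \<sigma> = realize (pt (snd \<tau>) (fst \<tau>)) L \<and>
     set (fst L) \<subseteq> set (node_labels (CARD('n)))"
proof -
  have \<beta>: "snd \<tau> < CARD('n)" using v by (simp add: valid_tsimplex_def)
  obtain L where L: "L \<in> set (pattern (CARD('n)) (snd \<tau>))" "\<sigma> = realize (pt (snd \<tau>) (fst \<tau>)) L"
    using s by (auto simp: local_refinement_def)
  have "set (fst L) \<subseteq> set (node_labels (CARD('n)))"
    using pattern_checks(2)[OF d \<beta>] L(1) by (auto simp: check_nodes_def list_all_iff)
  then show ?thesis using L by blast
qed

lemma local_refinement_inj_verts:
  fixes \<tau> :: "'n::finite tsimplex"
  assumes v: "valid_tsimplex \<tau>" and d: "CARD('n) = 2 \<or> CARD('n) = 3"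
  shows "inj_on verts (local_refinement \<tau>)"
proof (rule inj_onI)
  let ?\<rho> = "pt (snd \<tau>) (fst \<tau>)"
  have \<beta>: "snd \<tau> < CARD('n)" using v by (simp add: valid_tsimplex_def)
  fix \<sigma> \<sigma>' assume s: "\<sigma> \<in> local_refinement \<tau>" "\<sigma>' \<in> local_refinement \<tau>" and eq: "verts \<sigma> = verts \<sigma>'"
  obtain L L' where L: "L \<in> set (pattern (CARD('n)) (snd \<tau>))" "\<sigma> = realize ?\<rho> L"
    and L': "L' \<in> set (pattern (CARD('n)) (snd \<tau>))" "\<sigma>' = realize ?\<rho> L'"
    using s by (auto simp: local_refinement_def)
  have "?\<rho> ` set (fst L) = ?\<rho> ` set (fst L')"
    using eq unfolding L L' verts_realize .
  moreover have "set (fst L) \<subseteq> labels (pattern (CARD('n)) (snd \<tau>))" "set (fst L') \<subseteq> labels (pattern (CARD('n)) (snd \<tau>))"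
    using L L' by (auto simp: labels_def)
  ultimately have "set (fst L) = set (fst L')"
    using inj_on_image_eq_iff[OF local_refinement_sound(1)[OF v d]] by blast
  then have "L' = L"
    using pattern_checks(2)[OF d \<beta>] L(1) L'(1) by (auto simp: check_nodes_def list_all_iff)
  then show "\<sigma> = \<sigma>'" using L L' by simp
qed

lemma pt_edge:
  fixes \<tau> :: "'n::finite tsimplex"
  assumes d: "d = 2 \<or> d = 3" and "a \<in> set (vertex_labels d)" "b \<in> set (vertex_labels d)" "a \<noteq> b"
  shows "pt \<beta> z (a + b) = midpoint (pt \<beta> z a) (pt \<beta> z b)"
proof -
  have ab: "(a = 1 \<or> a = 2 \<or> a = 4 \<or> a = 8)" "(b = 1 \<or> b = 2 \<or> b = 4 \<or> b = 8)"
    using assms by (auto simp: vertex_labels_def split: if_splits)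
  have "pt \<beta> z 3 = midpoint (pt \<beta> z 1) (pt \<beta> z 2)" "pt \<beta> z 5 = midpoint (pt \<beta> z 1) (pt \<beta> z 4)"
    "pt \<beta> z 9 = midpoint (pt \<beta> z 1) (pt \<beta> z 8)" "pt \<beta> z 6 = midpoint (pt \<beta> z 2) (pt \<beta> z 4)"
    "pt \<beta> z 10 = midpoint (pt \<beta> z 2) (pt \<beta> z 8)" "pt \<beta> z 12 = midpoint (pt \<beta> z 4) (pt \<beta> z 8)"
    by (simp_all add: pt_def)
  then show ?thesis
    using ab assms(4) by (elim disjE) (simp_all add: midpoint_sym del: One_nat_def)
qed

lemma local_refinement_label_mem:
  fixes \<tau> :: "'n::finite tsimplex"
  assumes v: "valid_tsimplex \<tau>" and d: "CARD('n) = 2 \<or> CARD('n) = 3"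
    and L: "L \<in> set (pattern (CARD('n)) (snd \<tau>))" and l: "l \<in> labels (pattern (CARD('n)) (snd \<tau>))"
  shows "pt (snd \<tau>) (fst \<tau>) l \<in> verts (realize (pt (snd \<tau>) (fst \<tau>)) L) \<longleftrightarrow> l \<in> set (fst L)"
proof -
  have "set (fst L) \<subseteq> labels (pattern (CARD('n)) (snd \<tau>))" using L by (auto simp: labels_def)
  then show ?thesis
    unfolding verts_realize using inj_on_image_mem_iff[OF local_refinement_sound(1)[OF v d] l] by blast
qed

text \<open>On an edge the trace is always the edge halved at its midpoint, whatever the tag.
  Elements meeting in a single edge therefore match automatically.\<close>

lemma local_refinement_edges:
  fixes \<tau> :: "'n::finite tsimplex"
  assumes v: "valid_tsimplex \<tau>" and d: "CARD('n) = 2 \<or> CARD('n) = 3"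
    and gh: "g \<in> verts \<tau>" "h \<in> verts \<tau>" "g \<noteq> h"
  shows "\<exists>\<sigma>\<in>local_refinement \<tau>. {g, midpoint g h} \<subseteq> verts \<sigma>"
    and "\<And>\<sigma>. \<sigma> \<in> local_refinement \<tau> \<Longrightarrow> \<not> {g, h} \<subseteq> verts \<sigma> \<and> verts \<sigma> \<inter> convex hull {g, h} \<subseteq> {g, h, midpoint g h}"
proof -
  let ?\<rho> = "pt (snd \<tau>) (fst \<tau>)" and ?V = "vertex_labels (CARD('n))"
  let ?P = "pattern (CARD('n)) (snd \<tau>)"
  have \<beta>: "snd \<tau> < CARD('n)" using v by (simp add: valid_tsimplex_def)
  obtain a b where a: "a \<in> set ?V" "g = ?\<rho> a" and b: "b \<in> set ?V" "h = ?\<rho> b"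
    using gh unfolding verts_pt(1)[OF v d] by blast
  have ab: "a \<noteq> b" using a b gh by auto
  have m: "?\<rho> (a + b) = midpoint g h" using pt_edge[OF d a(1) b(1) ab] a b by simp
  note ce = check_edgesD[OF pattern_checks(3)[OF d \<beta>] a(1) b(1) ab]
  have ce': "\<exists>\<tau>\<in>set ?P. has_edge b (b + a) \<tau>"
    by (rule check_edgesD(2)[OF pattern_checks(3)[OF d \<beta>] b(1) a(1) ab[symmetric]])
  obtain L where L: "L \<in> set ?P" "has_edge a (a + b) L" using ce(2) by blast
  have "realize ?\<rho> L \<in> local_refinement \<tau>" using L by (simp add: local_refinement_def)
  moreover have "{g, midpoint g h} \<subseteq> verts (realize ?\<rho> L)"
  proof -
    have "{?\<rho> a, ?\<rho> (a + b)} \<subseteq> verts (realize ?\<rho> L)"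
      using L(2) unfolding verts_realize by (auto simp: has_edge_def)
    then show ?thesis unfolding m a(2)[symmetric] .
  qed
  ultimately show "\<exists>\<sigma>\<in>local_refinement \<tau>. {g, midpoint g h} \<subseteq> verts \<sigma>" by blast
  fix \<sigma> assume s: "\<sigma> \<in> local_refinement \<tau>"
  obtain M where M: "M \<in> set ?P" "\<sigma> = realize ?\<rho> M" "set (fst M) \<subseteq> set (node_labels (CARD('n)))"
    using local_refinement_nodes[OF v d s] by blast
  have lab: "a \<in> labels ?P" "b \<in> labels ?P"
    using ce(2) ce' by (auto simp: labels_def has_edge_def)
  have "\<not> {g, h} \<subseteq> verts \<sigma>"
    using ce(1)[OF M(1)] local_refinement_label_mem[OF v d M(1) lab(1)] local_refinement_label_mem[OF v d M(1) lab(2)]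
    unfolding M(2) a(2) b(2) by (auto simp: has_edge_def)
  moreover have "verts \<sigma> \<inter> convex hull {g, h} \<subseteq> {g, h, midpoint g h}"
  proof
    fix w assume w: "w \<in> verts \<sigma> \<inter> convex hull {g, h}"
    then obtain l where l: "l \<in> set (fst M)" "w = ?\<rho> l" unfolding M(2) verts_realize by blast
    have ln: "l \<in> set (node_labels (CARD('n)))" using l M by blast
    have "even (l div c)" if c: "c \<in> set ?V" "c \<noteq> a" "c \<noteq> b" for c
    proof -
      have "?\<rho> c \<noteq> g" "?\<rho> c \<noteq> h"
        using c a b inj_onD[OF pt_inj[OF v d]] by blast+
      then have "bary (verts \<tau>) w (?\<rho> c) = 0"
        using w subset_hull_iff_bary[OF nondeg_verts[OF v], of "{g, h}" w] gh by auto
      then show ?thesis using bary_pt(2)[OF v d ln c(1)] l by simp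
    qed
    then have "l = a \<or> l = b \<or> l = a + b"
      using check_edge_bitsD[OF d a(1) b(1) ln] by blast
    then show "w \<in> {g, h, midpoint g h}" using l a b m by auto
  qed
  ultimately show "\<not> {g, h} \<subseteq> verts \<sigma> \<and> verts \<sigma> \<inter> convex hull {g, h} \<subseteq> {g, h, midpoint g h}" by blast
qed

text \<open>\<open>face_ref \<tau> g h k\<close>: the face of the tetrahedron \<open>\<tau>\<close> with vertices \<open>g, h, k\<close> is first bisected at the
  edge between \<open>g\<close> and \<open>h\<close>.\<close>

definition face_ref :: "'n::finite tsimplex \<Rightarrow> real^'n \<Rightarrow> real^'n \<Rightarrow> real^'n \<Rightarrow> bool" where
  "face_ref \<tau> g h k \<longleftrightarrow> (\<exists>a b c. (a, b, c) \<in> set (lab_faces (snd \<tau>)) \<and>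
      g = pt (snd \<tau>) (fst \<tau>) a \<and> h = pt (snd \<tau>) (fst \<tau>) b \<and> k = pt (snd \<tau>) (fst \<tau>) c)"

text \<open>Geometric counterpart of \<open>lab_pieces\<close>, for the half of the face at
  \<open>g\<close>.\<close>

definition half_pieces :: "real^'n::finite \<Rightarrow> real^'n \<Rightarrow> real^'n \<Rightarrow> (real^'n) set set" where
  "half_pieces g h k =
     {{g, midpoint g h, midpoint g k}, {k, midpoint k (midpoint g h), midpoint g k},
      {midpoint g h, midpoint k (midpoint g h), midpoint g k}}"

definition pieces :: "real^'n::finite \<Rightarrow> real^'n \<Rightarrow> real^'n \<Rightarrow> (real^'n) set set" where
  "pieces g h k = half_pieces g h k \<union> half_pieces h g k"

lemma pieces_sym: "pieces g h k = pieces h g k"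
  by (simp add: pieces_def Un_commute)

lemma lab_faces_props:
  assumes "(a, b, c) \<in> set (lab_faces \<beta>)"
  shows "a \<in> set (vertex_labels 3)" "b \<in> set (vertex_labels 3)" "c \<in> set (vertex_labels 3)"
    "a \<noteq> b" "a \<noteq> c" "b \<noteq> c" "pt \<beta> z (a + b + c) = midpoint (pt \<beta> z c) (midpoint (pt \<beta> z a) (pt \<beta> z b))"
proof -
  have "(a = 1 \<and> b = 8 \<and> c = 2) \<or> (a = 1 \<and> b = 8 \<and> c = 4) \<or> (a = 1 \<and> b = 4 \<and> c = 2) \<or>
      (\<beta> = 0 \<and> a = 2 \<and> b = 8 \<and> c = 4) \<or> (\<beta> \<noteq> 0 \<and> a = 4 \<and> b = 8 \<and> c = 2)"
    using assms by (cases "\<beta> = 0") (simp_all add: lab_faces_def)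
  then have "a \<in> set (vertex_labels 3) \<and> b \<in> set (vertex_labels 3) \<and> c \<in> set (vertex_labels 3) \<and>
    a \<noteq> b \<and> a \<noteq> c \<and> b \<noteq> c \<and> pt \<beta> z (a + b + c) = midpoint (pt \<beta> z c) (midpoint (pt \<beta> z a) (pt \<beta> z b))"
    by (elim disjE conjE) (simp_all add: vertex_labels_def pt_def del: One_nat_def)
  then show "a \<in> set (vertex_labels 3)" "b \<in> set (vertex_labels 3)" "c \<in> set (vertex_labels 3)"
    "a \<noteq> b" "a \<noteq> c" "b \<noteq> c" "pt \<beta> z (a + b + c) = midpoint (pt \<beta> z c) (midpoint (pt \<beta> z a) (pt \<beta> z b))"
    by simp_all
qed

lemma pieces_image:
  assumes "(a, b, c) \<in> set (lab_faces \<beta>)"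
  shows "(\<lambda>X. pt \<beta> z ` set X) ` set (lab_pieces (a, b, c)) = pieces (pt \<beta> z a) (pt \<beta> z b) (pt \<beta> z c)"
proof -
  note p = lab_faces_props[OF assms]
  have e: "pt \<beta> z (a + b) = midpoint (pt \<beta> z a) (pt \<beta> z b)" "pt \<beta> z (a + c) = midpoint (pt \<beta> z a) (pt \<beta> z c)"
    "pt \<beta> z (b + c) = midpoint (pt \<beta> z b) (pt \<beta> z c)"
    using p by (auto intro!: pt_edge[of 3])
  have s: "midpoint (pt \<beta> z b) (pt \<beta> z a) = midpoint (pt \<beta> z a) (pt \<beta> z b)" by (rule midpoint_sym)
  show ?thesis
    unfolding lab_pieces_def pieces_def half_pieces_def s by (simp add: e p(7) insert_commute Un_commute)
qed

lemma face_ref_verts: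
  fixes \<tau> :: "'n::finite tsimplex"
  assumes v: "valid_tsimplex \<tau>" and d: "CARD('n) = 3" and f: "face_ref \<tau> g h k"
  shows "g \<in> verts \<tau>" "h \<in> verts \<tau>" "k \<in> verts \<tau>" "g \<noteq> h" "g \<noteq> k" "h \<noteq> k"
proof -
  obtain a b c where abc: "(a, b, c) \<in> set (lab_faces (snd \<tau>))" "g = pt (snd \<tau>) (fst \<tau>) a"
    "h = pt (snd \<tau>) (fst \<tau>) b" "k = pt (snd \<tau>) (fst \<tau>) c"
    using f unfolding face_ref_def by blast
  have d': "CARD('n) = 2 \<or> CARD('n) = 3" using d by simp
  note p = lab_faces_props[OF abc(1)]
  show "g \<in> verts \<tau>" "h \<in> verts \<tau>" "k \<in> verts \<tau>"
    unfolding verts_pt(1)[OF v d'] d abc using p by blast+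
  have "inj_on (pt (snd \<tau>) (fst \<tau>)) (set (vertex_labels 3))"
    using pt_inj[OF v d'] unfolding d .
  then show "g \<noteq> h" "g \<noteq> k" "h \<noteq> k"
    unfolding abc using p by (auto dest: inj_onD)
qed

text \<open>Vertex order and type of \<open>\<tau>\<close> enter the trace on a face only through
  \<open>g\<close>, \<open>h\<close>, \<open>k\<close>. Matching two neighbours is thereby reduced
  to their agreement on the first bisected edge of the common face.\<close>

lemma local_refinement_faces:
  fixes \<tau> :: "'n::finite tsimplex"
  assumes v: "valid_tsimplex \<tau>" and d: "CARD('n) = 3" and f: "face_ref \<tau> g h k"
  shows "X \<in> pieces g h k \<Longrightarrow> \<exists>\<sigma>\<in>local_refinement \<tau>. X \<subseteq> verts \<sigma>"
    and "\<sigma> \<in> local_refinement \<tau> \<Longrightarrow> \<exists>X\<in>pieces g h k. verts \<sigma> \<inter> convex hull {g, h, k} \<subseteq> X"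
proof -
  let ?\<rho> = "pt (snd \<tau>) (fst \<tau>)"
  let ?P = "pattern 3 (snd \<tau>)"
  have \<beta>: "snd \<tau> < CARD('n)" using v by (simp add: valid_tsimplex_def)
  have d': "CARD('n) = 2 \<or> CARD('n) = 3" using d by simp
  obtain a b c where abc: "(a, b, c) \<in> set (lab_faces (snd \<tau>))" "g = ?\<rho> a" "h = ?\<rho> b" "k = ?\<rho> c"
    using f unfolding face_ref_def by blast
  note p = lab_faces_props[OF abc(1)]
  have pc: "pieces g h k = (\<lambda>X. ?\<rho> ` set X) ` set (lab_pieces (a, b, c))"
    unfolding abc(2-4) pieces_image[OF abc(1)] ..
  note cf = check_facesD[OF pattern_checks(4)[OF d' \<beta> d, unfolded d] abc(1)]
  show "\<exists>\<sigma>\<in>local_refinement \<tau>. X \<subseteq> verts \<sigma>" if "X \<in> pieces g h k" for X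
  proof -
    obtain Y where Y: "Y \<in> set (lab_pieces (a, b, c))" "X = ?\<rho> ` set Y" using \<open>X \<in> pieces g h k\<close> pc by blast
    obtain L where L: "L \<in> set ?P" "set Y \<subseteq> set (fst L)" using cf(2)[OF Y(1)] by blast
    have "X \<subseteq> verts (realize ?\<rho> L)" unfolding Y(2) verts_realize using L(2) by (rule image_mono)
    moreover have "realize ?\<rho> L \<in> local_refinement \<tau>" using L(1) by (simp add: local_refinement_def d)
    ultimately show ?thesis by blast
  qed
  show "\<exists>X\<in>pieces g h k. verts \<sigma> \<inter> convex hull {g, h, k} \<subseteq> X" if s: "\<sigma> \<in> local_refinement \<tau>" for \<sigma>
  proof -
    obtain M where M: "M \<in> set ?P" "\<sigma> = realize ?\<rho> M" "set (fst M) \<subseteq> set (node_labels 3)"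
      using local_refinement_nodes[OF v d' s] unfolding d by blast
    obtain Y where Y: "Y \<in> set (lab_pieces (a, b, c))"
      "\<forall>l\<in>set (fst M). List.member (lab_in_face (a, b, c)) l \<longrightarrow> l \<in> set Y"
      using cf(1)[OF M(1)] by blast
    have "verts \<sigma> \<inter> convex hull {g, h, k} \<subseteq> ?\<rho> ` set Y"
    proof
      fix w assume w: "w \<in> verts \<sigma> \<inter> convex hull {g, h, k}"
      then obtain l where l: "l \<in> set (fst M)" "w = ?\<rho> l" unfolding M(2) verts_realize by blast
      have ln: "l \<in> set (node_labels 3)" using l M by blast
      have inj: "inj_on ?\<rho> (set (vertex_labels 3))"
        using pt_inj[OF v d'] unfolding d .
      have "even (l div e)" if e: "e \<in> set (vertex_labels 3)" "e \<noteq> a" "e \<noteq> b" "e \<noteq> c" for e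
      proof -
        have "?\<rho> e \<notin> {g, h, k}"
          unfolding abc(2-4) using inj e p(1-3) by (auto dest: inj_onD)
        then have "bary (verts \<tau>) w (?\<rho> e) = 0"
          using w subset_hull_iff_bary[OF nondeg_verts[OF v], of "{g, h, k}" w] face_ref_verts[OF v d f] by auto
        then show ?thesis using bary_pt(2)[OF v d', of l e] ln e(1) l(2) unfolding d by simp
      qed
      then have "List.member (lab_in_face (a, b, c)) l"
        by (rule check_face_bitsD[OF abc(1) ln])
      then show "w \<in> ?\<rho> ` set Y" using Y(2) l by blast
    qed
    then show ?thesis using pc Y(1) by blast
  qed
qed

section \<open>Agreement of the face refinement edges\<close>

text \<open>\<open>face_ref\<close> lists the end points of the first bisected edge in an order
  inherited from the tag; the geometry of the face only knows the unordered edge.\<close>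

definition face_side :: "'n::finite tsimplex \<Rightarrow> real^'n \<Rightarrow> real^'n \<Rightarrow> real^'n \<Rightarrow> bool" where
  "face_side \<tau> g h k \<longleftrightarrow> face_ref \<tau> g h k \<or> face_ref \<tau> h g k"

lemma face_side_sym: "face_side \<tau> g h k \<Longrightarrow> face_side \<tau> h g k"
  by (auto simp: face_side_def)

lemma face_ref_list:
  "face_ref ([w, x, y, z], \<beta>) g h k \<longleftrightarrow>
     (g = w \<and> h = z \<and> k = x) \<or> (g = w \<and> h = z \<and> k = y) \<or> (g = w \<and> h = y \<and> k = x) \<or>
     (\<beta> = 0 \<and> g = x \<and> h = z \<and> k = y) \<or> (\<beta> \<noteq> 0 \<and> g = y \<and> h = z \<and> k = x)"
proof -
  have p: "pt \<beta> [w, x, y, z] 1 = w" "pt \<beta> [w, x, y, z] 2 = x" "pt \<beta> [w, x, y, z] 4 = y" "pt \<beta> [w, x, y, z] 8 = z"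
    by (simp_all add: pt_def numeral_eq_Suc)
  have im: "face_ref ([w, x, y, z], \<beta>) g h k \<longleftrightarrow>
      (g, h, k) \<in> (\<lambda>(a, b, c). (pt \<beta> [w, x, y, z] a, pt \<beta> [w, x, y, z] b, pt \<beta> [w, x, y, z] c)) ` set (lab_faces \<beta>)"
    unfolding face_ref_def fst_conv snd_conv by force
  show ?thesis
  proof (cases "\<beta> = 0")
    case True
    then have l: "set (lab_faces \<beta>) = {(1,8,2), (1,8,4), (1,4,2), (2,8,4)}" by (auto simp: lab_faces_def)
    show ?thesis
      unfolding im l image_insert image_empty prod.case p using True by auto
  next
    case False
    then have l: "set (lab_faces \<beta>) = {(1,8,2), (1,8,4), (1,4,2), (4,8,2)}" by (auto simp: lab_faces_def)
    show ?thesis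
      unfolding im l image_insert image_empty prod.case p using False by auto
  qed
qed

lemma tetra_list:
  fixes \<tau> :: "'n::finite tsimplex"
  assumes v: "valid_tsimplex \<tau>" and d: "CARD('n) = 3"
  shows "\<exists>w x y z \<beta>. \<tau> = ([w, x, y, z], \<beta>) \<and> distinct [w, x, y, z] \<and> ref0 \<tau> = w \<and> ref1 \<tau> = z \<and> verts \<tau> = {w, x, y, z} \<and>
    sons \<tau> = {([w, midpoint w z, x, y], (\<beta> + 1) mod 3),
              if \<beta> = 0 then ([z, midpoint w z, y, x], 1) else ([z, midpoint w z, x, y], (\<beta> + 1) mod 3)}"
proof -
  obtain zs \<beta> where t: "\<tau> = (zs, \<beta>)" by (cases \<tau>)
  have len: "length zs = 4" and dist: "distinct zs" and \<beta>: "\<beta> < 3"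
    using v d by (auto simp: t valid_tsimplex_def)
  obtain w x y z where zs: "zs = [w, x, y, z]"
    using len by (auto simp: length_Suc_conv numeral_eq_Suc)
  have n: "[w, x, y, z] ! 0 = w" "[w, x, y, z] ! 1 = x" "[w, x, y, z] ! 2 = y" "[w, x, y, z] ! 3 = z"
    by (simp_all add: numeral_eq_Suc)
  have "\<beta> = 0 \<or> \<beta> = 1 \<or> \<beta> = 2" using \<beta> by auto
  moreover have u: "[1..<Suc 0] = []" "[Suc 0..<3] = [1, 2]" "[1..<Suc 1] = [1]" "[Suc 1..<3] = [2]" "[1..<Suc 2] = [1, 2]" "[Suc 2..<3] = []"
    by (simp_all add: upt_rec numeral_eq_Suc)
  ultimately have s: "sons \<tau> = {([w, midpoint w z, x, y], (\<beta> + 1) mod 3),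
              if \<beta> = 0 then ([z, midpoint w z, y, x], 1) else ([z, midpoint w z, x, y], (\<beta> + 1) mod 3)}"
    unfolding t zs sons_def Let_def d prod.case
    by (elim disjE) (simp_all only: u n list.map append.simps rev.simps, simp_all)
  show ?thesis
    using dist n(4) s by (intro exI[of _ w] exI[of _ x] exI[of _ y] exI[of _ z] exI[of _ \<beta>])
      (simp add: t zs ref0_def ref1_def d)
qed

lemma face_has_face_ref:
  fixes \<tau> :: "'n::finite tsimplex"
  assumes v: "valid_tsimplex \<tau>" and d: "CARD('n) = 3" and F: "F \<subseteq> verts \<tau>" "card F = 3"
  shows "\<exists>g h k. face_ref \<tau> g h k \<and> F = {g, h, k}"
proof -
  obtain w x y z \<beta> where t: "\<tau> = ([w, x, y, z], \<beta>)" "distinct [w, x, y, z]" "verts \<tau> = {w, x, y, z}"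
    using tetra_list[OF v d] by (elim exE conjE) (rule that, assumption+)
  have fin: "finite F" using F(2) by (simp add: card_ge_0_finite)
  have "card (verts \<tau> - F) = 1"
    using F fin t(2) by (subst card_Diff_subset) (auto simp: t(3))
  then obtain r where r: "verts \<tau> - F = {r}" by (meson card_1_singletonE)
  then have Fr: "F = {w, x, y, z} - {r}" and "r \<in> {w, x, y, z}" using F(1) t(3) by auto
  then consider "r = w" | "r = x" | "r = y" | "r = z" by auto
  then show ?thesis
  proof cases
    case 1
    then have "F = {x, z, y}" using Fr t(2) by auto
    then show ?thesis unfolding t(1) face_ref_list
      by (cases "\<beta> = 0") (blast, metis insert_commute)
  next
    case 2
    then have "F = {w, z, y}" using Fr t(2) by auto
    then show ?thesis unfolding t(1) face_ref_list by blast
  next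
    case 3
    then have "F = {w, z, x}" using Fr t(2) by auto
    then show ?thesis unfolding t(1) face_ref_list by blast
  next
    case 4
    then have "F = {w, y, x}" using Fr t(2) by auto
    then show ?thesis unfolding t(1) face_ref_list by blast
  qed
qed

text \<open>On a face, bisecting tetrahedra acts as newest vertex bisection of triangles: a half of
  the face is next bisected at the edge opposite to the new midpoint. Otherwise the face survives
  with the same first edge, or the son loses a vertex \<open>p\<close> of the face by bisecting an
  edge that leaves the face at \<open>q\<close>, and keeps only an edge of it.\<close>

lemma face_side_son:
  fixes \<tau> :: "'n::finite tsimplex"
  assumes v: "valid_tsimplex \<tau>" and d: "CARD('n) = 3" and f: "face_ref \<tau> g h k" and \<rho>: "\<rho> \<in> sons \<tau>"
  shows "(verts \<rho> = insert (midpoint g h) (verts \<tau> - {h}) \<and> face_side \<rho> g k (midpoint g h)) \<or>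
         (verts \<rho> = insert (midpoint g h) (verts \<tau> - {g}) \<and> face_side \<rho> h k (midpoint g h)) \<or>
         face_side \<rho> g h k \<or>
         (\<exists>p q. p \<in> {g, h} \<and> p \<in> verts \<tau> \<and> q \<in> verts \<tau> \<and> p \<noteq> q \<and> q \<notin> {g, h, k} \<and> verts \<rho> = insert (midpoint p q) (verts \<tau> - {p}))"
proof -
  obtain w x y z \<beta> where t: "\<tau> = ([w, x, y, z], \<beta>)" "distinct [w, x, y, z]" "verts \<tau> = {w, x, y, z}"
    and s: "sons \<tau> = {([w, midpoint w z, x, y], (\<beta> + 1) mod 3),
              if \<beta> = 0 then ([z, midpoint w z, y, x], 1) else ([z, midpoint w z, x, y], (\<beta> + 1) mod 3)}"
    using tetra_list[OF v d] by (elim exE conjE) (rule that, assumption+)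
  define m where "m = midpoint w z"
  have ms: "midpoint z w = m" by (simp add: m_def midpoint_sym)
  consider (0) "\<rho> = ([w, m, x, y], (\<beta> + 1) mod 3)" | (1) "\<beta> = 0" "\<rho> = ([z, m, y, x], 1)"
    | (2) "\<beta> \<noteq> 0" "\<rho> = ([z, m, x, y], (\<beta> + 1) mod 3)"
    using \<rho> unfolding s m_def by (auto split: if_splits)
  then show ?thesis
  proof cases
    case 0
    have V: "verts \<rho> = insert m (verts \<tau> - {z})" using t(2,3) 0 by auto
    have fw: "face_side \<rho> w x m" "face_side \<rho> w y m" "face_side \<rho> w y x" unfolding 0 face_side_def face_ref_list by auto
    from f[unfolded t(1) face_ref_list] show ?thesis
    proof (elim disjE conjE)
      assume "g = w" "h = z" "k = x"
      then show ?thesis using V fw(1) by (simp add: m_def)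
    next
      assume "g = w" "h = z" "k = y"
      then show ?thesis using V fw(2) by (simp add: m_def)
    next
      assume "g = w" "h = y" "k = x"
      then show ?thesis using fw(3) by simp
    next
      assume "g = x" "h = z" "k = y"
      moreover have "verts \<rho> = insert (midpoint z w) (verts \<tau> - {z})" using V ms by simp
      ultimately show ?thesis using t(2,3)
        by - (rule disjI2, rule disjI2, rule disjI2, rule exI[of _ z], rule exI[of _ w], auto)
    next
      assume "g = y" "h = z" "k = x"
      moreover have "verts \<rho> = insert (midpoint z w) (verts \<tau> - {z})" using V ms by simp
      ultimately show ?thesis using t(2,3)
        by - (rule disjI2, rule disjI2, rule disjI2, rule exI[of _ z], rule exI[of _ w], auto)
    qed
  next
    case 1
    have V: "verts \<rho> = insert m (verts \<tau> - {w})" using t(2,3) 1 by auto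
    have fw: "face_side \<rho> z x m" "face_side \<rho> z y m" "face_side \<rho> x z y" unfolding 1 face_side_def face_ref_list by auto
    from f[unfolded t(1) face_ref_list] show ?thesis
    proof (elim disjE conjE)
      assume "g = w" "h = z" "k = x"
      then show ?thesis using V fw(1) by (simp add: m_def)
    next
      assume "g = w" "h = z" "k = y"
      then show ?thesis using V fw(2) by (simp add: m_def)
    next
      assume "g = w" "h = y" "k = x"
      moreover have "verts \<rho> = insert (midpoint w z) (verts \<tau> - {w})" using V m_def by simp
      ultimately show ?thesis using t(2,3)
        by - (rule disjI2, rule disjI2, rule disjI2, rule exI[of _ w], rule exI[of _ z], auto)
    next
      assume "g = x" "h = z" "k = y"
      then show ?thesis using fw(3) by simp
    qed (use 1 in simp)
  next
    case 2
    have V: "verts \<rho> = insert m (verts \<tau> - {w})" using t(2,3) 2 by auto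
    have fw: "face_side \<rho> z x m" "face_side \<rho> z y m" "face_side \<rho> y z x" unfolding 2 face_side_def face_ref_list by auto
    from f[unfolded t(1) face_ref_list] show ?thesis
    proof (elim disjE conjE)
      assume "g = w" "h = z" "k = x"
      then show ?thesis using V fw(1) by (simp add: m_def)
    next
      assume "g = w" "h = z" "k = y"
      then show ?thesis using V fw(2) by (simp add: m_def)
    next
      assume "g = w" "h = y" "k = x"
      moreover have "verts \<rho> = insert (midpoint w z) (verts \<tau> - {w})" using V m_def by simp
      ultimately show ?thesis using t(2,3)
        by - (rule disjI2, rule disjI2, rule disjI2, rule exI[of _ w], rule exI[of _ z], auto)
    next
      assume "g = y" "h = z" "k = x"
      then show ?thesis using fw(3) by simp
    qed (use 2 in simp)
  qed
qed

lemma face_side_son_cases: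
  fixes \<tau> :: "'n::finite tsimplex"
  assumes v: "valid_tsimplex \<tau>" and d: "CARD('n) = 3" and f: "face_side \<tau> g h k" and \<rho>: "\<rho> \<in> sons \<tau>"
  shows "(verts \<rho> = insert (midpoint g h) (verts \<tau> - {h}) \<and> face_side \<rho> g k (midpoint g h)) \<or>
         (verts \<rho> = insert (midpoint g h) (verts \<tau> - {g}) \<and> face_side \<rho> h k (midpoint g h)) \<or>
         face_side \<rho> g h k \<or>
         (\<exists>p q. p \<in> {g, h} \<and> p \<in> verts \<tau> \<and> q \<in> verts \<tau> \<and> p \<noteq> q \<and> q \<notin> {g, h, k} \<and> verts \<rho> = insert (midpoint p q) (verts \<tau> - {p}))"
proof -
  have "face_ref \<tau> g h k \<or> face_ref \<tau> h g k" using f by (simp add: face_side_def)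
  then show ?thesis
  proof
    assume "face_ref \<tau> g h k"
    then show ?thesis by (rule face_side_son[OF v d _ \<rho>])
  next
    assume "face_ref \<tau> h g k"
    from face_side_son[OF v d this \<rho>, unfolded midpoint_sym[of h g] insert_commute[of h g]] show ?thesis
      using face_side_sym[of \<rho> h g k] by (elim disjE) simp_all
  qed
qed

lemma face_side_verts:
  fixes \<tau> :: "'n::finite tsimplex"
  assumes "valid_tsimplex \<tau>" "CARD('n) = 3" "face_side \<tau> g h k"
  shows "g \<in> verts \<tau>" "h \<in> verts \<tau>" "k \<in> verts \<tau>" "g \<noteq> h" "g \<noteq> k" "h \<noteq> k"
  using assms(3) face_ref_verts[OF assms(1,2)] unfolding face_side_def by metis+

text \<open>Edges of descendants within a face are parallel to an edge of the face or to the median that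
  is bisected first; the other two medians are not among these directions.  So an edge along a
  median, see \<open>edge_on_median\<close> below, shows which edge of the face is bisected first, and this
  is the same for both tetrahedra sharing the face.\<close>

definition face_dirs :: "real^'n::finite \<Rightarrow> real^'n \<Rightarrow> real^'n \<Rightarrow> (real^'n) set" where
  "face_dirs g h k = {v. \<exists>c. v = c *\<^sub>R (g - h) \<or> v = c *\<^sub>R (g - k) \<or> v = c *\<^sub>R (h - k) \<or> v = c *\<^sub>R (k - midpoint g h)}"

text \<open>The half at \<open>g\<close> is next bisected at \<open>g\<close>-\<open>k\<close>. Its
  sides point along \<open>g - h\<close>, \<open>g - k\<close> and the median of the whole face, and
  its own median is parallel to \<open>h - k\<close>. This closure is why four directions suffice
  for all descendants.\<close>

lemma face_dirs_left: "face_dirs g k (midpoint g h) \<subseteq> face_dirs g h k"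
proof
  fix v assume "v \<in> face_dirs g k (midpoint g h)"
  then obtain c where "v = c *\<^sub>R (g - k) \<or> v = c *\<^sub>R (g - midpoint g h) \<or> v = c *\<^sub>R (k - midpoint g h)
     \<or> v = c *\<^sub>R (midpoint g h - midpoint g k)" by (auto simp: face_dirs_def)
  moreover have "c *\<^sub>R (g - midpoint g h) = (c / 2) *\<^sub>R (g - h)"
    "c *\<^sub>R (midpoint g h - midpoint g k) = (c / 2) *\<^sub>R (h - k)"
    by (simp_all add: midpoint_def algebra_simps scaleR_2[symmetric] flip: scaleR_add_left)
  ultimately show "v \<in> face_dirs g h k" unfolding face_dirs_def by auto
qed

lemma face_dirs_sym:
  fixes g h k :: "real^'n::finite"
  shows "face_dirs g h k = face_dirs h g k"
proof -
  have "face_dirs g h k \<subseteq> face_dirs h g k" for g h :: "real^'n"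
  proof
    fix v assume "v \<in> face_dirs g h k"
    then obtain c where "v = (- c) *\<^sub>R (h - g) \<or> v = c *\<^sub>R (g - k) \<or> v = c *\<^sub>R (h - k) \<or> v = c *\<^sub>R (k - midpoint h g)"
      by (auto simp: face_dirs_def midpoint_sym algebra_simps)
    then show "v \<in> face_dirs h g k" unfolding face_dirs_def by blast
  qed
  then show ?thesis by blast
qed

lemma hull_son_face:
  assumes N: "nondeg S" and gh: "g \<in> S" "h \<in> S" "k \<in> S" "g \<noteq> h" "g \<noteq> k" "h \<noteq> k"
    and x: "x \<in> convex hull (insert (midpoint g h) (S - {h}))" "x \<in> convex hull {g, h, k}"
  shows "x \<in> convex hull {g, k, midpoint g h}"
proof -
  have N': "nondeg (insert (midpoint g h) (S - {h}))"
    using nondeg_bisect[OF N gh(2,1)] gh(4) by (simp add: midpoint_sym)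
  have sub: "{g, k, midpoint g h} \<subseteq> insert (midpoint g h) (S - {h})" using gh by auto
  have z: "bary S x v = 0" if "v \<notin> {g, h, k}" for v
    using x(2) subset_hull_iff_bary[OF N, of "{g, h, k}" x] gh that by auto
  have b: "bary (insert (midpoint g h) (S - {h})) x v = (if v = midpoint g h then 2 * bary S x h
      else if v = h then 0 else if v = g then bary S x g - bary S x h else bary S x v)" for v
    using bary_bisect[OF N gh(2,1) gh(4)[symmetric], of x v] by (simp add: midpoint_sym)
  show ?thesis
    unfolding subset_hull_iff_bary[OF N' sub]
  proof (intro allI conjI impI)
    fix v
    show "0 \<le> bary (insert (midpoint g h) (S - {h})) x v" using bary_nonneg[OF N' x(1)] .
    assume "v \<notin> {g, k, midpoint g h}"
    then show "bary (insert (midpoint g h) (S - {h})) x v = 0"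
      unfolding b using z[of v] by (cases "v = h") auto
  qed
qed

text \<open>In the son that gave up \<open>p\<close>, the coordinate of \<open>p\<close> is at most
  that of \<open>q\<close>, and the latter vanishes on a face without \<open>q\<close>.\<close>

lemma son_off_face:
  assumes N: "nondeg S" and "p \<in> S" "q \<in> S" "p \<noteq> q" and F: "F \<subseteq> S" "q \<notin> F"
    and x: "x \<in> convex hull (insert (midpoint p q) (S - {p}))" "x \<in> convex hull F"
  shows "bary S x p = 0"
proof -
  have "bary S x p \<le> bary S x q" using x(1) hull_bisect_iff[OF N assms(2-4)] by simp
  moreover have "bary S x q = 0" "0 \<le> bary S x p"
    using x(2) subset_hull_iff_bary[OF N F(1), of x] F(2) by auto
  ultimately show ?thesis by simp
qed

lemma verts_subset_hull: "verts \<tau> \<subseteq> convex hull (verts \<tau>)"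
  by (rule hull_subset)

text \<open>The induction peels off the oldest bisection, because the face and its first edge change
  from father to son. If the son keeps only an edge of the face, all remaining points of the face
  lie on one line and the direction is that of this edge.\<close>

lemma desc_face_dirs:
  fixes \<tau> :: "'n::finite tsimplex"
  assumes "desc \<tau> \<rho>" and d: "CARD('n) = 3" and "valid_tsimplex \<tau>" "face_side \<tau> g h k"
    and "p \<in> verts \<rho>" "q \<in> verts \<rho>" "p \<in> convex hull {g, h, k}" "q \<in> convex hull {g, h, k}"
  shows "p - q \<in> face_dirs g h k"
  using assms(1,3-) unfolding desc_def
proof (induction arbitrary: g h k rule: converse_rtranclp_induct)
  case base
  note f = face_side_verts[OF base(1) d base(2)]
  have sub: "{g, h, k} \<subseteq> verts \<rho>" using f by auto
  have "p \<in> {g, h, k}" "q \<in> {g, h, k}"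
    using subset_hull_subset[OF nondeg_verts[OF base(1)] sub] base by blast+
  moreover have "r - s = 1 *\<^sub>R (r - s)" "s - r = (- 1) *\<^sub>R (r - s)" "r - r = 0 *\<^sub>R (g - h)" for r s
    by simp_all
  ultimately show ?case unfolding face_dirs_def by blast
next
  case (step \<tau> \<sigma>)
  note v = \<open>valid_tsimplex \<tau>\<close>
  note N = nondeg_verts[OF v]
  note f = face_side_verts[OF v d \<open>face_side \<tau> g h k\<close>]
  have vs: "valid_tsimplex \<sigma>" using son_cases[OF v step.hyps(1)] by blast
  have pq: "p \<in> convex hull (verts \<sigma>)" "q \<in> convex hull (verts \<sigma>)"
    using desc_hull[of \<sigma> \<rho>] step.hyps(2) vs step.prems verts_subset_hull[of \<rho>] by (auto simp: desc_def)
  from face_side_son_cases[OF v d \<open>face_side \<tau> g h k\<close> step.hyps(1)] consider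
      (left) "verts \<sigma> = insert (midpoint g h) (verts \<tau> - {h})" "face_side \<sigma> g k (midpoint g h)"
    | (right) "verts \<sigma> = insert (midpoint g h) (verts \<tau> - {g})" "face_side \<sigma> h k (midpoint g h)"
    | (keep) "face_side \<sigma> g h k"
    | (off) a b where "a \<in> {g, h}" "a \<in> verts \<tau>" "b \<in> verts \<tau>" "a \<noteq> b" "b \<notin> {g, h, k}"
        "verts \<sigma> = insert (midpoint a b) (verts \<tau> - {a})"
    by (elim disjE exE conjE) (rule that, assumption+)+
  then show ?case
  proof cases
    case left
    have "p \<in> convex hull {g, k, midpoint g h}" "q \<in> convex hull {g, k, midpoint g h}"
      using hull_son_face[OF N f] pq step.prems unfolding left(1) by blast+
    then have "p - q \<in> face_dirs g k (midpoint g h)"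
      by (intro step.IH vs left step.prems)
    then show ?thesis using face_dirs_left by blast
  next
    case right
    have r: "verts \<sigma> = insert (midpoint h g) (verts \<tau> - {g})" "face_side \<sigma> h k (midpoint h g)"
      using right by (simp_all add: midpoint_sym)
    have "p \<in> convex hull {h, k, midpoint h g}" "q \<in> convex hull {h, k, midpoint h g}"
      using hull_son_face[OF N f(2,1,3) f(4)[symmetric] f(6,5)] pq step.prems unfolding r(1) insert_commute[of h g] by blast+
    then have "p - q \<in> face_dirs h k (midpoint h g)"
      by (intro step.IH vs r step.prems)
    then show ?thesis using face_dirs_left face_dirs_sym by blast
  next
    case keep
    then show ?thesis by (intro step.IH vs step.prems)
  next
    case (off a b)
    have F: "{g, h, k} \<subseteq> verts \<tau>" using f by auto
    define r where "r = (if a = g then h else g)"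
    have r: "r \<in> verts \<tau>" "r \<noteq> k" "{g, h, k} - {a} \<subseteq> {r, k}" "r = g \<or> r = h" using f off by (auto simp: r_def)
    have on: "\<exists>s. x = k + s *\<^sub>R (r - k)" if x: "x \<in> convex hull (verts \<sigma>)" "x \<in> convex hull {g, h, k}" for x
    proof -
      have "bary (verts \<tau>) x a = 0"
        using son_off_face[OF N off(2-4) F off(5)] x unfolding off(6) by blast
      moreover have rk: "{r, k} \<subseteq> verts \<tau>" using r f by auto
      ultimately have "x \<in> convex hull {r, k}"
        using x(2) r(3) unfolding subset_hull_iff_bary[OF N F] subset_hull_iff_bary[OF N rk] by blast
      then obtain u where "x = r + u *\<^sub>R (k - r)"
        unfolding convex_hull_2_alt by blast
      then have "x = k + (1 - u) *\<^sub>R (r - k)" by (simp add: algebra_simps)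
      then show ?thesis ..
    qed
    obtain s t where st: "p = k + s *\<^sub>R (r - k)" "q = k + t *\<^sub>R (r - k)"
      using on pq step.prems by blast
    have "p - q = (s - t) *\<^sub>R (r - k)" unfolding st by (simp add: algebra_simps)
    then show ?thesis using r(4) unfolding face_dirs_def by blast
  qed
qed

text \<open>The first bisection that affects the face decides: at \<open>g\<close>-\<open>h\<close>
  it puts the son on one side of the median, and if it removes an end point without halving the
  face, the coordinate of this end point vanishes there, which also places everything on one
  side.\<close>

lemma desc_face_sides:
  fixes \<tau> :: "'n::finite tsimplex"
  assumes "desc \<tau> \<rho>" and d: "CARD('n) = 3" and "valid_tsimplex \<tau>" "face_side \<tau> g h k"
  shows "{g, h, k} \<subseteq> verts \<rho> \<or>
    (\<forall>x\<in>convex hull (verts \<rho>) \<inter> convex hull {g, h, k}. bary (verts \<tau>) x h \<le> bary (verts \<tau>) x g) \<or>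
    (\<forall>x\<in>convex hull (verts \<rho>) \<inter> convex hull {g, h, k}. bary (verts \<tau>) x g \<le> bary (verts \<tau>) x h)"
  using assms(1,3-) unfolding desc_def
proof (induction rule: converse_rtranclp_induct)
  case base
  then show ?case using face_side_verts[OF base(1) d base(2)] by auto
next
  case (step \<tau> \<sigma>)
  note v = \<open>valid_tsimplex \<tau>\<close>
  note N = nondeg_verts[OF v]
  note f = face_side_verts[OF v d \<open>face_side \<tau> g h k\<close>]
  have vs: "valid_tsimplex \<sigma>" using son_cases[OF v step.hyps(1)] by blast
  have sub: "convex hull (verts \<rho>) \<subseteq> convex hull (verts \<sigma>)"
    using desc_hull[of \<sigma> \<rho>] step.hyps(2) vs by (simp add: desc_def)
  have F: "{g, h, k} \<subseteq> verts \<tau>" using f by auto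
  from face_side_son_cases[OF v d \<open>face_side \<tau> g h k\<close> step.hyps(1)] consider
      (left) "verts \<sigma> = insert (midpoint g h) (verts \<tau> - {h})" "face_side \<sigma> g k (midpoint g h)"
    | (right) "verts \<sigma> = insert (midpoint g h) (verts \<tau> - {g})" "face_side \<sigma> h k (midpoint g h)"
    | (keep) "face_side \<sigma> g h k"
    | (off) a b where "a \<in> {g, h}" "a \<in> verts \<tau>" "b \<in> verts \<tau>" "a \<noteq> b" "b \<notin> {g, h, k}"
        "verts \<sigma> = insert (midpoint a b) (verts \<tau> - {a})"
    by (elim disjE exE conjE) (rule that, assumption+)+
  then show ?case
  proof cases
    case left
    then have "bary (verts \<tau>) x h \<le> bary (verts \<tau>) x g" if "x \<in> convex hull (verts \<sigma>)" for x
      using that hull_bisect_iff[OF N f(2,1) f(4)[symmetric], of x] by (simp add: midpoint_sym)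
    then show ?thesis using sub by blast
  next
    case right
    then have "bary (verts \<tau>) x g \<le> bary (verts \<tau>) x h" if "x \<in> convex hull (verts \<sigma>)" for x
      using that hull_bisect_iff[OF N f(1,2) f(4), of x] by simp
    then show ?thesis using sub by blast
  next
    case keep
    have F': "{g, h, k} \<subseteq> verts \<sigma>" using face_side_verts[OF vs d keep] by auto
    have "bary (verts \<sigma>) x = bary (verts \<tau>) x" if "x \<in> convex hull {g, h, k}" for x
      using bary_eq_of_conforming[OF nondeg_verts[OF vs] N] that F F' hull_mono[of "{g, h, k}" "verts \<sigma> \<inter> verts \<tau>"] by blast
    then show ?thesis using step.IH[OF vs keep] by (metis IntD2)
  next
    case (off a b)
    have "bary (verts \<tau>) x a = 0" "0 \<le> bary (verts \<tau>) x g" "0 \<le> bary (verts \<tau>) x h"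
      if x: "x \<in> convex hull (verts \<rho>) \<inter> convex hull {g, h, k}" for x
      using son_off_face[OF N off(2-4) F off(5), of x] x sub subset_hull_iff_bary[OF N F, of x] unfolding off(6)[symmetric]
      by blast+
    then show ?thesis using off(1) by auto
  qed
qed

text \<open>A coordinate outside \<open>G\<close> is affine, nonnegative on \<open>R\<close> and
  zero at \<open>x\<close>. Since \<open>x\<close> is a convex combination of the vertices of
  \<open>R\<close>, the coordinate vanishes at every vertex that has positive weight.\<close>

lemma subsimplex_face_trace:
  assumes S: "nondeg S" "G \<subseteq> S" and R: "nondeg R" "R \<subseteq> convex hull S"
    and x: "x \<in> convex hull G" and v: "v \<in> R" "bary R x v > 0" "x \<in> convex hull R"
  shows "v \<in> convex hull G"
proof -
  have vb: "0 \<le> bary S w u" if "w \<in> R" for w u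
    using that R(2) bary_nonneg[OF S(1)] by blast
  have "bary S v u = 0" if u: "u \<notin> G" for u
  proof -
    have "bary S x u = (\<Sum>w\<in>R. bary R x w * bary S w u)"
      using bary_affine_combination[OF S(1) nondegD(1)[OF R(1)] sum_bary[OF R(1)], of x "\<lambda>w. w" u]
        sum_bary_scaleR[OF R(1), of x] by simp
    moreover have "bary S x u = 0"
      using x u subset_hull_iff_bary[OF S] by blast
    ultimately have "(\<Sum>w\<in>R. bary R x w * bary S w u) = 0" by simp
    then have "bary R x v * bary S v u = 0"
      using vb bary_nonneg[OF R(1) v(3)] v(1) nondegD(1)[OF R(1)]
      by (subst (asm) sum_nonneg_eq_0_iff) auto
    then show ?thesis using v(2) by simp
  qed
  then show ?thesis
    using vb[OF v(1)] subset_hull_iff_bary[OF S] by blast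
qed

lemma triangulation_conf:
  assumes "triangulation \<Omega> \<T>"
  shows "conf \<T>" "finite \<T>" "inj_on verts \<T>" "\<And>\<tau>. \<tau> \<in> \<T> \<Longrightarrow> valid_tsimplex \<tau>"
  using assms unfolding triangulation_def conforming_def conf_def by blast+

lemma conf_nondeg: "conf K \<Longrightarrow> \<tau> \<in> K \<Longrightarrow> nondeg (verts \<tau>)"
  by (intro nondeg_verts) (simp add: conf_def)

lemma elem_iff_bary: "valid_tsimplex \<tau> \<Longrightarrow> x \<in> elem \<tau> \<longleftrightarrow> (\<forall>v\<in>verts \<tau>. 0 < bary (verts \<tau>) x v)"
  unfolding elem_def by (intro interior_hull_iff_bary nondeg_verts)

lemma elem_hull: "elem \<tau> \<subseteq> convex hull (verts \<tau>)"
  unfolding elem_def by (rule interior_subset)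

text \<open>An interior point of \<open>\<sigma>\<close> has all its coordinates positive; as they
  agree with those in \<open>\<tau>\<close>, all vertices of \<open>\<sigma>\<close> are vertices of
  \<open>\<tau>\<close>, and cardinality does the rest.\<close>

lemma elem_disjoint:
  assumes K: "conf K" "inj_on verts K" and st: "\<sigma> \<in> K" "\<tau> \<in> K" and x: "x \<in> elem \<sigma>" "x \<in> convex hull (verts \<tau>)"
  shows "\<sigma> = \<tau>"
proof -
  have v: "valid_tsimplex \<sigma>" "valid_tsimplex \<tau>" using K st by (auto simp: conf_def)
  have "bary (verts \<sigma>) x = bary (verts \<tau>) x"
    using x elem_hull[of \<sigma>] by (intro conf_bary_eq[OF K(1) st]) blast+
  then have "verts \<sigma> \<subseteq> verts \<tau>"
    using x(1) bary_outside[OF nondeg_verts[OF v(2)]] unfolding elem_iff_bary[OF v(1)]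
    by (metis less_irrefl subsetI)
  then have "verts \<sigma> = verts \<tau>"
    using nondegD(1,3)[OF nondeg_verts[OF v(1)]] nondegD(1,3)[OF nondeg_verts[OF v(2)]]
    by (intro card_subset_eq) auto
  then show ?thesis using K(2) st by (auto dest: inj_onD)
qed

lemma rel_interior_triangle:
  assumes N: "nondeg S" and F: "F \<subseteq> S"
  shows "y \<in> rel_interior (convex hull F) \<longleftrightarrow> y \<in> convex hull F \<and> (\<forall>v\<in>F. 0 < bary S y v)"
proof -
  have fin: "finite F" using F nondegD(1)[OF N] finite_subset by blast
  have ind: "\<not> affine_dependent F"
    using nondegD(2)[OF N] affine_independent_subset[OF _ F] by blast
  have "y \<in> rel_interior (convex hull F) \<longleftrightarrow> (\<exists>u. (\<forall>v\<in>F. 0 < u v) \<and> sum u F = 1 \<and> (\<Sum>v\<in>F. u v *\<^sub>R v) = y)"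
    unfolding rel_interior_convex_hull_explicit[OF ind] by simp
  also have "\<dots> \<longleftrightarrow> y \<in> convex hull F \<and> (\<forall>v\<in>F. 0 < bary S y v)"
  proof
    assume "\<exists>u. (\<forall>v\<in>F. 0 < u v) \<and> sum u F = 1 \<and> (\<Sum>v\<in>F. u v *\<^sub>R v) = y"
    then obtain u where u: "\<forall>v\<in>F. 0 < u v" "sum u F = 1" "(\<Sum>v\<in>F. u v *\<^sub>R v) = y" by blast
    have "bary S y = (\<lambda>v. if v \<in> F then u v else 0)"
      using u F nondegD(1)[OF N]
      by (intro bary_unique[OF N])
        (auto simp: if_distrib[of "\<lambda>c. c *\<^sub>R _"] sum.If_cases Int_absorb1 cong: if_cong)
    moreover from this have "y \<in> convex hull F"
      unfolding subset_hull_iff_bary[OF N F] using u(1) by (auto simp: less_imp_le)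
    ultimately show "y \<in> convex hull F \<and> (\<forall>v\<in>F. 0 < bary S y v)" using u(1) by simp
  next
    assume y: "y \<in> convex hull F \<and> (\<forall>v\<in>F. 0 < bary S y v)"
    then have z: "bary S y v = 0" if "v \<notin> F" for v
      using that subset_hull_iff_bary[OF N F] by blast
    have "sum (bary S y) F = sum (bary S y) S"
      using z F nondegD(1)[OF N] by (intro sum.mono_neutral_left) auto
    moreover have "(\<Sum>v\<in>F. bary S y v *\<^sub>R v) = (\<Sum>v\<in>S. bary S y v *\<^sub>R v)"
      using z F nondegD(1)[OF N] by (intro sum.mono_neutral_left) auto
    ultimately show "\<exists>u. (\<forall>v\<in>F. 0 < u v) \<and> sum u F = 1 \<and> (\<Sum>v\<in>F. u v *\<^sub>R v) = y"
      using y sum_bary[OF N] sum_bary_scaleR[OF N] by (intro exI[of _ "bary S y"]) simp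
  qed
  finally show ?thesis .
qed

text \<open>Descendants of \<open>\<tau>\<close> that do not contain the whole face lie, within the face, on one side of
  the median.  Hence at a point of the median that is not a node, the smallest subsimplex of
  \<open>\<T>'\<close> containing it is an edge along the median.\<close>

lemma edge_on_median:
  fixes \<tau> :: "'n::finite tsimplex"
  assumes d: "CARD('n) = 3" and T: "\<forall>\<tau>\<in>\<T>. valid_tsimplex \<tau>" and nvb: "nvb_refinement \<T> \<T>'" and fin: "finite \<T>'"
    and K: "conf \<T>'" and t: "\<tau> \<in> \<T>" and f: "face_side \<tau> g h k"
    and y: "y \<in> nodes \<T>'" "y \<in> rel_interior (convex hull {g, h, k})"
  obtains \<rho> p q c where "\<rho> \<in> \<T>'" "p \<in> verts \<rho>" "q \<in> verts \<rho>" "p \<noteq> q" "p \<in> convex hull {g, h, k}"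
    "q \<in> convex hull {g, h, k}" "p - q = c *\<^sub>R (k - midpoint g h)"
proof -
  have v: "valid_tsimplex \<tau>" using T t by blast
  note N = nondeg_verts[OF v] and fv = face_side_verts[OF v d f]
  have F: "{g, h, k} \<subseteq> verts \<tau>" using fv by auto
  \<comment> \<open>A simplex of \<open>\<T>'\<close> with the whole face among its vertices would
    contain the node \<open>y\<close>, hence have it as a vertex by conformity, although
    \<open>y\<close> is none of the corners of the face.\<close>
  have no: "\<not> {g, h, k} \<subseteq> verts \<rho>" if r: "\<rho> \<in> \<T>'" for \<rho>
  proof
    assume sub: "{g, h, k} \<subseteq> verts \<rho>"
    obtain \<rho>' where r': "\<rho>' \<in> \<T>'" "y \<in> verts \<rho>'" using y(1) by (auto simp: nodes_def)
    have yF: "y \<in> convex hull {g, h, k}" using y(2) rel_interior_subset by blast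
    then have "y \<in> convex hull (verts \<rho>)" using sub hull_mono by blast
    then have "y \<in> verts \<rho>" by (rule conf_vertex[OF K r'(1) r r'(2)])
    have Nr: "nondeg (verts \<rho>)" using conf_nondeg[OF K r] .
    have "y \<in> {g, h, k}" by (rule subset_hull_subset[OF Nr sub \<open>y \<in> verts \<rho>\<close> yF])
    moreover have "\<forall>v\<in>{g, h, k}. 0 < bary (verts \<tau>) y v"
      using y(2) rel_interior_triangle[OF N F] by blast
    ultimately show False using fv by (auto simp: bary_vertex[OF N])
  qed
  define m where "m = midpoint g h"
  have bm: "bary (verts \<tau>) m g = 1/2" "bary (verts \<tau>) m h = 1/2" "bary (verts \<tau>) m k = 0"
    using fv by (simp_all add: m_def bary_midpoint[OF N] bary_vertex[OF N])
  have km: "k \<noteq> m" using bm(3) bary_vertex[OF N fv(3), of k] by auto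
  define X where "X t = k + t *\<^sub>R (m - k)" for t :: real
  have injX: "inj X" using km by (auto simp: inj_def X_def)
  \<comment> \<open>The median has infinitely many points and there are finitely many nodes, so some
    inner point \<open>X s\<close> of the median is not a node.\<close>
  have "finite (nodes \<T>')" using fin by (simp add: nodes_def)
  then have "finite (X -` nodes \<T>' \<inter> {0<..<1})" by (intro finite_Int disjI1 finite_vimageI injX)
  moreover have "infinite {0<..<1::real}" by (simp add: infinite_Ioo)
  ultimately obtain s where s: "s \<in> {0<..<1}" "X s \<notin> nodes \<T>'"
    by (metis (no_types, lifting) Int_absorb1 subsetI vimageI2 vimage_eq)
  define x where "x = X s"
  have mF: "m \<in> convex hull {g, h, k}" unfolding m_def by (intro midpoints_in_convex_hull hull_inc) auto
  have x2: "x = (1 - s) *\<^sub>R k + s *\<^sub>R m" by (simp add: x_def X_def algebra_simps)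
  have xF: "x \<in> convex hull {g, h, k}"
    unfolding x2 using s mF by (intro convexD[OF convex_convex_hull]) (auto intro: hull_inc)
  have xb: "bary (verts \<tau>) x g = bary (verts \<tau>) x h"
    unfolding x2 using bary_comb2[OF N, of "1 - s" s k m] bm fv by (simp add: bary_vertex[OF N])
  have "x \<in> convex hull (verts \<tau>)" using xF hull_mono[OF F] by blast
  then obtain \<rho> where r: "\<rho> \<in> \<T>'" "desc \<tau> \<rho>" "x \<in> convex hull (verts \<rho>)"
    using nvb_cover[OF nvb T t] by blast
  have vr: "valid_tsimplex \<rho>" using desc_valid[OF r(2) v] .
  note Nr = nondeg_verts[OF vr]
  define A where "A = {v \<in> verts \<rho>. 0 < bary (verts \<rho>) x v}"
  have rsub: "verts \<rho> \<subseteq> convex hull (verts \<tau>)"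
    using desc_hull[OF r(2) v] verts_subset_hull by blast
  have AF: "v \<in> convex hull {g, h, k}" if "v \<in> A" for v
    using subsimplex_face_trace[OF N F Nr rsub xF _ _ r(3)] that by (auto simp: A_def)
  have xA: "x = (\<Sum>v\<in>A. bary (verts \<rho>) x v *\<^sub>R v)" "sum (bary (verts \<rho>) x) A = 1"
  proof -
    have "(\<Sum>v\<in>A. bary (verts \<rho>) x v *\<^sub>R v) = (\<Sum>v\<in>verts \<rho>. bary (verts \<rho>) x v *\<^sub>R v)"
      using bary_nonneg[OF Nr r(3)] by (intro sum.mono_neutral_left) (auto simp: A_def less_le)
    then show "x = (\<Sum>v\<in>A. bary (verts \<rho>) x v *\<^sub>R v)" using sum_bary_scaleR[OF Nr] by simp
    have "sum (bary (verts \<rho>) x) A = sum (bary (verts \<rho>) x) (verts \<rho>)"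
      using bary_nonneg[OF Nr r(3)] by (intro sum.mono_neutral_left) (auto simp: A_def less_le)
    then show "sum (bary (verts \<rho>) x) A = 1" using sum_bary[OF Nr] by simp
  qed
  have finA: "finite A" by (simp add: A_def)
  \<comment> \<open>\<open>A\<close> is the set of vertices carrying \<open>x\<close>. On the median
    the coordinates of \<open>g\<close> and \<open>h\<close> agree, so their difference averages to
    zero over \<open>A\<close>. As it has one sign on \<open>A\<close> by
    \<open>desc_face_sides\<close>, it vanishes at each vertex of \<open>A\<close>: they all lie on
    the median.\<close>
  have zero: "(\<Sum>v\<in>A. bary (verts \<rho>) x v * (bary (verts \<tau>) v g - bary (verts \<tau>) v h)) = 0"
    using bary_affine_combination[OF N finA xA(2), of "\<lambda>v. v" g] bary_affine_combination[OF N finA xA(2), of "\<lambda>v. v" h] xb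
    unfolding xA(1)[symmetric] by (simp add: algebra_simps sum_subtractf)
  have eq: "bary (verts \<tau>) v g = bary (verts \<tau>) v h" if vA: "v \<in> A" for v
  proof -
    have in1: "w \<in> convex hull (verts \<rho>) \<inter> convex hull {g, h, k}" if "w \<in> A" for w
      using that AF by (auto simp: A_def intro: hull_inc)
    have pos: "0 < bary (verts \<rho>) x w" if "w \<in> A" for w using that by (simp add: A_def)
    consider "\<forall>w\<in>A. 0 \<le> bary (verts \<tau>) w g - bary (verts \<tau>) w h" | "\<forall>w\<in>A. 0 \<le> bary (verts \<tau>) w h - bary (verts \<tau>) w g"
      using desc_face_sides[OF r(2) d v f] no[OF r(1)] in1 by fastforce
    then show ?thesis
    proof cases
      case 1
      then have "\<forall>w\<in>A. bary (verts \<rho>) x w * (bary (verts \<tau>) w g - bary (verts \<tau>) w h) = 0"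
        using zero sum_nonneg_eq_0_iff[OF finA, of "\<lambda>w. bary (verts \<rho>) x w * (bary (verts \<tau>) w g - bary (verts \<tau>) w h)"] pos
        by (simp add: less_imp_le)
      then show ?thesis using pos[OF vA] vA by fastforce
    next
      case 2
      have "(\<Sum>v\<in>A. bary (verts \<rho>) x v * (bary (verts \<tau>) v h - bary (verts \<tau>) v g)) = 0"
        using zero by (simp add: algebra_simps sum_subtractf)
      then have "\<forall>w\<in>A. bary (verts \<rho>) x w * (bary (verts \<tau>) w h - bary (verts \<tau>) w g) = 0"
        using 2 sum_nonneg_eq_0_iff[OF finA, of "\<lambda>w. bary (verts \<rho>) x w * (bary (verts \<tau>) w h - bary (verts \<tau>) w g)"] pos
        by (simp add: less_imp_le)
      then show ?thesis using pos[OF vA] vA by fastforce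
    qed
  qed
  have line: "w = m + bary (verts \<tau>) w k *\<^sub>R (k - m)" if wA: "w \<in> A" for w
  proof -
    have z: "bary (verts \<tau>) w u = 0" if "u \<notin> {g, h, k}" for u
      using AF[OF wA] subset_hull_iff_bary[OF N F] that by blast
    have fin': "finite (verts \<tau>)" by simp
    have "sum (bary (verts \<tau>) w) {g, h, k} = 1" "(\<Sum>u\<in>{g, h, k}. bary (verts \<tau>) w u *\<^sub>R u) = w"
      using z F sum_bary[OF N, of w] sum_bary_scaleR[OF N, of w]
        sum.mono_neutral_left[of "verts \<tau>" "{g,h,k}" "bary (verts \<tau>) w"]
        sum.mono_neutral_left[of "verts \<tau>" "{g,h,k}" "\<lambda>u. bary (verts \<tau>) w u *\<^sub>R u"] by auto
    then have s1: "bary (verts \<tau>) w h + bary (verts \<tau>) w h + bary (verts \<tau>) w k = 1"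
      and s2: "bary (verts \<tau>) w h *\<^sub>R g + bary (verts \<tau>) w h *\<^sub>R h + bary (verts \<tau>) w k *\<^sub>R k = w"
      using fv eq[OF wA] by (simp_all add: add.assoc)
    have "bary (verts \<tau>) w h *\<^sub>R g + bary (verts \<tau>) w h *\<^sub>R h = (2 * bary (verts \<tau>) w h) *\<^sub>R m"
      by (simp add: m_def midpoint_def scaleR_add_right)
    moreover have "2 * bary (verts \<tau>) w h = 1 - bary (verts \<tau>) w k" using s1 by simp
    ultimately have "w = (1 - bary (verts \<tau>) w k) *\<^sub>R m + bary (verts \<tau>) w k *\<^sub>R k" using s2 by simp
    then show ?thesis by (simp add: algebra_simps)
  qed
  have "A \<noteq> {}" using xA(2) by auto
  then obtain p where p: "p \<in> A" by blast
  \<comment> \<open>A single carrying vertex would be \<open>x\<close> itself, which was chosen not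
    to be a node.\<close>
  have "\<exists>q\<in>A. q \<noteq> p"
  proof (rule ccontr)
    assume "\<not> (\<exists>q\<in>A. q \<noteq> p)"
    then have "A = {p}" using p by blast
    then have "x = p" using xA by simp
    then have "x \<in> nodes \<T>'" using p r(1) by (auto simp: A_def nodes_def)
    then show False using s(2) by (simp add: x_def)
  qed
  then obtain q where q: "q \<in> A" "q \<noteq> p" by blast
  have "p - q = (bary (verts \<tau>) p k - bary (verts \<tau>) q k) *\<^sub>R (k - m)"
    by (subst line[OF p], subst line[OF q(1)]) (simp add: algebra_simps)
  then show thesis
    using that[OF r(1), of p q] p q AF unfolding m_def A_def by blast
qed

lemma bary_difference:
  assumes N: "nondeg S" and "p - q = a *\<^sub>R u + b *\<^sub>R w + c *\<^sub>R t" "a + b + c = 0"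
  shows "bary S p v - bary S q v = a * bary S u v + b * bary S w v + c * bary S t v"
proof -
  obtain n e where n: "\<And>x. bary S x v = n \<bullet> x + e" using bary_inner[OF N] by blast
  have "bary S p v - bary S q v = n \<bullet> (p - q)" by (simp add: n inner_diff_right)
  also have "\<dots> = a * (n \<bullet> u) + b * (n \<bullet> w) + c * (n \<bullet> t)" by (simp add: assms(2) inner_add_right)
  also have "\<dots> = a * bary S u v + b * bary S w v + c * bary S t v"
    using assms(3) unfolding n by (simp add: algebra_simps) (metis distrib_right mult_zero_left add.assoc)
  finally show ?thesis .
qed

text \<open>In the coordinates of \<open>g\<close>, \<open>h\<close>, \<open>k\<close> the direction
  is a multiple of (-1/2, -1/2, 1). No entry is zero, unlike for the sides, and the entry of largest
  modulus belongs to \<open>k\<close>, whereas for the median in question it belongs to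
  \<open>g\<close>.\<close>

lemma median_not_face_dirs:
  assumes N: "nondeg S" and f: "g \<in> S" "h \<in> S" "k \<in> S" "g \<noteq> h" "g \<noteq> k" "h \<noteq> k"
    and pq: "p \<noteq> q" "p - q = c *\<^sub>R (k - midpoint g h)"
  shows "p - q \<notin> face_dirs k h g"
proof
  assume "p - q \<in> face_dirs k h g"
  then obtain e where e: "p - q = e *\<^sub>R (k - h) \<or> p - q = e *\<^sub>R (k - g) \<or> p - q = e *\<^sub>R (h - g) \<or> p - q = e *\<^sub>R (g - midpoint k h)"
    by (auto simp: face_dirs_def)
  have c: "c \<noteq> 0" using pq by auto
  have 1: "p - q = (- c / 2) *\<^sub>R g + (- c / 2) *\<^sub>R h + c *\<^sub>R k"
    using pq(2) by (simp add: midpoint_def algebra_simps)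
  note b = bary_vertex[OF N]
  have d: "bary S p g - bary S q g = - c / 2" "bary S p h - bary S q h = - c / 2" "bary S p k - bary S q k = c"
    using bary_difference[OF N 1] f by (simp_all add: b)
  from e show False
  proof (elim disjE)
    assume "p - q = e *\<^sub>R (k - h)"
    then have 2: "p - q = 0 *\<^sub>R g + (- e) *\<^sub>R h + e *\<^sub>R k" by (simp add: algebra_simps)
    show False using bary_difference[OF N 2, of g] f d c by (simp add: b)
  next
    assume "p - q = e *\<^sub>R (k - g)"
    then have 2: "p - q = (- e) *\<^sub>R g + 0 *\<^sub>R h + e *\<^sub>R k" by (simp add: algebra_simps)
    show False using bary_difference[OF N 2, of h] f d c by (simp add: b)
  next
    assume "p - q = e *\<^sub>R (h - g)"
    then have 2: "p - q = (- e) *\<^sub>R g + e *\<^sub>R h + 0 *\<^sub>R k" by (simp add: algebra_simps)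
    show False using bary_difference[OF N 2, of k] f d c by (simp add: b)
  next
    assume "p - q = e *\<^sub>R (g - midpoint k h)"
    then have 2: "p - q = e *\<^sub>R g + (- e / 2) *\<^sub>R h + (- e / 2) *\<^sub>R k"
      by (simp add: midpoint_def algebra_simps)
    show False
      using bary_difference[OF N 2, of g] bary_difference[OF N 2, of h] bary_difference[OF N 2, of k] f d c by (simp add: b)
  qed
qed

lemma face_side_agree:
  fixes \<sigma> \<tau> :: "'n::finite tsimplex"
  assumes d: "CARD('n) = 3" and T: "\<forall>\<tau>\<in>\<T>. valid_tsimplex \<tau>" and nvb: "nvb_refinement \<T> \<T>'" and fin: "finite \<T>'"
    and K: "conf \<T>'" and st: "\<sigma> \<in> \<T>" "\<tau> \<in> \<T>" and f: "face_side \<tau> g h k" "face_side \<sigma> g' h' k'" and F: "{g, h, k} = {g', h', k'}"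
    and y: "y \<in> nodes \<T>'" "y \<in> rel_interior (convex hull {g, h, k})"
  shows "k = k'"
proof (rule ccontr)
  assume "k \<noteq> k'"
  obtain \<rho> p q c where r: "\<rho> \<in> \<T>'" "p \<in> verts \<rho>" "q \<in> verts \<rho>" "p \<noteq> q" "p \<in> convex hull {g, h, k}"
    "q \<in> convex hull {g, h, k}" "p - q = c *\<^sub>R (k - midpoint g h)"
    by (rule edge_on_median[OF d T nvb fin K st(2) f(1) y])
  have vt: "valid_tsimplex \<tau>" and vs: "valid_tsimplex \<sigma>" using T st by auto
  note fv = face_side_verts[OF vt d f(1)] and fv' = face_side_verts[OF vs d f(2)]
  have Nr: "nondeg (verts \<rho>)" using conf_nondeg[OF K r(1)] .
  \<comment> \<open>The edge is carried over to the other side of the face: its midpoint lies in a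
    descendant of \<open>\<sigma>\<close>, where by conformity both \<open>p\<close> and
    \<open>q\<close> have weight 1/2 and so are vertices. Descendants of \<open>\<sigma>\<close>
    admit only the directions belonging to \<open>k'\<close>.\<close>
  have "midpoint p q \<in> convex hull {g, h, k}" using r by (intro midpoints_in_convex_hull)
  moreover have "convex hull {g, h, k} \<subseteq> convex hull (verts \<sigma>)" unfolding F using fv' by (intro hull_mono) auto
  ultimately obtain \<rho>' where r': "\<rho>' \<in> \<T>'" "desc \<sigma> \<rho>'" "midpoint p q \<in> convex hull (verts \<rho>')"
    using nvb_cover[OF nvb T st(1)] by blast
  have Nr': "nondeg (verts \<rho>')" using conf_nondeg[OF K r'(1)] .
  have "midpoint p q \<in> convex hull (verts \<rho>)" using r by (intro midpoints_in_convex_hull hull_inc)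
  then have "bary (verts \<rho>') (midpoint p q) = bary (verts \<rho>) (midpoint p q)"
    using r' r by (intro conf_bary_eq[OF K])
  moreover have "bary (verts \<rho>) (midpoint p q) p = 1/2" "bary (verts \<rho>) (midpoint p q) q = 1/2"
    using r by (simp_all add: bary_midpoint[OF Nr] bary_vertex[OF Nr])
  ultimately have "p \<in> verts \<rho>'" "q \<in> verts \<rho>'"
    using bary_outside[OF Nr'] by (metis zero_neq_one divide_eq_0_iff zero_neq_numeral)+
  then have dir: "p - q \<in> face_dirs g' h' k'"
    using r F by (intro desc_face_dirs[OF r'(2) d vs f(2)]) simp_all
  have "k' \<in> {g, h}" using F \<open>k \<noteq> k'\<close> by auto
  then show False
  proof (elim insertE emptyE)
    assume k': "k' = g"
    then have "(g' = k \<and> h' = h) \<or> (g' = h \<and> h' = k)"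
      using F fv fv' by auto
    then have "face_dirs g' h' k' = face_dirs k h g" using k' face_dirs_sym by blast
    then show False using median_not_face_dirs[OF nondeg_verts[OF vt] fv r(4,7)] dir by simp
  next
    assume k': "k' = h"
    then have "(g' = k \<and> h' = g) \<or> (g' = g \<and> h' = k)"
      using F fv fv' by auto
    then have "face_dirs g' h' k' = face_dirs k g h" using k' face_dirs_sym by blast
    moreover have pq': "p - q = c *\<^sub>R (k - midpoint h g)" using r(7) by (simp add: midpoint_sym)
    ultimately show False
      using median_not_face_dirs[OF nondeg_verts[OF vt] fv(2,1,3) fv(4)[symmetric] fv(6,5) r(4) pq'] dir by simp
  qed
qed

section \<open>The uniform refinement\<close>

text \<open>Refining one element does not disturb the others, unless a descendant to be bisected
  were already present in \<open>X\<close> and got removed with the bisected one; the assumption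
  rules this out.\<close>

lemma nvb_local:
  assumes "nvb_refinement {\<tau>} R" "\<And>\<rho>. desc \<tau> \<rho> \<Longrightarrow> \<rho> \<notin> X"
  shows "nvb_refinement (X \<union> {\<tau>}) (X \<union> R)"
  using assms
proof (induction rule: nvb_refinement.induct)
  case refl
  show ?case by (rule nvb_refinement.refl)
next
  case (bisect R \<rho>)
  have "desc \<tau> \<rho>" using nvb_desc[OF bisect.hyps(1,2)] by simp
  then have "\<rho> \<notin> X" using bisect.prems by blast
  have "nvb_refinement (X \<union> {\<tau>}) ((X \<union> R) - {\<rho>} \<union> sons \<rho>)"
    using bisect.hyps(2) by (intro nvb_refinement.bisect bisect.IH bisect.prems) auto
  moreover have "(X \<union> R) - {\<rho>} \<union> sons \<rho> = X \<union> (R - {\<rho>} \<union> sons \<rho>)"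
    using \<open>\<rho> \<notin> X\<close> by blast
  ultimately show ?case by simp
qed

lemma desc_unique:
  assumes K: "conf K" "inj_on verts K" and st: "\<sigma> \<in> K" "\<tau> \<in> K" and d: "desc \<sigma> \<rho>" "desc \<tau> \<rho>"
  shows "\<sigma> = \<tau>"
proof -
  have v: "valid_tsimplex \<sigma>" "valid_tsimplex \<tau>" using K st by (auto simp: conf_def)
  have "valid_tsimplex \<rho>" using desc_valid[OF d(1) v(1)] .
  then obtain x where x: "x \<in> elem \<rho>" using elem_nonempty by blast
  then have "x \<in> elem \<sigma>" "x \<in> convex hull (verts \<tau>)"
    using desc_elem[OF d(1) v(1)] desc_elem[OF d(2) v(2)] elem_hull[of \<tau>] by blast+
  then show ?thesis by (rule elem_disjoint[OF K st])
qed

lemma nvb_Union: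
  assumes K: "conf K" "inj_on verts K" "finite K" and R: "\<And>\<tau>. \<tau> \<in> K \<Longrightarrow> nvb_refinement {\<tau>} (R \<tau>)"
  shows "nvb_refinement K (\<Union>\<tau>\<in>K. R \<tau>)"
proof -
  have "nvb_refinement K ((K - D) \<union> (\<Union>\<tau>\<in>D. R \<tau>))" if "finite D" "D \<subseteq> K" for D
    using that
  proof (induction D rule: finite_induct)
    case empty
    then show ?case by (simp add: nvb_refinement.refl)
  next
    case (insert \<tau> D)
    let ?X = "(K - insert \<tau> D) \<union> (\<Union>\<tau>\<in>D. R \<tau>)"
    have "\<rho> \<notin> ?X" if d: "desc \<tau> \<rho>" for \<rho>
    proof
      assume "\<rho> \<in> ?X"
      then obtain \<sigma> where "\<sigma> \<in> K" "\<sigma> \<noteq> \<tau>" "desc \<sigma> \<rho>"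
      proof
        assume "\<rho> \<in> K - insert \<tau> D"
        then show thesis using that[of \<rho>] by simp
      next
        assume "\<rho> \<in> (\<Union>\<tau>\<in>D. R \<tau>)"
        then obtain \<sigma> where s: "\<sigma> \<in> D" "\<rho> \<in> R \<sigma>" by blast
        then have "desc \<sigma> \<rho>" using nvb_desc[OF R] insert.prems by blast
        then show thesis using that[of \<sigma>] s insert by blast
      qed
      then show False using desc_unique[OF K(1,2), of \<sigma> \<tau> \<rho>] d insert.prems by blast
    qed
    then have 1: "nvb_refinement (?X \<union> {\<tau>}) (?X \<union> R \<tau>)"
      using insert.prems by (intro nvb_local R) auto
    have e1: "?X \<union> {\<tau>} = (K - D) \<union> (\<Union>\<tau>\<in>D. R \<tau>)"
      using insert by blast
    have e2: "?X \<union> R \<tau> = (K - insert \<tau> D) \<union> (\<Union>\<tau>\<in>insert \<tau> D. R \<tau>)" by blast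
    have 2: "nvb_refinement K ((K - D) \<union> (\<Union>\<tau>\<in>D. R \<tau>))"
      using insert by blast
    show ?case
      using nvb_trans[OF 2 1[unfolded e1]] unfolding e2 .
  qed
  from this[OF K(3) order_refl] show ?thesis by simp
qed

text \<open>At a common point of \<open>\<rho>\<close> and \<open>\<rho>'\<close> the vertices of
  \<open>\<rho>\<close> that carry it lie on the common face, hence are vertices of some simplex of
  \<open>R \<tau>\<close> by \<open>trace\<close>. This simplex and \<open>\<rho>'\<close> are
  conforming with each other, so the carrying vertices belong to \<open>\<rho>'\<close> as
  well.\<close>

lemma conforming_Union:
  assumes K: "conf K" "inj_on verts K"
    and R: "\<And>\<tau>. \<tau> \<in> K \<Longrightarrow> conf (R \<tau>)" "\<And>\<tau>. \<tau> \<in> K \<Longrightarrow> inj_on verts (R \<tau>)"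
    and desc: "\<And>\<tau> \<rho>. \<tau> \<in> K \<Longrightarrow> \<rho> \<in> R \<tau> \<Longrightarrow> desc \<tau> \<rho>"
    and trace: "\<And>\<sigma> \<tau> \<rho>. \<sigma> \<in> K \<Longrightarrow> \<tau> \<in> K \<Longrightarrow> \<sigma> \<noteq> \<tau> \<Longrightarrow> \<rho> \<in> R \<sigma> \<Longrightarrow>
      \<exists>\<rho>'\<in>R \<tau>. verts \<rho> \<inter> convex hull (verts \<sigma> \<inter> verts \<tau>) \<subseteq> verts \<rho>'"
  shows "conforming (\<Union>\<tau>\<in>K. R \<tau>)"
proof -
  have pair: "convex hull (verts \<rho>) \<inter> convex hull (verts \<rho>') = convex hull (verts \<rho> \<inter> verts \<rho>')"
    if st: "\<sigma> \<in> K" "\<tau> \<in> K" and r: "\<rho> \<in> R \<sigma>" "\<rho>' \<in> R \<tau>" for \<sigma> \<tau> \<rho> \<rho>'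
  proof (cases "\<sigma> = \<tau>")
    case True
    then show ?thesis using R(1)[OF st(2)] r unfolding conf_def by blast
  next
    case False
    let ?G = "verts \<sigma> \<inter> verts \<tau>"
    have v: "valid_tsimplex \<sigma>" "valid_tsimplex \<tau>" using K st by (auto simp: conf_def)
    note Nr = conf_nondeg[OF R(1)[OF st(1)] r(1)] and Nr' = conf_nondeg[OF R(1)[OF st(2)] r(2)]
    obtain \<pi> where pi: "\<pi> \<in> R \<tau>" "verts \<rho> \<inter> convex hull ?G \<subseteq> verts \<pi>"
      using trace[OF st False r(1)] by blast
    note Np = conf_nondeg[OF R(1)[OF st(2)] pi(1)]
    have subr: "verts \<rho> \<subseteq> convex hull (verts \<sigma>)" "verts \<rho>' \<subseteq> convex hull (verts \<tau>)"
      using desc_hull[OF desc[OF st(1) r(1)] v(1)] desc_hull[OF desc[OF st(2) r(2)] v(2)] verts_subset_hull by blast+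
    show ?thesis
    proof
      show "convex hull (verts \<rho> \<inter> verts \<rho>') \<subseteq> convex hull (verts \<rho>) \<inter> convex hull (verts \<rho>')"
        by (simp add: hull_mono)
      show "convex hull (verts \<rho>) \<inter> convex hull (verts \<rho>') \<subseteq> convex hull (verts \<rho> \<inter> verts \<rho>')"
      proof
        fix x assume "x \<in> convex hull (verts \<rho>) \<inter> convex hull (verts \<rho>')"
        then have x: "x \<in> convex hull (verts \<rho>)" "x \<in> convex hull (verts \<rho>')" by auto
        have "x \<in> convex hull (verts \<sigma>)" "x \<in> convex hull (verts \<tau>)"
          using x desc_hull[OF desc[OF st(1) r(1)] v(1)] desc_hull[OF desc[OF st(2) r(2)] v(2)] by blast+
        then have xG: "x \<in> convex hull ?G" using K(1) st unfolding conf_def by blast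
        have supp: "bary (verts \<rho>) x u = 0" if "u \<notin> verts \<rho> \<inter> convex hull ?G" for u
        proof (rule ccontr)
          assume "bary (verts \<rho>) x u \<noteq> 0"
          then have "u \<in> verts \<rho>" "0 < bary (verts \<rho>) x u"
            using bary_outside[OF Nr] bary_nonneg[OF Nr x(1), of u] by (blast, simp)
          then show False
            using subsimplex_face_trace[OF nondeg_verts[OF v(1)] _ Nr subr(1) xG _ _ x(1)] that by blast
        qed
        have supp': "bary (verts \<rho>') x u = 0" if "u \<notin> verts \<rho>'" for u
          using bary_outside[OF Nr' that] .
        have xA: "x \<in> convex hull (verts \<rho> \<inter> convex hull ?G)"
          using supp bary_nonneg[OF Nr x(1)] subset_hull_iff_bary[OF Nr, of "verts \<rho> \<inter> convex hull ?G" x] by blast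
        then have xp: "x \<in> convex hull (verts \<pi>)" using pi(2) hull_mono by blast
        have eq: "bary (verts \<pi>) x = bary (verts \<rho>') x"
          by (rule conf_bary_eq[OF R(1)[OF st(2)] pi(1) r(2) xp x(2)])
        have "bary (verts \<pi>) x u = 0" if "u \<notin> verts \<rho> \<inter> convex hull ?G" for u
          using xA subset_hull_iff_bary[OF Np pi(2)] that by blast
        then have "\<forall>u. 0 \<le> bary (verts \<rho>') x u \<and> (u \<notin> verts \<rho> \<inter> verts \<rho>' \<longrightarrow> bary (verts \<rho>') x u = 0)"
          using eq supp' bary_nonneg[OF Nr' x(2)] by (metis IntD1 IntI)
        then show "x \<in> convex hull (verts \<rho> \<inter> verts \<rho>')"
          using subset_hull_iff_bary[OF Nr', of "verts \<rho> \<inter> verts \<rho>'"] by blast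
      qed
    qed
  qed
  have inj: "inj_on verts (\<Union>\<tau>\<in>K. R \<tau>)"
  proof (rule inj_onI)
    fix \<rho> \<rho>' assume "\<rho> \<in> (\<Union>\<tau>\<in>K. R \<tau>)" "\<rho>' \<in> (\<Union>\<tau>\<in>K. R \<tau>)" and eq: "verts \<rho> = verts \<rho>'"
    then obtain \<sigma> \<tau> where st: "\<sigma> \<in> K" "\<tau> \<in> K" "\<rho> \<in> R \<sigma>" "\<rho>' \<in> R \<tau>" by blast
    have v: "valid_tsimplex \<sigma>" "valid_tsimplex \<tau>" using K st by (auto simp: conf_def)
    have "valid_tsimplex \<rho>" using desc_valid[OF desc[OF st(1,3)] v(1)] .
    then obtain x where x: "x \<in> elem \<rho>" using elem_nonempty by blast
    have "x \<in> elem \<rho>'" using x eq by (simp add: elem_def)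
    then have "x \<in> elem \<sigma>" "x \<in> convex hull (verts \<tau>)"
      using x desc_elem[OF desc[OF st(1,3)] v(1)] desc_elem[OF desc[OF st(2,4)] v(2)] elem_hull[of \<tau>] by blast+
    then have "\<sigma> = \<tau>" by (rule elem_disjoint[OF K st(1,2)])
    then show "\<rho> = \<rho>'" using inj_onD[OF R(2)[OF st(2)] eq] st by blast
  qed
  show ?thesis
    unfolding conforming_def using inj pair by blast
qed

text \<open>Distinct elements share at most d vertices, so the common part is empty, a vertex, an
  edge, or for d = 3 a face. Only the last case depends on tags: agreement on \<open>k\<close> makes
  the six pieces of the face the same from both sides.\<close>

lemma uniform_trace:
  fixes \<sigma> \<tau> :: "'n::finite tsimplex"
  assumes d: "CARD('n) = 2 \<or> CARD('n) = 3" and T: "conf \<T>" "inj_on verts \<T>"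
    and agree: "\<And>\<sigma> \<tau> g h k g' h' k'. CARD('n) = 3 \<Longrightarrow> \<sigma> \<in> \<T> \<Longrightarrow> \<tau> \<in> \<T> \<Longrightarrow> face_side \<tau> g h k \<Longrightarrow> face_side \<sigma> g' h' k' \<Longrightarrow>
      {g, h, k} = {g', h', k'} \<Longrightarrow> k = k'"
    and st: "\<sigma> \<in> \<T>" "\<tau> \<in> \<T>" "\<sigma> \<noteq> \<tau>" and \<rho>: "\<rho> \<in> local_refinement \<sigma>"
  shows "\<exists>\<rho>'\<in>local_refinement \<tau>. verts \<rho> \<inter> convex hull (verts \<sigma> \<inter> verts \<tau>) \<subseteq> verts \<rho>'"
proof -
  let ?G = "verts \<sigma> \<inter> verts \<tau>"
  have v: "valid_tsimplex \<sigma>" "valid_tsimplex \<tau>" using T st by (auto simp: conf_def)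
  have card: "card (verts \<sigma>) = CARD('n) + 1" "card (verts \<tau>) = CARD('n) + 1"
    using nondegD(3)[OF nondeg_verts] v by blast+
  have "?G \<noteq> verts \<sigma>"
  proof
    assume "?G = verts \<sigma>"
    then have "verts \<sigma> = verts \<tau>" using card by (intro card_subset_eq) auto
    then show False using inj_onD[OF T(2)] st by blast
  qed
  then have "card ?G < card (verts \<sigma>)" by (intro psubset_card_mono) auto
  then have "card ?G \<le> CARD('n)" using card by simp
  then consider "card ?G = 0" | "card ?G = 1" | "card ?G = 2" | "card ?G = 3" "CARD('n) = 3"
    using d by linarith
  then show ?thesis
  proof cases
    case 1
    then have "?G = {}" by simp
    moreover have "local_refinement \<tau> \<noteq> {}"
    proof -
      obtain x where "x \<in> convex hull (verts \<tau>)" using elem_nonempty[OF v(2)] elem_hull by blast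
      then show ?thesis using nvb_cover[OF local_refinement_sound(3)[OF v(2) d], of \<tau> x] v by auto
    qed
    ultimately show ?thesis by auto
  next
    case 2
    then obtain g where g: "?G = {g}" by (meson card_1_singletonE)
    then have "g \<in> verts \<tau>" by blast
    then obtain h where h: "h \<in> verts \<tau>" "h \<noteq> g" using two_vertices[OF nondeg_verts[OF v(2)]] by metis
    obtain \<rho>' where "\<rho>' \<in> local_refinement \<tau>" "{g, midpoint g h} \<subseteq> verts \<rho>'"
      using local_refinement_edges(1)[OF v(2) d \<open>g \<in> verts \<tau>\<close> h(1) h(2)[symmetric]] by blast
    then show ?thesis unfolding g by auto
  next
    case 3
    then obtain g h where gh: "?G = {g, h}" "g \<noteq> h" by (meson card_2_iff)
    then have m: "g \<in> verts \<tau>" "h \<in> verts \<tau>" "g \<in> verts \<sigma>" "h \<in> verts \<sigma>" by blast+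
    have A: "\<not> {g, h} \<subseteq> verts \<rho>" "verts \<rho> \<inter> convex hull {g, h} \<subseteq> {g, h, midpoint g h}"
      using local_refinement_edges(2)[OF v(1) d m(3,4) gh(2) \<rho>] by blast+
    obtain \<rho>1 where r1: "\<rho>1 \<in> local_refinement \<tau>" "{g, midpoint g h} \<subseteq> verts \<rho>1"
      using local_refinement_edges(1)[OF v(2) d m(1,2) gh(2)] by blast
    obtain \<rho>2 where r2: "\<rho>2 \<in> local_refinement \<tau>" "{h, midpoint g h} \<subseteq> verts \<rho>2"
      using local_refinement_edges(1)[OF v(2) d m(2,1) gh(2)[symmetric]] by (auto simp: midpoint_sym)
    show ?thesis
    proof (cases "g \<in> verts \<rho>")
      case True
      then have "verts \<rho> \<inter> convex hull {g, h} \<subseteq> {g, midpoint g h}" using A by blast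
      then show ?thesis unfolding gh(1) using r1 by blast
    next
      case False
      then have "verts \<rho> \<inter> convex hull {g, h} \<subseteq> {h, midpoint g h}" using A by blast
      then show ?thesis unfolding gh(1) using r2 by blast
    qed
  next
    case 4
    obtain g h k where f: "face_ref \<sigma> g h k" "?G = {g, h, k}"
      using face_has_face_ref[OF v(1) 4(2) _ 4(1)] by blast
    obtain g' h' k' where f': "face_ref \<tau> g' h' k'" "?G = {g', h', k'}"
      using face_has_face_ref[OF v(2) 4(2) _ 4(1)] by blast
    have eq: "{g', h', k'} = {g, h, k}" using f f' by simp
    have "k' = k"
      using f f' by (intro agree[OF 4(2) st(1,2), of g' h' k' g h k] eq) (simp_all add: face_side_def)
    moreover note face_ref_verts[OF v(1) 4(2) f(1)] face_ref_verts[OF v(2) 4(2) f'(1)]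
    ultimately have "(g' = g \<and> h' = h) \<or> (g' = h \<and> h' = g)" using eq by auto
    then have pc: "pieces g' h' k' = pieces g h k" using \<open>k' = k\<close> pieces_sym by metis
    obtain X where X: "X \<in> pieces g h k" "verts \<rho> \<inter> convex hull {g, h, k} \<subseteq> X"
      using local_refinement_faces(2)[OF v(1) 4(2) f(1) \<rho>] by blast
    obtain \<rho>' where "\<rho>' \<in> local_refinement \<tau>" "X \<subseteq> verts \<rho>'"
      using local_refinement_faces(1)[OF v(2) 4(2) f'(1)] X(1) pc by blast
    then show ?thesis unfolding f(2) using X(2) by blast
  qed
qed

text \<open>The explicit local patterns form an admissible refinement \<open>U\<close>, so the coarsest one has no
  elements smaller than those of \<open>U\<close>.\<close>

lemma uniform_refinement_volume:
  fixes \<T> :: "'n::finite tsimplex set"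
  assumes d: "CARD('n) = 2 \<or> CARD('n) = 3" and tri: "triangulation \<Omega> \<T>" and cr: "coarsest_refinement \<T> \<T> \<T>'"
    and t: "\<tau> \<in> \<T>" and r: "\<rho> \<in> \<T>'" "desc \<tau> \<rho>"
  shows "vol (verts \<tau>) / 2 ^ 10 \<le> vol (verts \<rho>)"
proof -
  note T = triangulation_conf[OF tri]
  have vT: "\<forall>\<tau>\<in>\<T>. valid_tsimplex \<tau>" using T(4) by blast
  have nvb: "nvb_refinement \<T> \<T>'" and conf': "conforming \<T>'" and mark: "marking_resolved \<T> \<T> \<T>'"
    and coarse: "\<And>\<T>''. admissible_refinement \<T> \<T> \<T>'' \<Longrightarrow> nvb_refinement \<T>' \<T>''"
    using cr unfolding coarsest_refinement_def admissible_refinement_def by blast+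
  note T' = triangulation_conf[OF nvb_triangulation[OF tri nvb conf']]
  have nbhd: "edge_neighbourhood \<T> \<T> = \<T>" by (auto simp: edge_neighbourhood_def)
  \<comment> \<open>The node inside the face is supplied by the coarsest refinement itself: all
    elements are marked, so every face of the mesh has to contain one.\<close>
  have agree: "k = k'" if agr: "CARD('n) = 3" "\<sigma> \<in> \<T>" "\<tau> \<in> \<T>" "face_side \<tau> g h k" "face_side \<sigma> g' h' k'" "{g, h, k} = {g', h', k'}"
    for \<sigma> \<tau> :: "'n tsimplex" and g h k g' h' k'
  proof -
    note fv = face_side_verts[OF T(4)[OF agr(3)] agr(1,4)]
    have "{g, h, k} \<subseteq> verts \<tau> \<and> card {g, h, k} = 3" using fv by auto
    then have "\<exists>y\<in>nodes \<T>'. y \<in> rel_interior (convex hull {g, h, k})"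
      using mark agr(1,3) unfolding marking_resolved_def nbhd by simp
    then obtain y where y: "y \<in> nodes \<T>'" "y \<in> rel_interior (convex hull {g, h, k})" by blast
    show ?thesis
      by (rule face_side_agree[OF agr(1) vT nvb T'(2) T'(1) agr(2-6) y])
  qed
  define U where "U = (\<Union>\<tau>\<in>\<T>. local_refinement \<tau>)"
  have desc: "desc \<tau> \<rho>" if "\<tau> \<in> \<T>" "\<rho> \<in> local_refinement \<tau>" for \<tau> \<rho>
    using nvb_desc[OF local_refinement_sound(3)[OF T(4)[OF that(1)] d] that(2)] by simp
  have nvbU: "nvb_refinement \<T> U"
    unfolding U_def by (intro nvb_Union T local_refinement_sound(3) d)
  have confU: "conforming U"
    unfolding U_def
  proof (rule conforming_Union[OF T(1,3)])
    show "conf (local_refinement \<tau>)" "inj_on verts (local_refinement \<tau>)" if "\<tau> \<in> \<T>" for \<tau>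
      using local_refinement_sound(2)[OF T(4)[OF that] d] local_refinement_inj_verts[OF T(4)[OF that] d] by auto
    show "desc \<tau> \<rho>" if "\<tau> \<in> \<T>" "\<rho> \<in> local_refinement \<tau>" for \<tau> \<rho> using desc that by blast
    show "\<exists>\<rho>'\<in>local_refinement \<tau>. verts \<rho> \<inter> convex hull (verts \<sigma> \<inter> verts \<tau>) \<subseteq> verts \<rho>'"
      if "\<sigma> \<in> \<T>" "\<tau> \<in> \<T>" "\<sigma> \<noteq> \<tau>" "\<rho> \<in> local_refinement \<sigma>" for \<sigma> \<tau> \<rho>
      by (rule uniform_trace[OF d T(1,3) agree that])
  qed
  have "marking_resolved \<T> \<T> U"
  proof (cases "CARD('n) = 2")
    case True
    have "midpoint a b \<in> nodes U" if "\<tau> \<in> \<T>" "a \<in> verts \<tau>" "b \<in> verts \<tau>" "a \<noteq> b" for \<tau> a b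
      using local_refinement_edges(1)[OF T(4)[OF that(1)] d that(2-4)] that(1) unfolding nodes_def U_def by blast
    then show ?thesis using True by (simp add: marking_resolved_def)
  next
    case False
    then have d3: "CARD('n) = 3" using d by simp
    have "\<exists>z\<in>nodes U. z \<in> rel_interior (convex hull F)" if F: "\<tau> \<in> \<T>" "F \<subseteq> verts \<tau>" "card F = 3" for \<tau> F
    proof -
      note v = T(4)[OF F(1)]
      obtain g h k where f: "face_ref \<tau> g h k" "F = {g, h, k}"
        using face_has_face_ref[OF v d3 F(2,3)] by blast
      note fv = face_ref_verts[OF v d3 f(1)]
      have "{k, midpoint k (midpoint g h), midpoint g k} \<in> pieces g h k"
        by (simp add: pieces_def half_pieces_def)
      then obtain \<rho> where "\<rho> \<in> local_refinement \<tau>" "midpoint k (midpoint g h) \<in> verts \<rho>"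
        using local_refinement_faces(1)[OF v d3 f(1)] by blast
      then have "midpoint k (midpoint g h) \<in> nodes U" using F(1) unfolding nodes_def U_def by blast
      moreover have "midpoint k (midpoint g h) \<in> rel_interior (convex hull F)"
      proof -
        have "midpoint k (midpoint g h) \<in> convex hull F"
          unfolding f(2) by (intro midpoints_in_convex_hull hull_inc) auto
        moreover have "\<forall>u\<in>F. 0 < bary (verts \<tau>) (midpoint k (midpoint g h)) u"
          unfolding f(2) using fv by (simp add: bary_midpoint[OF nondeg_verts[OF v]] bary_vertex[OF nondeg_verts[OF v]])
        ultimately show ?thesis
          unfolding rel_interior_triangle[OF nondeg_verts[OF v] F(2)] by blast
      qed
      ultimately show ?thesis by blast
    qed
    then show ?thesis using False unfolding marking_resolved_def nbhd by auto
  qed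
  then have nvbU': "nvb_refinement \<T>' U"
    using nvbU confU by (intro coarse) (simp add: admissible_refinement_def)
  have vr: "valid_tsimplex \<rho>" using T'(4)[OF r(1)] .
  have "\<forall>\<tau>\<in>\<T>'. valid_tsimplex \<tau>" using T'(4) by blast
  moreover obtain x where "x \<in> convex hull (verts \<rho>)" using elem_nonempty[OF vr] elem_hull by blast
  \<comment> \<open>Below \<open>\<rho>\<close> there is an element \<open>\<pi>\<close> of
    \<open>U\<close>. It descends from only one element of \<open>\<T>\<close>, so it belongs to the
    pattern of \<open>\<tau>\<close>, and \<open>\<rho>\<close> has at least its volume.\<close>
  ultimately obtain \<pi> where pi: "\<pi> \<in> U" "desc \<rho> \<pi>" using nvb_cover[OF nvbU' _ r(1)] by blast
  then obtain \<sigma> where s: "\<sigma> \<in> \<T>" "\<pi> \<in> local_refinement \<sigma>" by (auto simp: U_def)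
  have "\<sigma> = \<tau>"
    by (rule desc_unique[OF T(1,3) s(1) t desc[OF s] desc_trans[OF r(2) pi(2)]])
  then have "vol (verts \<tau>) / 2 ^ 10 \<le> vol (verts \<pi>)"
    using local_refinement_sound(4)[OF T(4)[OF t] d] s(2) by simp
  also have "\<dots> \<le> vol (verts \<rho>)" by (rule desc_vol[OF pi(2) vr])
  finally show ?thesis .
qed

section \<open>Hat functions\<close>

text \<open>Moving from a boundary point a little in the direction \<open>- e\<close> leads strictly
  below the graph, hence out of the closure. This excludes slits: a triangulation only determines
  the closure of the domain, and the domain is recovered as its interior.\<close>

lemma interior_closure_lipschitz:
  fixes \<Omega> :: "(real^'n::finite) set"
  assumes op: "open \<Omega>" and lip: "lipschitz_boundary \<Omega>"
  shows "interior (closure \<Omega>) = \<Omega>"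
proof
  show "\<Omega> \<subseteq> interior (closure \<Omega>)"
    using op by (simp add: closure_subset interior_maximal)
  show "interior (closure \<Omega>) \<subseteq> \<Omega>"
  proof
    fix x assume x: "x \<in> interior (closure \<Omega>)"
    show "x \<in> \<Omega>"
    proof (rule ccontr)
      assume nx: "x \<notin> \<Omega>"
      have "x \<in> frontier \<Omega>"
        using x nx interior_subset[of "closure \<Omega>"] interior_open[OF op] by (auto simp: frontier_def)
      then obtain r e and g :: "real^'n \<Rightarrow> real" and L where r: "r > 0" and e: "norm e = 1" and g: "L-lipschitz_on UNIV g"
        and gr: "\<forall>y\<in>ball x r. y \<in> \<Omega> \<longleftrightarrow> g (y - (y \<bullet> e) *\<^sub>R e) < y \<bullet> e"
        using lip unfolding lipschitz_boundary_def by blast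
      obtain r' where r': "r' > 0" "ball x r' \<subseteq> closure \<Omega>"
        using x unfolding mem_interior by blast
      define t where "t = min r r' / 2"
      have t: "0 < t" "t < r" "t < r'" using r r' by (auto simp: t_def)
      define y where "y = x - t *\<^sub>R e"
      have ee: "e \<bullet> e = 1" using e by (simp add: norm_eq_1)
      have ye: "y \<bullet> e = x \<bullet> e - t" by (simp add: y_def inner_diff_left ee)
      have py: "y - (y \<bullet> e) *\<^sub>R e = x - (x \<bullet> e) *\<^sub>R e"
        unfolding ye by (simp add: y_def algebra_simps)
      have dy: "dist x y = t" using t e by (simp add: y_def dist_norm)
      have "x \<in> ball x r" using r by simp
      then have "x \<bullet> e \<le> g (x - (x \<bullet> e) *\<^sub>R e)" using gr nx by (meson not_le)
      moreover have "y \<bullet> e < x \<bullet> e" using ye t by simp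
      ultimately have gy: "y \<bullet> e < g (y - (y \<bullet> e) *\<^sub>R e)" by (simp only: py)
      have contg: "continuous_on UNIV g" using g by (rule lipschitz_on_continuous_on)
      have c1: "continuous_on UNIV (\<lambda>y. g (y - (y \<bullet> e) *\<^sub>R e))"
        by (intro continuous_on_compose2[OF contg] continuous_intros) auto
      have "open {y. y \<bullet> e < g (y - (y \<bullet> e) *\<^sub>R e)}"
        by (intro open_Collect_less c1 continuous_intros)
      then have V: "open ({y. y \<bullet> e < g (y - (y \<bullet> e) *\<^sub>R e)} \<inter> ball x r)" by (intro open_Int open_ball)
      have yV: "y \<in> {y. y \<bullet> e < g (y - (y \<bullet> e) *\<^sub>R e)} \<inter> ball x r" using gy dy t by simp
      have "{y. y \<bullet> e < g (y - (y \<bullet> e) *\<^sub>R e)} \<inter> ball x r \<inter> \<Omega> = {}" using gr by force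
      then have "y \<notin> closure \<Omega>"
        using V yV open_Int_closure_eq_empty by blast
      moreover have "y \<in> closure \<Omega>" using r' dy t by auto
      ultimately show False by simp
    qed
  qed
qed

locale fe_mesh =
  fixes \<Omega> :: "(real^'n::finite) set" and \<T> :: "'n tsimplex set"
  assumes tri: "triangulation \<Omega> \<T>" and dom: "polyhedral_lipschitz_domain \<Omega>"
begin

lemma dom_open: "open \<Omega>" and interior_closure: "interior (closure \<Omega>) = \<Omega>"
  using dom interior_closure_lipschitz unfolding polyhedral_lipschitz_domain_def by blast+

lemmas conf_T = triangulation_conf(1)[OF tri] and fin_T = triangulation_conf(2)[OF tri]
  and inj_T = triangulation_conf(3)[OF tri] and valid_T = triangulation_conf(4)[OF tri]

lemma N_T: "\<tau> \<in> \<T> \<Longrightarrow> nondeg (verts \<tau>)"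
  using valid_T nondeg_verts by blast

lemma cover: "closure \<Omega> = (\<Union>\<tau>\<in>\<T>. convex hull (verts \<tau>))"
  using tri by (simp add: triangulation_def)

lemma hull_closure: "\<tau> \<in> \<T> \<Longrightarrow> convex hull (verts \<tau>) \<subseteq> closure \<Omega>"
  using cover by blast

lemma elem_sub: "\<tau> \<in> \<T> \<Longrightarrow> elem \<tau> \<subseteq> \<Omega>"
  using interior_closure interior_mono[OF hull_closure] unfolding elem_def by blast

lemma closed_hull: "closed (convex hull (verts \<tau>))"
  by (intro compact_imp_closed compact_convex_hull finite_imp_compact) simp

text \<open>This is what makes the hat function of an interior node vanish on the boundary. Let
  \<open>A\<close> be the set of vertices carrying \<open>x\<close>, and \<open>p\<close> a point of
  the segment from \<open>z\<close> to \<open>x\<close> so close to \<open>z\<close> that it lies in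
  the domain. For \<open>y\<close> near \<open>x\<close>, the displaced point
  \<open>p + \<epsilon> *\<^sub>R (y - x)\<close> lies in an element containing \<open>p\<close>,
  and this element has \<open>A\<close> among its vertices. Off \<open>A\<close> the coordinates of
  \<open>p\<close> and \<open>x\<close> vanish, so those of \<open>y\<close> have the sign of those
  of the displaced point; on \<open>A\<close> they are positive by the choice of \<open>V\<close>.
  Hence \<open>y\<close> is in the same element.\<close>

lemma star_interior:
  assumes z: "z \<in> \<Omega>" and t: "\<tau> \<in> \<T>" and x: "x \<in> convex hull (verts \<tau>)" and pos: "0 < bary (verts \<tau>) x z"
  shows "x \<in> \<Omega>"
proof -
  note N = N_T[OF t]
  have zt: "z \<in> verts \<tau>" using pos bary_outside[OF N] by fastforce
  define A where "A = {a \<in> verts \<tau>. 0 < bary (verts \<tau>) x a}"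
  have zA: "z \<in> A" using zt pos by (simp add: A_def)
  define V where "V = (\<Inter>\<sigma>\<in>{\<sigma>\<in>\<T>. A \<subseteq> verts \<sigma>}. \<Inter>a\<in>A. {y. 0 < bary (verts \<sigma>) y a})"
  have xA: "x \<in> convex hull A"
    using x subset_hull_iff_bary[OF N, of A x] bary_nonneg[OF N x] bary_outside[OF N]
    by (auto simp: A_def less_le)
  have "open V"
    unfolding V_def using fin_T N_T
    by (intro open_INT open_Collect_less continuous_intros ballI) (auto simp: A_def)
  have xV: "x \<in> V"
  proof -
    have "0 < bary (verts \<sigma>) x a" if "\<sigma> \<in> \<T>" "A \<subseteq> verts \<sigma>" "a \<in> A" for \<sigma> a
    proof -
      have "x \<in> convex hull (verts \<sigma>)" using xA hull_mono[OF that(2)] by blast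
      then have "bary (verts \<sigma>) x = bary (verts \<tau>) x" by (rule conf_bary_eq[OF conf_T that(1) t _ x])
      then show ?thesis using that(3) by (simp add: A_def)
    qed
    then show ?thesis unfolding V_def by blast
  qed
  have "V \<subseteq> closure \<Omega>"
  proof
    fix y assume y: "y \<in> V"
    obtain r where r: "r > 0" "ball z r \<subseteq> \<Omega>" using z dom_open open_contains_ball by blast
    obtain t where t01: "0 < t" "t < 1" "t * norm (x - z) < r"
    proof (cases "x = z")
      case True
      then show thesis using that[of "1/2"] r by simp
    next
      case False
      have "0 < min (1/2) (r / (2 * norm (x - z)))" using r False by simp
      moreover have "min (1/2) (r / (2 * norm (x - z))) * norm (x - z) \<le> (r / (2 * norm (x - z))) * norm (x - z)"
        by (intro mult_right_mono) auto
      moreover have "(r / (2 * norm (x - z))) * norm (x - z) < r" using r False by simp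
      ultimately show thesis using that[of "min (1/2) (r / (2 * norm (x - z)))"] by linarith
    qed
    define p where "p = (1 - t) *\<^sub>R z + t *\<^sub>R x"
    have p2: "p = z + t *\<^sub>R (x - z)" by (simp add: p_def algebra_simps)
    have pO: "p \<in> \<Omega>" using r t01 by (auto simp: p2 dist_norm)
    have pA: "p \<in> convex hull A"
      unfolding p_def using zA xA t01 by (intro convexD[OF convex_convex_hull]) (auto intro: hull_inc)
    have pt: "p \<in> convex hull (verts \<tau>)" using pA hull_mono[of A "verts \<tau>"] by (auto simp: A_def)
    have pb: "bary (verts \<tau>) p a > 0" if "a \<in> A" for a
      unfolding p_def using bary_comb2[OF N, of "1 - t" t z x a] t01 that
      by (simp add: bary_vertex[OF N zt] A_def add_nonneg_pos)
    define W where "W = \<Omega> \<inter> - (\<Union>\<sigma>\<in>{\<sigma>\<in>\<T>. p \<notin> convex hull (verts \<sigma>)}. convex hull (verts \<sigma>))"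
    have "open W"
      unfolding W_def using fin_T dom_open closed_hull
      by (intro open_Int open_Compl closed_UN) auto
    moreover have "p \<in> W" using pO by (auto simp: W_def)
    ultimately obtain d where d: "d > 0" "ball p d \<subseteq> W" using open_contains_ball by blast
    define M where "M = 1 + norm (y - x)"
    define \<epsilon> where "\<epsilon> = d / (2 * M)"
    have n: "0 < M" by (simp add: M_def add_pos_nonneg)
    have eps: "\<epsilon> > 0" using d n by (simp add: \<epsilon>_def)
    have "\<epsilon> * norm (y - x) \<le> \<epsilon> * M" using eps by (simp add: M_def)
    also have "\<dots> = d / 2" using n by (simp add: \<epsilon>_def)
    finally have "\<epsilon> * norm (y - x) < d" using d by simp
    then have q: "p + \<epsilon> *\<^sub>R (y - x) \<in> W" using d eps by (intro subsetD[OF d(2)]) (simp add: dist_norm)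
    then have "p + \<epsilon> *\<^sub>R (y - x) \<in> closure \<Omega>" using closure_subset by (auto simp: W_def)
    then obtain \<sigma> where s: "\<sigma> \<in> \<T>" "p + \<epsilon> *\<^sub>R (y - x) \<in> convex hull (verts \<sigma>)" using cover by blast
    then have ps: "p \<in> convex hull (verts \<sigma>)" using q unfolding W_def by blast
    note Ns = N_T[OF s(1)]
    have beq: "bary (verts \<sigma>) p = bary (verts \<tau>) p" by (rule conf_bary_eq[OF conf_T s(1) t ps pt])
    have As: "A \<subseteq> verts \<sigma>"
    proof
      fix a assume "a \<in> A"
      then have "bary (verts \<sigma>) p a > 0" using pb beq by simp
      then show "a \<in> verts \<sigma>" using bary_outside[OF Ns] by fastforce
    qed
    have "0 \<le> bary (verts \<sigma>) y b" if b: "b \<in> verts \<sigma>" for b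
    proof (cases "b \<in> A")
      case True
      then have "0 < bary (verts \<sigma>) y b" using y s(1) As unfolding V_def by blast
      then show ?thesis by simp
    next
      case False
      have "bary (verts \<sigma>) p b = 0" using False pA subset_hull_iff_bary[OF Ns As] by blast
      moreover have "bary (verts \<sigma>) x b = 0" using False xA subset_hull_iff_bary[OF Ns As] by blast
      moreover have e: "p + \<epsilon> *\<^sub>R (y - x) = 1 *\<^sub>R p + \<epsilon> *\<^sub>R y + (- \<epsilon>) *\<^sub>R x" by (simp add: algebra_simps)
      ultimately have "bary (verts \<sigma>) (p + \<epsilon> *\<^sub>R (y - x)) b = \<epsilon> * bary (verts \<sigma>) y b"
        unfolding e using bary_comb3[OF Ns, of 1 \<epsilon> "- \<epsilon>" p y x b] by (simp del: scaleR_minus_left)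
      then show ?thesis
        using bary_nonneg[OF Ns s(2), of b] eps by (simp add: zero_le_mult_iff)
    qed
    then show "y \<in> closure \<Omega>" using hull_iff_bary[OF Ns] hull_closure[OF s(1)] by blast
  qed
  then have "V \<subseteq> interior (closure \<Omega>)" using \<open>open V\<close> by (rule interior_maximal)
  then show ?thesis using xV interior_closure by blast
qed

lemma S1_affine:
  assumes p: "p \<in> S1 \<Omega> \<T>" and t: "\<tau> \<in> \<T>"
  shows "\<exists>f. affine_on UNIV f \<and> (\<forall>x\<in>convex hull (verts \<tau>). p x = f x)"
proof -
  obtain a b where ab: "\<forall>x\<in>elem \<tau>. p x = a \<bullet> x + b"
    using p t unfolding S1_def affine_on_def by blast
  have cl: "closure (elem \<tau>) = convex hull (verts \<tau>)"
    unfolding elem_def by (rule hull_props(7)[OF N_T[OF t]])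
  have "continuous_on (closure (elem \<tau>)) (\<lambda>x. p x - (a \<bullet> x + b))"
    unfolding cl using p hull_closure[OF t]
    by (auto simp: S1_def intro!: continuous_intros elim: continuous_on_subset)
  then have "p x - (a \<bullet> x + b) = 0" if "x \<in> closure (elem \<tau>)" for x
    by (rule continuous_constant_on_closure) (use ab that in auto)
  then show ?thesis
    unfolding cl by (intro exI[of _ "\<lambda>x. a \<bullet> x + b"]) (auto simp: affine_on_def)
qed

lemma S1_interp:
  assumes p: "p \<in> S1 \<Omega> \<T>" and t: "\<tau> \<in> \<T>" and x: "x \<in> convex hull (verts \<tau>)"
  shows "p x = (\<Sum>v\<in>verts \<tau>. p v * bary (verts \<tau>) x v)"
proof -
  obtain f where f: "affine_on UNIV f" "\<forall>x\<in>convex hull (verts \<tau>). p x = f x"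
    using S1_affine[OF p t] by blast
  have "p x = f x" using f(2) x by simp
  also have "\<dots> = (\<Sum>v\<in>verts \<tau>. f v * bary (verts \<tau>) x v)"
    by (rule affine_eq_sum_bary[OF N_T[OF t] f(1)])
  also have "\<dots> = (\<Sum>v\<in>verts \<tau>. p v * bary (verts \<tau>) x v)"
    by (intro sum.cong) (simp_all add: f(2) hull_inc)
  finally show ?thesis .
qed

lemma S1_eqI:
  assumes p: "p \<in> S1 \<Omega> \<T>" "q \<in> S1 \<Omega> \<T>" and eq: "\<And>v. v \<in> nodes \<T> \<Longrightarrow> p v = q v"
  shows "p = q"
proof
  fix x
  show "p x = q x"
  proof (cases "x \<in> closure \<Omega>")
    case True
    then obtain \<tau> where t: "\<tau> \<in> \<T>" "x \<in> convex hull (verts \<tau>)" using cover by blast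
    show ?thesis
      unfolding S1_interp[OF p(1) t] S1_interp[OF p(2) t] using eq t
      by (intro sum.cong) (auto simp: nodes_def)
  qed (use p in \<open>auto simp: S1_def\<close>)
qed

text \<open>Explicit candidate for the functions given by description operators. Which element the
  choice picks is immaterial, since coordinates agree on intersections of elements.\<close>

definition hat_fun :: "real^'n \<Rightarrow> real^'n \<Rightarrow> real" where
  "hat_fun z x = (if x \<in> closure \<Omega> then bary (verts (SOME \<tau>. \<tau> \<in> \<T> \<and> x \<in> convex hull (verts \<tau>))) x z else 0)"

lemma hat_fun_bary:
  assumes t: "\<tau> \<in> \<T>" and x: "x \<in> convex hull (verts \<tau>)"
  shows "hat_fun z x = bary (verts \<tau>) x z"
proof -
  let ?s = "SOME \<tau>. \<tau> \<in> \<T> \<and> x \<in> convex hull (verts \<tau>)"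
  have "?s \<in> \<T> \<and> x \<in> convex hull (verts ?s)"
    by (rule someI[of "\<lambda>\<tau>. \<tau> \<in> \<T> \<and> x \<in> convex hull (verts \<tau>)" \<tau>]) (use t x in simp)
  then have "bary (verts ?s) x = bary (verts \<tau>) x"
    using conf_bary_eq[OF conf_T _ t _ x] by blast
  then show ?thesis using hull_closure[OF t] x by (auto simp: hat_fun_def)
qed

lemma hat_fun_S1: "hat_fun z \<in> S1 \<Omega> \<T>"
  unfolding S1_def
proof (intro CollectI conjI ballI allI impI)
  show "continuous_on (closure \<Omega>) (hat_fun z)"
    unfolding cover
  proof (rule continuous_on_closed_Union[OF fin_T closed_hull])
    fix \<tau> assume t: "\<tau> \<in> \<T>"
    have "continuous_on (convex hull (verts \<tau>)) (\<lambda>x. bary (verts \<tau>) x z)"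
      by (intro continuous_on_bary N_T t)
    then show "continuous_on (convex hull (verts \<tau>)) (hat_fun z)"
      by (rule continuous_on_eq) (simp add: hat_fun_bary[OF t])
  qed
  fix \<tau> assume t: "\<tau> \<in> \<T>"
  obtain n c where n: "\<And>x. bary (verts \<tau>) x z = n \<bullet> x + c" using bary_inner[OF N_T[OF t]] by blast
  have "\<forall>x\<in>elem \<tau>. hat_fun z x = n \<bullet> x + c"
    using hat_fun_bary[OF t] elem_hull[of \<tau>] n by auto
  then show "affine_on (elem \<tau>) (hat_fun z)" unfolding affine_on_def by blast
qed (simp add: hat_fun_def)

lemma hat_fun_node:
  assumes "v \<in> nodes \<T>"
  shows "hat_fun z v = (if v = z then 1 else 0)"
proof -
  obtain \<tau> where t: "\<tau> \<in> \<T>" "v \<in> verts \<tau>" using assms by (auto simp: nodes_def)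
  then have "hat_fun z v = bary (verts \<tau>) v z" by (intro hat_fun_bary) (auto intro: hull_inc)
  then show ?thesis using bary_vertex[OF N_T[OF t(1)] t(2), of z] by auto
qed

lemma hat_eq: "hat \<Omega> \<T> z = hat_fun z"
  unfolding hat_def
proof (rule the_equality)
  show "hat_fun z \<in> S1 \<Omega> \<T> \<and> (\<forall>z'\<in>nodes \<T>. hat_fun z z' = (if z' = z then 1 else 0))"
    using hat_fun_S1 hat_fun_node by blast
  fix p assume "p \<in> S1 \<Omega> \<T> \<and> (\<forall>z'\<in>nodes \<T>. p z' = (if z' = z then 1 else 0))"
  then show "p = hat_fun z" by (intro S1_eqI hat_fun_S1) (simp_all add: hat_fun_node)
qed

lemma nodes_closure: "nodes \<T> \<subseteq> closure \<Omega>"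
  using cover verts_subset_hull by (fastforce simp: nodes_def)

lemma frontier_eq: "frontier \<Omega> = closure \<Omega> - \<Omega>"
  using interior_open[OF dom_open] by (simp add: frontier_def)

lemma hat_fun_S10: 
  assumes "z \<in> interior_nodes \<Omega> \<T>"
  shows "hat_fun z \<in> S10 \<Omega> \<T>"
proof -
  have "hat_fun z x = 0" if x: "x \<in> frontier \<Omega>" for x
  proof (rule ccontr)
    assume n: "hat_fun z x \<noteq> 0"
    obtain \<tau> where t: "\<tau> \<in> \<T>" "x \<in> convex hull (verts \<tau>)" using x cover frontier_eq by blast
    then have pos: "0 < bary (verts \<tau>) x z"
      using n hat_fun_bary[OF t] bary_nonneg[OF N_T[OF t(1)] t(2), of z] by simp
    have "z \<in> \<Omega>" using assms by (simp add: interior_nodes_def)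
    then have "x \<in> \<Omega>" by (rule star_interior[OF _ t pos])
    then show False using x frontier_eq by blast
  qed
  then show ?thesis using hat_fun_S1 by (simp add: S10_def)
qed

lemma S10_node: "p \<in> S10 \<Omega> \<T> \<Longrightarrow> v \<in> nodes \<T> \<Longrightarrow> v \<notin> \<Omega> \<Longrightarrow> p v = 0"
  using nodes_closure frontier_eq by (auto simp: S10_def)

lemma nodal_basis_eq:
  assumes z: "z \<in> interior_nodes \<Omega> \<T>"
  shows "nodal_basis \<Omega> \<T> z = hat_fun z"
  unfolding nodal_basis_def
proof (rule the_equality)
  show "hat_fun z \<in> S10 \<Omega> \<T> \<and> (\<forall>z'\<in>interior_nodes \<Omega> \<T>. hat_fun z z' = (if z' = z then 1 else 0))"
    using hat_fun_S10[OF z] hat_fun_node by (auto simp: interior_nodes_def)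
  fix p assume p: "p \<in> S10 \<Omega> \<T> \<and> (\<forall>z'\<in>interior_nodes \<Omega> \<T>. p z' = (if z' = z then 1 else 0))"
  show "p = hat_fun z"
  proof (rule S1_eqI[OF _ hat_fun_S1])
    show "p \<in> S1 \<Omega> \<T>" using p by (simp add: S10_def)
    fix v assume v: "v \<in> nodes \<T>"
    show "p v = hat_fun z v"
    proof (cases "v \<in> \<Omega>")
      case True
      then show ?thesis using p v hat_fun_node by (simp add: interior_nodes_def)
    next
      case False
      then have "v \<noteq> z" using z by (auto simp: interior_nodes_def)
      then show ?thesis using S10_node[OF _ v False] p hat_fun_node[OF v] by simp
    qed
  qed
qed

lemma interior_nodes_finite: "finite (interior_nodes \<Omega> \<T>)"
  using fin_T by (auto simp: interior_nodes_def nodes_def)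

lemma S10_measurable:
  assumes "p \<in> S1 \<Omega> \<T>"
  shows "p \<in> borel_measurable borel"
proof -
  have "(\<lambda>x. if x \<in> closure \<Omega> then p x else 0) \<in> borel_measurable borel"
    using assms by (intro borel_measurable_continuous_on_if) (auto simp: S1_def)
  moreover have "(\<lambda>x. if x \<in> closure \<Omega> then p x else 0) = p" using assms by (auto simp: S1_def fun_eq_iff)
  ultimately show ?thesis by simp
qed

lemma nodal_sum:
  assumes t: "\<tau> \<in> \<T>" and x: "x \<in> convex hull (verts \<tau>)"
  shows "(\<Sum>z\<in>interior_nodes \<Omega> \<T>. c z * nodal_basis \<Omega> \<T> z x) = (\<Sum>z\<in>verts \<tau> \<inter> \<Omega>. c z * bary (verts \<tau>) x z)"
proof -
  have "(\<Sum>z\<in>interior_nodes \<Omega> \<T>. c z * nodal_basis \<Omega> \<T> z x) = (\<Sum>z\<in>interior_nodes \<Omega> \<T>. c z * bary (verts \<tau>) x z)"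
    by (intro sum.cong) (auto simp: nodal_basis_eq hat_fun_bary[OF t x])
  also have "\<dots> = (\<Sum>z\<in>verts \<tau> \<inter> \<Omega>. c z * bary (verts \<tau>) x z)"
  proof (rule sum.mono_neutral_right[OF interior_nodes_finite])
    show "verts \<tau> \<inter> \<Omega> \<subseteq> interior_nodes \<Omega> \<T>" using t unfolding interior_nodes_def nodes_def by blast
    show "\<forall>z\<in>interior_nodes \<Omega> \<T> - verts \<tau> \<inter> \<Omega>. c z * bary (verts \<tau>) x z = 0"
      using bary_outside[OF N_T[OF t]] by (auto simp: interior_nodes_def)
  qed
  finally show ?thesis .
qed

end

section \<open>Patches of interior vertices\<close>

definition hsize :: "'n::finite tsimplex \<Rightarrow> real" where
  "hsize \<tau> = vol (verts \<tau>) powr (1 / real CARD('n))"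

definition diam :: "'n::finite tsimplex \<Rightarrow> real" where
  "diam \<tau> = diameter (convex hull (verts \<tau>))"

lemma hsize_pos:
  assumes "valid_tsimplex \<tau>"
  shows "0 < hsize \<tau>"
  using hull_props(5)[OF nondeg_verts[OF assms]] by (simp add: hsize_def)

lemma hsize_power:
  fixes \<tau> :: "'n::finite tsimplex"
  assumes "valid_tsimplex \<tau>"
  shows "hsize \<tau> ^ CARD('n) = vol (verts \<tau>)"
proof -
  have p: "0 < vol (verts \<tau>)" using hull_props(5)[OF nondeg_verts[OF assms]] .
  have "hsize \<tau> ^ CARD('n) = hsize \<tau> powr real CARD('n)"
    using hsize_pos[OF assms] by (simp add: powr_realpow)
  also have "\<dots> = vol (verts \<tau>)" using p by (simp add: hsize_def powr_powr)
  finally show ?thesis .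
qed

lemma bounded_hull_verts: "bounded (convex hull (verts \<tau>))"
  by (intro compact_imp_bounded compact_convex_hull finite_imp_compact) simp

lemma diam_nonneg: "0 \<le> diam \<tau>"
  unfolding diam_def by (rule diameter_ge_0[OF bounded_hull_verts])

lemma diam_bound: "x \<in> convex hull (verts \<tau>) \<Longrightarrow> y \<in> convex hull (verts \<tau>) \<Longrightarrow> norm (x - y) \<le> diam \<tau>"
  unfolding diam_def using diameter_bounded_bound[OF bounded_hull_verts] by (simp add: dist_norm)

lemma measure_elem: "valid_tsimplex \<tau> \<Longrightarrow> measure lborel (elem \<tau>) = vol (verts \<tau>)"
  unfolding elem_def by (intro hull_props(6) nondeg_verts)

lemma shape_diam:
  fixes \<tau> :: "'n::finite tsimplex"
  assumes "shape_regular \<gamma> \<T>" "\<tau> \<in> \<T>" "valid_tsimplex \<tau>"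
  shows "diam \<tau> \<le> \<gamma> * hsize \<tau>"
proof -
  have "bounded (elem \<tau>)" using bounded_hull_verts elem_hull bounded_subset by blast
  then have "diameter (elem \<tau>) = diam \<tau>"
    unfolding diam_def using diameter_closure[of "elem \<tau>"] hull_props(7)[OF nondeg_verts[OF assms(3)]]
    by (simp add: elem_def)
  then have "diam \<tau> / hsize \<tau> \<le> \<gamma>"
    using assms unfolding shape_regular_def hsize_def by (metis measure_elem)
  then show ?thesis using hsize_pos[OF assms(3)] by (simp add: field_simps)
qed

context fe_mesh
begin

definition patch :: "real^'n \<Rightarrow> 'n tsimplex set" where
  "patch z = {\<tau>\<in>\<T>. z \<in> verts \<tau>}"

text \<open>If \<open>Q\<close> met the rest of the patch only in \<open>z\<close>, the two unions
  of elements would split a small punctured ball around \<open>z\<close> into two nonempty disjoint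
  relatively closed sets. In dimension at least 2 the punctured ball is connected.\<close>

lemma patch_adjacent:
  assumes d: "2 \<le> CARD('n)" and z: "z \<in> interior_nodes \<Omega> \<T>" and Q: "Q \<subseteq> patch z" "Q \<noteq> {}" "Q \<noteq> patch z"
  shows "\<exists>\<sigma>\<in>Q. \<exists>\<tau>\<in>patch z - Q. \<exists>w. w \<noteq> z \<and> w \<in> verts \<sigma> \<and> w \<in> verts \<tau>"
proof (rule ccontr)
  assume contra: "\<not> ?thesis"
  have zO: "z \<in> \<Omega>" and zn: "z \<in> nodes \<T>" using z by (auto simp: interior_nodes_def)
  obtain \<sigma>0 where s0: "\<sigma>0 \<in> \<T>" "z \<in> verts \<sigma>0" using zn by (auto simp: nodes_def)
  define U where "U = \<Omega> \<inter> - (\<Union>\<sigma>\<in>{\<sigma>\<in>\<T>. z \<notin> convex hull (verts \<sigma>)}. convex hull (verts \<sigma>))"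
  have "open U"
    unfolding U_def using fin_T dom_open closed_hull by (intro open_Int open_Compl closed_UN) auto
  moreover have "z \<in> U" using zO by (auto simp: U_def)
  ultimately obtain r where r: "r > 0" "ball z r \<subseteq> U" using open_contains_ball by blast
  let ?B = "ball z r - {z}"
  have in_patch: "\<tau> \<in> patch z" if "\<tau> \<in> \<T>" "z \<in> convex hull (verts \<tau>)" for \<tau>
    using conf_vertex[OF conf_T s0(1) that(1) s0(2) that(2)] that(1) by (simp add: patch_def)
  have fin: "finite Q" "finite (patch z - Q)"
    using fin_T Q(1) finite_subset[of Q \<T>] by (auto simp: patch_def)
  let ?A = "\<Union>\<sigma>\<in>Q. convex hull (verts \<sigma>)" and ?C = "\<Union>\<tau>\<in>patch z - Q. convex hull (verts \<tau>)"
  have cl: "closed ?A" "closed ?C" by (intro closed_UN fin ballI closed_hull)+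
  have cov: "?B \<subseteq> ?A \<union> ?C"
  proof
    fix x assume "x \<in> ?B"
    then have x: "x \<in> U" using r by auto
    then have "x \<in> closure \<Omega>" using closure_subset by (auto simp: U_def)
    then obtain \<tau> where t: "\<tau> \<in> \<T>" "x \<in> convex hull (verts \<tau>)" using cover by blast
    then have "z \<in> convex hull (verts \<tau>)" using x unfolding U_def by blast
    then show "x \<in> ?A \<union> ?C" using in_patch[OF t(1)] t(2) by blast
  qed
  have disj: "?A \<inter> ?C \<inter> ?B = {}"
  proof (rule ccontr)
    assume "?A \<inter> ?C \<inter> ?B \<noteq> {}"
    then obtain x \<sigma> \<tau> where x: "\<sigma> \<in> Q" "\<tau> \<in> patch z - Q" "x \<in> convex hull (verts \<sigma>)" "x \<in> convex hull (verts \<tau>)" "x \<noteq> z"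
      by blast
    then have T: "\<sigma> \<in> \<T>" "\<tau> \<in> \<T>" using Q(1) by (auto simp: patch_def)
    have "verts \<sigma> \<inter> verts \<tau> \<subseteq> {z}" using contra x(1,2) by blast
    then have "convex hull (verts \<sigma> \<inter> verts \<tau>) \<subseteq> {z}"
      using hull_mono[of "verts \<sigma> \<inter> verts \<tau>" "{z}" convex] by simp
    moreover have "x \<in> convex hull (verts \<sigma> \<inter> verts \<tau>)"
      using conf_T T x(3,4) unfolding conf_def by blast
    ultimately show False using x(5) by blast
  qed
  have meet: "\<exists>x\<in>?B. x \<in> convex hull (verts \<tau>)" if tp: "\<tau> \<in> patch z" for \<tau>
  proof -
    have t: "\<tau> \<in> \<T>" "z \<in> verts \<tau>" using tp by (auto simp: patch_def)
    obtain w where w: "w \<in> verts \<tau>" "w \<noteq> z" using two_vertices[OF N_T[OF t(1)] t(2)] by metis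
    have n: "norm (w - z) > 0" using w by simp
    define t' where "t' = min 1 (r / (2 * norm (w - z)))"
    have t': "0 < t'" "t' \<le> 1" using r n by (auto simp: t'_def)
    have "t' * norm (w - z) \<le> (r / (2 * norm (w - z))) * norm (w - z)"
      unfolding t'_def by (intro mult_right_mono) auto
    also have "\<dots> < r" using n r by simp
    finally have lt: "t' * norm (w - z) < r" .
    let ?x = "(1 - t') *\<^sub>R z + t' *\<^sub>R w"
    have x: "?x = z + t' *\<^sub>R (w - z)" by (simp add: algebra_simps)
    have "?x \<in> convex hull (verts \<tau>)"
      using t' t(2) w(1) by (intro convexD[OF convex_convex_hull]) (auto intro: hull_inc)
    moreover have "?x \<in> ?B" unfolding x using lt t' w by (simp add: dist_norm)
    ultimately show ?thesis by blast
  qed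
  obtain \<sigma> where "\<sigma> \<in> Q" using Q(2) by blast
  then have A: "?A \<inter> ?B \<noteq> {}" using meet[of \<sigma>] Q(1) by blast
  obtain \<tau> where "\<tau> \<in> patch z - Q" using Q by blast
  then have C: "?C \<inter> ?B \<noteq> {}" using meet[of \<tau>] by blast
  have "connected ?B" using d by (intro connected_punctured_ball) simp
  then show False
    unfolding connected_closed using cl cov disj A C by blast
qed

text \<open>Each element at \<open>z\<close> is rescaled about \<open>z\<close> by its own diameter.
  The images lie in the unit ball and have measure at least \<open>1 / \<gamma> ^ CARD('n)\<close>.
  They are disjoint: if two share a point, scaling it back by the smaller diameter gives a point of
  that element on a segment from \<open>z\<close> into the other one. The count precedes any
  comparison of sizes, which relies on it.\<close>

lemma patch_card:
  assumes sh: "shape_regular \<gamma> \<T>" and g: "0 < \<gamma>" and zn: "z \<in> nodes \<T>"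
  shows "real (card (patch z)) \<le> \<gamma> ^ CARD('n) * measure lborel (cball (0 :: real^'n) 1)"
proof -
  let ?d = "CARD('n)"
  define B where "B \<tau> = {u. z + diam \<tau> *\<^sub>R u \<in> elem \<tau>}" for \<tau> :: "'n tsimplex"
  have P: "\<tau> \<in> \<T>" "z \<in> verts \<tau>" "valid_tsimplex \<tau>" if "\<tau> \<in> patch z" for \<tau>
    using that valid_T unfolding patch_def by blast+
  have Dpos: "0 < diam \<tau>" if t: "\<tau> \<in> patch z" for \<tau>
  proof -
    obtain w where w: "w \<in> verts \<tau>" "w \<noteq> z"
      using two_vertices[OF N_T[OF P(1)[OF t]] P(2)[OF t]] by metis
    then have "0 < norm (w - z)" by simp
    also have "\<dots> \<le> diam \<tau>" using w P(2)[OF t] by (intro diam_bound hull_inc)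
    finally show ?thesis .
  qed
  have Bopen: "open (B \<tau>)" for \<tau>
  proof -
    have "B \<tau> = (\<lambda>u. z + diam \<tau> *\<^sub>R u) -` elem \<tau>" by (auto simp: B_def)
    then show ?thesis by (auto simp: elem_def intro!: open_vimage continuous_intros)
  qed
  have Bball: "B \<tau> \<subseteq> cball 0 1" if "\<tau> \<in> patch z" for \<tau>
  proof
    fix u assume "u \<in> B \<tau>"
    then have "norm (z + diam \<tau> *\<^sub>R u - z) \<le> diam \<tau>"
      using elem_hull[of \<tau>] P(2)[OF that] by (intro diam_bound) (auto simp: B_def intro: hull_inc)
    then show "u \<in> cball 0 1" using Dpos[OF that] by simp
  qed
  have Bmeas: "1 / \<gamma> ^ ?d \<le> measure lborel (B \<tau>)" if t: "\<tau> \<in> patch z" for \<tau>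
  proof -
    have "emeasure lborel (elem \<tau>) = emeasure (density (distr lborel borel (\<lambda>x. z + diam \<tau> *\<^sub>R x)) (\<lambda>_. \<bar>diam \<tau>\<bar> ^ DIM(real^'n))) (elem \<tau>)"
      using lborel_affine[of "diam \<tau>" z] Dpos[OF t] by simp
    also have "\<dots> = ennreal (diam \<tau> ^ ?d) * emeasure (distr lborel borel (\<lambda>x. z + diam \<tau> *\<^sub>R x)) (elem \<tau>)"
      using Dpos[OF t] by (subst emeasure_density_const) (auto simp: elem_def ennreal_power)
    also have "emeasure (distr lborel borel (\<lambda>x. z + diam \<tau> *\<^sub>R x)) (elem \<tau>) = emeasure lborel (B \<tau>)"
      by (subst emeasure_distr) (auto simp: elem_def B_def vimage_def)
    finally have "measure lborel (elem \<tau>) = diam \<tau> ^ ?d * measure lborel (B \<tau>)"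
      using Dpos[OF t] by (simp add: measure_def enn2real_mult)
    then have e: "vol (verts \<tau>) = diam \<tau> ^ ?d * measure lborel (B \<tau>)" using measure_elem[OF P(3)[OF t]] by simp
    have "diam \<tau> ^ ?d \<le> (\<gamma> * hsize \<tau>) ^ ?d"
      using shape_diam[OF sh P(1,3)[OF t]] diam_nonneg by (intro power_mono)
    also have "\<dots> = \<gamma> ^ ?d * vol (verts \<tau>)" using hsize_power[OF P(3)[OF t]] by (simp add: power_mult_distrib)
    also have "\<dots> = \<gamma> ^ ?d * measure lborel (B \<tau>) * diam \<tau> ^ ?d" unfolding e by simp
    finally have "1 * diam \<tau> ^ ?d \<le> (\<gamma> ^ ?d * measure lborel (B \<tau>)) * diam \<tau> ^ ?d" by simp
    then have "1 \<le> \<gamma> ^ ?d * measure lborel (B \<tau>)"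
      using Dpos[OF t] by (simp only: mult_le_cancel_right_pos zero_less_power)
    then show ?thesis using g by (simp add: field_simps)
  qed
  have sub: "\<sigma> = \<tau>" if st: "\<sigma> \<in> patch z" "\<tau> \<in> patch z" "u \<in> B \<sigma>" "u \<in> B \<tau>" "diam \<sigma> \<le> diam \<tau>" for \<sigma> \<tau> u
  proof -
    define \<theta> where "\<theta> = diam \<sigma> / diam \<tau>"
    have th: "0 < \<theta>" "\<theta> \<le> 1" using Dpos st by (auto simp: \<theta>_def)
    have x: "z + diam \<sigma> *\<^sub>R u = (1 - \<theta>) *\<^sub>R z + \<theta> *\<^sub>R (z + diam \<tau> *\<^sub>R u)"
      using Dpos[OF st(2)] by (simp add: \<theta>_def algebra_simps)
    have "z \<in> convex hull (verts \<tau>)" using P(2)[OF st(2)] by (rule hull_inc)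
    moreover have "z + diam \<tau> *\<^sub>R u \<in> convex hull (verts \<tau>)" using st(4) elem_hull[of \<tau>] by (auto simp: B_def)
    ultimately have "z + diam \<sigma> *\<^sub>R u \<in> convex hull (verts \<tau>)"
      unfolding x using th by (intro convexD[OF convex_convex_hull]) auto
    then show ?thesis
      using st(3) P(1) st by (intro elem_disjoint[OF conf_T inj_T, of \<sigma> \<tau> "z + diam \<sigma> *\<^sub>R u"]) (auto simp: B_def)
  qed
  have disj: "disjoint_family_on B (patch z)"
    unfolding disjoint_family_on_def
  proof (intro ballI impI)
    fix \<sigma> \<tau> assume st: "\<sigma> \<in> patch z" "\<tau> \<in> patch z" "\<sigma> \<noteq> \<tau>"
    show "B \<sigma> \<inter> B \<tau> = {}"
    proof (rule ccontr)
      assume "B \<sigma> \<inter> B \<tau> \<noteq> {}"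
      then obtain u where "u \<in> B \<sigma>" "u \<in> B \<tau>" by blast
      then show False using sub st linear[of "diam \<sigma>" "diam \<tau>"] by metis
    qed
  qed
  have finP: "finite (patch z)" using fin_T by (simp add: patch_def)
  have Bfin: "emeasure lborel (B \<tau>) \<noteq> \<infinity>" if "\<tau> \<in> patch z" for \<tau>
  proof -
    have "emeasure lborel (B \<tau>) \<le> emeasure lborel (cball (0::real^'n) 1)"
      using Bball[OF that] by (intro emeasure_mono) auto
    also have "\<dots> < \<infinity>" using emeasure_lborel_cball_finite by blast
    finally show ?thesis by simp
  qed
  have "real (card (patch z)) * (1 / \<gamma> ^ ?d) \<le> (\<Sum>\<tau>\<in>patch z. measure lborel (B \<tau>))"
    using Bmeas sum_bounded_below[of "patch z" "1 / \<gamma> ^ ?d" "\<lambda>\<tau>. measure lborel (B \<tau>)"] by simp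
  also have "\<dots> = measure lborel (\<Union>\<tau>\<in>patch z. B \<tau>)"
    using finP disj Bfin Bopen by (intro measure_finite_Union[symmetric]) (auto simp: borel_open)
  also have "\<dots> \<le> measure lborel (cball (0::real^'n) 1)"
    using Bball finP Bopen emeasure_lborel_cball_finite[of "0::real^'n" 1]
    by (intro measure_mono_fmeasurable) (auto simp: fmeasurable_def intro!: borel_open)
  finally show ?thesis using g by (simp add: field_simps)
qed

text \<open>Along the common edge the coordinate of \<open>z\<close> in \<open>\<tau>\<close> drops
  from 1 to 0. Its Lipschitz constant is of order \<open>1 / hsize \<tau>\<close>, while the edge
  has length at most \<open>\<gamma> * hsize \<sigma>\<close>.\<close>

lemma adjacent_size:
  assumes sh: "shape_regular \<gamma> \<T>" and g: "0 < \<gamma>" and st: "\<sigma> \<in> \<T>" "\<tau> \<in> \<T>"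
    and zw: "z \<noteq> w" "z \<in> verts \<sigma>" "w \<in> verts \<sigma>" "z \<in> verts \<tau>" "w \<in> verts \<tau>"
  shows "hsize \<tau> \<le> 2 ^ CARD('n) * \<gamma> ^ CARD('n) * hsize \<sigma>"
proof -
  let ?d = "CARD('n)"
  note v = valid_T[OF st(1)] valid_T[OF st(2)]
  have ht: "0 < hsize \<tau>" "0 < hsize \<sigma>" using hsize_pos[OF v(1)] hsize_pos[OF v(2)] by simp_all
  have "1 = \<bar>bary (verts \<tau>) z z - bary (verts \<tau>) w z\<bar>"
    using zw by (simp add: bary_vertex[OF N_T[OF st(2)]])
  also have "\<dots> \<le> 2 ^ ?d * diam \<tau> ^ (?d - 1) / vol (verts \<tau>) * norm (z - w)"
    unfolding diam_def by (rule bary_lipschitz[OF N_T[OF st(2)] zw(4)])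
  also have "\<dots> \<le> 2 ^ ?d * (\<gamma> * hsize \<tau>) ^ (?d - 1) / vol (verts \<tau>) * (\<gamma> * hsize \<sigma>)"
  proof (intro mult_mono divide_right_mono mult_left_mono power_mono)
    show "diam \<tau> \<le> \<gamma> * hsize \<tau>" by (rule shape_diam[OF sh st(2) v(2)])
    have "norm (z - w) \<le> diam \<sigma>" using zw by (intro diam_bound hull_inc)
    then show "norm (z - w) \<le> \<gamma> * hsize \<sigma>" using shape_diam[OF sh st(1) v(1)] by linarith
    show "0 \<le> 2 ^ ?d * (\<gamma> * hsize \<tau>) ^ (?d - 1) / vol (verts \<tau>)"
      using g ht hull_props(5)[OF N_T[OF st(2)]] by simp
  qed (use diam_nonneg[of \<tau>] hull_props(5)[OF N_T[OF st(2)]] in \<open>auto simp: less_imp_le\<close>)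
  also have "vol (verts \<tau>) = hsize \<tau> * hsize \<tau> ^ (?d - 1)"
    using hsize_power[OF v(2)] power_minus_mult[of ?d "hsize \<tau>"] by (simp add: mult.commute)
  also have "2 ^ ?d * (\<gamma> * hsize \<tau>) ^ (?d - 1) / (hsize \<tau> * hsize \<tau> ^ (?d - 1)) * (\<gamma> * hsize \<sigma>)
      = 2 ^ ?d * (\<gamma> ^ (?d - 1) * \<gamma>) * hsize \<sigma> / hsize \<tau>"
    using ht by (simp add: power_mult_distrib)
  also have "\<gamma> ^ (?d - 1) * \<gamma> = \<gamma> ^ ?d"
    using power_minus_mult[of ?d \<gamma>] by simp
  finally show ?thesis using ht by (simp add: field_simps)
qed

text \<open>\<open>Q k\<close> collects the elements within \<open>k\<close> factors of the size of
  \<open>\<sigma>\<close>. By adjacency across edges at \<open>z\<close> it gains an element in each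
  step until it is the whole patch, so \<open>N\<close> steps suffice.\<close>

lemma patch_size:
  assumes d: "2 \<le> CARD('n)" and sh: "shape_regular \<gamma> \<T>" and g: "0 < \<gamma>" and z: "z \<in> interior_nodes \<Omega> \<T>"
    and N: "card (patch z) \<le> N" and st: "\<sigma> \<in> patch z" "\<tau> \<in> patch z"
  shows "hsize \<tau> \<le> (2 ^ CARD('n) * \<gamma> ^ CARD('n)) ^ N * hsize \<sigma>"
proof -
  let ?c = "2 ^ CARD('n) * \<gamma> ^ CARD('n)"
  have P: "\<tau> \<in> \<T>" "z \<in> verts \<tau>" "0 < hsize \<tau>" if "\<tau> \<in> patch z" for \<tau>
    using that valid_T hsize_pos unfolding patch_def by blast+
  have c1: "1 \<le> ?c"
  proof -
    obtain w where w: "w \<in> verts \<sigma>" "w \<noteq> z" using two_vertices[OF N_T[OF P(1)[OF st(1)]] P(2)[OF st(1)]] by metis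
    have "1 * hsize \<sigma> \<le> ?c * hsize \<sigma>"
      using adjacent_size[OF sh g P(1)[OF st(1)] P(1)[OF st(1)] w(2)[symmetric]] P(2)[OF st(1)] w by simp
    then show ?thesis using P(3)[OF st(1)] by (simp only: mult_le_cancel_right_pos)
  qed
  define Q where "Q k = {\<tau> \<in> patch z. hsize \<tau> \<le> ?c ^ k * hsize \<sigma>}" for k
  have finP: "finite (patch z)" using fin_T by (simp add: patch_def)
  have Q: "Q k \<subseteq> patch z" for k by (auto simp: Q_def)
  have step: "Q k = patch z \<or> k + 1 \<le> card (Q k)" for k
  proof (induction k)
    case 0
    have "\<sigma> \<in> Q 0" using st by (simp add: Q_def)
    then have "card (Q 0) \<noteq> 0" using finite_subset[OF Q finP] by auto
    then show ?case by simp
  next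
    case (Suc k)
    have mono: "Q k \<subseteq> Q (Suc k)"
    proof
      fix \<pi> assume p: "\<pi> \<in> Q k"
      have "?c ^ k * hsize \<sigma> \<le> ?c ^ Suc k * hsize \<sigma>"
        using c1 P(3)[OF st(1)] by (intro mult_right_mono power_increasing) auto
      then show "\<pi> \<in> Q (Suc k)" using p by (auto simp: Q_def)
    qed
    show ?case
    proof (cases "Q k = patch z")
      case True
      then show ?thesis using mono Q by blast
    next
      case False
      have "Q k \<noteq> {}"
        using Suc.IH False by auto
      then obtain \<pi> \<pi>' w where a: "\<pi> \<in> Q k" "\<pi>' \<in> patch z - Q k" "w \<noteq> z" "w \<in> verts \<pi>" "w \<in> verts \<pi>'"
        using patch_adjacent[OF d z Q _ False] by blast
      have p: "\<pi> \<in> patch z" "\<pi>' \<in> patch z" using a Q by auto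
      have "hsize \<pi>' \<le> ?c * hsize \<pi>"
        using adjacent_size[OF sh g P(1)[OF p(1)] P(1)[OF p(2)] a(3)[symmetric]] P(2)[OF p(1)] P(2)[OF p(2)] a by simp
      also have "\<dots> \<le> ?c * (?c ^ k * hsize \<sigma>)"
        using a(1) c1 by (intro mult_left_mono) (auto simp: Q_def)
      finally have "\<pi>' \<in> Q (Suc k)" using p by (simp add: Q_def mult.assoc)
      then have "insert \<pi>' (Q k) \<subseteq> Q (Suc k)" using mono by blast
      then have "card (insert \<pi>' (Q k)) \<le> card (Q (Suc k))"
        using finite_subset[OF Q finP] by (intro card_mono) auto
      moreover have "card (insert \<pi>' (Q k)) = card (Q k) + 1"
        using a(2) finite_subset[OF Q finP] by simp
      ultimately show ?thesis using Suc.IH False by linarith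
    qed
  qed
  have "card (Q N) \<le> N" using card_mono[OF finP Q[of N]] N by linarith
  then have "Q N = patch z" using step[of N] by linarith
  then show ?thesis using st(2) by (auto simp: Q_def)
qed

end

text \<open>Restated outside the locale, so that \<open>N\<close> and \<open>C\<close> are fixed
  before the domain, the mesh and the node.\<close>

lemma patch_bounds:
  assumes d: "2 \<le> CARD('n::finite)" and g: "0 < \<gamma>"
  shows "\<exists>N C. 0 < C \<and> (\<forall>(\<Omega> :: (real^'n) set) \<T> z. fe_mesh \<Omega> \<T> \<longrightarrow> shape_regular \<gamma> \<T> \<longrightarrow> z \<in> interior_nodes \<Omega> \<T> \<longrightarrow>
     card {\<tau>\<in>\<T>. z \<in> verts \<tau>} \<le> N \<and>
     (\<forall>\<sigma>\<in>\<T>. \<forall>\<tau>\<in>\<T>. z \<in> verts \<sigma> \<longrightarrow> z \<in> verts \<tau> \<longrightarrow> hsize \<tau> \<le> C * hsize \<sigma>))"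
proof -
  define N where "N = nat \<lceil>\<gamma> ^ CARD('n) * measure lborel (cball (0 :: real^'n) 1)\<rceil>"
  define C where "C = (2 ^ CARD('n) * \<gamma> ^ CARD('n)) ^ N"
  have "0 < C" using g by (simp add: C_def)
  moreover have "card {\<tau>\<in>\<T>. z \<in> verts \<tau>} \<le> N \<and>
     (\<forall>\<sigma>\<in>\<T>. \<forall>\<tau>\<in>\<T>. z \<in> verts \<sigma> \<longrightarrow> z \<in> verts \<tau> \<longrightarrow> hsize \<tau> \<le> C * hsize \<sigma>)"
    if m: "fe_mesh \<Omega> \<T>" and sh: "shape_regular \<gamma> \<T>" and z: "z \<in> interior_nodes \<Omega> \<T>"
    for \<Omega> :: "(real^'n) set" and \<T> z
  proof -
    interpret fe_mesh \<Omega> \<T> by (rule m)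
    have p: "{\<tau>\<in>\<T>. z \<in> verts \<tau>} = patch z" by (simp add: patch_def)
    have "real (card (patch z)) \<le> \<gamma> ^ CARD('n) * measure lborel (cball (0 :: real^'n) 1)"
      using z by (intro patch_card[OF sh g]) (simp add: interior_nodes_def)
    also have "\<dots> \<le> real N" unfolding N_def by (rule real_nat_ceiling_ge)
    finally have c: "card (patch z) \<le> N" by simp
    then show ?thesis
      unfolding p C_def using patch_size[OF d sh g z c] by (auto simp: patch_def)
  qed
  ultimately show ?thesis by blast
qed

section \<open>Bounds for the weight\<close>

lemma powr_square: "(x powr p)\<^sup>2 = x powr (2 * p)" for x p :: real
  by (simp add: power2_eq_square powr_add[symmetric])

lemma inverse_powr_square: "(1 / x powr p)\<^sup>2 = x powr (- 2 * p)" for x p :: real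
  unfolding power_divide powr_square by (simp add: powr_minus_divide[of x "2 * p"])

context fe_mesh
begin

lemma mesh_width_elem:
  assumes t: "\<tau> \<in> \<T>" and x: "x \<in> elem \<tau>"
  shows "mesh_width \<T> x = hsize \<tau>"
proof -
  have "mesh_width \<T> x = (\<Sum>\<sigma>\<in>\<T>. if \<sigma> = \<tau> then hsize \<tau> else 0)"
    unfolding mesh_width_def
  proof (rule sum.cong[OF HOL.refl])
    fix \<sigma> assume s: "\<sigma> \<in> \<T>"
    show "indicator (elem \<sigma>) x * measure lborel (elem \<sigma>) powr (1 / real CARD('n)) = (if \<sigma> = \<tau> then hsize \<tau> else 0)"
    proof (cases "\<sigma> = \<tau>")
      case True
      then show ?thesis using x measure_elem[OF valid_T[OF t]] by (simp add: hsize_def)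
    next
      case False
      have "x \<notin> elem \<sigma>"
        using elem_disjoint[OF conf_T inj_T t s x] elem_hull[of \<sigma>] False by blast
      then show ?thesis using False by simp
    qed
  qed
  also have "\<dots> = hsize \<tau>" using t fin_T by simp
  finally show ?thesis .
qed

lemma open_elem: "open (elem \<tau>)"
  by (simp add: elem_def)

lemma verts_frontier:
  assumes "\<tau> \<in> \<T>"
  shows "verts \<tau> \<subseteq> frontier (elem \<tau>)"
proof
  fix v assume v: "v \<in> verts \<tau>"
  note N = N_T[OF assms]
  obtain w where w: "w \<in> verts \<tau>" "w \<noteq> v" using two_vertices[OF N v] by metis
  have "bary (verts \<tau>) v w = 0" using bary_vertex[OF N v] w by simp
  then have "v \<notin> elem \<tau>" using w(1) elem_iff_bary[OF valid_T[OF assms]] by force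
  moreover have "v \<in> closure (elem \<tau>)"
    unfolding elem_def hull_props(7)[OF N] using v by (rule hull_inc)
  ultimately show "v \<in> frontier (elem \<tau>)"
    using open_elem[of \<tau>] by (simp add: frontier_def interior_open)
qed

lemma frontier_nonempty:
  assumes "\<tau> \<in> \<T>"
  shows "frontier (elem \<tau>) \<noteq> {}"
proof -
  obtain v where "v \<in> verts \<tau>" using nondegD(4)[OF N_T[OF assms]] by (meson ex_in_conv)
  then show ?thesis using verts_frontier[OF assms] by auto
qed

lemma T_nonempty: "\<T> \<noteq> {}"
proof
  assume "\<T> = {}"
  then have "closure \<Omega> = {}" using cover by simp
  then show False using dom by (simp add: polyhedral_lipschitz_domain_def)
qed

lemma skeleton_dist_infdist: "skeleton_dist \<T> x = (INF \<tau>\<in>\<T>. infdist x (frontier (elem \<tau>)))"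
  unfolding skeleton_dist_def
  by (intro INF_cong HOL.refl) (simp add: infdist_notempty[OF frontier_nonempty] dist_norm)

lemma skeleton_dist_Min: "skeleton_dist \<T> x = Min ((\<lambda>\<tau>. infdist x (frontier (elem \<tau>))) ` \<T>)"
  unfolding skeleton_dist_infdist using fin_T T_nonempty by (intro cInf_eq_Min) auto

lemma skeleton_dist_measurable: "skeleton_dist \<T> \<in> borel_measurable borel"
proof -
  have "(\<lambda>x. infdist x (frontier (elem \<tau>))) \<in> borel_measurable borel" for \<tau> :: "'n tsimplex"
    by (rule borel_measurable_continuous_onI[OF continuous_on_infdist[OF continuous_on_id]])
  then have "(\<lambda>x. Min ((\<lambda>\<tau>. infdist x (frontier (elem \<tau>))) ` \<T>)) \<in> borel_measurable borel"
    by (rule borel_measurable_Min[OF fin_T, where f = "\<lambda>\<tau> x. infdist x (frontier (elem \<tau>))"])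
  then show ?thesis by (simp add: skeleton_dist_Min[abs_def])
qed

lemma mesh_width_measurable: "mesh_width \<T> \<in> borel_measurable borel"
  unfolding mesh_width_def[abs_def] using open_elem
  by (intro borel_measurable_sum borel_measurable_times borel_measurable_indicator borel_measurable_const borel_open)

lemma weight_measurable: "weight s \<T> \<in> borel_measurable borel"
proof (cases "s \<le> 1/2")
  case True
  then have "weight s \<T> = (\<lambda>x. mesh_width \<T> x powr s)" by (simp add: weight_def fun_eq_iff)
  then show ?thesis using mesh_width_measurable by simp
next
  case False
  then have "weight s \<T> = (\<lambda>x. mesh_width \<T> x powr (1/2) * skeleton_dist \<T> x powr (s - 1/2))"
    by (simp add: weight_def fun_eq_iff)
  then show ?thesis using mesh_width_measurable skeleton_dist_measurable by simp
qed

lemma skeleton_dist_upper: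
  assumes t: "\<tau> \<in> \<T>" and x: "x \<in> elem \<tau>"
  shows "skeleton_dist \<T> x \<le> diam \<tau>"
proof -
  obtain v where v: "v \<in> verts \<tau>" using nondegD(4)[OF N_T[OF t]] by (meson ex_in_conv)
  have "skeleton_dist \<T> x \<le> infdist x (frontier (elem \<tau>))"
    unfolding skeleton_dist_Min using fin_T t by (intro Min_le) auto
  also have "\<dots> \<le> dist x v" using verts_frontier[OF t] v by (intro infdist_le) auto
  also have "\<dots> \<le> diam \<tau>"
    unfolding dist_norm using x elem_hull[of \<tau>] v by (intro diam_bound) (auto intro: hull_inc)
  finally show ?thesis .
qed

text \<open>The nearest skeleton point is not in the open set \<open>elem \<tau>\<close>, because an
  open element meets no frontier of another one. So some coordinate is at most 0 there, and the
  Lipschitz bound converts the drop from \<open>x\<close> into a distance.\<close>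

lemma skeleton_dist_lower:
  assumes t: "\<tau> \<in> \<T>" and x: "x \<in> elem \<tau>" and k: "0 < k"
    and lip: "\<And>y a. a \<in> verts \<tau> \<Longrightarrow> \<bar>bary (verts \<tau>) x a - bary (verts \<tau>) y a\<bar> \<le> k * norm (x - y)"
  shows "\<exists>a\<in>verts \<tau>. bary (verts \<tau>) x a / k \<le> skeleton_dist \<T> x"
proof -
  have "skeleton_dist \<T> x \<in> (\<lambda>\<tau>. infdist x (frontier (elem \<tau>))) ` \<T>"
    unfolding skeleton_dist_Min using fin_T T_nonempty by (intro Min_in) auto
  then obtain \<sigma> where s: "\<sigma> \<in> \<T>" "skeleton_dist \<T> x = infdist x (frontier (elem \<sigma>))" by blast
  obtain y where y: "y \<in> frontier (elem \<sigma>)" "infdist x (frontier (elem \<sigma>)) = dist x y"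
    using infdist_attains_inf[OF frontier_closed frontier_nonempty[OF s(1)]] by metis
  have "y \<notin> elem \<tau>"
  proof
    assume yt: "y \<in> elem \<tau>"
    have "y \<in> closure (elem \<sigma>)" using y(1) by (simp add: frontier_def)
    then have "elem \<tau> \<inter> elem \<sigma> \<noteq> {}"
      using yt open_elem[of \<tau>] by (metis disjoint_iff open_Int_closure_eq_empty)
    then obtain p where "p \<in> elem \<tau>" "p \<in> elem \<sigma>" by blast
    then have "\<tau> = \<sigma>" using elem_disjoint[OF conf_T inj_T t s(1)] elem_hull[of \<sigma>] by blast
    then show False using yt y(1) interior_open[OF open_elem[of \<sigma>]] by (simp add: frontier_def)
  qed
  then obtain a where a: "a \<in> verts \<tau>" "bary (verts \<tau>) y a \<le> 0"
    unfolding elem_iff_bary[OF valid_T[OF t]] by (meson not_le)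
  have "bary (verts \<tau>) x a \<le> k * norm (x - y)" using lip[OF a(1), of y] a(2) by linarith
  then have "bary (verts \<tau>) x a / k \<le> skeleton_dist \<T> x"
    using k s(2) y(2) by (simp add: dist_norm field_simps)
  then show ?thesis using a(1) by blast
qed

lemma bary_lipschitz_hsize:
  assumes sh: "shape_regular \<gamma> \<T>" and g: "0 < \<gamma>" and t: "\<tau> \<in> \<T>" and a: "a \<in> verts \<tau>"
  shows "\<bar>bary (verts \<tau>) x a - bary (verts \<tau>) y a\<bar> \<le> (2 ^ CARD('n) * \<gamma> ^ (CARD('n) - 1) / hsize \<tau>) * norm (x - y)"
proof -
  let ?d = "CARD('n)"
  note v = valid_T[OF t]
  have h: "0 < hsize \<tau>" using hsize_pos[OF v] .
  have "2 ^ ?d * diam \<tau> ^ (?d - 1) / vol (verts \<tau>) \<le> 2 ^ ?d * (\<gamma> * hsize \<tau>) ^ (?d - 1) / vol (verts \<tau>)"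
    using shape_diam[OF sh t v] diam_nonneg[of \<tau>] hull_props(5)[OF N_T[OF t]]
    by (intro divide_right_mono mult_left_mono power_mono) auto
  also have "vol (verts \<tau>) = hsize \<tau> * hsize \<tau> ^ (?d - 1)"
    using hsize_power[OF v] power_minus_mult[of ?d "hsize \<tau>"] by (simp add: mult.commute)
  also have "2 ^ ?d * (\<gamma> * hsize \<tau>) ^ (?d - 1) / (hsize \<tau> * hsize \<tau> ^ (?d - 1)) = 2 ^ ?d * \<gamma> ^ (?d - 1) / hsize \<tau>"
    using h by (simp add: power_mult_distrib)
  finally have "2 ^ ?d * diam \<tau> ^ (?d - 1) / vol (verts \<tau>) * norm (x - y) \<le> 2 ^ ?d * \<gamma> ^ (?d - 1) / hsize \<tau> * norm (x - y)"
    using hsize_power[OF v] power_minus_mult[of ?d "hsize \<tau>"] by (intro mult_right_mono) (simp_all add: mult.commute)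
  then show ?thesis
    using bary_lipschitz[OF N_T[OF t] a, of x y] unfolding diam_def by linarith
qed

end

lemma weight_bounds:
  fixes s \<gamma> :: real
  assumes s: "0 < s" "s < 1" and g: "0 < \<gamma>"
  shows "\<exists>c C. 0 < c \<and> 0 < C \<and> (\<forall>(\<Omega> :: (real^'n::finite) set) \<T> \<tau>. fe_mesh \<Omega> \<T> \<longrightarrow> shape_regular \<gamma> \<T> \<longrightarrow> \<tau> \<in> \<T> \<longrightarrow>
     (\<forall>x\<in>elem \<tau>. c * hsize \<tau> powr (- 2 * s) \<le> (1 / weight s \<T> x)\<^sup>2) \<and>
     (\<integral>\<^sup>+x. ennreal ((1 / weight s \<T> x)\<^sup>2) * indicator (elem \<tau>) x \<partial>lborel)
       \<le> ennreal (C * hsize \<tau> powr (- 2 * s) * vol (verts \<tau>)))"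
proof (cases "s \<le> 1/2")
  case True
  have "(\<forall>x\<in>elem \<tau>. 1 * hsize \<tau> powr (- 2 * s) \<le> (1 / weight s \<T> x)\<^sup>2) \<and>
     (\<integral>\<^sup>+x. ennreal ((1 / weight s \<T> x)\<^sup>2) * indicator (elem \<tau>) x \<partial>lborel)
       \<le> ennreal (1 * hsize \<tau> powr (- 2 * s) * vol (verts \<tau>))"
    if m: "fe_mesh \<Omega> \<T>" and t: "\<tau> \<in> \<T>" for \<Omega> :: "(real^'n) set" and \<T> \<tau>
  proof -
    interpret fe_mesh \<Omega> \<T> by (rule m)
    have w: "(1 / weight s \<T> x)\<^sup>2 = hsize \<tau> powr (- 2 * s)" if "x \<in> elem \<tau>" for x
      using mesh_width_elem[OF t that] True inverse_powr_square[of "hsize \<tau>" s] by (simp add: weight_def)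
    have "(\<integral>\<^sup>+x. ennreal ((1 / weight s \<T> x)\<^sup>2) * indicator (elem \<tau>) x \<partial>lborel)
        = (\<integral>\<^sup>+x. ennreal (hsize \<tau> powr (- 2 * s)) * indicator (elem \<tau>) x \<partial>lborel)"
      by (intro nn_integral_cong) (auto simp: indicator_def w)
    also have "\<dots> = ennreal (hsize \<tau> powr (- 2 * s)) * emeasure lborel (elem \<tau>)"
      using open_elem[of \<tau>] by (intro nn_integral_cmult_indicator) (auto intro: borel_open)
    also have "\<dots> \<le> ennreal (hsize \<tau> powr (- 2 * s)) * emeasure lborel (convex hull (verts \<tau>))"
      using hull_props(2)[OF N_T[OF t]] by (intro mult_left_mono emeasure_mono elem_hull) auto
    also have "\<dots> = ennreal (1 * hsize \<tau> powr (- 2 * s) * vol (verts \<tau>))"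
      using hull_props(4)[OF N_T[OF t]] by (simp add: ennreal_mult')
    finally show ?thesis using w by simp
  qed
  then show ?thesis by (intro exI[of _ 1]) simp
next
  case False
  \<comment> \<open>The exponent of the skeleton distance in the squared inverse weight is
    \<open>- t\<close>; integrability requires \<open>t < 1\<close>, which is the assumption
    \<open>s < 1\<close>.\<close>
  define t where "t = 2 * s - 1"
  have t: "0 \<le> t" "t < 1" "0 < t" using False s by (auto simp: t_def)
  obtain K where K: "0 < K" "\<forall>(S :: (real^'n) set) a. nondeg S \<longrightarrow> a \<in> S \<longrightarrow>
       (\<integral>\<^sup>+x. ennreal (bary S x a powr (- t)) * indicator (convex hull S) x \<partial>lborel) \<le> ennreal (K * vol S)"
    using bary_powr_integral[OF t(1,2), where 'n = 'n] by blast
  define c where "c = 2 ^ CARD('n) * \<gamma> ^ (CARD('n) - 1)"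
  have c: "0 < c" using g by (simp add: c_def)
  define C where "C = c powr t * (real (CARD('n) + 1) * K)"
  have C: "0 < C" using c K by (simp add: C_def)
  have "(\<forall>x\<in>elem \<tau>. \<gamma> powr (- t) * hsize \<tau> powr (- 2 * s) \<le> (1 / weight s \<T> x)\<^sup>2) \<and>
     (\<integral>\<^sup>+x. ennreal ((1 / weight s \<T> x)\<^sup>2) * indicator (elem \<tau>) x \<partial>lborel)
       \<le> ennreal (C * hsize \<tau> powr (- 2 * s) * vol (verts \<tau>))"
    if m: "fe_mesh \<Omega> \<T>" and sh: "shape_regular \<gamma> \<T>" and tt: "\<tau> \<in> \<T>" for \<Omega> :: "(real^'n) set" and \<T> \<tau>
  proof -
    interpret fe_mesh \<Omega> \<T> by (rule m)
    note N = N_T[OF tt] and v = valid_T[OF tt]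
    define h where "h = hsize \<tau>"
    have h: "0 < h" using hsize_pos[OF v] by (simp add: h_def)
    have ch: "0 < c / h" using c h by simp
    have lower: "\<exists>a\<in>verts \<tau>. bary (verts \<tau>) x a * (h / c) \<le> skeleton_dist \<T> x" if x: "x \<in> elem \<tau>" for x
      using skeleton_dist_lower[OF tt x ch] bary_lipschitz_hsize[OF sh g tt] by (simp add: c_def h_def)
    have bpos: "0 < bary (verts \<tau>) x a" if "x \<in> elem \<tau>" "a \<in> verts \<tau>" for x a
      using that elem_iff_bary[OF v] by blast
    have wpos: "0 < skeleton_dist \<T> x" if x: "x \<in> elem \<tau>" for x
    proof -
      obtain a where "a \<in> verts \<tau>" "bary (verts \<tau>) x a * (h / c) \<le> skeleton_dist \<T> x" using lower[OF x] by blast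
      moreover have "0 < bary (verts \<tau>) x a * (h / c)" using bpos[OF x] calculation h c by simp
      ultimately show ?thesis by linarith
    qed
    have w: "(1 / weight s \<T> x)\<^sup>2 = h powr (- 1) * skeleton_dist \<T> x powr (- t)" if x: "x \<in> elem \<tau>" for x
    proof -
      have "- 2 * (s - 1/2) = - t" by (simp add: t_def)
      moreover have "1 / weight s \<T> x = (1 / h powr (1/2)) * (1 / skeleton_dist \<T> x powr (s - 1/2))"
        using mesh_width_elem[OF tt x] False by (simp add: weight_def h_def)
      ultimately show ?thesis
        using inverse_powr_square[of h "1/2"] inverse_powr_square[of "skeleton_dist \<T> x" "s - 1/2"]
        by (simp only: power_mult_distrib) simp
    qed
    have hh: "h powr (- 1) * h powr (- t) = h powr (- 2 * s)"
      unfolding powr_add[symmetric] by (simp add: t_def)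
    have low: "\<gamma> powr (- t) * h powr (- 2 * s) \<le> (1 / weight s \<T> x)\<^sup>2" if x: "x \<in> elem \<tau>" for x
    proof -
      have "skeleton_dist \<T> x \<le> \<gamma> * h"
        using skeleton_dist_upper[OF tt x] shape_diam[OF sh tt v] by (simp add: h_def)
      then have "(\<gamma> * h) powr (- t) \<le> skeleton_dist \<T> x powr (- t)"
        using wpos[OF x] t by (intro powr_mono2') auto
      then have "h powr (- 1) * (\<gamma> powr (- t) * h powr (- t)) \<le> (1 / weight s \<T> x)\<^sup>2"
        unfolding w[OF x] using g h by (intro mult_left_mono) (simp_all add: powr_mult)
      then show ?thesis unfolding hh[symmetric] by (simp add: mult_ac)
    qed
    define A where "A = h powr (- 1) * (h / c) powr (- t)"
    have A: "0 \<le> A" by (simp add: A_def)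
    \<comment> \<open>The vertex for which the lower bound on the distance holds varies with
      \<open>x\<close>; the sum over all vertices dominates each single term and has an integral
      independent of this choice.\<close>
    have up: "(1 / weight s \<T> x)\<^sup>2 \<le> A * (\<Sum>a\<in>verts \<tau>. bary (verts \<tau>) x a powr (- t))"
      if x: "x \<in> elem \<tau>" for x
    proof -
      obtain a where a: "a \<in> verts \<tau>" "bary (verts \<tau>) x a * (h / c) \<le> skeleton_dist \<T> x" using lower[OF x] by blast
      have p: "0 < bary (verts \<tau>) x a" "0 < h / c" using bpos[OF x a(1)] h c by auto
      have "0 < bary (verts \<tau>) x a * (h / c)" using p by (rule mult_pos_pos)
      then have "skeleton_dist \<T> x powr (- t) \<le> (bary (verts \<tau>) x a * (h / c)) powr (- t)"
        using a(2) t by (intro powr_mono2') simp_all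
      also have "\<dots> = (h / c) powr (- t) * bary (verts \<tau>) x a powr (- t)"
        unfolding mult.commute[of "bary (verts \<tau>) x a"] using p by (simp only: powr_mult less_imp_le)
      also have "\<dots> \<le> (h / c) powr (- t) * (\<Sum>a\<in>verts \<tau>. bary (verts \<tau>) x a powr (- t))"
        using a(1) by (intro mult_left_mono member_le_sum) auto
      finally show ?thesis unfolding w[OF x] A_def mult.assoc by (intro mult_left_mono) simp_all
    qed
    have "(\<integral>\<^sup>+x. ennreal ((1 / weight s \<T> x)\<^sup>2) * indicator (elem \<tau>) x \<partial>lborel)
        \<le> (\<integral>\<^sup>+x. ennreal (A) *
             (\<Sum>a\<in>verts \<tau>. ennreal (bary (verts \<tau>) x a powr (- t)) * indicator (convex hull (verts \<tau>)) x) \<partial>lborel)"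
    proof (rule nn_integral_mono)
      fix x
      show "ennreal ((1 / weight s \<T> x)\<^sup>2) * indicator (elem \<tau>) x
        \<le> ennreal (A) *
             (\<Sum>a\<in>verts \<tau>. ennreal (bary (verts \<tau>) x a powr (- t)) * indicator (convex hull (verts \<tau>)) x)"
      proof (cases "x \<in> elem \<tau>")
        case True
        then have "x \<in> convex hull (verts \<tau>)" using elem_hull[of \<tau>] by blast
        then have "ennreal (A) *
             (\<Sum>a\<in>verts \<tau>. ennreal (bary (verts \<tau>) x a powr (- t)) * indicator (convex hull (verts \<tau>)) x)
            = ennreal (A * (\<Sum>a\<in>verts \<tau>. bary (verts \<tau>) x a powr (- t)))"
          using A by (simp add: sum_ennreal ennreal_mult' sum_nonneg)
        then show ?thesis using up[OF True] True by (simp add: ennreal_leI)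
      qed simp
    qed
    also have "\<dots> = ennreal (A) *
        (\<Sum>a\<in>verts \<tau>. \<integral>\<^sup>+x. ennreal (bary (verts \<tau>) x a powr (- t)) * indicator (convex hull (verts \<tau>)) x \<partial>lborel)"
    proof -
      have m: "(\<lambda>x. ennreal (bary (verts \<tau>) x a powr (- t)) * indicator (convex hull (verts \<tau>)) x) \<in> borel_measurable lborel" for a
      proof -
        have [measurable]: "(\<lambda>x. bary (verts \<tau>) x a) \<in> borel_measurable borel" "convex hull (verts \<tau>) \<in> sets borel"
          using borel_measurable_bary[OF N] hull_props(2)[OF N] by auto
        show ?thesis by measurable
      qed
      show ?thesis
        unfolding nn_integral_cmult[OF borel_measurable_sum[OF m]] nn_integral_sum[OF m] ..
    qed
    also have "\<dots> \<le> ennreal (A) * (\<Sum>a\<in>verts \<tau>. ennreal (K * vol (verts \<tau>)))"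
      using K(2) N by (intro mult_left_mono sum_mono) auto
    also have "(\<Sum>a\<in>verts \<tau>. ennreal (K * vol (verts \<tau>))) = ennreal (real (CARD('n) + 1) * (K * vol (verts \<tau>)))"
      using K(1) hull_props(5)[OF N] nondegD(3)[OF N] by (simp add: ennreal_mult' ennreal_of_nat_eq_real_of_nat del: of_nat_Suc of_nat_add)
    also have "ennreal (A) * ennreal (real (CARD('n) + 1) * (K * vol (verts \<tau>)))
        = ennreal (A * (real (CARD('n) + 1) * (K * vol (verts \<tau>))))"
      by (rule ennreal_mult'[OF A, symmetric])
    also have "A * (real (CARD('n) + 1) * (K * vol (verts \<tau>)))
        = C * h powr (- 2 * s) * vol (verts \<tau>)"
    proof -
      have "(h / c) powr (- t) = h powr (- t) * c powr t"
        using h c by (simp add: powr_divide powr_minus field_simps)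
      then show ?thesis unfolding hh[symmetric] C_def A_def by (simp only: mult_ac)
    qed
    finally show ?thesis using low by (simp add: h_def)
  qed
  moreover have "0 < \<gamma> powr (- t)" using g by simp
  ultimately show ?thesis using C by blast
qed

section \<open>The interpolation operators\<close>

text \<open>Nonnegativity of the integral of \<open>(v x - t * \<psi> x)\<^sup>2\<close> at
  \<open>t = c / m\<close>, where \<open>m = M\<^sup>2 * vol S\<close> replaces the integral of the
  square of \<open>\<psi>\<close>; unlike the latter, \<open>m\<close> is known to be
  positive.\<close>

lemma cauchy_schwarz_bounded:
  fixes \<psi> v :: "real^'n::finite \<Rightarrow> real"
  assumes S: "nondeg S" and M: "0 < M" "\<And>x. x \<in> convex hull S \<Longrightarrow> \<bar>\<psi> x\<bar> \<le> M"
    and int: "set_integrable lborel (convex hull S) (\<lambda>x. (v x)\<^sup>2)" "set_integrable lborel (convex hull S) (\<lambda>x. \<psi> x * v x)"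
      "set_integrable lborel (convex hull S) (\<lambda>x. (\<psi> x)\<^sup>2)"
  shows "(LINT x:convex hull S|lborel. \<psi> x * v x)\<^sup>2 \<le> M\<^sup>2 * vol S * (LINT x:convex hull S|lborel. (v x)\<^sup>2)"
proof -
  let ?E = "convex hull S"
  define c where "c = (LINT x:?E|lborel. \<psi> x * v x)"
  define I where "I = (LINT x:?E|lborel. (v x)\<^sup>2)"
  define n where "n = (LINT x:?E|lborel. (\<psi> x)\<^sup>2)"
  define m where "m = M\<^sup>2 * vol S"
  have m: "0 < m" using M(1) hull_props(5)[OF S] by (simp add: m_def)
  have intc: "set_integrable lborel ?E (\<lambda>x. M\<^sup>2)"
    by (intro nn_integral_compact(1) hull_props(1)[OF S] continuous_intros)
  have "n \<le> (LINT x:?E|lborel. M\<^sup>2)"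
    unfolding n_def by (intro set_integral_mono int intc abs_le_square_iff[THEN iffD1]) (use M in auto)
  also have "\<dots> = m"
    using hull_props(2,3)[OF S] by (simp add: m_def vol_def set_lebesgue_integral_def mult.commute)
  finally have n: "n \<le> m" .
  define t where "t = c / m"
  have "0 \<le> (LINT x:?E|lborel. (v x - t * \<psi> x)\<^sup>2)"
    by (intro set_lebesgue_integral_nonneg_compact) simp
  also have "\<dots> = (LINT x:?E|lborel. ((v x)\<^sup>2 - (2 * t) * (\<psi> x * v x)) + t\<^sup>2 * (\<psi> x)\<^sup>2)"
    by (intro arg_cong[where f="\<lambda>g. set_lebesgue_integral lborel ?E g"] ext) (simp add: power2_eq_square algebra_simps)
  also have "\<dots> = I - 2 * t * c + t\<^sup>2 * n"
    using int unfolding I_def c_def n_def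
    by (simp add: set_integral_add(2) set_integral_diff)
  also have "\<dots> \<le> I - 2 * t * c + t\<^sup>2 * m"
    using n by (intro add_left_mono mult_left_mono) auto
  also have "\<dots> = I - c\<^sup>2 / m"
    using m by (simp add: t_def power2_eq_square field_simps)
  finally show ?thesis
    using m unfolding c_def I_def m_def[symmetric] by (simp add: field_simps)
qed

text \<open>A class containing the discrete functions and closed under differences, on which the
  Bochner integrals in the Scott-Zhang coefficients are genuine. Without integrability they would
  default to 0 and linearity could fail.\<close>

definition bdd_meas :: "(real^'n::finite \<Rightarrow> real) \<Rightarrow> bool" where
  "bdd_meas v \<longleftrightarrow> v \<in> borel_measurable borel \<and> (\<exists>B. \<forall>x. \<bar>v x\<bar> \<le> B)"

lemma bdd_meas_integrable:
  fixes v :: "real^'n::finite \<Rightarrow> real"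
  assumes S: "nondeg S" and v: "bdd_meas v"
  shows "set_integrable lborel (convex hull S) v"
proof -
  obtain B where B: "\<And>x. \<bar>v x\<bar> \<le> B" using v by (auto simp: bdd_meas_def)
  have [measurable]: "v \<in> borel_measurable borel" "convex hull S \<in> sets borel"
    using v hull_props[OF S] by (auto simp: bdd_meas_def)
  have "set_integrable lborel (convex hull S) (\<lambda>_. B)"
    by (intro nn_integral_compact(1) hull_props(1)[OF S] continuous_intros)
  then show ?thesis
    unfolding set_integrable_def
    by (rule Bochner_Integration.integrable_bound)
      (auto simp: indicator_def intro: order_trans[OF B] abs_ge_self)
qed

lemma bdd_meas_diff: "bdd_meas u \<Longrightarrow> bdd_meas v \<Longrightarrow> bdd_meas (\<lambda>x. u x - v x)"
proof -
  assume u: "bdd_meas u" and v: "bdd_meas v"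
  obtain A where A: "\<And>x. \<bar>u x\<bar> \<le> A" using u by (auto simp: bdd_meas_def)
  obtain B where B: "\<And>x. \<bar>v x\<bar> \<le> B" using v by (auto simp: bdd_meas_def)
  have "\<bar>u x - v x\<bar> \<le> A + B" for x using A[of x] B[of x] by linarith
  moreover have "(\<lambda>x. u x - v x) \<in> borel_measurable borel"
    using u v by (intro borel_measurable_diff) (simp_all only: bdd_meas_def)
  ultimately show ?thesis unfolding bdd_meas_def by blast
qed

lemma bdd_meas_mult: "bdd_meas u \<Longrightarrow> bdd_meas v \<Longrightarrow> bdd_meas (\<lambda>x. u x * v x)"
proof -
  assume u: "bdd_meas u" and v: "bdd_meas v"
  obtain A where A: "\<And>x. \<bar>u x\<bar> \<le> A" using u by (auto simp: bdd_meas_def)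
  obtain B where B: "\<And>x. \<bar>v x\<bar> \<le> B" using v by (auto simp: bdd_meas_def)
  have "\<bar>u x * v x\<bar> \<le> A * B" for x
    using A[of x] B[of x] by (simp add: abs_mult mult_mono')
  moreover have "(\<lambda>x. u x * v x) \<in> borel_measurable borel"
    using u v by (intro borel_measurable_times) (simp_all only: bdd_meas_def)
  ultimately show ?thesis unfolding bdd_meas_def by blast
qed

lemma bdd_meas_power2: "bdd_meas u \<Longrightarrow> bdd_meas (\<lambda>x. (u x)\<^sup>2)"
  using bdd_meas_mult[of u u] by (simp add: power2_eq_square)

lemma affine_measurable: "affine_on UNIV f \<Longrightarrow> f \<in> borel_measurable borel"
  and affine_continuous: "affine_on UNIV f \<Longrightarrow> continuous_on A f"
proof -
  assume "affine_on UNIV f"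
  then obtain a b where f: "f = (\<lambda>x. a \<bullet> x + b)" by (auto simp: affine_on_def fun_eq_iff)
  show "f \<in> borel_measurable borel" unfolding f by (intro borel_measurable_continuous_onI continuous_intros)
  show "continuous_on A f" unfolding f by (intro continuous_intros)
qed

lemma affine_on_diff:
  assumes "affine_on UNIV f" "affine_on UNIV g"
  shows "affine_on UNIV (\<lambda>x. f x - g x)"
proof -
  obtain a b c e where "\<forall>x. f x = a \<bullet> x + b" "\<forall>x. g x = c \<bullet> x + e"
    using assms unfolding affine_on_def by auto
  then have "\<forall>x\<in>UNIV. f x - g x = (a - c) \<bullet> x + (b - e)" by (simp add: inner_diff_left)
  then show ?thesis unfolding affine_on_def by blast
qed

lemma affine_moment:
  assumes S: "nondeg S" and f: "affine_on UNIV f" and g: "affine_on UNIV g"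
  shows "(LINT x:convex hull S|lborel. g x * f x) = (\<Sum>v\<in>S. f v * (LINT x:convex hull S|lborel. g x * bary S x v))"
proof -
  have int: "set_integrable lborel (convex hull S) (\<lambda>x. f v * (g x * bary S x v))" for v
    by (intro nn_integral_compact(1) hull_props(1)[OF S] continuous_intros S affine_continuous g)
  have "(LINT x:convex hull S|lborel. g x * f x) = (LINT x:convex hull S|lborel. \<Sum>v\<in>S. f v * (g x * bary S x v))"
    by (intro arg_cong[where f="\<lambda>h. set_lebesgue_integral lborel (convex hull S) h"] ext)
      (subst affine_eq_sum_bary[OF S f], simp add: sum_distrib_left mult_ac)
  also have "\<dots> = (\<Sum>v\<in>S. LINT x:convex hull S|lborel. f v * (g x * bary S x v))"
    using int unfolding set_lebesgue_integral_def set_integrable_def scaleR_sum_right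
    by (simp add: Bochner_Integration.integral_sum)
  finally show ?thesis by simp
qed

context fe_mesh
begin

lemma S1_bdd_meas:
  assumes "p \<in> S1 \<Omega> \<T>"
  shows "bdd_meas p"
proof -
  have "compact (closure \<Omega>)"
    using dom by (simp add: polyhedral_lipschitz_domain_def compact_closure)
  then have "compact (p ` closure \<Omega>)"
    using assms by (intro compact_continuous_image) (auto simp: S1_def)
  then obtain B where "\<forall>y\<in>p ` closure \<Omega>. norm y \<le> B"
    using compact_imp_bounded bounded_iff by blast
  then have "\<bar>p x\<bar> \<le> max B 0" for x
    using assms by (cases "x \<in> closure \<Omega>") (auto simp: S1_def le_max_iff_disj)
  then show ?thesis using S10_measurable[OF assms] unfolding bdd_meas_def by blast
qed

text \<open>Gives the description operator in \<open>dual_basis\<close> its value: the function from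
  \<open>dual_function\<close> satisfies the conditions, and it is the only affine one that
  does.\<close>

lemma dual_basis_spec:
  assumes K: "\<forall>S :: (real^'n) set. nondeg S \<longrightarrow> dual_bounded K S"
    and t: "\<tau> \<in> \<T>" and z: "z \<in> verts \<tau>"
  shows "affine_on UNIV (dual_basis \<Omega> \<T> \<tau> z)"
    and "\<And>v. v \<in> verts \<tau> \<Longrightarrow> (LINT x:convex hull (verts \<tau>)|lborel. dual_basis \<Omega> \<T> \<tau> z x * bary (verts \<tau>) x v) = (if v = z then 1 else 0)"
    and "\<And>x. x \<in> convex hull (verts \<tau>) \<Longrightarrow> \<bar>dual_basis \<Omega> \<T> \<tau> z x\<bar> \<le> K / vol (verts \<tau>)"
proof -
  note N = N_T[OF t]
  obtain \<psi> where p: "affine_on UNIV \<psi>"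
    "\<forall>v\<in>verts \<tau>. (LINT x:convex hull (verts \<tau>)|lborel. \<psi> x * bary (verts \<tau>) x v) = (if v = z then 1 else 0)"
    "\<forall>x\<in>convex hull (verts \<tau>). \<bar>\<psi> x\<bar> \<le> K / vol (verts \<tau>)"
    using K[rule_format, OF N] z unfolding dual_bounded_def by blast
  have conv: "(LINT x:elem \<tau>|lborel. g x * hat \<Omega> \<T> v x) = (LINT x:convex hull (verts \<tau>)|lborel. g x * bary (verts \<tau>) x v)"
    if g: "affine_on UNIV g" for g v
  proof -
    have "(LINT x:elem \<tau>|lborel. g x * hat \<Omega> \<T> v x) = (LINT x:elem \<tau>|lborel. g x * bary (verts \<tau>) x v)"
      using open_elem[of \<tau>] elem_hull[of \<tau>]
      by (intro set_lebesgue_integral_cong) (auto simp: hat_eq hat_fun_bary[OF t] borel_open)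
    also have "\<dots> = (LINT x:convex hull (verts \<tau>)|lborel. g x * bary (verts \<tau>) x v)"
      unfolding elem_def
      by (intro set_integral_interior_hull N borel_measurable_times affine_measurable g borel_measurable_bary)
    finally show ?thesis .
  qed
  have "dual_basis \<Omega> \<T> \<tau> z = \<psi>"
    unfolding dual_basis_def
  proof (rule the_equality)
    show "affine_on UNIV \<psi> \<and> (\<forall>z'\<in>verts \<tau>. (LINT x:elem \<tau>|lborel. \<psi> x * hat \<Omega> \<T> z' x) = (if z' = z then 1 else 0))"
      using p conv by simp
    fix \<psi>' assume p': "affine_on UNIV \<psi>' \<and> (\<forall>z'\<in>verts \<tau>. (LINT x:elem \<tau>|lborel. \<psi>' x * hat \<Omega> \<T> z' x) = (if z' = z then 1 else 0))"
    define g where "g x = \<psi>' x - \<psi> x" for x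
    have g: "affine_on UNIV g" unfolding g_def[abs_def] using p p' by (intro affine_on_diff) auto
    have zero: "(LINT x:convex hull (verts \<tau>)|lborel. g x * bary (verts \<tau>) x v) = 0" if v: "v \<in> verts \<tau>" for v
    proof -
      have i: "set_integrable lborel (convex hull (verts \<tau>)) (\<lambda>x. h x * bary (verts \<tau>) x v)" if "affine_on UNIV h" for h
        by (intro nn_integral_compact(1) hull_props(1)[OF N] continuous_intros N affine_continuous that)
      have "(LINT x:convex hull (verts \<tau>)|lborel. g x * bary (verts \<tau>) x v) =
        (LINT x:convex hull (verts \<tau>)|lborel. \<psi>' x * bary (verts \<tau>) x v) - (LINT x:convex hull (verts \<tau>)|lborel. \<psi> x * bary (verts \<tau>) x v)"
        unfolding g_def left_diff_distrib using p p' by (intro set_integral_diff(2) i) auto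
      also have "\<dots> = 0" using p(2) conjunct2[OF p'] conv[OF conjunct1[OF p'], of v] v by simp
      finally show ?thesis .
    qed
    obtain C where C: "0 < C" "\<forall>(S :: (real^'n) set) f a. nondeg S \<longrightarrow> affine_on UNIV f \<longrightarrow> a \<in> S \<longrightarrow>
       (f a)\<^sup>2 * vol S \<le> C * (LINT x:convex hull S|lborel. (f x)\<^sup>2)"
      using affine_vertex_bound[where 'n = 'n] by blast
    \<comment> \<open>The difference \<open>g\<close> is orthogonal to all coordinates and, being
      affine, is a combination of them, hence orthogonal to itself. The vertex bound then kills its
      vertex values.\<close>
    have "(LINT x:convex hull (verts \<tau>)|lborel. (g x)\<^sup>2) = 0"
      unfolding power2_eq_square affine_moment[OF N g g] using zero by simp
    then have gv: "g a = 0" if "a \<in> verts \<tau>" for a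
      using C(2)[rule_format, OF N g that] hull_props(5)[OF N] by (simp add: mult_le_0_iff)
    have "g x = 0" for x
      using affine_eq_sum_bary[OF N g, of x] gv by simp
    then show "\<psi>' = \<psi>" by (simp add: g_def fun_eq_iff)
  qed
  then show "affine_on UNIV (dual_basis \<Omega> \<T> \<tau> z)"
    "\<And>v. v \<in> verts \<tau> \<Longrightarrow> (LINT x:convex hull (verts \<tau>)|lborel. dual_basis \<Omega> \<T> \<tau> z x * bary (verts \<tau>) x v) = (if v = z then 1 else 0)"
    "\<And>x. x \<in> convex hull (verts \<tau>) \<Longrightarrow> \<bar>dual_basis \<Omega> \<T> \<tau> z x\<bar> \<le> K / vol (verts \<tau>)"
    using p by simp_all
qed

section \<open>Nodal coefficients and element energies\<close>

definition coef :: "(real^'n \<Rightarrow> 'n tsimplex) \<Rightarrow> (real^'n \<Rightarrow> real) \<Rightarrow> real^'n \<Rightarrow> real" where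
  "coef Tz v z = (LINT y:elem (Tz z)|lborel. dual_basis \<Omega> \<T> (Tz z) z y * v y)"

text \<open>Common form of both operators: nodal interpolation has the coefficients \<open>v\<close>
  itself, the Scott-Zhang projection has \<open>coef Tz v\<close>. Only the stability of the
  coefficients differs.\<close>

definition hat_sum :: "(real^'n \<Rightarrow> real) \<Rightarrow> real^'n \<Rightarrow> real" where
  "hat_sum c x = (\<Sum>z\<in>interior_nodes \<Omega> \<T>. c z * nodal_basis \<Omega> \<T> z x)"

lemma scott_zhang_hat_sum: "scott_zhang \<Omega> \<T> Tz v = hat_sum (coef Tz v)"
  by (simp add: scott_zhang_def hat_sum_def coef_def fun_eq_iff)

lemma interpolation_hat_sum: "nodal_interpolation \<Omega> \<T> v = hat_sum v"
  by (simp add: nodal_interpolation_def hat_sum_def fun_eq_iff)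

lemma hat_sum_elem: "\<tau> \<in> \<T> \<Longrightarrow> x \<in> convex hull (verts \<tau>) \<Longrightarrow> hat_sum c x = (\<Sum>z\<in>verts \<tau> \<inter> \<Omega>. c z * bary (verts \<tau>) x z)"
  unfolding hat_sum_def by (rule nodal_sum)

lemma hat_sum_diff: "hat_sum (\<lambda>z. a z - b z) x = hat_sum a x - hat_sum b x"
  by (simp add: hat_sum_def left_diff_distrib sum_subtractf)

lemma hat_sum_node:
  assumes z: "z \<in> interior_nodes \<Omega> \<T>"
  shows "hat_sum c z = c z"
proof -
  have "hat_sum c z = (\<Sum>w\<in>interior_nodes \<Omega> \<T>. if w = z then c w else 0)"
    unfolding hat_sum_def using z hat_fun_node by (intro sum.cong) (auto simp: nodal_basis_eq interior_nodes_def)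
  then show ?thesis using z interior_nodes_finite by simp
qed

lemma hat_sum_cong: "(\<And>z. z \<in> interior_nodes \<Omega> \<T> \<Longrightarrow> a z = b z) \<Longrightarrow> hat_sum a = hat_sum b"
  by (simp add: hat_sum_def fun_eq_iff)

lemma hat_sum_bdd_meas: "bdd_meas (hat_sum c)"
proof -
  have meas: "nodal_basis \<Omega> \<T> z \<in> borel_measurable borel" if "z \<in> interior_nodes \<Omega> \<T>" for z
    unfolding nodal_basis_eq[OF that] by (rule S10_measurable[OF hat_fun_S1])
  have "(\<lambda>x. hat_sum c x) \<in> borel_measurable borel"
    unfolding hat_sum_def using meas by (intro borel_measurable_sum borel_measurable_times) auto
  moreover have "\<bar>hat_sum c x\<bar> \<le> (\<Sum>z\<in>interior_nodes \<Omega> \<T>. \<bar>c z\<bar>)" for x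
  proof -
    have b: "\<bar>nodal_basis \<Omega> \<T> z x\<bar> \<le> 1" if z: "z \<in> interior_nodes \<Omega> \<T>" for z
    proof (cases "x \<in> closure \<Omega>")
      case True
      then obtain \<tau> where t: "\<tau> \<in> \<T>" "x \<in> convex hull (verts \<tau>)" using cover by blast
      show ?thesis
        unfolding nodal_basis_eq[OF z] hat_fun_bary[OF t]
        using bary_nonneg[OF N_T[OF t(1)] t(2), of z] bary_le_1[OF N_T[OF t(1)] t(2), of z] by simp
    qed (simp add: nodal_basis_eq[OF z] hat_fun_def)
    have "\<bar>hat_sum c x\<bar> \<le> (\<Sum>z\<in>interior_nodes \<Omega> \<T>. \<bar>c z * nodal_basis \<Omega> \<T> z x\<bar>)"
      unfolding hat_sum_def by (rule sum_abs)
    also have "\<dots> \<le> (\<Sum>z\<in>interior_nodes \<Omega> \<T>. \<bar>c z\<bar>)"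
      using b by (intro sum_mono) (simp add: abs_mult mult_left_le)
    finally show ?thesis .
  qed
  ultimately show ?thesis unfolding bdd_meas_def by blast
qed

lemma hat_sum_affine:
  assumes t: "\<tau> \<in> \<T>"
  shows "\<exists>f. affine_on UNIV f \<and> (\<forall>x\<in>convex hull (verts \<tau>). hat_sum c x = f x)"
proof -
  have lin: "affine_on UNIV (\<lambda>x. \<Sum>z\<in>A. c z * bary (verts \<tau>) x z)" if "finite A" for A
    using that
  proof (induction A rule: finite_induct)
    case empty
    have "\<forall>x\<in>UNIV. (\<Sum>z\<in>{}. c z * bary (verts \<tau>) x z) = 0 \<bullet> x + 0" by simp
    then show ?case unfolding affine_on_def by blast
  next
    case (insert z A)
    obtain a b where ab: "\<forall>x. (\<Sum>z\<in>A. c z * bary (verts \<tau>) x z) = a \<bullet> x + b"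
      using insert.IH unfolding affine_on_def by auto
    obtain n e where n: "\<And>x. bary (verts \<tau>) x z = n \<bullet> x + e" using bary_inner[OF N_T[OF t]] by blast
    have "\<forall>x\<in>UNIV. (\<Sum>z\<in>insert z A. c z * bary (verts \<tau>) x z) = (c z *\<^sub>R n + a) \<bullet> x + (c z * e + b)"
      using insert.hyps ab n by (simp add: inner_add_left algebra_simps)
    then show ?case unfolding affine_on_def by blast
  qed
  show ?thesis
    by (intro exI[of _ "\<lambda>x. \<Sum>z\<in>verts \<tau> \<inter> \<Omega>. c z * bary (verts \<tau>) x z"] conjI lin) (simp_all add: hat_sum_elem[OF t])
qed

lemma coef_hull:
  assumes K: "\<forall>S :: (real^'n) set. nondeg S \<longrightarrow> dual_bounded K S"
    and t: "Tz z \<in> \<T>" "z \<in> verts (Tz z)" and v: "bdd_meas v"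
  shows "coef Tz v z = (LINT y:convex hull (verts (Tz z))|lborel. dual_basis \<Omega> \<T> (Tz z) z y * v y)"
    and "set_integrable lborel (convex hull (verts (Tz z))) (\<lambda>y. dual_basis \<Omega> \<T> (Tz z) z y * v y)"
proof -
  note d = dual_basis_spec[OF K t] and N = N_T[OF t(1)]
  let ?\<psi> = "dual_basis \<Omega> \<T> (Tz z) z"
  have vm: "v \<in> borel_measurable borel" using v by (simp add: bdd_meas_def)
  show "coef Tz v z = (LINT y:convex hull (verts (Tz z))|lborel. ?\<psi> y * v y)"
    unfolding coef_def elem_def
    by (intro set_integral_interior_hull N borel_measurable_times affine_measurable d vm)
  obtain B where B: "\<And>x. \<bar>v x\<bar> \<le> B" using v by (auto simp: bdd_meas_def)
  have B0: "0 \<le> B" using B[of 0] by linarith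
  have [measurable]: "v \<in> borel_measurable borel" "convex hull (verts (Tz z)) \<in> sets borel" "?\<psi> \<in> borel_measurable borel"
    using vm hull_props[OF N] affine_measurable[OF d(1)] by auto
  have "set_integrable lborel (convex hull (verts (Tz z))) (\<lambda>y. B * ?\<psi> y)"
    by (intro nn_integral_compact(1) hull_props(1)[OF N] continuous_intros affine_continuous d(1))
  then show "set_integrable lborel (convex hull (verts (Tz z))) (\<lambda>y. ?\<psi> y * v y)"
    unfolding set_integrable_def
  proof (rule Bochner_Integration.integrable_bound)
    show "AE y in lborel. norm (indicator (convex hull (verts (Tz z))) y *\<^sub>R (?\<psi> y * v y))
        \<le> norm (indicator (convex hull (verts (Tz z))) y *\<^sub>R (B * ?\<psi> y))"
    proof (rule AE_I2)
      fix y
      have "\<bar>?\<psi> y\<bar> * \<bar>v y\<bar> \<le> B * \<bar>?\<psi> y\<bar>" using B[of y] by (subst mult.commute) (rule mult_right_mono, simp_all)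
      then show "norm (indicator (convex hull (verts (Tz z))) y *\<^sub>R (?\<psi> y * v y))
        \<le> norm (indicator (convex hull (verts (Tz z))) y *\<^sub>R (B * ?\<psi> y))"
        using B0 by (auto simp: indicator_def abs_mult)
    qed
  qed measurable
qed

lemma coef_diff:
  assumes K: "\<forall>S :: (real^'n) set. nondeg S \<longrightarrow> dual_bounded K S"
    and t: "Tz z \<in> \<T>" "z \<in> verts (Tz z)" and uv: "bdd_meas u" "bdd_meas v"
  shows "coef Tz (\<lambda>x. u x - v x) z = coef Tz u z - coef Tz v z"
proof -
  note cu = coef_hull[where Tz = Tz and z = z, OF K t uv(1)] and cv = coef_hull[where Tz = Tz and z = z, OF K t uv(2)]
  show ?thesis
    unfolding coef_hull(1)[where Tz = Tz and z = z, OF K t bdd_meas_diff[OF uv]] cu(1) cv(1) right_diff_distrib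
    by (rule set_integral_diff(2)[OF cu(2) cv(2)])
qed

text \<open>The projection property of the Scott-Zhang operator: on the chosen element a hat sum is
  affine, so pairing it with the dual function extracts its value at \<open>z\<close>.\<close>

lemma coef_affine:
  assumes K: "\<forall>S :: (real^'n) set. nondeg S \<longrightarrow> dual_bounded K S"
    and t: "Tz z \<in> \<T>" "z \<in> verts (Tz z)" and z: "z \<in> interior_nodes \<Omega> \<T>"
  shows "coef Tz (hat_sum c) z = c z"
proof -
  note d = dual_basis_spec[OF K t] and N = N_T[OF t(1)]
  obtain f where f: "affine_on UNIV f" "\<forall>x\<in>convex hull (verts (Tz z)). hat_sum c x = f x"
    using hat_sum_affine[OF t(1)] by blast
  have "coef Tz (hat_sum c) z = (LINT y:convex hull (verts (Tz z))|lborel. dual_basis \<Omega> \<T> (Tz z) z y * hat_sum c y)"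
    by (rule coef_hull(1)[where Tz = Tz and z = z, OF K t hat_sum_bdd_meas])
  also have "\<dots> = (LINT y:convex hull (verts (Tz z))|lborel. dual_basis \<Omega> \<T> (Tz z) z y * f y)"
    using f(2) hull_props(2)[OF N] by (intro set_lebesgue_integral_cong) auto
  also have "\<dots> = (\<Sum>v\<in>verts (Tz z). f v * (if v = z then 1 else 0))"
    unfolding affine_moment[OF N f(1) d(1)] using d(2) by (intro sum.cong) auto
  also have "\<dots> = f z" using t(2) by (simp add: if_distrib cong: if_cong)
  also have "\<dots> = hat_sum c z" using f(2) t(2) by (simp add: hull_inc)
  also have "\<dots> = c z" by (rule hat_sum_node[OF z])
  finally show ?thesis .
qed

lemma coef_bound:
  assumes K: "\<forall>S :: (real^'n) set. nondeg S \<longrightarrow> dual_bounded K S" "0 < K"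
    and t: "Tz z \<in> \<T>" "z \<in> verts (Tz z)" and v: "bdd_meas v"
  shows "(coef Tz v z)\<^sup>2 * vol (verts (Tz z)) \<le> K\<^sup>2 * (LINT y:convex hull (verts (Tz z))|lborel. (v y)\<^sup>2)"
proof -
  let ?S = "verts (Tz z)"
  note d = dual_basis_spec[OF K(1) t] and N = N_T[OF t(1)]
  have V: "0 < vol ?S" using hull_props(5)[OF N] .
  have "(coef Tz v z)\<^sup>2 \<le> (K / vol ?S)\<^sup>2 * vol ?S * (LINT y:convex hull ?S|lborel. (v y)\<^sup>2)"
    unfolding coef_hull(1)[where Tz = Tz and z = z, OF K(1) t v]
    using K(2) V d(3)
    by (intro cauchy_schwarz_bounded N coef_hull(2)[where Tz = Tz and z = z, OF K(1) t v] bdd_meas_integrable bdd_meas_power2 v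
        nn_integral_compact(1) hull_props(1) continuous_intros affine_continuous d(1)) auto
  then have "(coef Tz v z)\<^sup>2 * vol ?S \<le> (K / vol ?S)\<^sup>2 * vol ?S * (LINT y:convex hull ?S|lborel. (v y)\<^sup>2) * vol ?S"
    using V by (intro mult_right_mono) auto
  then show ?thesis using V by (simp add: power_divide power2_eq_square field_simps)
qed

text \<open>Squared weighted norm on one element, with values in \<open>[0, \<infinity>]\<close>, so
  that sums over elements and nodes can be rearranged without integrability of the singular
  weight.\<close>

definition energy :: "real \<Rightarrow> (real^'n \<Rightarrow> real) \<Rightarrow> 'n tsimplex \<Rightarrow> ennreal" where
  "energy s u \<tau> = (\<integral>\<^sup>+x. ennreal (((1 / weight s \<T> x) * u x)\<^sup>2) * indicator (elem \<tau>) x \<partial>lborel)"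

lemma energy_sum:
  assumes "u \<in> borel_measurable borel"
  shows "(\<integral>\<^sup>+x\<in>\<Omega>. ennreal (((1 / weight s \<T> x) * u x)\<^sup>2) \<partial>lborel) = (\<Sum>\<tau>\<in>\<T>. energy s u \<tau>)"
proof -
  have [measurable]: "u \<in> borel_measurable borel" "weight s \<T> \<in> borel_measurable borel" using assms weight_measurable by auto
  have el[measurable]: "elem \<tau> \<in> sets borel" for \<tau> :: "'n tsimplex" using open_elem by (rule borel_open)
  have "AE x in lborel. \<forall>\<tau>\<in>\<T>. x \<in> elem \<tau> \<longleftrightarrow> x \<in> convex hull (verts \<tau>)"
    unfolding elem_def using fin_T AE_interior_hull_iff[OF N_T] by (intro AE_finite_allI) auto
  then have "AE x in lborel. ennreal (((1 / weight s \<T> x) * u x)\<^sup>2) * indicator \<Omega> x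
      = (\<Sum>\<tau>\<in>\<T>. ennreal (((1 / weight s \<T> x) * u x)\<^sup>2) * indicator (elem \<tau>) x)"
  proof eventually_elim
    case (elim x)
    show ?case
    proof (cases "x \<in> \<Omega>")
      case True
      then have "x \<in> closure \<Omega>" using closure_subset by blast
      then obtain \<tau> where t: "\<tau> \<in> \<T>" "x \<in> elem \<tau>" using cover elim by blast
      have "indicator (elem \<sigma>) x = (if \<sigma> = \<tau> then 1 else 0 :: ennreal)" if s: "\<sigma> \<in> \<T>" for \<sigma>
        using elem_disjoint[OF conf_T inj_T t(1) s t(2)] elem_hull[of \<sigma>] t(2) by (auto simp: indicator_def)
      then have "(\<Sum>\<sigma>\<in>\<T>. ennreal (((1 / weight s \<T> x) * u x)\<^sup>2) * indicator (elem \<sigma>) x)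
          = (\<Sum>\<sigma>\<in>\<T>. if \<sigma> = \<tau> then ennreal (((1 / weight s \<T> x) * u x)\<^sup>2) else 0)"
        by (intro sum.cong) auto
      then show ?thesis using True t(1) fin_T by simp
    next
      case False
      then have "x \<notin> elem \<tau>" if "\<tau> \<in> \<T>" for \<tau> using elem_sub[OF that] by blast
      then show ?thesis using False by simp
    qed
  qed
  then have "(\<integral>\<^sup>+x\<in>\<Omega>. ennreal (((1 / weight s \<T> x) * u x)\<^sup>2) \<partial>lborel)
     = (\<integral>\<^sup>+x. (\<Sum>\<tau>\<in>\<T>. ennreal (((1 / weight s \<T> x) * u x)\<^sup>2) * indicator (elem \<tau>) x) \<partial>lborel)"
    by (rule nn_integral_cong_AE)
  also have "\<dots> = (\<Sum>\<tau>\<in>\<T>. energy s u \<tau>)"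
    unfolding energy_def by (rule nn_integral_sum) measurable
  finally show ?thesis .
qed

lemma energy_diff:
  assumes "u \<in> borel_measurable borel" "v \<in> borel_measurable borel"
  shows "energy s (\<lambda>x. u x - v x) \<tau> \<le> 2 * energy s u \<tau> + 2 * energy s v \<tau>"
proof -
  have [measurable]: "u \<in> borel_measurable borel" "v \<in> borel_measurable borel" "weight s \<T> \<in> borel_measurable borel"
    using assms weight_measurable by auto
  have el[measurable]: "elem \<tau> \<in> sets borel" using open_elem by (rule borel_open)
  have "energy s (\<lambda>x. u x - v x) \<tau> \<le> (\<integral>\<^sup>+x. 2 * (ennreal (((1 / weight s \<T> x) * u x)\<^sup>2) * indicator (elem \<tau>) x)
      + 2 * (ennreal (((1 / weight s \<T> x) * v x)\<^sup>2) * indicator (elem \<tau>) x) \<partial>lborel)"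
    unfolding energy_def
  proof (rule nn_integral_mono)
    fix x
    define a where "a = (1 / weight s \<T> x) * u x"
    define b where "b = (1 / weight s \<T> x) * v x"
    have "(a - b)\<^sup>2 \<le> 2 * a\<^sup>2 + 2 * b\<^sup>2"
      using zero_le_power2[of "a + b"] by (simp add: power2_eq_square algebra_simps)
    then have "ennreal ((a - b)\<^sup>2) \<le> ennreal (2 * a\<^sup>2 + 2 * b\<^sup>2)" by (rule ennreal_leI)
    also have "\<dots> = 2 * ennreal (a\<^sup>2) + 2 * ennreal (b\<^sup>2)"
      by (simp add: ennreal_mult')
    finally have "ennreal ((a - b)\<^sup>2) \<le> 2 * ennreal (a\<^sup>2) + 2 * ennreal (b\<^sup>2)" .
    then show "ennreal (((1 / weight s \<T> x) * (u x - v x))\<^sup>2) * indicator (elem \<tau>) x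
      \<le> 2 * (ennreal (((1 / weight s \<T> x) * u x)\<^sup>2) * indicator (elem \<tau>) x)
        + 2 * (ennreal (((1 / weight s \<T> x) * v x)\<^sup>2) * indicator (elem \<tau>) x)"
      unfolding right_diff_distrib a_def[symmetric] b_def[symmetric] by (simp add: indicator_def)
  qed
  also have "\<dots> = 2 * energy s u \<tau> + 2 * energy s v \<tau>"
    unfolding energy_def by (subst nn_integral_add) (auto simp: nn_integral_cmult)
  finally show ?thesis .
qed

text \<open>By Cauchy-Schwarz the square of a hat sum is at most the sum of the squared
  coefficients, since squares of coordinates sum to at most 1. This pointwise bound leaves the
  weight alone under the integral.\<close>

lemma energy_hat_sum:
  assumes t: "\<tau> \<in> \<T>" and W: "(\<integral>\<^sup>+x. ennreal ((1 / weight s \<T> x)\<^sup>2) * indicator (elem \<tau>) x \<partial>lborel) \<le> ennreal w"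
  shows "energy s (hat_sum c) \<tau> \<le> (\<Sum>z\<in>verts \<tau> \<inter> \<Omega>. ennreal ((c z)\<^sup>2 * w))"
proof -
  note N = N_T[OF t]
  let ?c = "\<Sum>z\<in>verts \<tau> \<inter> \<Omega>. (c z)\<^sup>2"
  have [measurable]: "weight s \<T> \<in> borel_measurable borel" "elem \<tau> \<in> sets borel"
    using weight_measurable borel_open[OF open_elem[of \<tau>]] by auto
  have b: "(hat_sum c x)\<^sup>2 \<le> ?c" if x: "x \<in> elem \<tau>" for x
  proof -
    have xh: "x \<in> convex hull (verts \<tau>)" using x elem_hull[of \<tau>] by blast
    have "(hat_sum c x)\<^sup>2 \<le> ?c * (\<Sum>z\<in>verts \<tau> \<inter> \<Omega>. (bary (verts \<tau>) x z)\<^sup>2)"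
      unfolding hat_sum_elem[OF t xh] by (rule Cauchy_Schwarz_ineq_sum)
    also have "\<dots> \<le> ?c * 1"
    proof (intro mult_left_mono sum_nonneg)
      have "(\<Sum>z\<in>verts \<tau> \<inter> \<Omega>. (bary (verts \<tau>) x z)\<^sup>2) \<le> (\<Sum>z\<in>verts \<tau> \<inter> \<Omega>. bary (verts \<tau>) x z)"
        using bary_nonneg[OF N xh] bary_le_1[OF N xh]
        by (intro sum_mono) (simp add: power2_eq_square mult_left_le)
      also have "\<dots> \<le> (\<Sum>z\<in>verts \<tau>. bary (verts \<tau>) x z)"
        using bary_nonneg[OF N xh] by (intro sum_mono2) auto
      finally show "(\<Sum>z\<in>verts \<tau> \<inter> \<Omega>. (bary (verts \<tau>) x z)\<^sup>2) \<le> 1" using sum_bary[OF N] by simp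
    qed simp
    finally show ?thesis by simp
  qed
  have c0: "0 \<le> ?c" by (intro sum_nonneg) simp
  have "energy s (hat_sum c) \<tau> \<le> (\<integral>\<^sup>+x. ennreal ?c * (ennreal ((1 / weight s \<T> x)\<^sup>2) * indicator (elem \<tau>) x) \<partial>lborel)"
    unfolding energy_def
  proof (rule nn_integral_mono)
    fix x
    show "ennreal (((1 / weight s \<T> x) * hat_sum c x)\<^sup>2) * indicator (elem \<tau>) x
        \<le> ennreal ?c * (ennreal ((1 / weight s \<T> x)\<^sup>2) * indicator (elem \<tau>) x)"
    proof (cases "x \<in> elem \<tau>")
      case True
      have "((1 / weight s \<T> x) * hat_sum c x)\<^sup>2 \<le> ?c * (1 / weight s \<T> x)\<^sup>2"
        unfolding power_mult_distrib mult.commute[of "(1 / weight s \<T> x)\<^sup>2"]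
        using b[OF True] by (intro mult_right_mono) simp_all
      then show ?thesis using True c0 by (simp add: ennreal_mult[symmetric] ennreal_leI)
    qed simp
  qed
  also have "\<dots> = ennreal ?c * (\<integral>\<^sup>+x. ennreal ((1 / weight s \<T> x)\<^sup>2) * indicator (elem \<tau>) x \<partial>lborel)"
    by (rule nn_integral_cmult) measurable
  also have "\<dots> \<le> ennreal ?c * ennreal w" by (rule mult_left_mono[OF W]) simp
  also have "\<dots> = (\<Sum>z\<in>verts \<tau> \<inter> \<Omega>. ennreal ((c z)\<^sup>2) * ennreal w)"
    by (simp only: sum_distrib_right[symmetric] sum_ennreal zero_le_power2)
  also have "\<dots> = (\<Sum>z\<in>verts \<tau> \<inter> \<Omega>. ennreal ((c z)\<^sup>2 * w))"
    by (intro sum.cong HOL.refl ennreal_mult'[symmetric]) simp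
  finally show ?thesis .
qed

lemma energy_lower:
  assumes t: "\<tau> \<in> \<T>" and w: "\<forall>x\<in>elem \<tau>. w \<le> (1 / weight s \<T> x)\<^sup>2" "0 \<le> w" and u: "bdd_meas u"
  shows "ennreal (w * (LINT x:convex hull (verts \<tau>)|lborel. (u x)\<^sup>2)) \<le> energy s u \<tau>"
proof -
  note N = N_T[OF t]
  have um: "(\<lambda>x. (u x)\<^sup>2) \<in> borel_measurable borel" using bdd_meas_power2[OF u] by (simp add: bdd_meas_def)
  have int: "set_integrable lborel (convex hull (verts \<tau>)) (\<lambda>x. (u x)\<^sup>2)" by (rule bdd_meas_integrable[OF N bdd_meas_power2[OF u]])
  have "ennreal (w * (LINT x:convex hull (verts \<tau>)|lborel. (u x)\<^sup>2)) = ennreal (LINT x:convex hull (verts \<tau>)|lborel. w * (u x)\<^sup>2)"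
    by simp
  also have "\<dots> = (\<integral>\<^sup>+x. ennreal (indicator (convex hull (verts \<tau>)) x *\<^sub>R (w * (u x)\<^sup>2)) \<partial>lborel)"
    unfolding set_lebesgue_integral_def
  proof (rule nn_integral_eq_integral[symmetric])
    show "integrable lborel (\<lambda>x. indicator (convex hull (verts \<tau>)) x *\<^sub>R (w * (u x)\<^sup>2))"
      using set_integrable_mult_right[of w lborel "convex hull (verts \<tau>)" "\<lambda>x. (u x)\<^sup>2"] int
      unfolding set_integrable_def by simp
    show "AE x in lborel. 0 \<le> indicator (convex hull (verts \<tau>)) x *\<^sub>R (w * (u x)\<^sup>2)"
      using w(2) by (intro AE_I2) (simp add: indicator_def)
  qed
  also have "\<dots> = (\<integral>\<^sup>+x. ennreal (w * (u x)\<^sup>2) * indicator (convex hull (verts \<tau>)) x \<partial>lborel)"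
    by (intro nn_integral_cong) (simp add: indicator_def)
  also have "\<dots> = (\<integral>\<^sup>+x. ennreal (w * (u x)\<^sup>2) * indicator (elem \<tau>) x \<partial>lborel)"
    unfolding elem_def by (rule nn_integral_interior_hull[OF N, symmetric])
  also have "\<dots> \<le> energy s u \<tau>"
    unfolding energy_def
  proof (rule nn_integral_mono)
    fix x
    show "ennreal (w * (u x)\<^sup>2) * indicator (elem \<tau>) x \<le> ennreal (((1 / weight s \<T> x) * u x)\<^sup>2) * indicator (elem \<tau>) x"
    proof (cases "x \<in> elem \<tau>")
      case True
      have "w * (u x)\<^sup>2 \<le> (1 / weight s \<T> x)\<^sup>2 * (u x)\<^sup>2" using w(1) True by (intro mult_right_mono) auto
      also have "\<dots> = ((1 / weight s \<T> x) * u x)\<^sup>2" by (simp only: power_mult_distrib)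
      finally show ?thesis using True by (simp add: ennreal_leI)
    qed simp
  qed
  finally show ?thesis .
qed

end

section \<open>Equivalence of the interpolation errors\<close>

lemma L2_norm_mono:
  assumes le: "(\<integral>\<^sup>+x\<in>\<Omega>. ennreal ((f x)\<^sup>2) \<partial>lborel) \<le> ennreal M * (\<integral>\<^sup>+x\<in>\<Omega>. ennreal ((g x)\<^sup>2) \<partial>lborel)"
    and M: "0 < M"
  shows "L2_norm \<Omega> f \<le> ennreal (sqrt M) * L2_norm \<Omega> g"
proof -
  define F where "F = (\<integral>\<^sup>+x\<in>\<Omega>. ennreal ((f x)\<^sup>2) \<partial>lborel)"
  define G where "G = (\<integral>\<^sup>+x\<in>\<Omega>. ennreal ((g x)\<^sup>2) \<partial>lborel)"
  note le = le[folded F_def G_def]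
  show ?thesis
  proof (cases "G = \<infinity>")
    case True
    then have "L2_norm \<Omega> g = \<infinity>" by (simp add: L2_norm_def G_def)
    then show ?thesis using M by (simp add: ennreal_mult_top)
  next
    case False
    then obtain b where b: "G = ennreal b" "0 \<le> b" by (cases G) auto
    have Mb: "0 \<le> M * b" using M b(2) by simp
    have F: "F \<le> ennreal (M * b)" using le M b by (simp add: ennreal_mult')
    then obtain a where a: "F = ennreal a" "0 \<le> a" by (cases F) (auto simp: top_unique)
    have "a \<le> M * b" using F Mb unfolding a(1) by (simp add: ennreal_le_iff)
    then have "sqrt a \<le> sqrt M * sqrt b" by (simp add: real_sqrt_mult[symmetric])
    moreover have "L2_norm \<Omega> f = ennreal (sqrt a)" "L2_norm \<Omega> g = ennreal (sqrt b)"
      unfolding L2_norm_def F_def[symmetric] G_def[symmetric] a(1) b(1) Let_def using a(2) b(2) by simp_all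
    ultimately show ?thesis using M b(2) by (simp add: ennreal_mult'[symmetric] ennreal_leI)
  qed
qed

context fe_mesh
begin

text \<open>Turns stability of an operator into a bound for its error: \<open>b\<close> is the image
  of \<open>a\<close>, and the square of a difference is at most twice the sum of the
  squares.\<close>

lemma L2_norm_diff:
  assumes a: "a \<in> borel_measurable borel" and b: "b \<in> borel_measurable borel"
    and le: "(\<Sum>\<tau>\<in>\<T>. energy s b \<tau>) \<le> ennreal M * (\<Sum>\<tau>\<in>\<T>. energy s a \<tau>)" and M: "0 \<le> M"
  shows "L2_norm \<Omega> (\<lambda>x. (1 / weight s \<T> x) * (a x - b x)) \<le> ennreal (sqrt (2 + 2 * M)) * L2_norm \<Omega> (\<lambda>x. (1 / weight s \<T> x) * a x)"
proof (rule L2_norm_mono)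
  have ab: "(\<lambda>x. a x - b x) \<in> borel_measurable borel" using a b by (rule borel_measurable_diff)
  have "(\<Sum>\<tau>\<in>\<T>. energy s (\<lambda>x. a x - b x) \<tau>) \<le> (\<Sum>\<tau>\<in>\<T>. 2 * energy s a \<tau> + 2 * energy s b \<tau>)"
    by (intro sum_mono energy_diff a b)
  also have "\<dots> = 2 * (\<Sum>\<tau>\<in>\<T>. energy s a \<tau>) + 2 * (\<Sum>\<tau>\<in>\<T>. energy s b \<tau>)"
    by (simp add: sum.distrib sum_distrib_left)
  also have "\<dots> \<le> 2 * (\<Sum>\<tau>\<in>\<T>. energy s a \<tau>) + 2 * (ennreal M * (\<Sum>\<tau>\<in>\<T>. energy s a \<tau>))"
    by (intro add_left_mono mult_left_mono le) simp
  also have "\<dots> = ennreal (2 + 2 * M) * (\<Sum>\<tau>\<in>\<T>. energy s a \<tau>)"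
    using M by (simp add: ennreal_mult' distrib_right mult.assoc)
  finally show "(\<integral>\<^sup>+x\<in>\<Omega>. ennreal (((1 / weight s \<T> x) * (a x - b x))\<^sup>2) \<partial>lborel)
      \<le> ennreal (2 + 2 * M) * (\<integral>\<^sup>+x\<in>\<Omega>. ennreal (((1 / weight s \<T> x) * a x)\<^sup>2) \<partial>lborel)"
    unfolding energy_sum[OF ab] energy_sum[OF a] .
qed (use M in simp)

lemma interior_nodes_verts: "\<tau> \<in> \<T> \<Longrightarrow> {z \<in> interior_nodes \<Omega> \<T>. z \<in> verts \<tau>} = verts \<tau> \<inter> \<Omega>"
  unfolding interior_nodes_def nodes_def by blast

text \<open>Origin of the constant: \<open>K\<close> bounds the dual functions,
  \<open>C\<^sub>w / c\<close> compares upper and lower weight bounds, and the two powers of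
  \<open>C\<close> transfer volume and weight from \<open>\<tau>\<close> to the chosen element. The
  last factors count the elements at a node and the nodes of an element.\<close>

lemma scott_zhang_energy:
  fixes s c C\<^sub>w K C :: real and N :: nat
  assumes K: "\<forall>S :: (real^'n) set. nondeg S \<longrightarrow> dual_bounded K S" "0 < K"
    and c: "0 < c" "0 < C\<^sub>w" "0 < C" "0 < s"
    and W: "\<And>\<tau>. \<tau> \<in> \<T> \<Longrightarrow> \<forall>x\<in>elem \<tau>. c * hsize \<tau> powr (- 2 * s) \<le> (1 / weight s \<T> x)\<^sup>2"
      "\<And>\<tau>. \<tau> \<in> \<T> \<Longrightarrow> (\<integral>\<^sup>+x. ennreal ((1 / weight s \<T> x)\<^sup>2) * indicator (elem \<tau>) x \<partial>lborel)
         \<le> ennreal (C\<^sub>w * hsize \<tau> powr (- 2 * s) * vol (verts \<tau>))"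
    and P: "\<And>z. z \<in> interior_nodes \<Omega> \<T> \<Longrightarrow> card {\<tau>\<in>\<T>. z \<in> verts \<tau>} \<le> N"
      "\<And>z \<sigma> \<tau>. z \<in> interior_nodes \<Omega> \<T> \<Longrightarrow> \<sigma> \<in> \<T> \<Longrightarrow> \<tau> \<in> \<T> \<Longrightarrow> z \<in> verts \<sigma> \<Longrightarrow> z \<in> verts \<tau> \<Longrightarrow> hsize \<tau> \<le> C * hsize \<sigma>"
    and Tz: "scott_zhang_choice \<Omega> \<T> Tz" and w: "bdd_meas w"
  shows "(\<Sum>\<tau>\<in>\<T>. energy s (hat_sum (coef Tz w)) \<tau>)
    \<le> ennreal (K\<^sup>2 * C\<^sub>w * C ^ CARD('n) * C powr (2 * s) / c * (real N * real (CARD('n) + 1))) * (\<Sum>\<tau>\<in>\<T>. energy s w \<tau>)"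
proof -
  define M where "M = K\<^sup>2 * C\<^sub>w * C ^ CARD('n) * C powr (2 * s) / c"
  have M: "0 \<le> M" using c by (simp add: M_def)
  let ?I = "interior_nodes \<Omega> \<T>"
  have tz: "Tz z \<in> \<T>" "z \<in> verts (Tz z)" if "z \<in> ?I" for z using Tz that by (auto simp: scott_zhang_choice_def)
  have node_term: "ennreal ((coef Tz w z)\<^sup>2 * (C\<^sub>w * hsize \<tau> powr (- 2 * s) * vol (verts \<tau>))) \<le> ennreal M * energy s w (Tz z)"
    if t: "\<tau> \<in> \<T>" and zt: "z \<in> verts \<tau>" and z: "z \<in> ?I" for \<tau> z
  proof -
    define h where "h = hsize \<tau>"
    define k where "k = hsize (Tz z)"
    define I where "I = (LINT y:convex hull (verts (Tz z))|lborel. (w y)\<^sup>2)"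
    have hk: "0 < h" "0 < k" using hsize_pos[OF valid_T[OF t]] hsize_pos[OF valid_T[OF tz(1)[OF z]]] by (auto simp: h_def k_def)
    have le: "h \<le> C * k" "k \<le> C * h" using P(2)[OF z] t zt tz[OF z] by (auto simp: h_def k_def)
    have v: "vol (verts \<tau>) = h ^ CARD('n)" "vol (verts (Tz z)) = k ^ CARD('n)"
      using hsize_power[OF valid_T[OF t]] hsize_power[OF valid_T[OF tz(1)[OF z]]] by (simp_all add: h_def k_def)
    have "h ^ CARD('n) \<le> (C * k) ^ CARD('n)" using le(1) hk(1) by (intro power_mono) auto
    then have hp: "h ^ CARD('n) \<le> C ^ CARD('n) * k ^ CARD('n)" by (simp add: power_mult_distrib)
    have "k / C \<le> h" using le(2) c(3) by (simp add: field_simps)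
    then have "h powr (- 2 * s) \<le> (k / C) powr (- 2 * s)"
      using hk c by (intro powr_mono2') auto
    also have "\<dots> = C powr (2 * s) * k powr (- 2 * s)"
      using hk c by (simp add: powr_divide powr_minus field_simps)
    finally have hs: "h powr (- 2 * s) \<le> C powr (2 * s) * k powr (- 2 * s)" .
    have cb: "(coef Tz w z)\<^sup>2 * k ^ CARD('n) \<le> K\<^sup>2 * I"
      using coef_bound[where Tz = Tz and z = z, OF K tz[OF z] w] by (simp add: v I_def)
    have "(coef Tz w z)\<^sup>2 * (C\<^sub>w * h powr (- 2 * s) * h ^ CARD('n))
        \<le> (coef Tz w z)\<^sup>2 * (C\<^sub>w * (C powr (2 * s) * k powr (- 2 * s)) * (C ^ CARD('n) * k ^ CARD('n)))"
      using c hk hs hp by (intro mult_left_mono mult_mono) auto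
    also have "\<dots> = C\<^sub>w * C powr (2 * s) * C ^ CARD('n) * k powr (- 2 * s) * ((coef Tz w z)\<^sup>2 * k ^ CARD('n))"
      by (simp only: mult_ac)
    also have "\<dots> \<le> C\<^sub>w * C powr (2 * s) * C ^ CARD('n) * k powr (- 2 * s) * (K\<^sup>2 * I)"
      using c cb by (intro mult_left_mono) auto
    also have "\<dots> = M * (c * k powr (- 2 * s) * I)"
      using c(1) by (simp add: M_def)
    finally have "ennreal ((coef Tz w z)\<^sup>2 * (C\<^sub>w * h powr (- 2 * s) * h ^ CARD('n))) \<le> ennreal (M * (c * k powr (- 2 * s) * I))"
      by (rule ennreal_leI)
    also have "\<dots> = ennreal M * ennreal (c * k powr (- 2 * s) * I)" using M by (rule ennreal_mult')
    also have "\<dots> \<le> ennreal M * energy s w (Tz z)"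
      unfolding I_def k_def using c(1) by (intro mult_left_mono energy_lower tz(1)[OF z] W(1) w) auto
    finally show ?thesis unfolding v h_def .
  qed
  have "(\<Sum>\<tau>\<in>\<T>. energy s (hat_sum (coef Tz w)) \<tau>)
      \<le> (\<Sum>\<tau>\<in>\<T>. \<Sum>z\<in>{z \<in> ?I. z \<in> verts \<tau>}. ennreal M * energy s w (Tz z))"
  proof (rule sum_mono)
    fix \<tau> assume t: "\<tau> \<in> \<T>"
    have "energy s (hat_sum (coef Tz w)) \<tau>
        \<le> (\<Sum>z\<in>{z \<in> ?I. z \<in> verts \<tau>}. ennreal ((coef Tz w z)\<^sup>2 * (C\<^sub>w * hsize \<tau> powr (- 2 * s) * vol (verts \<tau>))))"
      unfolding interior_nodes_verts[OF t] by (rule energy_hat_sum[OF t W(2)[OF t]])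
    also have "\<dots> \<le> (\<Sum>z\<in>{z \<in> ?I. z \<in> verts \<tau>}. ennreal M * energy s w (Tz z))"
      by (intro sum_mono node_term[OF t]) simp_all
    finally show "energy s (hat_sum (coef Tz w)) \<tau> \<le> \<dots>" .
  qed
  \<comment> \<open>After the interchange the term of the chosen element is repeated once for each
    element at \<open>z\<close>, at most \<open>N\<close> times.\<close>
  also have "\<dots> = (\<Sum>z\<in>?I. \<Sum>\<tau>\<in>{\<tau> \<in> \<T>. z \<in> verts \<tau>}. ennreal M * energy s w (Tz z))"
    using fin_T interior_nodes_finite by (rule sum.swap_restrict)
  also have "\<dots> \<le> (\<Sum>z\<in>?I. of_nat N * (ennreal M * energy s w (Tz z)))"
    unfolding sum_constant using P(1) by (intro sum_mono mult_right_mono) simp_all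
  \<comment> \<open>The chosen element is one of the elements at \<open>z\<close>. Summing over all
    of them and interchanging back counts each element at most once per vertex.\<close>
  also have "\<dots> \<le> (\<Sum>z\<in>?I. of_nat N * (ennreal M * (\<Sum>\<sigma>\<in>{\<sigma> \<in> \<T>. z \<in> verts \<sigma>}. energy s w \<sigma>)))"
    using tz fin_T by (intro sum_mono mult_left_mono member_le_sum) auto
  also have "\<dots> = of_nat N * (ennreal M * (\<Sum>z\<in>?I. \<Sum>\<sigma>\<in>{\<sigma> \<in> \<T>. z \<in> verts \<sigma>}. energy s w \<sigma>))"
    by (simp only: sum_distrib_left)
  also have "(\<Sum>z\<in>?I. \<Sum>\<sigma>\<in>{\<sigma> \<in> \<T>. z \<in> verts \<sigma>}. energy s w \<sigma>) = (\<Sum>\<sigma>\<in>\<T>. \<Sum>z\<in>{z \<in> ?I. z \<in> verts \<sigma>}. energy s w \<sigma>)"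
    using fin_T interior_nodes_finite by (rule sum.swap_restrict[symmetric])
  also have "of_nat N * (ennreal M * \<dots>) \<le> of_nat N * (ennreal M * (\<Sum>\<sigma>\<in>\<T>. of_nat (CARD('n) + 1) * energy s w \<sigma>))"
  proof (intro mult_left_mono sum_mono)
    fix \<sigma> assume s: "\<sigma> \<in> \<T>"
    have "card {z \<in> ?I. z \<in> verts \<sigma>} \<le> CARD('n) + 1"
      unfolding interior_nodes_verts[OF s] nondegD(3)[OF N_T[OF s], symmetric] by (intro card_mono) auto
    then show "(\<Sum>z\<in>{z \<in> ?I. z \<in> verts \<sigma>}. energy s w \<sigma>) \<le> of_nat (CARD('n) + 1) * energy s w \<sigma>"
      unfolding sum_constant by (intro mult_right_mono of_nat_mono) simp_all
  qed simp_all
  also have "\<dots> = of_nat N * (ennreal M * (of_nat (CARD('n) + 1) * (\<Sum>\<sigma>\<in>\<T>. energy s w \<sigma>)))"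
    by (simp only: sum_distrib_left)
  also have "\<dots> = ennreal (M * (real N * real (CARD('n) + 1))) * (\<Sum>\<sigma>\<in>\<T>. energy s w \<sigma>)"
    using M by (simp only: ennreal_mult' ennreal_of_nat_eq_real_of_nat of_nat_0_le_iff mult_ac)
  finally show ?thesis unfolding M_def .
qed

text \<open>Interpolation on \<open>\<tau>\<close> only uses values at vertices of
  \<open>\<tau>\<close>, so the estimate is elementwise: \<open>B\<close> comes from the vertex
  values, \<open>C\<^sub>w / c\<close> from the weight bounds, and the remaining factor counts
  vertices.\<close>

lemma interpolation_energy:
  assumes t: "\<tau> \<in> \<T>" and c: "0 < c" "0 < C\<^sub>w" "0 < B"
    and W: "\<forall>x\<in>elem \<tau>. c * hsize \<tau> powr (- 2 * s) \<le> (1 / weight s \<T> x)\<^sup>2"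
      "(\<integral>\<^sup>+x. ennreal ((1 / weight s \<T> x)\<^sup>2) * indicator (elem \<tau>) x \<partial>lborel)
         \<le> ennreal (C\<^sub>w * hsize \<tau> powr (- 2 * s) * vol (verts \<tau>))"
    and e: "bdd_meas e" "\<And>z. z \<in> verts \<tau> \<Longrightarrow> (e z)\<^sup>2 * vol (verts \<tau>) \<le> B * (LINT x:convex hull (verts \<tau>)|lborel. (e x)\<^sup>2)"
  shows "energy s (hat_sum e) \<tau> \<le> ennreal (real (CARD('n) + 1) * (B * C\<^sub>w / c)) * energy s e \<tau>"
proof -
  define M where "M = B * C\<^sub>w / c"
  define k where "k = hsize \<tau> powr (- 2 * s)"
  define I where "I = (LINT x:convex hull (verts \<tau>)|lborel. (e x)\<^sup>2)"
  have M: "0 \<le> M" and k: "0 \<le> k" using c by (auto simp: M_def k_def)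
  have "energy s (hat_sum e) \<tau> \<le> (\<Sum>z\<in>verts \<tau> \<inter> \<Omega>. ennreal ((e z)\<^sup>2 * (C\<^sub>w * k * vol (verts \<tau>))))"
    unfolding k_def by (rule energy_hat_sum[OF t W(2)])
  also have "\<dots> \<le> (\<Sum>z\<in>verts \<tau> \<inter> \<Omega>. ennreal M * energy s e \<tau>)"
  proof (rule sum_mono)
    fix z assume "z \<in> verts \<tau> \<inter> \<Omega>"
    then have "(e z)\<^sup>2 * vol (verts \<tau>) \<le> B * I" using e(2) unfolding I_def by blast
    then have "C\<^sub>w * k * ((e z)\<^sup>2 * vol (verts \<tau>)) \<le> C\<^sub>w * k * (B * I)"
      using c k by (intro mult_left_mono) auto
    also have "\<dots> = M * (c * k * I)" using c(1) by (simp add: M_def)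
    finally have "ennreal ((e z)\<^sup>2 * (C\<^sub>w * k * vol (verts \<tau>))) \<le> ennreal (M * (c * k * I))"
      by (intro ennreal_leI) (simp only: mult_ac)
    also have "\<dots> = ennreal M * ennreal (c * k * I)" using M by (rule ennreal_mult')
    also have "\<dots> \<le> ennreal M * energy s e \<tau>"
      unfolding I_def k_def using c(1) by (intro mult_left_mono energy_lower t W(1) e(1)) auto
    finally show "ennreal ((e z)\<^sup>2 * (C\<^sub>w * k * vol (verts \<tau>))) \<le> ennreal M * energy s e \<tau>" .
  qed
  also have "\<dots> \<le> of_nat (CARD('n) + 1) * (ennreal M * energy s e \<tau>)"
    unfolding sum_constant nondegD(3)[OF N_T[OF t], symmetric] by (intro mult_right_mono of_nat_mono card_mono) auto
  also have "\<dots> = ennreal (real (CARD('n) + 1) * M) * energy s e \<tau>"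
    using M by (simp only: ennreal_mult' ennreal_of_nat_eq_real_of_nat of_nat_0_le_iff mult.assoc)
  finally show ?thesis unfolding M_def .
qed

text \<open>On \<open>\<tau>\<close> the function \<open>e\<close> is only piecewise affine, so the
  vertex bound is applied on a fine element at \<open>z\<close>. Passing from its volume to that of
  \<open>\<tau>\<close> costs the factor \<open>2 ^ 10\<close>.\<close>

lemma refined_vertex_bound:
  assumes d: "CARD('n) = 2 \<or> CARD('n) = 3" and cr: "coarsest_refinement \<T> \<T> \<T>'"
    and Cv: "\<forall>(S :: (real^'n) set) f a. nondeg S \<longrightarrow> affine_on UNIV f \<longrightarrow> a \<in> S \<longrightarrow>
       (f a)\<^sup>2 * vol S \<le> C * (LINT x:convex hull S|lborel. (f x)\<^sup>2)" "0 < C"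
    and t: "\<tau> \<in> \<T>" and z: "z \<in> verts \<tau>" and e: "bdd_meas e"
      "\<And>\<rho>. \<rho> \<in> \<T>' \<Longrightarrow> desc \<tau> \<rho> \<Longrightarrow> \<exists>f. affine_on UNIV f \<and> (\<forall>x\<in>convex hull (verts \<rho>). e x = f x)"
  shows "(e z)\<^sup>2 * vol (verts \<tau>) \<le> (2 ^ 10 * C) * (LINT x:convex hull (verts \<tau>)|lborel. (e x)\<^sup>2)"
proof -
  have nvb: "nvb_refinement \<T> \<T>'"
    using cr by (simp add: coarsest_refinement_def admissible_refinement_def)
  have zh: "z \<in> convex hull (verts \<tau>)" using z by (rule hull_inc)
  obtain \<rho> where r: "\<rho> \<in> \<T>'" "desc \<tau> \<rho>" "z \<in> convex hull (verts \<rho>)"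
    using nvb_cover[OF nvb _ t zh] valid_T by blast
  note N = N_T[OF t] and R = nondeg_verts[OF desc_valid[OF r(2) valid_T[OF t]]]
  note rt = desc_hull[OF r(2) valid_T[OF t]]
  have "\<exists>v\<in>verts \<rho>. 0 < bary (verts \<rho>) z v"
  proof (rule ccontr)
    assume "\<not> ?thesis"
    then have "(\<Sum>v\<in>verts \<rho>. bary (verts \<rho>) z v) \<le> 0" by (intro sum_nonpos) force
    then show False using sum_bary[OF R, of z] by simp
  qed
  then obtain v where v: "v \<in> verts \<rho>" "0 < bary (verts \<rho>) z v" by blast
  have "verts \<rho> \<subseteq> convex hull (verts \<tau>)" using rt hull_subset[of "verts \<rho>" convex] by (rule order_trans[rotated])
  \<comment> \<open>The vertex \<open>z\<close> is a face of \<open>\<tau>\<close>, so any vertex of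
    \<open>\<rho>\<close> with positive weight at \<open>z\<close> lies in this face and equals
    \<open>z\<close>.\<close>
  then have "v \<in> convex hull {z}"
    using z by (intro subsimplex_face_trace[OF N _ R _ _ v r(3)]) auto
  then have zr: "z \<in> verts \<rho>" using v(1) by simp
  obtain f where f: "affine_on UNIV f" "\<forall>x\<in>convex hull (verts \<rho>). e x = f x" using e(2)[OF r(1,2)] by blast
  have I: "set_integrable lborel (convex hull (verts \<tau>)) (\<lambda>x. (e x)\<^sup>2)" by (rule bdd_meas_integrable[OF N bdd_meas_power2[OF e(1)]])
  have "(e z)\<^sup>2 * vol (verts \<rho>) = (f z)\<^sup>2 * vol (verts \<rho>)" using f(2) r(3) by simp
  also have "\<dots> \<le> C * (LINT x:convex hull (verts \<rho>)|lborel. (f x)\<^sup>2)" using Cv(1) R f(1) zr by blast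
  also have "(LINT x:convex hull (verts \<rho>)|lborel. (f x)\<^sup>2) = (LINT x:convex hull (verts \<rho>)|lborel. (e x)\<^sup>2)"
    using f(2) hull_props(2)[OF R] by (intro set_lebesgue_integral_cong) auto
  also have "C * \<dots> \<le> C * (LINT x:convex hull (verts \<tau>)|lborel. (e x)\<^sup>2)"
  proof (rule mult_left_mono)
    have "set_integrable lborel (convex hull (verts \<rho>)) (\<lambda>x. (e x)\<^sup>2)"
      by (rule set_integrable_subset[OF I _ rt]) (use hull_props(2)[OF R] in simp)
    then show "(LINT x:convex hull (verts \<rho>)|lborel. (e x)\<^sup>2) \<le> (LINT x:convex hull (verts \<tau>)|lborel. (e x)\<^sup>2)"
      using I rt unfolding set_lebesgue_integral_def set_integrable_def
      by (intro integral_mono) (auto simp: indicator_def)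
  qed (use Cv(2) in simp)
  finally have "(e z)\<^sup>2 * vol (verts \<rho>) \<le> C * (LINT x:convex hull (verts \<tau>)|lborel. (e x)\<^sup>2)" .
  moreover have "(e z)\<^sup>2 * (vol (verts \<tau>) / 2 ^ 10) \<le> (e z)\<^sup>2 * vol (verts \<rho>)"
    by (intro mult_left_mono uniform_refinement_volume[OF d tri cr t r(1,2)]) simp
  ultimately show ?thesis by simp
qed

end

theorem theorem3p4:
  fixes s \<gamma> :: real
  assumes "CARD('n::finite) \<in> {2, 3}" and "0 < s" and "s < 1" and "0 < \<gamma>"
  shows "\<exists>C>0. \<forall>(\<Omega> :: (real^'n) set) \<T>\<^sub>0 \<T> \<T>\<^sub>u Tz v.
     polyhedral_lipschitz_domain \<Omega> \<longrightarrow> initial_triangulation \<Omega> \<T>\<^sub>0 \<longrightarrow>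
     \<T> \<in> meshes \<T>\<^sub>0 \<longrightarrow> shape_regular \<gamma> \<T> \<longrightarrow> \<T>\<^sub>u = refine \<T> \<T> \<longrightarrow>
     scott_zhang_choice \<Omega> \<T> Tz \<longrightarrow> v \<in> S10 \<Omega> \<T>\<^sub>u \<longrightarrow>
       ennreal (inverse C) * L2_norm \<Omega> (\<lambda>x. (1 / weight s \<T> x) * (v x - scott_zhang \<Omega> \<T> Tz v x))
         \<le> L2_norm \<Omega> (\<lambda>x. (1 / weight s \<T> x) * (v x - nodal_interpolation \<Omega> \<T> v x)) \<and>
       L2_norm \<Omega> (\<lambda>x. (1 / weight s \<T> x) * (v x - nodal_interpolation \<Omega> \<T> v x))
         \<le> ennreal C * L2_norm \<Omega> (\<lambda>x. (1 / weight s \<T> x) * (v x - scott_zhang \<Omega> \<T> Tz v x))"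
proof -
  have d: "CARD('n) = 2 \<or> CARD('n) = 3" and d2: "2 \<le> CARD('n)" using assms(1) by auto
  obtain N C where P: "0 < C" "\<forall>(\<Omega> :: (real^'n) set) \<T> z. fe_mesh \<Omega> \<T> \<longrightarrow> shape_regular \<gamma> \<T> \<longrightarrow> z \<in> interior_nodes \<Omega> \<T> \<longrightarrow>
     card {\<tau>\<in>\<T>. z \<in> verts \<tau>} \<le> N \<and>
     (\<forall>\<sigma>\<in>\<T>. \<forall>\<tau>\<in>\<T>. z \<in> verts \<sigma> \<longrightarrow> z \<in> verts \<tau> \<longrightarrow> hsize \<tau> \<le> C * hsize \<sigma>)"
    using patch_bounds[OF d2 assms(4)] by (elim exE conjE) (rule that, assumption+)
  obtain c C\<^sub>w where W: "0 < c" "0 < C\<^sub>w" "\<forall>(\<Omega> :: (real^'n::finite) set) \<T> \<tau>. fe_mesh \<Omega> \<T> \<longrightarrow> shape_regular \<gamma> \<T> \<longrightarrow> \<tau> \<in> \<T> \<longrightarrow>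
     (\<forall>x\<in>elem \<tau>. c * hsize \<tau> powr (- 2 * s) \<le> (1 / weight s \<T> x)\<^sup>2) \<and>
     (\<integral>\<^sup>+x. ennreal ((1 / weight s \<T> x)\<^sup>2) * indicator (elem \<tau>) x \<partial>lborel)
       \<le> ennreal (C\<^sub>w * hsize \<tau> powr (- 2 * s) * vol (verts \<tau>))"
    using weight_bounds[OF assms(2-4), where 'n = 'n] by (elim exE conjE) (rule that, assumption+)
  obtain K where K: "0 < K" "\<forall>S :: (real^'n) set. nondeg S \<longrightarrow> dual_bounded K S"
    using dual_function[where 'n = 'n] by (elim exE conjE) (rule that, assumption+)
  obtain Cv where Cv: "0 < Cv" "\<forall>(S :: (real^'n) set) f a. nondeg S \<longrightarrow> affine_on UNIV f \<longrightarrow> a \<in> S \<longrightarrow>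
       (f a)\<^sup>2 * vol S \<le> Cv * (LINT x:convex hull S|lborel. (f x)\<^sup>2)"
    using affine_vertex_bound[where 'n = 'n] by (elim exE conjE) (rule that, assumption+)
  define M1 where "M1 = K\<^sup>2 * C\<^sub>w * C ^ CARD('n) * C powr (2 * s) / c * (real N * real (CARD('n) + 1))"
  define M2 where "M2 = real (CARD('n) + 1) * ((2 ^ 10 * Cv) * C\<^sub>w / c)"
  have M: "0 \<le> M1" "0 \<le> M2" using P(1) W(1,2) K(1) Cv(1) by (auto simp: M1_def M2_def)
  \<comment> \<open>The sum serves as a common bound for the constants of both directions.\<close>
  define R where "R = sqrt (2 + 2 * M1) + sqrt (2 + 2 * M2)"
  have pos: "0 < sqrt (2 + 2 * M1)" "0 < sqrt (2 + 2 * M2)" using M by (auto simp: real_sqrt_gt_zero)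
  then have R: "0 < R" "sqrt (2 + 2 * M1) \<le> R" "sqrt (2 + 2 * M2) \<le> R" unfolding R_def by linarith+
  have "ennreal (inverse R) * L2_norm \<Omega> (\<lambda>x. (1 / weight s \<T> x) * (v x - scott_zhang \<Omega> \<T> Tz v x))
         \<le> L2_norm \<Omega> (\<lambda>x. (1 / weight s \<T> x) * (v x - nodal_interpolation \<Omega> \<T> v x)) \<and>
       L2_norm \<Omega> (\<lambda>x. (1 / weight s \<T> x) * (v x - nodal_interpolation \<Omega> \<T> v x))
         \<le> ennreal R * L2_norm \<Omega> (\<lambda>x. (1 / weight s \<T> x) * (v x - scott_zhang \<Omega> \<T> Tz v x))"
    if \<Omega>: "polyhedral_lipschitz_domain \<Omega>" and T0: "initial_triangulation \<Omega> \<T>\<^sub>0" and T: "\<T> \<in> meshes \<T>\<^sub>0"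
      and sh: "shape_regular \<gamma> \<T>" and Tz: "scott_zhang_choice \<Omega> \<T> Tz" and v: "v \<in> S10 \<Omega> (refine \<T> \<T>)"
    for \<Omega> :: "(real^'n) set" and \<T>\<^sub>0 \<T> Tz v
  proof -
    have m: "fe_mesh \<Omega> \<T>" using mesh_triangulation[OF T0 T] \<Omega> by (rule fe_mesh.intro)
    interpret fe_mesh \<Omega> \<T> by (rule m)
    have cr: "coarsest_refinement \<T> \<T> (refine \<T> \<T>)" by (rule mesh_refine_coarsest[OF T0 T order_refl])
    have tu: "triangulation \<Omega> (refine \<T> \<T>)"
      using cr by (intro nvb_triangulation[OF tri]) (auto simp: coarsest_refinement_def admissible_refinement_def)
    interpret fine: fe_mesh \<Omega> "refine \<T> \<T>" using tu \<Omega> by (rule fe_mesh.intro)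
    have v1: "v \<in> S1 \<Omega> (refine \<T> \<T>)" using v by (simp add: S10_def)
    have va: "bdd_meas v" by (rule fine.S1_bdd_meas[OF v1])
    have tz: "Tz z \<in> \<T>" "z \<in> verts (Tz z)" if "z \<in> interior_nodes \<Omega> \<T>" for z
      using Tz that by (auto simp: scott_zhang_choice_def)
    have Wt: "\<forall>x\<in>elem \<tau>. c * hsize \<tau> powr (- 2 * s) \<le> (1 / weight s \<T> x)\<^sup>2"
      "(\<integral>\<^sup>+x. ennreal ((1 / weight s \<T> x)\<^sup>2) * indicator (elem \<tau>) x \<partial>lborel)
         \<le> ennreal (C\<^sub>w * hsize \<tau> powr (- 2 * s) * vol (verts \<tau>))" if "\<tau> \<in> \<T>" for \<tau>
      using W(3)[rule_format, OF m sh that] by blast+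
    define w where "w x = v x - hat_sum v x" for x
    define e where "e x = v x - hat_sum (coef Tz v) x" for x
    have wa: "bdd_meas w" unfolding w_def[abs_def] by (intro bdd_meas_diff va hat_sum_bdd_meas)
    have ea: "bdd_meas e" unfolding e_def[abs_def] by (intro bdd_meas_diff va hat_sum_bdd_meas)
    have mw: "w \<in> borel_measurable borel" "e \<in> borel_measurable borel" "\<And>a. hat_sum a \<in> borel_measurable borel"
      using wa ea hat_sum_bdd_meas by (auto simp: bdd_meas_def)
    \<comment> \<open>\<open>coef Tz\<close> returns the coefficients of the hat sum subtracted from
      \<open>v\<close>, here the nodal values of \<open>v\<close>. So removing the interpolant does
      not change the Scott-Zhang error.\<close>
    have "coef Tz w z = coef Tz v z - v z" if z: "z \<in> interior_nodes \<Omega> \<T>" for z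
      unfolding w_def[abs_def] coef_diff[where Tz = Tz and z = z, OF K(2) tz[OF z] va hat_sum_bdd_meas]
        coef_affine[where Tz = Tz and z = z, OF K(2) tz[OF z] z] ..
    then have "hat_sum (coef Tz w) = hat_sum (\<lambda>z. coef Tz v z - v z)" by (rule hat_sum_cong)
    then have we: "w x - hat_sum (coef Tz w) x = e x" for x
      by (simp add: hat_sum_diff w_def e_def)
    \<comment> \<open>At an interior node a hat sum takes its coefficient as value, so interpolating
      \<open>e\<close> undoes the Scott-Zhang projection and leaves the interpolation error of
      \<open>v\<close>.\<close>
    have "hat_sum e = hat_sum (\<lambda>z. v z - coef Tz v z)"
      by (rule hat_sum_cong) (simp add: e_def hat_sum_node)
    then have ew: "e x - hat_sum e x = w x" for x
      by (simp add: hat_sum_diff w_def e_def)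
    have "(\<Sum>\<tau>\<in>\<T>. energy s (hat_sum (coef Tz w)) \<tau>) \<le> ennreal M1 * (\<Sum>\<tau>\<in>\<T>. energy s w \<tau>)"
      unfolding M1_def
      by (rule scott_zhang_energy[OF K(2,1) W(1,2) P(1) assms(2) Wt _ _ Tz wa])
        (use P(2)[rule_format, OF m sh] in blast)+
    then have "L2_norm \<Omega> (\<lambda>x. (1 / weight s \<T> x) * (w x - hat_sum (coef Tz w) x))
        \<le> ennreal (sqrt (2 + 2 * M1)) * L2_norm \<Omega> (\<lambda>x. (1 / weight s \<T> x) * w x)"
      by (intro L2_norm_diff mw M)
    then have left: "L2_norm \<Omega> (\<lambda>x. (1 / weight s \<T> x) * e x) \<le> ennreal R * L2_norm \<Omega> (\<lambda>x. (1 / weight s \<T> x) * w x)"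
      unfolding we using R(2) by (elim order_trans) (intro mult_right_mono ennreal_leI, simp_all)
    \<comment> \<open>\<open>v\<close> is affine on fine elements, and the projection is affine on
      the coarse element \<open>\<tau>\<close> that contains \<open>\<rho>\<close>.\<close>
    have eaff: "\<exists>f. affine_on UNIV f \<and> (\<forall>x\<in>convex hull (verts \<rho>). e x = f x)"
      if r: "\<rho> \<in> refine \<T> \<T>" "desc \<tau> \<rho>" and t: "\<tau> \<in> \<T>" for \<rho> \<tau>
    proof -
      obtain f where f: "affine_on UNIV f" "\<forall>x\<in>convex hull (verts \<rho>). v x = f x" using fine.S1_affine[OF v1 r(1)] by blast
      obtain g where g: "affine_on UNIV g" "\<forall>x\<in>convex hull (verts \<tau>). hat_sum (coef Tz v) x = g x" using hat_sum_affine[OF t] by blast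
      have "\<forall>x\<in>convex hull (verts \<rho>). e x = f x - g x"
        using f(2) g(2) desc_hull[OF r(2) valid_T[OF t]] unfolding e_def by (metis subsetD)
      then show ?thesis using affine_on_diff[OF f(1) g(1)] by blast
    qed
    have "energy s (hat_sum e) \<tau> \<le> ennreal M2 * energy s e \<tau>" if t: "\<tau> \<in> \<T>" for \<tau>
      unfolding M2_def
      by (rule interpolation_energy[OF t W(1,2) _ Wt[OF t] ea refined_vertex_bound[OF d cr Cv(2,1) t _ ea eaff[OF _ _ t]]])
        (use Cv(1) in auto)
    then have "(\<Sum>\<tau>\<in>\<T>. energy s (hat_sum e) \<tau>) \<le> ennreal M2 * (\<Sum>\<tau>\<in>\<T>. energy s e \<tau>)"
      unfolding sum_distrib_left by (rule sum_mono)
    then have "L2_norm \<Omega> (\<lambda>x. (1 / weight s \<T> x) * (e x - hat_sum e x))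
        \<le> ennreal (sqrt (2 + 2 * M2)) * L2_norm \<Omega> (\<lambda>x. (1 / weight s \<T> x) * e x)"
      by (intro L2_norm_diff mw M)
    then have right: "L2_norm \<Omega> (\<lambda>x. (1 / weight s \<T> x) * w x) \<le> ennreal R * L2_norm \<Omega> (\<lambda>x. (1 / weight s \<T> x) * e x)"
      unfolding ew using R(3) by (elim order_trans) (intro mult_right_mono ennreal_leI, simp_all)
    have "ennreal (inverse R) * L2_norm \<Omega> (\<lambda>x. (1 / weight s \<T> x) * e x)
        \<le> ennreal (inverse R) * (ennreal R * L2_norm \<Omega> (\<lambda>x. (1 / weight s \<T> x) * w x))"
      by (intro mult_left_mono left) simp
    also have "\<dots> = L2_norm \<Omega> (\<lambda>x. (1 / weight s \<T> x) * w x)"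
      using R(1) by (simp add: mult.assoc[symmetric] ennreal_mult'[symmetric])
    finally show ?thesis
      using right unfolding scott_zhang_hat_sum interpolation_hat_sum w_def e_def by blast
  qed
  then show ?thesis using R(1) by blast
qed

end
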